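(* Let $\Gamma$ be a discrete quantum group and let $\mathbb{G}$ be its compact quantum group dual. Then $\Gamma$ has the Haagerup property if and only if $\mathrm{Pol}(\mathbb{G})$ admits a proper cocycle.
   Context: Inner products are linear in the second variable. $\mathrm{Pol}(\mathbb{G})$ is the Hopf $^*$-algebra spanned by the coefficients of finite-dimensional unitary representations of the compact quantum group $\mathbb{G}$ (in the sense of Woronowicz), with counit $\epsilon$. $\mathrm{Irr}(\mathbb{G})$ is the set of equivalence classes of irreducible unitary representations of $\mathbb{G}$; for each $\beta\in\mathrm{Irr}(\mathbb{G})$ a unitary representative $U^\beta=(u^\beta_{ij})_{i,j=1}^{n_\beta}\in M_{n_\beta}(\mathrm{Pol}(\mathbb{G}))$ is fixed. Cocycle: a linear map $\eta:\mathrm{Pol}(\mathbb{G})\to\mathsf{H}$ into a Hilbert space, with dense range, for which there is a unital $^*$-homomorphism $\pi:\mathrm{Pol}(\mathbb{G})\to B(\mathsf{H})$ with $\eta(ab)=\pi(a)\eta(b)+\eta(a)\epsilon(b)$ for all $a,b$. For $\beta\in\mathrm{Irr}(\mathbb{G})$ let $\eta^\beta=(\eta(u^\beta_{ij}))_{i,j}$, regarded as an operator in $B(\mathbb{C}^{n_\beta};\mathbb{C}^{n_\beta}\otimes\mathsf{H})$, $\eta^\beta e_j=\sum_k e_k\otimes\eta(u^\beta_{kj})$; thus $(\eta^\beta)^*\eta^\beta\in M_{n_\beta}$ has $(i,j)$ entry $\sum_k\langle\eta(u^\beta_{ki}),\eta(u^\beta_{kj})\rangle$. The cocycle $\eta$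 is proper if for every $M>0$ there is a finite set $F\subset\mathrm{Irr}(\mathbb{G})$ such that $(\eta^\beta)^*\eta^\beta\ge M I_{\mathbb{C}^{n_\beta}}$ for all $\beta\in\mathrm{Irr}(\mathbb{G})\setminus F$. Haagerup property: $\Gamma$ has the Haagerup property if it admits a mixing unitary representation with almost invariant vectors. In terms of $\mathrm{Pol}(\mathbb{G})$ (unitary representations of $\Gamma$ correspond to unital $^*$-homomorphisms $\pi:\mathrm{Pol}(\mathbb{G})\to B(\mathsf{K})$, $\mathsf{K}$ a Hilbert space) this means: there is such a $\pi$ for which (a) (mixing) for all $\xi,\zeta\in\mathsf{K}$ and every $\varepsilon>0$, the operator norm of the matrix $(\langle\xi,\pi(u^\beta_{ij})\zeta\rangle)_{i,j}\in M_{n_\beta}$ is less than $\varepsilon$ for all but finitely many $\beta\in\mathrm{Irr}(\mathbb{G})$; and (b) (almost invariant vectors) there is a sequence of unit vectors $\xi_n\in\mathsf{K}$ with $\|\pi(a)\xi_n-\epsilon(a)\xi_n\|\to0$ for every $a\in\mathrm{Pol}(\mathbb{G})$. *)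

theory Defs
  imports Complex_Main "Jordan_Normal_Form.Matrix"
begin

text \<open>
  A compact quantum group \<open>\<G>\<close> is given by its Hopf \<open>*\<close>-algebra \<open>Pol(\<G>)\<close>: the elements form the
  type \<open>'a::ring_1\<close>, whose operations are the sum and product of \<open>Pol(\<G>)\<close>; the remaining structure
  is collected in a record.

  The library has no algebraic tensor product. An element \<open>\<Sum> x\<^sub>i \<otimes> y\<^sub>i\<close> of \<open>Pol(\<G>) \<otimes> Pol(\<G>)\<close> is
  represented by the functional \<open>B \<mapsto> \<Sum> B x\<^sub>i y\<^sub>i\<close> on bilinear forms (extended by 0 to arguments
  that are not bilinear). By the universal property this identifies \<open>Pol(\<G>) \<otimes> Pol(\<G>)\<close> with a
  subspace of the dual of the space of bilinear forms; over a field no tensors are identified, since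
  bilinear forms separate the points of the algebraic tensor product.
\<close>

type_synonym 'a tens = "('a \<Rightarrow> 'a \<Rightarrow> complex) \<Rightarrow> complex"

record 'a cqg =
  scl :: "complex \<Rightarrow> 'a \<Rightarrow> 'a"
  star :: "'a \<Rightarrow> 'a"
  comult :: "'a \<Rightarrow> 'a tens"
  counit :: "'a \<Rightarrow> complex"


section \<open>Hopf \<open>*\<close>-algebras\<close>

definition linear_form :: "('a::ring_1) cqg \<Rightarrow> ('a \<Rightarrow> complex) \<Rightarrow> bool" where
  "linear_form G f \<longleftrightarrow> Vector_Spaces.linear (scl G) (*) f"

definition bilinear_form :: "('a::ring_1) cqg \<Rightarrow> ('a \<Rightarrow> 'a \<Rightarrow> complex) \<Rightarrow> bool" where
  "bilinear_form G B \<longleftrightarrow>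
     (\<forall>x. linear_form G (\<lambda>y. B x y)) \<and> (\<forall>y. linear_form G (\<lambda>x. B x y))"

definition trilinear_form :: "('a::ring_1) cqg \<Rightarrow> ('a \<Rightarrow> 'a \<Rightarrow> 'a \<Rightarrow> complex) \<Rightarrow> bool" where
  "trilinear_form G T \<longleftrightarrow>
     (\<forall>x y. linear_form G (\<lambda>z. T x y z)) \<and> (\<forall>x z. linear_form G (\<lambda>y. T x y z)) \<and>
     (\<forall>y z. linear_form G (\<lambda>x. T x y z))"

definition pure_tensor :: "('a::ring_1) cqg \<Rightarrow> 'a \<Rightarrow> 'a \<Rightarrow> 'a tens" where
  "pure_tensor G x y = (\<lambda>B. if bilinear_form G B then B x y else 0)"

definition tensor_square :: "('a::ring_1) cqg \<Rightarrow> 'a tens set" where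
  "tensor_square G = {t. \<exists>(m::nat) x y. t = (\<lambda>B. \<Sum>k<m. pure_tensor G (x k) (y k) B)}"

text \<open>\<open>(x \<otimes> y)(p \<otimes> q) = xp \<otimes> yq\<close> and \<open>(x \<otimes> y)\<^sup>* = x\<^sup>* \<otimes> y\<^sup>*\<close>.\<close>

definition tensor_mult :: "('a::ring_1) cqg \<Rightarrow> 'a tens \<Rightarrow> 'a tens \<Rightarrow> 'a tens" where
  "tensor_mult G s t =
     (\<lambda>B. if bilinear_form G B then s (\<lambda>x y. t (\<lambda>p q. B (x * p) (y * q))) else 0)"

definition tensor_star :: "('a::ring_1) cqg \<Rightarrow> 'a tens \<Rightarrow> 'a tens" where
  "tensor_star G t =
     (\<lambda>B. if bilinear_form G B then cnj (t (\<lambda>x y. cnj (B (star G x) (star G y)))) else 0)"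

definition star_algebra :: "('a::ring_1) cqg \<Rightarrow> bool" where
  "star_algebra G \<longleftrightarrow>
     vector_space (scl G) \<and>
     (\<forall>c a b. scl G c (a * b) = scl G c a * b \<and> scl G c (a * b) = a * scl G c b) \<and>
     (\<forall>a b. star G (a + b) = star G a + star G b) \<and>
     (\<forall>c a. star G (scl G c a) = scl G (cnj c) (star G a)) \<and>
     (\<forall>a b. star G (a * b) = star G b * star G a) \<and>
     (\<forall>a. star G (star G a) = a)"

text \<open>
  For \<open>\<Delta>(a) = \<Sum> a\<^sub>1 \<otimes> a\<^sub>2\<close> and a bilinear form \<open>B\<close> one has \<open>comult G a B = \<Sum> B a\<^sub>1 a\<^sub>2\<close>. The
  axioms valued in \<open>Pol(\<G>)\<close> and in its triple tensor power (counit, antipode, coassociativity) are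
  accordingly tested against all linear and all trilinear forms.
\<close>

definition comult_star_hom :: "('a::ring_1) cqg \<Rightarrow> bool" where
  "comult_star_hom G \<longleftrightarrow>
     (\<forall>a. comult G a \<in> tensor_square G) \<and>
     (\<forall>a b. comult G (a + b) = (\<lambda>B. comult G a B + comult G b B)) \<and>
     (\<forall>c a. comult G (scl G c a) = (\<lambda>B. c * comult G a B)) \<and>
     comult G 1 = pure_tensor G 1 1 \<and>
     (\<forall>a b. comult G (a * b) = tensor_mult G (comult G a) (comult G b)) \<and>
     (\<forall>a. comult G (star G a) = tensor_star G (comult G a))"

definition coassociative :: "('a::ring_1) cqg \<Rightarrow> bool" where
  "coassociative G \<longleftrightarrow>
     (\<forall>a T. trilinear_form G T \<longrightarrow>
        comult G a (\<lambda>x y. comult G x (\<lambda>p q. T p q y)) =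
        comult G a (\<lambda>x y. comult G y (\<lambda>p q. T x p q)))"

definition counit_star_hom :: "('a::ring_1) cqg \<Rightarrow> bool" where
  "counit_star_hom G \<longleftrightarrow>
     linear_form G (counit G) \<and> counit G 1 = 1 \<and>
     (\<forall>a b. counit G (a * b) = counit G a * counit G b) \<and>
     (\<forall>a. counit G (star G a) = cnj (counit G a))"

definition counital :: "('a::ring_1) cqg \<Rightarrow> bool" where
  "counital G \<longleftrightarrow>
     (\<forall>a f. linear_form G f \<longrightarrow>
        comult G a (\<lambda>x y. counit G x * f y) = f a \<and>
        comult G a (\<lambda>x y. f x * counit G y) = f a)"

definition antipode :: "('a::ring_1) cqg \<Rightarrow> ('a \<Rightarrow> 'a) \<Rightarrow> bool" where
  "antipode G S \<longleftrightarrow>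
     Vector_Spaces.linear (scl G) (scl G) S \<and>
     (\<forall>a f. linear_form G f \<longrightarrow>
        comult G a (\<lambda>x y. f (S x * y)) = counit G a * f 1 \<and>
        comult G a (\<lambda>x y. f (x * S y)) = counit G a * f 1)"

definition hopf_star_algebra :: "('a::ring_1) cqg \<Rightarrow> bool" where
  "hopf_star_algebra G \<longleftrightarrow>
     star_algebra G \<and> comult_star_hom G \<and> coassociative G \<and>
     counit_star_hom G \<and> counital G \<and> (\<exists>S. antipode G S)"


section \<open>Unitary representations and compact quantum groups\<close>

definition unitary_over :: "('a::ring_1) cqg \<Rightarrow> 'a mat \<Rightarrow> bool" where
  "unitary_over G U \<longleftrightarrow> square_mat U \<and>
     (let n = dim_row U; V = mat n n (\<lambda>(i, j). star G (U $$ (j, i)))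
      in U * V = 1\<^sub>m n \<and> V * U = 1\<^sub>m n)"

definition unitary_rep :: "('a::ring_1) cqg \<Rightarrow> 'a mat \<Rightarrow> bool" where
  "unitary_rep G U \<longleftrightarrow> unitary_over G U \<and>
     (\<forall>i<dim_row U. \<forall>j<dim_row U.
        comult G (U $$ (i, j)) =
          (\<lambda>B. \<Sum>k<dim_row U. pure_tensor G (U $$ (i, k)) (U $$ (k, j)) B))"

definition compact_quantum_group :: "('a::ring_1) cqg \<Rightarrow> bool" where
  "compact_quantum_group G \<longleftrightarrow>
     hopf_star_algebra G \<and>
     module.span (scl G)
       {U $$ (i, j) | U i j. unitary_rep G U \<and> i < dim_row U \<and> j < dim_row U} = UNIV"

text \<open>
  A subspace \<open>W\<close> of \<open>\<complex>\<^sup>n\<close> is invariant if \<open>U (w \<otimes> 1) \<in> W \<otimes> Pol(\<G>)\<close> for all \<open>w \<in> W\<close>, which says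
  that all slices of \<open>U\<close> by linear forms on \<open>Pol(\<G>)\<close> map \<open>W\<close> into itself.
\<close>

definition invariant_subspace :: "('a::ring_1) cqg \<Rightarrow> 'a mat \<Rightarrow> complex vec set \<Rightarrow> bool" where
  "invariant_subspace G U W \<longleftrightarrow>
     W \<subseteq> carrier_vec (dim_row U) \<and> 0\<^sub>v (dim_row U) \<in> W \<and>
     (\<forall>v\<in>W. \<forall>w\<in>W. v + w \<in> W) \<and> (\<forall>c. \<forall>w\<in>W. c \<cdot>\<^sub>v w \<in> W) \<and>
     (\<forall>f. linear_form G f \<longrightarrow> (\<forall>w\<in>W. map_mat f U *\<^sub>v w \<in> W))"

definition irreducible_unitary_rep :: "('a::ring_1) cqg \<Rightarrow> 'a mat \<Rightarrow> bool" where
  "irreducible_unitary_rep G U \<longleftrightarrow>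
     unitary_rep G U \<and> dim_row U > 0 \<and>
     (\<forall>W. invariant_subspace G U W \<longrightarrow> W = {0\<^sub>v (dim_row U)} \<or> W = carrier_vec (dim_row U))"

definition equivalent_reps :: "('a::ring_1) cqg \<Rightarrow> 'a mat \<Rightarrow> 'a mat \<Rightarrow> bool" where
  "equivalent_reps G U V \<longleftrightarrow> dim_row U = dim_row V \<and>
     (\<exists>T \<in> carrier_mat (dim_row U) (dim_row U). invertible_mat T \<and>
        map_mat (\<lambda>c. scl G c 1) T * U = V * map_mat (\<lambda>c. scl G c 1) T)"

definition Irr :: "('a::ring_1) cqg \<Rightarrow> 'a mat set set" where
  "Irr G = {U. irreducible_unitary_rep G U} //
     {(U, V). irreducible_unitary_rep G U \<and> irreducible_unitary_rep G V \<and> equivalent_reps G U V}"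

definition irr_representatives :: "('a::ring_1) cqg \<Rightarrow> ('a mat set \<Rightarrow> 'a mat) \<Rightarrow> bool" where
  "irr_representatives G u \<longleftrightarrow> (\<forall>\<beta>\<in>Irr G. u \<beta> \<in> \<beta>)"


section \<open>Complex matrices\<close>

definition vec_norm2 :: "complex vec \<Rightarrow> real" where
  "vec_norm2 v = sqrt (\<Sum>i<dim_vec v. (cmod (v $ i))\<^sup>2)"

definition mat_opnorm :: "complex mat \<Rightarrow> real" where
  "mat_opnorm A = Sup {vec_norm2 (A *\<^sub>v v) | v. v \<in> carrier_vec (dim_col A) \<and> vec_norm2 v \<le> 1}"

text \<open>The order on \<open>complex\<close> is such that \<open>0 \<le> z\<close> means that \<open>z\<close> is real and nonnegative.\<close>

definition psd_mat :: "complex mat \<Rightarrow> bool" where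
  "psd_mat A \<longleftrightarrow> square_mat A \<and> (\<forall>v \<in> carrier_vec (dim_row A). 0 \<le> (A *\<^sub>v v) \<bullet>c v)"

definition mat_ge :: "complex mat \<Rightarrow> complex mat \<Rightarrow> bool" where
  "mat_ge A B \<longleftrightarrow> psd_mat (A - B)"


section \<open>Hilbert spaces\<close>

text \<open>
  HOL cannot quantify existentially over types, so a Hilbert space is a structure on a subset
  of an ambient type \<open>'h\<close>; the existence statements below have \<open>'h\<close> as a parameter.
\<close>

record 'h hilbert =
  vecs :: "'h set"
  hzero :: 'h
  hadd :: "'h \<Rightarrow> 'h \<Rightarrow> 'h"
  hscale :: "complex \<Rightarrow> 'h \<Rightarrow> 'h"
  hinner :: "'h \<Rightarrow> 'h \<Rightarrow> complex"

definition hnorm :: "'h hilbert \<Rightarrow> 'h \<Rightarrow> real" where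
  "hnorm H x = sqrt (Re (hinner H x x))"

definition hdiff :: "'h hilbert \<Rightarrow> 'h \<Rightarrow> 'h \<Rightarrow> 'h" where
  "hdiff H x y = hadd H x (hscale H (-1) y)"

definition complex_vector_space :: "'h hilbert \<Rightarrow> bool" where
  "complex_vector_space H \<longleftrightarrow>
     hzero H \<in> vecs H \<and>
     (\<forall>x\<in>vecs H. \<forall>y\<in>vecs H. hadd H x y \<in> vecs H \<and> hadd H x y = hadd H y x) \<and>
     (\<forall>x\<in>vecs H. \<forall>y\<in>vecs H. \<forall>z\<in>vecs H. hadd H (hadd H x y) z = hadd H x (hadd H y z)) \<and>
     (\<forall>x\<in>vecs H. hadd H (hzero H) x = x) \<and>
     (\<forall>x\<in>vecs H. \<exists>y\<in>vecs H. hadd H x y = hzero H) \<and>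
     (\<forall>c. \<forall>x\<in>vecs H. hscale H c x \<in> vecs H) \<and>
     (\<forall>c. \<forall>x\<in>vecs H. \<forall>y\<in>vecs H.
        hscale H c (hadd H x y) = hadd H (hscale H c x) (hscale H c y)) \<and>
     (\<forall>c d. \<forall>x\<in>vecs H. hscale H (c + d) x = hadd H (hscale H c x) (hscale H d x)) \<and>
     (\<forall>c d. \<forall>x\<in>vecs H. hscale H (c * d) x = hscale H c (hscale H d x)) \<and>
     (\<forall>x\<in>vecs H. hscale H 1 x = x)"

definition inner_product :: "'h hilbert \<Rightarrow> bool" where
  "inner_product H \<longleftrightarrow>
     (\<forall>x\<in>vecs H. \<forall>y\<in>vecs H. \<forall>z\<in>vecs H. hinner H x (hadd H y z) = hinner H x y + hinner H x z) \<and>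
     (\<forall>c. \<forall>x\<in>vecs H. \<forall>y\<in>vecs H. hinner H x (hscale H c y) = c * hinner H x y) \<and>
     (\<forall>x\<in>vecs H. \<forall>y\<in>vecs H. hinner H y x = cnj (hinner H x y)) \<and>
     (\<forall>x\<in>vecs H. 0 \<le> hinner H x x \<and> (hinner H x x = 0 \<longrightarrow> x = hzero H))"

definition complete_space_on :: "'h hilbert \<Rightarrow> bool" where
  "complete_space_on H \<longleftrightarrow>
     (\<forall>X::nat \<Rightarrow> 'h. (\<forall>n. X n \<in> vecs H) \<and>
        (\<forall>e>0. \<exists>N. \<forall>m\<ge>N. \<forall>n\<ge>N. hnorm H (hdiff H (X m) (X n)) < e) \<longrightarrow>
        (\<exists>x\<in>vecs H. (\<lambda>n. hnorm H (hdiff H (X n) x)) \<longlonglongrightarrow> 0))"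

definition hilbert_space :: "'h hilbert \<Rightarrow> bool" where
  "hilbert_space H \<longleftrightarrow> complex_vector_space H \<and> inner_product H \<and> complete_space_on H"

definition bounded_operator :: "'h hilbert \<Rightarrow> ('h \<Rightarrow> 'h) \<Rightarrow> bool" where
  "bounded_operator H T \<longleftrightarrow>
     (\<forall>x\<in>vecs H. T x \<in> vecs H) \<and>
     (\<forall>x\<in>vecs H. \<forall>y\<in>vecs H. T (hadd H x y) = hadd H (T x) (T y)) \<and>
     (\<forall>c. \<forall>x\<in>vecs H. T (hscale H c x) = hscale H c (T x)) \<and>
     (\<exists>C. \<forall>x\<in>vecs H. hnorm H (T x) \<le> C * hnorm H x)"

text \<open>Unital \<open>*\<close>-homomorphisms \<open>Pol(\<G>) \<rightarrow> B(H)\<close>.\<close>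

definition star_rep :: "('a::ring_1) cqg \<Rightarrow> 'h hilbert \<Rightarrow> ('a \<Rightarrow> 'h \<Rightarrow> 'h) \<Rightarrow> bool" where
  "star_rep G H \<pi> \<longleftrightarrow>
     (\<forall>a. bounded_operator H (\<pi> a)) \<and>
     (\<forall>a b. \<forall>x\<in>vecs H. \<pi> (a + b) x = hadd H (\<pi> a x) (\<pi> b x)) \<and>
     (\<forall>c a. \<forall>x\<in>vecs H. \<pi> (scl G c a) x = hscale H c (\<pi> a x)) \<and>
     (\<forall>a b. \<forall>x\<in>vecs H. \<pi> (a * b) x = \<pi> a (\<pi> b x)) \<and>
     (\<forall>x\<in>vecs H. \<pi> 1 x = x) \<and>
     (\<forall>a. \<forall>x\<in>vecs H. \<forall>y\<in>vecs H. hinner H (\<pi> (star G a) x) y = hinner H x (\<pi> a y))"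


section \<open>Proper cocycles\<close>

definition cocycle :: "('a::ring_1) cqg \<Rightarrow> 'h hilbert \<Rightarrow> ('a \<Rightarrow> 'h) \<Rightarrow> bool" where
  "cocycle G H \<eta> \<longleftrightarrow>
     (\<forall>a. \<eta> a \<in> vecs H) \<and>
     (\<forall>a b. \<eta> (a + b) = hadd H (\<eta> a) (\<eta> b)) \<and>
     (\<forall>c a. \<eta> (scl G c a) = hscale H c (\<eta> a)) \<and>
     (\<forall>x\<in>vecs H. \<forall>e>0. \<exists>a. hnorm H (hdiff H x (\<eta> a)) < e) \<and>
     (\<exists>\<pi>. star_rep G H \<pi> \<and>
        (\<forall>a b. \<eta> (a * b) = hadd H (\<pi> a (\<eta> b)) (hscale H (counit G b) (\<eta> a))))"

text \<open>The matrix \<open>(\<eta>\<^sup>\<beta>)\<^sup>* \<eta>\<^sup>\<beta>\<close>, where \<open>U = U\<^sup>\<beta>\<close>.\<close>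

definition cocycle_gram :: "'h hilbert \<Rightarrow> ('a \<Rightarrow> 'h) \<Rightarrow> 'a mat \<Rightarrow> complex mat" where
  "cocycle_gram H \<eta> U = mat (dim_row U) (dim_row U)
     (\<lambda>(i, j). \<Sum>k<dim_row U. hinner H (\<eta> (U $$ (k, i))) (\<eta> (U $$ (k, j))))"

definition proper_cocycle ::
    "('a::ring_1) cqg \<Rightarrow> ('a mat set \<Rightarrow> 'a mat) \<Rightarrow> 'h hilbert \<Rightarrow> ('a \<Rightarrow> 'h) \<Rightarrow> bool" where
  "proper_cocycle G u H \<eta> \<longleftrightarrow> cocycle G H \<eta> \<and>
     (\<forall>M>0. \<exists>F. finite F \<and> F \<subseteq> Irr G \<and>
        (\<forall>\<beta>\<in>Irr G - F.
           mat_ge (cocycle_gram H \<eta> (u \<beta>)) (complex_of_real M \<cdot>\<^sub>m 1\<^sub>m (dim_row (u \<beta>)))))"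

definition admits_proper_cocycle ::
    "'h itself \<Rightarrow> ('a::ring_1) cqg \<Rightarrow> ('a mat set \<Rightarrow> 'a mat) \<Rightarrow> bool" where
  "admits_proper_cocycle TYPE('h) G u \<longleftrightarrow>
     (\<exists>(H::'h hilbert) \<eta>. hilbert_space H \<and> proper_cocycle G u H \<eta>)"


section \<open>The Haagerup property\<close>

definition mixing ::
    "('a::ring_1) cqg \<Rightarrow> ('a mat set \<Rightarrow> 'a mat) \<Rightarrow> 'h hilbert \<Rightarrow> ('a \<Rightarrow> 'h \<Rightarrow> 'h) \<Rightarrow> bool" where
  "mixing G u K \<pi> \<longleftrightarrow>
     (\<forall>\<xi>\<in>vecs K. \<forall>\<zeta>\<in>vecs K. \<forall>e>0.
        finite {\<beta>\<in>Irr G. \<not> mat_opnorm (map_mat (\<lambda>a. hinner K \<xi> (\<pi> a \<zeta>)) (u \<beta>)) < e})"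

definition almost_invariant_vectors ::
    "('a::ring_1) cqg \<Rightarrow> 'h hilbert \<Rightarrow> ('a \<Rightarrow> 'h \<Rightarrow> 'h) \<Rightarrow> bool" where
  "almost_invariant_vectors G K \<pi> \<longleftrightarrow>
     (\<exists>\<xi>::nat \<Rightarrow> 'h. (\<forall>n. \<xi> n \<in> vecs K \<and> hnorm K (\<xi> n) = 1) \<and>
        (\<forall>a. (\<lambda>n. hnorm K (hdiff K (\<pi> a (\<xi> n)) (hscale K (counit G a) (\<xi> n)))) \<longlonglongrightarrow> 0))"

text \<open>The Haagerup property of the discrete dual of \<open>\<G>\<close>.\<close>

definition dual_haagerup ::
    "'h itself \<Rightarrow> ('a::ring_1) cqg \<Rightarrow> ('a mat set \<Rightarrow> 'a mat) \<Rightarrow> bool" where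
  "dual_haagerup TYPE('h) G u \<longleftrightarrow>
     (\<exists>(K::'h hilbert) \<pi>. hilbert_space K \<and> star_rep G K \<pi> \<and>
        mixing G u K \<pi> \<and> almost_invariant_vectors G K \<pi>)"

text \<open>
  An ambient type is large if it holds every Hilbert space with a dense subset indexed by (a subset
  of) \<open>'a\<close>, whose points are limits of sequences indexed by \<open>nat \<Rightarrow> 'a\<close>. The range of a cocycle is
  such a dense subset, and closed subspaces generated under \<open>\<pi>\<close> by sequences of vectors are also
  this small, so restricting to large ambient types excludes nothing.
\<close>

definition large_universe :: "'h itself \<Rightarrow> 'a itself \<Rightarrow> bool" where
  "large_universe TYPE('h) TYPE('a) \<longleftrightarrow> (\<exists>e :: (nat \<Rightarrow> 'a) \<Rightarrow> 'h. inj e)"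

end

theory Submission
  imports "HOL-Analysis.Uniform_Limit" "HOL-Analysis.L2_Norm" "Jordan_Normal_Form.Spectral_Radius" Defs
begin

text \<open>
  If \<open>\<pi>\<close> is mixing with almost invariant vectors \<open>\<xi>\<^sub>n\<close>, the form
  \<open>q(a, b) = \<Sum>\<^sub>n \<langle>(\<pi>(a) - \<epsilon>(a)) \<xi>\<^sub>n, (\<pi>(b) - \<epsilon>(b)) \<xi>\<^sub>n\<rangle>\<close> converges after passing to a subsequence, and
  completing \<open>Pol(\<G>)\<close> with respect to it gives a cocycle. Outside a finite set of \<open>\<beta>\<close> each of the first
  \<open>N\<close> summands contributes at least \<open>1\<close> to \<open>(\<eta>\<^sup>\<beta>)\<^sup>* \<eta>\<^sup>\<beta>\<close>, because mixing makes the coefficient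
  matrices of \<open>\<xi>\<^sub>n\<close> small; so the cocycle is proper.

  Conversely, let \<open>q\<close> be the form of a proper cocycle. The square of the antipode is diagonalizable with
  positive eigenvalues, so \<open>Pol(\<G>)\<close> is graded; pinching \<open>q\<close> to be diagonal for this grading keeps
  it a proper cocycle form and makes it the coboundary of a hermitian functional \<open>L\<close>. The convolution
  exponentials \<open>\<phi>\<^sub>n = exp\<^sub>*(L / n)\<close> are states (Schoenberg correspondence) converging to \<open>\<epsilon>\<close>. On
  a unitary representation \<open>\<phi>\<^sub>n\<close> is the exponential of the matrix \<open>L(u) / n\<close>, whose real part is at
  most \<open>- (\<eta>\<^sup>\<beta>)\<^sup>* \<eta>\<^sup>\<beta> / 4n\<close>; hence the coefficients are small outside a finite set, and the same
  estimate for tensor products \<open>x \<otimes> u \<otimes> y\<close> gives mixing of the sum of the GNS representations of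
  the \<open>\<phi>\<^sub>n\<close>, whose cyclic vectors are almost invariant.
\<close>

section \<open>Unitary matrices over the complex numbers\<close>

text \<open>The delicate point is the passage from a proper cocycle to states. The exponential needs
  a functional whose coboundary is a positive form. The candidate supplied by a cocycle, minus the
  entries of its Gram matrices, has as coboundary q plus the reflection r of q under the antipode,
  and positivity of r becomes available once different eigenspaces of the squared antipode are
  orthogonal for q. Pinching is harmless for properness because in an adapted basis
  \<open>u i j\<close> has eigenvalue \<open>d i / d j\<close>, so that the Gram matrix is merely
  cut down to diagonal blocks. The positive numbers d are eigenvalues of an inner product invariant
  under the conjugate representation; it is found algebraically, by expanding in irreducible unitary
  representations, rather than by integration. Only the form <\<eta> a, \<eta> b> enters these
  arguments, and Hilbert spaces arise as completions at the end. Tensor products enter because a GNS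
  matrix coefficient at vectors b and c is \<phi> (st b * u i j * c), which is not an entry of
  \<phi> on u itself.\<close>

definition unitary_cmat :: "nat \<Rightarrow> (nat \<Rightarrow> nat \<Rightarrow> complex) \<Rightarrow> bool" where
  "unitary_cmat n P \<longleftrightarrow>
     (\<forall>i<n. \<forall>j<n. (\<Sum>k<n. cnj (P k i) * P k j) = of_bool (i = j)) \<and>
     (\<forall>i<n. \<forall>j<n. (\<Sum>k<n. P i k * cnj (P j k)) = of_bool (i = j))"

definition mv :: "nat \<Rightarrow> (nat \<Rightarrow> nat \<Rightarrow> complex) \<Rightarrow> (nat \<Rightarrow> complex) \<Rightarrow> nat \<Rightarrow> complex" where
  "mv n A x = (\<lambda>i. \<Sum>k<n. A i k * x k)"

definition mm :: "nat \<Rightarrow> (nat \<Rightarrow> nat \<Rightarrow> complex) \<Rightarrow> (nat \<Rightarrow> nat \<Rightarrow> complex) \<Rightarrow> nat \<Rightarrow> nat \<Rightarrow> complex"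
  where "mm n A B = (\<lambda>i j. \<Sum>k<n. A i k * B k j)"

definition dg :: "(nat \<Rightarrow> nat \<Rightarrow> complex) \<Rightarrow> nat \<Rightarrow> nat \<Rightarrow> complex" where
  "dg A = (\<lambda>i j. cnj (A j i))"

lemma mv_mv: "mv n A (mv n B x) = mv n (mm n A B) x"
proof
  fix i
  have "mv n A (mv n B x) i = (\<Sum>k<n. \<Sum>l<n. A i k * B k l * x l)"
    by (simp add: mv_def sum_distrib_left mult.assoc)
  also have "\<dots> = mv n (mm n A B) x i"
    by (subst sum.swap) (simp add: mv_def mm_def sum_distrib_right)
  finally show "mv n A (mv n B x) i = mv n (mm n A B) x i" .
qed

lemma mm_assoc: "mm n (mm n A B) C = mm n A (mm n B C)"
  using mv_mv[of n A B "\<lambda>k. C k j" for j] by (auto simp: mv_def mm_def fun_eq_iff)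

lemma mv_cong: "(\<And>k. k < n \<Longrightarrow> x k = y k) \<Longrightarrow> mv n A x = mv n A y"
  by (auto simp: mv_def)

lemma mm_cong: "(\<And>k. k < n \<Longrightarrow> B k j = C k j) \<Longrightarrow> mm n A B i j = mm n A C i j"
  by (auto simp: mm_def)

lemma mv_scale: "mv n A (\<lambda>k. c * x k) = (\<lambda>i. c * mv n A x i)"
  by (auto simp: mv_def sum_distrib_left algebra_simps)

lemma mv_one: "i < n \<Longrightarrow> (\<And>j. j < n \<Longrightarrow> A i j = of_bool (i = j)) \<Longrightarrow> mv n A x i = x i"
  by (simp add: mv_def)

lemma mm_one: "i < n \<Longrightarrow> (\<And>j. j < n \<Longrightarrow> A i j = of_bool (i = j)) \<Longrightarrow> mm n A B i j = B i j"
  by (simp add: mm_def)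

lemma mm_one_right: "j < n \<Longrightarrow> (\<And>i. i < n \<Longrightarrow> A i j = of_bool (i = j)) \<Longrightarrow> mm n B A i j = B i j"
  by (simp add: mm_def)

lemma dg_dg [simp]: "dg (dg A) = A"
  by (simp add: dg_def)

lemma dg_mm: "dg (mm n A B) = mm n (dg B) (dg A)"
  by (auto simp: dg_def mm_def mult.commute)

lemma unitary_cmat_iff: "unitary_cmat n P \<longleftrightarrow>
    (\<forall>i<n. \<forall>j<n. mm n (dg P) P i j = of_bool (i = j)) \<and>
    (\<forall>i<n. \<forall>j<n. mm n P (dg P) i j = of_bool (i = j))"
  by (simp add: unitary_cmat_def mm_def dg_def)

lemma unitary_cmat_one: "unitary_cmat n (\<lambda>i j. of_bool (i = j))"
  by (auto simp: unitary_cmat_def of_bool_def if_distrib cong: if_cong)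

lemma unitary_cmat_dg: "unitary_cmat n P \<Longrightarrow> unitary_cmat n (dg P)"
  by (simp add: unitary_cmat_iff)

lemma unitary_cmat_cancel_left:
  assumes P: "unitary_cmat n P" and i: "i < n"
  shows "mm n (dg P) (mm n P A) i j = A i j"
  using assms by (simp add: mm_assoc[symmetric] unitary_cmat_iff mm_one)

lemma unitary_cmat_cancel_left':
  assumes P: "unitary_cmat n P" and i: "i < n"
  shows "mm n P (mm n (dg P) A) i j = A i j"
  using assms by (simp add: mm_assoc[symmetric] unitary_cmat_iff mm_one)

lemma unitary_cmat_mult:
  assumes P: "unitary_cmat n P" and H: "unitary_cmat n H"
  shows "unitary_cmat n (mm n P H)"
proof -
  have "mm n (dg (mm n P H)) (mm n P H) i j = of_bool (i = j)" if "i < n" "j < n" for i j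
  proof -
    have "mm n (dg (mm n P H)) (mm n P H) i j = mm n (dg H) (mm n (dg P) (mm n P H)) i j"
      by (simp add: dg_mm mm_assoc)
    also have "\<dots> = mm n (dg H) H i j"
      by (rule mm_cong) (simp add: unitary_cmat_cancel_left P)
    finally show ?thesis
      using H that by (simp add: unitary_cmat_iff)
  qed
  moreover have "mm n (mm n P H) (dg (mm n P H)) i j = of_bool (i = j)" if "i < n" "j < n" for i j
  proof -
    have "mm n (mm n P H) (dg (mm n P H)) i j = mm n P (mm n H (mm n (dg H) (dg P))) i j"
      by (simp add: dg_mm mm_assoc)
    also have "\<dots> = mm n P (dg P) i j"
      by (rule mm_cong) (simp add: unitary_cmat_cancel_left' H)
    finally show ?thesis
      using P that by (simp add: unitary_cmat_iff)
  qed
  ultimately show ?thesis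
    by (simp add: unitary_cmat_iff)
qed

text \<open>A reflection that swaps two unit vectors exists over the complex numbers only if their
  inner product is real, hence the preliminary phase \<open>c\<close>. The basis vectors with index
  below r are orthogonal to both and stay fixed.\<close>

lemma householder:
  assumes r: "r < n" and x0: "\<And>i. i < r \<Longrightarrow> x i = 0" and x1: "(\<Sum>i<n. (cmod (x i))\<^sup>2) = 1"
  obtains H c where "unitary_cmat n H" "\<And>i j. i < n \<Longrightarrow> j < r \<Longrightarrow> H i j = of_bool (i = j)"
    "c \<noteq> 0" "\<And>i. i < n \<Longrightarrow> H i r = c * x i"
proof -
  define c where "c = (if x r = 0 then 1 else cnj (x r) / cmod (x r))"
  have "cnj (x r) * x r = of_real (cmod (x r)) * of_real (cmod (x r))"
    using complex_norm_square[of "x r"] by (simp add: power2_eq_square mult.commute)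
  then have c: "cmod c = 1" "c * x r = cmod (x r)"
    by (auto simp: c_def norm_divide)
  define y where "y i = c * x i" for i
  have yr: "y r = cmod (x r)"
    using c by (simp add: y_def)
  have "y i * cnj (y i) = of_real ((cmod (x i))\<^sup>2)" for i
    unfolding complex_norm_square[symmetric] by (simp add: y_def norm_mult c(1))
  then have "(\<Sum>i<n. y i * cnj (y i)) = of_real (\<Sum>i<n. (cmod (x i))\<^sup>2)"
    by simp
  then have y1: "(\<Sum>i<n. y i * cnj (y i)) = 1"
    by (simp only: x1 of_real_1)
  define w where "w i = of_bool (i = r) - y i" for i
  define s where "s = (\<Sum>i<n. cnj (w i) * w i)"
  have "cnj (w i) * w i = y i * cnj (y i) + (if i = r then 1 - 2 * y r else 0)" for i
    by (cases "i = r") (auto simp: w_def yr algebra_simps)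
  then have "s = (\<Sum>i<n. y i * cnj (y i)) + (1 - 2 * y r)"
    using r by (simp add: s_def sum.distrib)
  then have s2: "s = 2 - 2 * y r"
    by (simp add: y1)
  then have cs: "cnj s = s"
    by (simp add: yr)
  have s_real: "s = of_real (\<Sum>i<n. (cmod (w i))\<^sup>2)"
    by (simp only: s_def of_real_sum complex_norm_square) (simp add: mult.commute)
  show thesis
  proof (cases "s = 0")
    case True
    then have "(\<Sum>i<n. (cmod (w i))\<^sup>2) = 0"
      by (simp only: s_real of_real_eq_0_iff)
    then have "w i = 0" if "i < n" for i
      using that by (subst (asm) sum_nonneg_eq_0_iff) auto
    then have "of_bool (i = r) = c * x i" if "i < n" for i
      using that by (auto simp: w_def y_def)
    moreover have "c \<noteq> 0"
      using c(1) by auto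
    ultimately show ?thesis
      using r by (intro that[OF unitary_cmat_one, of c]) auto
  next
    case False
    define t where "t = 2 / s"
    have ts: "t * s = 2" and ct: "cnj t = t"
      using False by (auto simp: t_def cs)
    define H where "H i j = of_bool (i = j) - t * (w i * cnj (w j))" for i j
    have dgH: "dg H = H"
      by (auto simp: dg_def H_def ct fun_eq_iff)
    have "mm n H H i j = of_bool (i = j)" if "i < n" "j < n" for i j
    proof -
      have "mm n H H i j = (\<Sum>k<n. of_bool (i = k) * H k j
          - of_bool (k = j) * (t * (w i * cnj (w k))) + t * t * (w i * cnj (w j)) * (cnj (w k) * w k))"
        by (auto simp: mm_def H_def algebra_simps intro!: sum.cong)
      also have "\<dots> = H i j - t * (w i * cnj (w j)) + t * t * (w i * cnj (w j)) * s"
        using that by (simp add: sum.distrib sum_subtractf sum_distrib_left[symmetric] s_def[symmetric])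
      also have "\<dots> = H i j - t * (w i * cnj (w j)) + t * (w i * cnj (w j)) * (t * s)"
        by (simp only: mult_ac)
      also have "\<dots> = of_bool (i = j)"
        by (simp add: ts H_def)
      finally show ?thesis .
    qed
    then have "unitary_cmat n H"
      by (simp add: unitary_cmat_iff dgH)
    moreover have "H i j = of_bool (i = j)" if "j < r" for i j
      using that x0 by (simp add: H_def w_def y_def)
    moreover have "H i r = c * x i" for i
    proof -
      have "cnj (w r) = s / 2"
        by (simp add: w_def s2 yr diff_divide_distrib)
      then have "t * cnj (w r) = t * s / 2"
        by (simp only: times_divide_eq_right)
      then have "t * cnj (w r) = 1"
        by (simp add: ts)
      moreover have "H i r = of_bool (i = r) - w i * (t * cnj (w r))"
        by (simp add: H_def)
      ultimately have "H i r = of_bool (i = r) - w i"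
        by simp
      then show ?thesis
        by (simp add: w_def y_def)
    qed
    moreover have "c \<noteq> 0"
      using c(1) by auto
    ultimately show ?thesis
      by (intro that)
  qed
qed

text \<open>Multiplying \<open>P\<close> on the right by a Householder unitary turns column r into a
  multiple of \<open>P x\<close> and keeps the earlier columns; this is the inductive step of both
  basis constructions that follow.\<close>

lemma unitary_cmat_extend:
  assumes P: "unitary_cmat n P" and r: "r < n" and x0: "\<And>i. i < r \<Longrightarrow> x i = 0"
    and x: "k < n" "x k \<noteq> 0"
  obtains P' c where "unitary_cmat n P'" "\<And>i j. j < r \<Longrightarrow> P' i j = P i j"
    "c \<noteq> 0" "\<And>i. P' i r = c * mv n P x i"
proof -
  define N where "N = sqrt (\<Sum>i<n. (cmod (x i))\<^sup>2)"
  have "(\<Sum>i<n. (cmod (x i))\<^sup>2) > 0"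
    by (rule sum_pos2[of _ k]) (use x in auto)
  then have N: "N > 0" and N2: "N\<^sup>2 = (\<Sum>i<n. (cmod (x i))\<^sup>2)"
    by (auto simp: N_def)
  define z where "z i = x i / N" for i
  have "(\<Sum>i<n. (cmod (z i))\<^sup>2) = 1"
    using N by (simp add: z_def norm_divide power_divide sum_divide_distrib[symmetric] N2[symmetric])
  moreover have "z i = 0" if "i < r" for i
    using that by (simp add: z_def x0)
  ultimately obtain H c where H: "unitary_cmat n H"
    "\<And>i j. i < n \<Longrightarrow> j < r \<Longrightarrow> H i j = of_bool (i = j)" "c \<noteq> 0" "\<And>i. i < n \<Longrightarrow> H i r = c * z i"
    using householder[OF r, of z] by blast
  show thesis
  proof (rule that)
    show "unitary_cmat n (mm n P H)"
      by (rule unitary_cmat_mult[OF P H(1)])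
    show "mm n P H i j = P i j" if "j < r" for i j
      using that H(2) r by (intro mm_one_right) auto
    show "c / N \<noteq> 0"
      using H(3) N by simp
    show "mm n P H i r = c / N * mv n P x i" for i
      by (simp add: mm_def mv_def H(4) z_def sum_distrib_left algebra_simps)
  qed
qed

text \<open>Take the largest r for which some unitary has its first r columns in W. If a vector of W
  had a nonzero coordinate from r on, removing its components along the first r columns would give a
  vector of W that could serve as column r. Vectors are functions on nat; \<open>ext\<close> says
  that W depends only on the entries below n.\<close>

lemma unitary_cmat_adapted:
  assumes add: "\<And>v w. v \<in> W \<Longrightarrow> w \<in> W \<Longrightarrow> (\<lambda>i. v i + w i) \<in> W"
    and scale: "\<And>c v. v \<in> W \<Longrightarrow> (\<lambda>i. c * v i) \<in> W"
    and ext: "\<And>v w. v \<in> W \<Longrightarrow> (\<And>i. i < n \<Longrightarrow> v i = w i) \<Longrightarrow> w \<in> W"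
  obtains P r where "unitary_cmat n P" "r \<le> n" "\<And>j. j < r \<Longrightarrow> (\<lambda>i. P i j) \<in> W"
    "\<And>w j. w \<in> W \<Longrightarrow> r \<le> j \<Longrightarrow> j < n \<Longrightarrow> mv n (dg P) w j = 0"
proof -
  define Q where "Q r \<longleftrightarrow> r \<le> n \<and> (\<exists>P. unitary_cmat n P \<and> (\<forall>j<r. (\<lambda>i. P i j) \<in> W))" for r
  define R where "R = Greatest Q"
  have "Q 0"
    using unitary_cmat_one by (auto simp: Q_def)
  then have "Q R"
    unfolding R_def by (rule GreatestI_nat[where b = n]) (auto simp: Q_def)
  have not_Suc: "\<not> Q (Suc R)"
    using Greatest_le_nat[of Q "Suc R" n] by (auto simp: R_def[symmetric] Q_def)
  obtain P where P: "unitary_cmat n P" "\<And>j. j < R \<Longrightarrow> (\<lambda>i. P i j) \<in> W" and R: "R \<le> n"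
    using \<open>Q R\<close> by (auto simp: Q_def)
  have "mv n (dg P) w j = 0" if w: "w \<in> W" and j: "R \<le> j" "j < n" for w j
  proof (rule ccontr)
    assume neq: "mv n (dg P) w j \<noteq> 0"
    define x where "x = mv n (dg P) w"
    \<comment> \<open>\<open>P x'\<close> is w minus its components along the first R columns. It
      lies in W by \<open>partial\<close>, and its coordinate j in the basis P is nonzero.\<close>
    define x' where "x' k = (if k < R then 0 else x k)" for k
    have "R < n"
      using j by simp
    obtain P' c where P': "unitary_cmat n P'" "\<And>i j. j < R \<Longrightarrow> P' i j = P i j"
      "c \<noteq> 0" "\<And>i. P' i R = c * mv n P x' i"
      by (rule unitary_cmat_extend[OF P(1) \<open>R < n\<close>, of x' j]) (use j neq in \<open>auto simp: x'_def x_def\<close>)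
    have partial: "(\<lambda>i. w i + (\<Sum>k<m. - x k * P i k)) \<in> W" if "m \<le> R" for m
      using that
    proof (induction m)
      case 0
      then show ?case
        using w by simp
    next
      case (Suc m)
      then have "(\<lambda>i. (w i + (\<Sum>k<m. - x k * P i k)) + - x m * P i m) \<in> W"
        by (intro add[of "\<lambda>i. w i + (\<Sum>k<m. - x k * P i k)"] scale P) auto
      then show ?case
        by (simp add: algebra_simps)
    qed
    have "mv n P x' i = w i + (\<Sum>k<R. - x k * P i k)" if "i < n" for i
    proof -
      have "mv n P x i = w i"
        unfolding x_def mv_mv using that P(1) by (intro mv_one) (auto simp: unitary_cmat_iff)
      moreover have "mv n P x i = (\<Sum>k<R. P i k * x k) + (\<Sum>k\<in>{R..<n}. P i k * x k)"
        unfolding mv_def using R by (simp add: sum.atLeastLessThan_concat lessThan_atLeast0)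
      moreover have "mv n P x' i = (\<Sum>k<R. P i k * x' k) + (\<Sum>k\<in>{R..<n}. P i k * x' k)"
        unfolding mv_def using R by (simp add: sum.atLeastLessThan_concat lessThan_atLeast0)
      ultimately show ?thesis
        by (simp add: x'_def sum_negf algebra_simps)
    qed
    then have "mv n P x' \<in> W"
      by (intro ext[OF partial[OF order_refl]]) simp
    then have "(\<lambda>i. P' i R) \<in> W"
      using scale by (simp add: P'(4))
    then have "Q (Suc R)"
      unfolding Q_def using P' P(2) \<open>R < n\<close> by (intro conjI exI[of _ P']) (auto simp: less_Suc_eq)
    then show False
      using not_Suc by contradiction
  qed
  then show thesis
    using that P R by blast
qed

section \<open>Eigenbases of Hermitian matrices\<close>

lemma complex_eigenvector:
  fixes B :: "nat \<Rightarrow> nat \<Rightarrow> complex"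
  assumes "0 < m"
  obtains e v k where "\<And>i. i < m \<Longrightarrow> mv m B v i = e * v i" "k < m" "v k \<noteq> 0"
proof -
  define M where "M = Matrix.mat m m (\<lambda>(i, j). B i j)"
  have M: "M \<in> carrier_mat m m"
    by (simp add: M_def)
  obtain e where "eigenvalue M e"
    using spectrum_non_empty[OF M] assms by (auto simp: spectrum_def)
  then obtain v where v: "v \<in> carrier_vec m" "v \<noteq> 0\<^sub>v m" "M *\<^sub>v v = e \<cdot>\<^sub>v v"
    using M by (auto simp: eigenvalue_def eigenvector_def)
  obtain k where "k < m" "v $ k \<noteq> 0"
    using v(1,2) by (metis carrier_vecD eq_vecI index_zero_vec)
  moreover have "mv m B (\<lambda>i. v $ i) i = e * v $ i" if "i < m" for i
  proof -
    have "(M *\<^sub>v v) $ i = mv m B (\<lambda>i. v $ i) i"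
      using that v(1) M by (simp add: scalar_prod_def M_def mv_def lessThan_atLeast0)
    then show ?thesis
      using that v by simp
  qed
  ultimately show thesis
    using that by blast
qed

text \<open>Induction on the number r of columns that are eigenvectors. In the basis P a Hermitian
  matrix is then block diagonal, so an eigenvector of the lower right block, padded by zeros, is an
  eigenvector of the whole matrix and can be moved to column r.\<close>

lemma hermitian_diagonalize:
  assumes A: "\<And>i j. i < n \<Longrightarrow> j < n \<Longrightarrow> A i j = cnj (A j i)"
  obtains P d where "unitary_cmat n P" "\<And>i j. i < n \<Longrightarrow> j < n \<Longrightarrow> mm n A P i j = d j * P i j"
proof -
  have "\<exists>P d. unitary_cmat n P \<and> (\<forall>j<r. \<forall>i<n. mm n A P i j = d j * P i j)" if "r \<le> n" for r
    using that
  proof (induction r)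
    case 0
    then show ?case
      using unitary_cmat_one by auto
  next
    case (Suc r)
    then obtain P d where P: "unitary_cmat n P" "\<And>i j. j < r \<Longrightarrow> i < n \<Longrightarrow> mm n A P i j = d j * P i j"
      by fastforce
    define A' where "A' = mm n (dg P) (mm n A P)"
    have A'r: "A' i j = d j * of_bool (i = j)" if "j < r" "i < n" for i j
    proof -
      have "A' i j = d j * mm n (dg P) P i j"
        using that Suc.prems by (simp add: A'_def mm_def[of _ "dg P"] P(2) sum_distrib_left algebra_simps)
      then show ?thesis
        using that P(1) Suc.prems by (simp add: unitary_cmat_iff)
    qed
    have A'h: "A' i j = cnj (A' j i)" if "i < n" "j < n" for i j
    proof -
      have "cnj (A' j i) = dg A' i j"
        by (simp add: dg_def)
      also have "\<dots> = mm n (dg P) (mm n (dg A) P) i j"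
        by (simp add: A'_def dg_mm mm_assoc)
      also have "\<dots> = A' i j"
        unfolding A'_def
        by (intro mm_cong) (use A[symmetric] in \<open>auto simp: mm_def dg_def intro!: sum.cong\<close>)
      finally show ?thesis ..
    qed
    have "0 < n - r"
      using Suc.prems by simp
    obtain e v k where v: "\<And>i. i < n - r \<Longrightarrow> mv (n - r) (\<lambda>i j. A' (i + r) (j + r)) v i = e * v i"
      "k < n - r" "v k \<noteq> 0"
      by (rule complex_eigenvector[OF \<open>0 < n - r\<close>, where B = "\<lambda>i j. A' (i + r) (j + r)"], blast)
    define x where "x i = (if i < r then 0 else v (i - r))" for i
    have split: "mv n A' x i = mv (n - r) (\<lambda>i j. A' i (j + r)) v i" for i
    proof -
      have "mv n A' x i = (\<Sum>k<r. A' i k * x k) + (\<Sum>k\<in>{0+r..<(n-r)+r}. A' i k * x k)"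
        unfolding mv_def using Suc.prems by (simp add: sum.atLeastLessThan_concat lessThan_atLeast0)
      moreover have "(\<Sum>k\<in>{0+r..<(n-r)+r}. A' i k * x k) = mv (n - r) (\<lambda>i j. A' i (j + r)) v i"
        unfolding sum.shift_bounds_nat_ivl by (simp add: mv_def x_def lessThan_atLeast0)
      moreover have "(\<Sum>k<r. A' i k * x k) = 0"
        by (simp add: x_def)
      ultimately show ?thesis
        by simp
    qed
    have eig: "mv n A' x i = e * x i" if "i < n" for i
    proof (cases "i < r")
      case True
      have "A' i (j + r) = 0" if "j < n - r" for j
        using A'h[of i "j + r"] A'r[of i "j + r"] True that by auto
      then show ?thesis
        using True by (simp add: split) (simp add: mv_def x_def)
    next
      case False
      then have "mv (n - r) (\<lambda>i j. A' i (j + r)) v i = e * v (i - r)"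
        using v(1)[of "i - r"] that by (simp add: mv_def)
      then show ?thesis
        using False by (simp add: split x_def)
    qed
    have r: "r < n"
      using Suc.prems by simp
    obtain P' c where P': "unitary_cmat n P'" "\<And>i j. j < r \<Longrightarrow> P' i j = P i j"
      "c \<noteq> 0" "\<And>i. P' i r = c * mv n P x i"
      by (rule unitary_cmat_extend[OF P(1) r, of x "k + r"]) (use v in \<open>auto simp: x_def\<close>)
    have "mm n A P' i j = (d(r := e)) j * P' i j" if "i < n" "j < Suc r" for i j
    proof (cases "j < r")
      case True
      then show ?thesis
        using P(2)[of j i] that by (simp add: mm_def P'(2))
    next
      case False
      then have j: "j = r"
        using that by simp
      have "mv n A (mv n P x) i = mv n (mm n P (mm n (dg P) (mm n A P))) x i"
        using that P(1) by (simp add: mv_mv) (simp add: mv_def unitary_cmat_cancel_left')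
      also have "\<dots> = mv n P (mv n A' x) i"
        by (simp add: mv_mv A'_def)
      also have "\<dots> = mv n P (\<lambda>i. e * x i) i"
        by (rule arg_cong[where f = "\<lambda>f. f i"], rule mv_cong) (simp add: eig)
      finally have "mv n A (mv n P x) i = e * mv n P x i"
        by (simp add: mv_scale)
      moreover have "mm n A P' i r = mv n A (\<lambda>k. c * mv n P x k) i"
        by (simp add: mm_def mv_def P'(4))
      ultimately show ?thesis
        by (simp add: j mv_scale P'(4))
    qed
    then show ?case
      using P'(1) by (intro exI[of _ P'] exI[of _ "d(r := e)"]) auto
  qed
  then show thesis
    using that by blast
qed

section \<open>Coefficients of representations\<close>

text \<open>Arbitrary finite index sets allow tensor products to be indexed by pairs. Unitarity is
  kept separate because the entrywise adjoint of a unitary representation is again a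
  corepresentation but in general not unitary.\<close>

definition corep :: "('a::ring_1) cqg \<Rightarrow> 'i set \<Rightarrow> ('i \<Rightarrow> 'i \<Rightarrow> 'a) \<Rightarrow> bool" where
  "corep G I w \<longleftrightarrow> finite I \<and> (\<forall>i\<in>I. \<forall>j\<in>I. \<forall>B. bilinear_form G B \<longrightarrow>
     comult G (w i j) B = (\<Sum>k\<in>I. B (w i k) (w k j)))"

definition urep :: "('a::ring_1) cqg \<Rightarrow> 'i set \<Rightarrow> ('i \<Rightarrow> 'i \<Rightarrow> 'a) \<Rightarrow> bool" where
  "urep G I u \<longleftrightarrow> corep G I u \<and>
     (\<forall>i\<in>I. \<forall>j\<in>I. (\<Sum>k\<in>I. star G (u k i) * u k j) = of_bool (i = j)) \<and>
     (\<forall>i\<in>I. \<forall>j\<in>I. (\<Sum>k\<in>I. u i k * star G (u j k)) = of_bool (i = j))"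

lemma linear_form_iff:
  assumes "vector_space (scl G)"
  shows "linear_form G f \<longleftrightarrow> (\<forall>a b. f (a + b) = f a + f b) \<and> (\<forall>c a. f (scl G c a) = c * f a)"
proof -
  have "vector_space ((*) :: complex \<Rightarrow> complex \<Rightarrow> complex)"
    by unfold_locales (auto simp: algebra_simps)
  then show ?thesis
    using assms
    by (auto simp: linear_form_def Vector_Spaces.linear_iff)
qed

locale cqg =
  fixes G :: "('a::ring_1) cqg" and S :: "'a \<Rightarrow> 'a"
  assumes cqg: "compact_quantum_group G" and antipode: "antipode G S"
begin

abbreviation st where "st \<equiv> star G"
abbreviation eps where "eps \<equiv> counit G"
abbreviation sc where "sc \<equiv> scl G"

lemma hopf: "star_algebra G" "comult_star_hom G" "counit_star_hom G" "counital G"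
  using cqg by (auto simp: compact_quantum_group_def hopf_star_algebra_def)

sublocale vs: vector_space "scl G"
  using hopf(1) by (simp add: star_algebra_def)

lemma scl_mult_left: "sc c a * b = sc c (a * b)" and scl_mult_right: "a * sc c b = sc c (a * b)"
  using hopf(1) by (metis star_algebra_def)+

lemma st_add [simp]: "st (a + b) = st a + st b"
  and st_scl [simp]: "st (sc c a) = sc (cnj c) (st a)"
  and st_mult [simp]: "st (a * b) = st b * st a"
  and st_st [simp]: "st (st a) = a"
  using hopf(1) by (auto simp: star_algebra_def)

lemma st_zero [simp]: "st 0 = 0"
  by (metis st_add add_cancel_right_right)

lemma st_uminus [simp]: "st (- a) = - st a"
  using st_add[of a "- a"] by (simp add: eq_neg_iff_add_eq_0 add.commute)

lemma st_sum: "st (sum f A) = (\<Sum>x\<in>A. st (f x))"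
  by (induction A rule: infinite_finite_induct) auto

lemma st_one [simp]: "st 1 = 1"
  by (metis st_mult st_st mult_1 mult_1_right)

lemma eps_one [simp]: "eps 1 = 1" and eps_mult [simp]: "eps (a * b) = eps a * eps b"
  and eps_st [simp]: "eps (st a) = cnj (eps a)" and eps_lf: "linear_form G eps"
  using hopf(3) by (auto simp: counit_star_hom_def)

lemma lf_iff: "linear_form G f \<longleftrightarrow> (\<forall>a b. f (a + b) = f a + f b) \<and> (\<forall>c a. f (sc c a) = c * f a)"
  by (rule linear_form_iff) unfold_locales

lemma eps_add [simp]: "eps (a + b) = eps a + eps b" and eps_scl [simp]: "eps (sc c a) = c * eps a"
  using eps_lf by (auto simp: lf_iff)

lemma lf_zero: "linear_form G f \<Longrightarrow> f 0 = 0"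
  unfolding lf_iff by (metis add_cancel_right_right)

lemma lf_sum: "linear_form G f \<Longrightarrow> f (sum g A) = (\<Sum>x\<in>A. f (g x))"
  by (induction A rule: infinite_finite_induct) (auto simp: lf_zero lf_iff)

lemma lf_uminus: "linear_form G f \<Longrightarrow> f (- a) = - f a"
  using lf_zero[of f] unfolding lf_iff by (metis add.right_inverse add_eq_0_iff2 minus_add_cancel)

lemma lf_diff: "linear_form G f \<Longrightarrow> f (a - b) = f a - f b"
  using lf_uminus[of f b] unfolding lf_iff by (metis uminus_add_conv_diff add.commute)

lemma eps_zero [simp]: "eps 0 = 0" and eps_uminus [simp]: "eps (- a) = - eps a"
  and eps_diff [simp]: "eps (a - b) = eps a - eps b"
  using lf_zero lf_uminus lf_diff eps_lf by auto

lemma eps_sum: "eps (sum f A) = (\<Sum>x\<in>A. eps (f x))"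
  by (rule lf_sum[OF eps_lf])

lemma eps_of_bool [simp]: "eps (of_bool p) = of_bool p"
  by (cases p) auto

lemma scl_sum_left: "sc (\<Sum>x\<in>A. c x) a = (\<Sum>x\<in>A. sc (c x) a)"
  by (induction A rule: infinite_finite_induct) (auto simp: vs.scale_left_distrib)

lemma scl_sum_right: "sc c (\<Sum>x\<in>A. f x) = (\<Sum>x\<in>A. sc c (f x))"
  by (induction A rule: infinite_finite_induct) (auto simp: vs.scale_right_distrib)

lemma S_add [simp]: "S (a + b) = S a + S b" and S_scl [simp]: "S (sc c a) = sc c (S a)"
  using antipode unfolding antipode_def
  by (auto simp: Vector_Spaces.linear_iff)

lemma S_zero [simp]: "S 0 = 0"
  by (metis S_add add_cancel_right_right)

lemma S_uminus [simp]: "S (- a) = - S a"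
  using S_add[of a "- a"] by (simp add: eq_neg_iff_add_eq_0 add.commute)

lemma S_sum: "S (sum f A) = (\<Sum>x\<in>A. S (f x))"
  by (induction A rule: infinite_finite_induct) auto

text \<open>The Hopf axioms are stated through linear forms, so identities in \<open>Pol(G)\<close>
  are obtained by applying every form to both sides. A nonzero difference can be completed to a
  basis and has a coordinate form that does not vanish on it.\<close>

lemma separating:
  assumes "\<And>f. linear_form G f \<Longrightarrow> f a = f b"
  shows "a = b"
proof (rule ccontr)
  assume "a \<noteq> b"
  interpret c: vector_space "(*) :: complex \<Rightarrow> complex \<Rightarrow> complex"
    by unfold_locales (auto simp: algebra_simps)
  interpret vsp: vector_space_pair "scl G" "(*) :: complex \<Rightarrow> complex \<Rightarrow> complex"
    by unfold_locales
  have "vs.independent {a - b}"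
    using \<open>a \<noteq> b\<close> by simp
  then obtain g where g: "Vector_Spaces.linear (scl G) (*) g" "g (a - b) = (1::complex)"
    using vsp.linear_independent_extend[of "{a - b}" "\<lambda>_. 1"] by auto
  then have "linear_form G g"
    by (simp add: linear_form_def)
  then show False
    using assms[of g] g(2) by (simp add: lf_diff)
qed

lemma bilinear_iff:
  "bilinear_form G B \<longleftrightarrow>
     (\<forall>a b y. B (a + b) y = B a y + B b y) \<and> (\<forall>c a y. B (sc c a) y = c * B a y) \<and>
     (\<forall>x a b. B x (a + b) = B x a + B x b) \<and> (\<forall>x c a. B x (sc c a) = c * B x a)"
  unfolding bilinear_form_def lf_iff by auto

lemma comult_nonbilinear: "\<not> bilinear_form G B \<Longrightarrow> comult G a B = 0"
proof -
  assume "\<not> bilinear_form G B"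
  moreover have "comult G a \<in> tensor_square G"
    using hopf(2) by (simp add: comult_star_hom_def)
  ultimately show ?thesis
    unfolding tensor_square_def by (auto simp: pure_tensor_def)
qed

lemma comult_add: "comult G (a + b) B = comult G a B + comult G b B"
  and comult_scl: "comult G (sc c a) B = c * comult G a B"
  using hopf(2) by (auto simp: comult_star_hom_def)

lemma comult_lf: "linear_form G (\<lambda>a. comult G a B)"
  by (simp add: lf_iff comult_add comult_scl)

lemma corep_comult:
  "corep G I w \<Longrightarrow> i \<in> I \<Longrightarrow> j \<in> I \<Longrightarrow> bilinear_form G B \<Longrightarrow>
     comult G (w i j) B = (\<Sum>k\<in>I. B (w i k) (w k j))"
  by (simp add: corep_def)

lemma urep_corep: "urep G I u \<Longrightarrow> corep G I u" and urep_finite: "urep G I u \<Longrightarrow> finite I"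
  by (auto simp: urep_def corep_def)

lemma urep_left: "urep G I u \<Longrightarrow> i \<in> I \<Longrightarrow> j \<in> I \<Longrightarrow> (\<Sum>k\<in>I. st (u k i) * u k j) = of_bool (i = j)"
  and urep_right: "urep G I u \<Longrightarrow> i \<in> I \<Longrightarrow> j \<in> I \<Longrightarrow> (\<Sum>k\<in>I. u i k * st (u j k)) = of_bool (i = j)"
  by (auto simp: urep_def)

lemma of_bool_mult: "(of_bool p :: 'a) * x = (if p then x else 0)"
  "x * (of_bool p :: 'a) = (if p then x else 0)"
  by auto

text \<open>By the counit axiom the scalar matrix \<open>eps (u i k)\<close> times u is u;
  multiplying by the inverse of u on the right leaves the identity matrix.\<close>

lemma urep_eps:
  assumes u: "urep G I u" and ij: "i \<in> I" "j \<in> I"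
  shows "eps (u i j) = of_bool (i = j)"
proof -
  have fin: "finite I"
    using u by (rule urep_finite)
  have *: "(\<Sum>k\<in>I. sc (eps (u i k)) (u k j)) = u i j" if "j \<in> I" for j
  proof (rule separating)
    fix f assume f: "linear_form G f"
    have "bilinear_form G (\<lambda>x y. eps x * f y)"
      using f unfolding bilinear_iff lf_iff by (auto simp: algebra_simps)
    then have "comult G (u i j) (\<lambda>x y. eps x * f y) = (\<Sum>k\<in>I. eps (u i k) * f (u k j))"
      using u ij that by (simp add: corep_comult[OF urep_corep])
    moreover have "comult G (u i j) (\<lambda>x y. eps x * f y) = f (u i j)"
      using hopf(4) f by (simp add: counital_def)
    ultimately show "f (\<Sum>k\<in>I. sc (eps (u i k)) (u k j)) = f (u i j)"
      using f by (simp add: lf_sum) (simp add: lf_iff)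
  qed
  have "of_bool (i = j) = (\<Sum>l\<in>I. u i l * st (u j l))"
    using u ij by (simp add: urep_right)
  also have "\<dots> = (\<Sum>l\<in>I. (\<Sum>k\<in>I. sc (eps (u i k)) (u k l)) * st (u j l))"
    using * by simp
  also have "\<dots> = (\<Sum>l\<in>I. \<Sum>k\<in>I. sc (eps (u i k)) (u k l * st (u j l)))"
    by (simp add: sum_distrib_right scl_mult_left)
  also have "\<dots> = (\<Sum>k\<in>I. sc (eps (u i k)) (\<Sum>l\<in>I. u k l * st (u j l)))"
    by (subst sum.swap) (simp add: scl_sum_right)
  also have "\<dots> = (\<Sum>k\<in>I. if k = j then sc (eps (u i k)) 1 else 0)"
    using u ij by (intro sum.cong) (auto simp: urep_right)
  also have "\<dots> = sc (eps (u i j)) 1"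
    using ij fin by simp
  finally have "eps (of_bool (i = j)) = eps (sc (eps (u i j)) 1)"
    by (rule arg_cong)
  then show ?thesis
    by simp
qed

text \<open>The antipode axiom makes the matrix \<open>S (u i k)\<close> a left inverse of u, and u
  already has the two-sided inverse formed by the adjoints.\<close>

lemma urep_S:
  assumes u: "urep G I u" and ij: "i \<in> I" "j \<in> I"
  shows "S (u i j) = st (u j i)"
proof -
  have fin: "finite I"
    using u by (rule urep_finite)
  have *: "(\<Sum>k\<in>I. S (u i k) * u k l) = of_bool (i = l)" if l: "l \<in> I" for l
  proof (rule separating)
    fix f assume f: "linear_form G f"
    have "bilinear_form G (\<lambda>x y. f (S x * y))"
      using f unfolding bilinear_iff lf_iff by (auto simp: algebra_simps scl_mult_left scl_mult_right)
    then have "comult G (u i l) (\<lambda>x y. f (S x * y)) = (\<Sum>k\<in>I. f (S (u i k) * u k l))"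
      using u ij l by (simp add: corep_comult[OF urep_corep])
    moreover have "comult G (u i l) (\<lambda>x y. f (S x * y)) = eps (u i l) * f 1"
      using antipode f by (simp add: antipode_def)
    ultimately show "f (\<Sum>k\<in>I. S (u i k) * u k l) = f (of_bool (i = l))"
      using f u ij l by (cases "i = l") (auto simp: lf_sum urep_eps lf_zero)
  qed
  have "st (u j i) = (\<Sum>l\<in>I. of_bool (i = l) * st (u j l))"
    using ij fin by (simp add: of_bool_mult)
  also have "\<dots> = (\<Sum>l\<in>I. (\<Sum>k\<in>I. S (u i k) * u k l) * st (u j l))"
    using * by simp
  also have "\<dots> = (\<Sum>k\<in>I. S (u i k) * (\<Sum>l\<in>I. u k l * st (u j l)))"
    by (simp add: sum_distrib_right sum_distrib_left mult.assoc) (rule sum.swap)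
  also have "\<dots> = (\<Sum>k\<in>I. S (u i k) * of_bool (k = j))"
    using u ij by (intro sum.cong) (auto simp: urep_right)
  also have "\<dots> = S (u i j)"
    using ij fin by (simp add: of_bool_mult)
  finally show ?thesis ..
qed

section \<open>Adjoint, tensor product and change of basis for representations\<close>

lemma corep_st:
  assumes "corep G I w" shows "corep G I (\<lambda>i j. st (w i j))"
proof -
  have "comult G (st (w i j)) B = (\<Sum>k\<in>I. B (st (w i k)) (st (w k j)))"
    if "i \<in> I" "j \<in> I" "bilinear_form G B" for i j B
  proof -
    have "bilinear_form G (\<lambda>x y. cnj (B (st x) (st y)))"
      using that(3) unfolding bilinear_iff by auto
    moreover have "comult G (st (w i j)) B = cnj (comult G (w i j) (\<lambda>x y. cnj (B (st x) (st y))))"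
      using hopf(2) that by (simp add: comult_star_hom_def tensor_star_def)
    ultimately show ?thesis
      using assms that by (simp add: corep_comult)
  qed
  then show ?thesis
    using assms by (auto simp: corep_def)
qed

lemma corep_tensor:
  assumes v: "corep G I v" and w: "corep G J w"
  shows "corep G (I \<times> J) (\<lambda>(i, k) (j, l). v i j * w k l)"
proof -
  have "comult G (v i j * w k l) B = (\<Sum>p\<in>I. \<Sum>q\<in>J. B (v i p * w k q) (v p j * w q l))"
    if "i \<in> I" "j \<in> I" "k \<in> J" "l \<in> J" and B: "bilinear_form G B" for i j k l B
  proof -
    have b1: "bilinear_form G (\<lambda>p q. B (x * p) (y * q))" for x y
      using B unfolding bilinear_iff by (auto simp: algebra_simps scl_mult_right)
    have "bilinear_form G (\<lambda>x y. \<Sum>q\<in>J. B (x * w k q) (y * w q l))"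
      using B unfolding bilinear_iff
      by (auto simp: algebra_simps scl_mult_left sum.distrib sum_distrib_left)
    then have b2: "bilinear_form G (\<lambda>x y. comult G (w k l) (\<lambda>p q. B (x * p) (y * q)))"
      using w that b1 by (simp add: corep_comult)
    have "comult G (v i j * w k l) B =
        comult G (v i j) (\<lambda>x y. comult G (w k l) (\<lambda>p q. B (x * p) (y * q)))"
      using hopf(2) B by (simp add: comult_star_hom_def tensor_mult_def)
    then show ?thesis
      using v w that b1 b2 by (simp add: corep_comult)
  qed
  then show ?thesis
    using v w by (auto simp: corep_def sum.cartesian_product')
qed

lemma urep_tensor:
  assumes v: "urep G I v" and w: "urep G J w"
  shows "urep G (I \<times> J) (\<lambda>(i, k) (j, l). v i j * w k l)"
proof -
  have fin: "finite I" "finite J"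
    using v w by (auto intro: urep_finite)
  have "(\<Sum>p\<in>I. \<Sum>q\<in>J. st (v p i * w q k) * (v p j * w q l)) = of_bool (i = j \<and> k = l)"
    if "i \<in> I" "j \<in> I" "k \<in> J" "l \<in> J" for i j k l
  proof -
    have "(\<Sum>p\<in>I. \<Sum>q\<in>J. st (v p i * w q k) * (v p j * w q l)) =
        (\<Sum>q\<in>J. st (w q k) * (\<Sum>p\<in>I. st (v p i) * v p j) * w q l)"
      by (simp add: sum_distrib_right sum_distrib_left mult.assoc) (rule sum.swap)
    also have "\<dots> = (\<Sum>q\<in>J. if i = j then st (w q k) * w q l else 0)"
      using v that by (cases "i = j") (auto simp: urep_left)
    also have "\<dots> = of_bool (i = j \<and> k = l)"
      using w that by (cases "i = j") (auto simp: urep_left)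
    finally show ?thesis .
  qed
  moreover have "(\<Sum>p\<in>I. \<Sum>q\<in>J. (v i p * w k q) * st (v j p * w l q)) = of_bool (i = j \<and> k = l)"
    if "i \<in> I" "j \<in> I" "k \<in> J" "l \<in> J" for i j k l
  proof -
    have "(\<Sum>p\<in>I. \<Sum>q\<in>J. (v i p * w k q) * st (v j p * w l q)) =
        (\<Sum>p\<in>I. v i p * (\<Sum>q\<in>J. w k q * st (w l q)) * st (v j p))"
      by (simp add: sum_distrib_right sum_distrib_left mult.assoc)
    also have "\<dots> = (\<Sum>p\<in>I. if k = l then v i p * st (v j p) else 0)"
      using w that by (cases "k = l") (auto simp: urep_right)
    also have "\<dots> = of_bool (i = j \<and> k = l)"
      using v that by (cases "k = l") (auto simp: urep_right)
    finally show ?thesis .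
  qed
  ultimately show ?thesis
    using corep_tensor[OF urep_corep[OF v] urep_corep[OF w]]
    by (auto simp: urep_def sum.cartesian_product')
qed

lemma urep_mat:
  assumes "unitary_rep G U"
  shows "urep G {..<dim_row U} (\<lambda>i j. U $$ (i, j))"
proof -
  define n where "n = dim_row U"
  define V where "V = mat n n (\<lambda>(i, j). st (U $$ (j, i)))"
  have U: "U \<in> carrier_mat n n" and UV: "U * V = 1\<^sub>m n" and VU: "V * U = 1\<^sub>m n"
    using assms by (auto simp: unitary_rep_def unitary_over_def Let_def n_def V_def)
  have V: "V \<in> carrier_mat n n"
    by (simp add: V_def)
  have "(\<Sum>k<n. U $$ (i, k) * st (U $$ (j, k))) = of_bool (i = j)" if "i < n" "j < n" for i j
  proof -
    have "(U * V) $$ (i, j) = (\<Sum>k<n. U $$ (i, k) * st (U $$ (j, k)))"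
      using U V that by (auto simp: scalar_prod_def V_def lessThan_atLeast0)
    then show ?thesis
      using that by (auto simp: UV)
  qed
  moreover have "(\<Sum>k<n. st (U $$ (k, i)) * U $$ (k, j)) = of_bool (i = j)" if "i < n" "j < n" for i j
  proof -
    have "(V * U) $$ (i, j) = (\<Sum>k<n. st (U $$ (k, i)) * U $$ (k, j))"
      using U V that by (auto simp: scalar_prod_def V_def lessThan_atLeast0)
    then show ?thesis
      using that by (auto simp: VU)
  qed
  ultimately show ?thesis
    using assms by (auto simp: urep_def corep_def unitary_rep_def n_def pure_tensor_def)
qed

lemma unitary_rep_mat:
  assumes u: "urep G {..<n} u"
  shows "unitary_rep G (mat n n (\<lambda>(i, j). u i j))"
proof -
  have "comult G (u i j) B = (\<Sum>k<n. pure_tensor G (u i k) (u k j) B)" if "i < n" "j < n" for i j B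
  proof (cases "bilinear_form G B")
    case True
    then show ?thesis
      using corep_comult[OF urep_corep[OF u], of i j B] that by (simp add: pure_tensor_def)
  next
    case False
    then show ?thesis
      by (simp add: pure_tensor_def comult_nonbilinear)
  qed
  moreover have "mat n n (\<lambda>(i, j). u i j) * mat n n (\<lambda>(i, j). st (u j i)) = 1\<^sub>m n"
    using urep_right[OF u] by (auto intro!: eq_matI simp: scalar_prod_def lessThan_atLeast0)
  moreover have "mat n n (\<lambda>(i, j). st (u j i)) * mat n n (\<lambda>(i, j). u i j) = 1\<^sub>m n"
    using urep_left[OF u] by (auto intro!: eq_matI simp: scalar_prod_def lessThan_atLeast0)
  moreover have "mat n n (\<lambda>(i, j). st (mat n n (\<lambda>(i, j). u i j) $$ (j, i))) =
      mat n n (\<lambda>(i, j). st (u j i))"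
    by (auto intro!: eq_matI)
  ultimately show ?thesis
    by (auto simp: unitary_rep_def unitary_over_def Let_def fun_eq_iff)
qed

text \<open>On coefficients of unitary representations the Hopf operations are explicit, and these
  coefficients span \<open>Pol(G)\<close>; multilinear identities are checked on them.
  \<open>P 0\<close> comes from the trivial representation by scaling.\<close>

lemma pol_induct [case_names add scl coeff]:
  assumes add: "\<And>a b. P a \<Longrightarrow> P b \<Longrightarrow> P (a + b)" and scl: "\<And>c a. P a \<Longrightarrow> P (sc c a)"
    and coeff: "\<And>n u i j. urep G {..<n::nat} u \<Longrightarrow> i < n \<Longrightarrow> j < n \<Longrightarrow> P (u i j)"
  shows "P a"
proof -
  let ?X = "{U $$ (i, j) | U i j. unitary_rep G U \<and> i < dim_row U \<and> j < dim_row U}"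
  have X: "P x" if x: "x \<in> ?X" for x
  proof -
    obtain U i j where "unitary_rep G U" "i < dim_row U" "j < dim_row U" "x = U $$ (i, j)"
      using x by auto
    then show ?thesis
      using coeff[OF urep_mat] by simp
  qed
  have "comult G 1 = pure_tensor G 1 1"
    using hopf(2) by (simp add: comult_star_hom_def)
  then have "urep G {..<1::nat} (\<lambda>_ _. 1)"
    by (simp add: urep_def corep_def pure_tensor_def lessThan_Suc)
  then have "P 1"
    using coeff[of 1 "\<lambda>_ _. 1" 0 0] by simp
  then have P0: "P 0"
    using scl[of 1 0] by simp
  have "a \<in> vs.span ?X"
    using cqg by (simp add: compact_quantum_group_def)
  then show ?thesis
    by (induction rule: vs.span_induct_alt) (use X scl add P0 in auto)
qed

lemma unitary_contract:
  fixes g :: "nat \<Rightarrow> nat \<Rightarrow> complex"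
  assumes "unitary_cmat n P"
  shows "(\<Sum>k<n. \<Sum>a<n. \<Sum>c<n. P a k * cnj (P c k) * g a c) = (\<Sum>a<n. g a a)"
proof -
  have "(\<Sum>k<n. \<Sum>a<n. \<Sum>c<n. P a k * cnj (P c k) * g a c) =
      (\<Sum>a<n. \<Sum>c<n. (\<Sum>k<n. P a k * cnj (P c k)) * g a c)"
    by (subst sum.swap, rule sum.cong[OF refl], subst sum.swap) (simp add: sum_distrib_right)
  also have "\<dots> = (\<Sum>a<n. \<Sum>c<n. of_bool (a = c) * g a c)"
    using assms by (intro sum.cong[OF refl] arg_cong2[where f = "(*)"]) (auto simp: unitary_cmat_def)
  finally show ?thesis
    by simp
qed

lemma unitary_contract_scl:
  assumes "unitary_cmat n P"
  shows "(\<Sum>k<n. \<Sum>a<n. \<Sum>c<n. sc (P a k * cnj (P c k)) (g a c)) = (\<Sum>a<n. g a a)"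
proof (rule separating)
  fix f assume f: "linear_form G f"
  have "f (\<Sum>k<n. \<Sum>a<n. \<Sum>c<n. sc (P a k * cnj (P c k)) (g a c)) =
      (\<Sum>k<n. \<Sum>a<n. \<Sum>c<n. P a k * cnj (P c k) * f (g a c))"
    using f by (simp add: lf_sum) (simp add: lf_iff)
  also have "\<dots> = f (\<Sum>a<n. g a a)"
    by (simp add: unitary_contract[OF assms] lf_sum[OF f])
  finally show "f (\<Sum>k<n. \<Sum>a<n. \<Sum>c<n. sc (P a k * cnj (P c k)) (g a c)) = f (\<Sum>a<n. g a a)" .
qed

lemma scl_sum_mult:
  "(\<Sum>a\<in>A. sc (p a) (x a)) * (\<Sum>b\<in>B. sc (q b) (y b)) = (\<Sum>a\<in>A. \<Sum>b\<in>B. sc (p a * q b) (x a * y b))"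
  by (simp add: sum_product scl_mult_left scl_mult_right mult.commute)

lemma st_scl_sum: "st (\<Sum>a\<in>A. sc (p a) (x a)) = (\<Sum>a\<in>A. sc (cnj (p a)) (st (x a)))"
  by (simp add: st_sum)

lemma urep_conj:
  assumes u: "urep G {..<n} u" and P: "unitary_cmat n P"
  shows "urep G {..<n} (\<lambda>i j. \<Sum>k<n. \<Sum>l<n. sc (cnj (P k i) * P l j) (u k l))" (is "urep G _ ?v")
proof -
  \<comment> \<open>In matrix notation \<open>r\<close> is u P and \<open>c\<close> is P^* u.
    Writing v as P^* r or as c P lets the inner product of P with its adjoint cancel by
    \<open>unitary_contract\<close>.\<close>
  define r where "r k j = (\<Sum>l<n. sc (P l j) (u k l))" for k j
  define c where "c i l = (\<Sum>k<n. sc (cnj (P k i)) (u k l))" for i l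
  have vr: "?v i j = (\<Sum>k<n. sc (cnj (P k i)) (r k j))" for i j
    by (simp add: r_def scl_sum_right)
  have vc: "?v i j = (\<Sum>l<n. sc (P l j) (c i l))" for i j
    unfolding c_def scl_sum_right by (subst sum.swap) (simp add: mult.commute)
  have P1: "(\<Sum>k<n. cnj (P k i) * P k j) = of_bool (i = j)" if "i < n" "j < n" for i j
    using P that by (simp add: unitary_cmat_def)
  have "comult G (?v i j) B = (\<Sum>k<n. B (?v i k) (?v k j))"
    if ij: "i < n" "j < n" and B: "bilinear_form G B" for i j B
  proof -
    have B1: "linear_form G (\<lambda>x. B x y)" and B2: "linear_form G (B x)" for x y
      using B by (auto simp: bilinear_form_def)
    have Bs: "B (sum f A) y = (\<Sum>x\<in>A. B (f x) y)" "B x (sum f A) = (\<Sum>z\<in>A. B x (f z))"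
       "B (sc c x) y = c * B x y" "B x (sc c y) = c * B x y"
      for f :: "nat \<Rightarrow> 'a" and A x y c
      using lf_sum[OF B1] lf_sum[OF B2] B by (auto simp: bilinear_iff)
    have Bs2: "B (\<Sum>a<n. sc (p a) (x a)) (\<Sum>b<n. sc (q b) (y b)) = (\<Sum>a<n. \<Sum>b<n. p a * q b * B (x a) (y b))"
      for p q x y
      by (simp only: Bs(1) Bs(3)) (simp only: Bs(2) Bs(4) sum_distrib_left mult.assoc)
    have "(\<Sum>k<n. B (?v i k) (?v k j)) = (\<Sum>k<n. B (\<Sum>l<n. sc (P l k) (c i l)) (\<Sum>l<n. sc (cnj (P l k)) (r l j)))"
      by (simp only: vc[of i, symmetric] vr[of _ j, symmetric])
    also have "\<dots> = (\<Sum>k<n. \<Sum>a<n. \<Sum>b<n. P a k * cnj (P b k) * B (c i a) (r b j))"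
      by (simp only: Bs2)
    also have "\<dots> = (\<Sum>a<n. B (c i a) (r a j))"
      by (rule unitary_contract[OF P])
    also have "\<dots> = (\<Sum>a<n. \<Sum>k<n. \<Sum>l<n. cnj (P k i) * P l j * B (u k a) (u a l))"
      by (simp only: c_def r_def Bs2)
    also have "\<dots> = (\<Sum>k<n. \<Sum>l<n. cnj (P k i) * P l j * (\<Sum>a<n. B (u k a) (u a l)))"
      by (subst sum.swap, rule sum.cong[OF refl], subst sum.swap) (simp add: sum_distrib_left)
    also have "\<dots> = comult G (?v i j) B"
      using corep_comult[OF urep_corep[OF u] _ _ B]
      by (simp add: lf_sum[OF comult_lf] comult_scl)
    finally show ?thesis ..
  qed
  moreover have "(\<Sum>k<n. st (?v k i) * ?v k j) = of_bool (i = j)" if ij: "i < n" "j < n" for i j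
  proof -
    have "(\<Sum>k<n. st (?v k i) * ?v k j) = (\<Sum>k<n. \<Sum>a<n. \<Sum>b<n. sc (P a k * cnj (P b k)) (st (r a i) * r b j))"
      by (simp only: vr st_scl_sum scl_sum_mult complex_cnj_cnj)
    also have "\<dots> = (\<Sum>a<n. st (r a i) * r a j)"
      by (rule unitary_contract_scl[OF P])
    also have "\<dots> = (\<Sum>a<n. \<Sum>b<n. \<Sum>d<n. sc (cnj (P b i) * P d j) (st (u a b) * u a d))"
      by (simp only: r_def st_scl_sum scl_sum_mult complex_cnj_cnj)
    also have "\<dots> = (\<Sum>b<n. \<Sum>d<n. sc (cnj (P b i) * P d j) (\<Sum>a<n. st (u a b) * u a d))"
      by (subst sum.swap, rule sum.cong[OF refl], subst sum.swap) (simp add: scl_sum_right)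
    also have "\<dots> = (\<Sum>b<n. \<Sum>d<n. if b = d then sc (cnj (P b i) * P d j) 1 else 0)"
      using urep_left[OF u] by (intro sum.cong[OF refl]) auto
    also have "\<dots> = sc (\<Sum>b<n. cnj (P b i) * P b j) 1"
      by (simp add: scl_sum_left)
    finally show ?thesis
      using ij by (cases "i = j") (simp_all add: P1)
  qed
  moreover have "(\<Sum>k<n. ?v i k * st (?v j k)) = of_bool (i = j)" if ij: "i < n" "j < n" for i j
  proof -
    have "(\<Sum>k<n. ?v i k * st (?v j k)) = (\<Sum>k<n. \<Sum>a<n. \<Sum>b<n. sc (P a k * cnj (P b k)) (c i a * st (c j b)))"
      by (simp only: vc st_scl_sum scl_sum_mult complex_cnj_cnj)
    also have "\<dots> = (\<Sum>a<n. c i a * st (c j a))"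
      by (rule unitary_contract_scl[OF P])
    also have "\<dots> = (\<Sum>a<n. \<Sum>b<n. \<Sum>d<n. sc (cnj (P b i) * P d j) (u b a * st (u d a)))"
      by (simp only: c_def st_scl_sum scl_sum_mult complex_cnj_cnj)
    also have "\<dots> = (\<Sum>b<n. \<Sum>d<n. sc (cnj (P b i) * P d j) (\<Sum>a<n. u b a * st (u d a)))"
      by (subst sum.swap, rule sum.cong[OF refl], subst sum.swap) (simp add: scl_sum_right)
    also have "\<dots> = (\<Sum>b<n. \<Sum>d<n. if b = d then sc (cnj (P b i) * P d j) 1 else 0)"
      using urep_right[OF u] by (intro sum.cong[OF refl]) auto
    also have "\<dots> = sc (\<Sum>b<n. cnj (P b i) * P b j) 1"
      by (simp add: scl_sum_left)
    finally show ?thesis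
      using ij by (cases "i = j") (simp_all add: P1)
  qed
  ultimately show ?thesis
    by (auto simp: urep_def corep_def)
qed

end

section \<open>Complete reducibility\<close>

lemma sum_lessThan_add: "(\<Sum>k<n + m. f k) = (\<Sum>k<n. f k) + (\<Sum>k<m. f (n + k :: nat))"
  for f :: "nat \<Rightarrow> 'b::comm_monoid_add"
  by (induction m) (auto simp: add_ac)

context cqg
begin

section \<open>Direct sums and diagonal blocks\<close>

lemma bilinear_zero:
  assumes "bilinear_form G B" shows "B 0 x = 0" "B x 0 = 0"
  using assms lf_zero[of "B x"] lf_zero[of "\<lambda>y. B y x"] by (auto simp: bilinear_form_def)

definition dsum :: "nat \<Rightarrow> (nat \<Rightarrow> nat \<Rightarrow> 'a) \<Rightarrow> (nat \<Rightarrow> nat \<Rightarrow> 'a) \<Rightarrow> nat \<Rightarrow> nat \<Rightarrow> 'a" where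
  "dsum n u v i j = (if i < n \<and> j < n then u i j else if n \<le> i \<and> n \<le> j then v (i - n) (j - n) else 0)"

lemma urep_dsum:
  fixes n m :: nat
  assumes u: "urep G {..<n} u" and v: "urep G {..<m} v"
  shows "urep G {..<n + m} (dsum n u v)"
proof -
  have "comult G (dsum n u v i j) B = (\<Sum>k<n+m. B (dsum n u v i k) (dsum n u v k j))"
    if "i < n + m" "j < n + m" and B: "bilinear_form G B" for i j B
  proof -
    have "comult G 0 B = 0"
      by (rule lf_zero[OF comult_lf])
    then show ?thesis
      using corep_comult[OF urep_corep[OF u] _ _ B] corep_comult[OF urep_corep[OF v] _ _ B] that
      by (cases "i < n"; cases "j < n") (auto simp: sum_lessThan_add dsum_def bilinear_zero)
  qed
  moreover have "(\<Sum>k<n+m. st (dsum n u v k i) * dsum n u v k j) = of_bool (i = j)"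
    if "i < n + m" "j < n + m" for i j
  proof -
    have "i - n = j - n \<longleftrightarrow> i = j" if "\<not> i < n" "\<not> j < n"
      using that by auto
    then show ?thesis
      using urep_left[OF u, of i j] urep_left[OF v, of "i - n" "j - n"] that
      by (cases "i < n"; cases "j < n") (auto simp: sum_lessThan_add dsum_def)
  qed
  moreover have "(\<Sum>k<n+m. dsum n u v i k * st (dsum n u v j k)) = of_bool (i = j)"
    if "i < n + m" "j < n + m" for i j
  proof -
    have "i - n = j - n \<longleftrightarrow> i = j" if "\<not> i < n" "\<not> j < n"
      using that by auto
    then show ?thesis
      using urep_right[OF u, of i j] urep_right[OF v, of "i - n" "j - n"] that
      by (cases "i < n"; cases "j < n") (auto simp: sum_lessThan_add dsum_def)
  qed
  ultimately show ?thesis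
    by (auto simp: urep_def corep_def)
qed

lemma urep_block:
  fixes n m :: nat
  assumes u: "urep G {..<n + m} u"
    and z: "\<And>i j. i < n \<Longrightarrow> n \<le> j \<Longrightarrow> j < n + m \<Longrightarrow> u i j = 0"
      "\<And>i j. j < n \<Longrightarrow> n \<le> i \<Longrightarrow> i < n + m \<Longrightarrow> u i j = 0"
  shows "urep G {..<n} u" "urep G {..<m} (\<lambda>i j. u (n + i) (n + j))"
proof -
  have c: "comult G (u i j) B = (\<Sum>k<n+m. B (u i k) (u k j))"
    if "i < n + m" "j < n + m" "bilinear_form G B" for i j B
    using corep_comult[OF urep_corep[OF u]] that by auto
  have l: "(\<Sum>k<n+m. st (u k i) * u k j) = of_bool (i = j)"
    and r: "(\<Sum>k<n+m. u i k * st (u j k)) = of_bool (i = j)" if "i < n + m" "j < n + m" for i j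
    using urep_left[OF u, of i j] urep_right[OF u, of i j] that by auto
  have c1: "comult G (u i j) B = (\<Sum>k<n. B (u i k) (u k j))"
    if "i < n" "j < n" "bilinear_form G B" for i j B
    using c[of i j B] that z by (simp add: sum_lessThan_add bilinear_zero)
  have l1: "(\<Sum>k<n. st (u k i) * u k j) = of_bool (i = j)"
    and r1: "(\<Sum>k<n. u i k * st (u j k)) = of_bool (i = j)" if "i < n" "j < n" for i j
    using l[of i j] r[of i j] that z by (simp_all add: sum_lessThan_add)
  show "urep G {..<n} u"
    by (auto simp: urep_def corep_def c1 l1 r1)
  have c2: "comult G (u (n + i) (n + j)) B = (\<Sum>k<m. B (u (n + i) (n + k)) (u (n + k) (n + j)))"
    if "i < m" "j < m" "bilinear_form G B" for i j B
    using c[of "n + i" "n + j" B] that z by (simp add: sum_lessThan_add bilinear_zero)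
  have l2: "(\<Sum>k<m. st (u (n + k) (n + i)) * u (n + k) (n + j)) = of_bool (i = j)"
    and r2: "(\<Sum>k<m. u (n + i) (n + k) * st (u (n + j) (n + k))) = of_bool (i = j)"
    if "i < m" "j < m" for i j
    using l[of "n + i" "n + j"] r[of "n + i" "n + j"] that z by (simp_all add: sum_lessThan_add)
  show "urep G {..<m} (\<lambda>i j. u (n + i) (n + j))"
    by (auto simp: urep_def corep_def c2 l2 r2)
qed

text \<open>Direct sums put the finitely many representations needed for an element into a single
  one, so that positivity of a functional at \<open>st a * a\<close> becomes a statement about one
  matrix.\<close>

lemma pol_expand:
  obtains n :: nat and u c where "urep G {..<n} u" "a = (\<Sum>i<n. \<Sum>j<n. sc (c i j) (u i j))"
proof -
  have "\<exists>(n::nat) u c. urep G {..<n} u \<and> a = (\<Sum>i<n. \<Sum>j<n. sc (c i j) (u i j))"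
  proof (induction a rule: pol_induct)
    case (add a b)
    then obtain n :: nat and u c m v d where u: "urep G {..<n} u" "a = (\<Sum>i<n. \<Sum>j<n. sc (c i j) (u i j))"
      and v: "urep G {..<m::nat} v" "b = (\<Sum>i<m. \<Sum>j<m. sc (d i j) (v i j))"
      by blast
    define e where "e i j = (if i < n then c i j else d (i - n) (j - n))" for i j
    have "a + b = (\<Sum>i<n+m. \<Sum>j<n+m. sc (e i j) (dsum n u v i j))"
      by (simp add: sum_lessThan_add dsum_def e_def u(2) v(2))
    then show ?case
      using urep_dsum[OF u(1) v(1)] by blast
  next
    case (scl c a)
    then obtain n :: nat and u d where u: "urep G {..<n} u" "a = (\<Sum>i<n. \<Sum>j<n. sc (d i j) (u i j))"
      by blast
    then have "sc c a = (\<Sum>i<n. \<Sum>j<n. sc (c * d i j) (u i j))"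
      by (simp add: scl_sum_right)
    then show ?case
      using u by (intro exI[of _ n] exI[of _ u] exI[of _ "\<lambda>i j. c * d i j"] conjI)
  next
    case (coeff n u i j)
    have "u i j = (\<Sum>k<n. \<Sum>l<n. if l = j then if k = i then u k l else 0 else 0)"
      using coeff by simp
    also have "\<dots> = (\<Sum>k<n. \<Sum>l<n. sc (of_bool (k = i \<and> l = j)) (u k l))"
      by (intro sum.cong refl) auto
    finally show ?case
      using coeff by (intro exI[of _ n] exI[of _ u] exI[of _ "\<lambda>k l. of_bool (k = i \<and> l = j)"]) simp
  qed
  then show thesis
    using that by blast
qed

lemma urep_conj_inverse:
  assumes P: "unitary_cmat n P" and kl: "k < n" "l < n"
    and v: "\<And>i j. i < n \<Longrightarrow> j < n \<Longrightarrow> v i j = (\<Sum>k<n. \<Sum>l<n. sc (cnj (P k i) * P l j) (u k l))"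
  shows "u k l = (\<Sum>i<n. \<Sum>j<n. sc (P k i * cnj (P l j)) (v i j))"
proof (rule separating)
  fix f assume f: "linear_form G f"
  have fs: "f (sc c a) = c * f a" for c a
    using f by (simp add: lf_iff)
  define F where "F k l = f (u k l)" for k l
  have fv: "f (v i j) = mm n (dg P) (mm n F P) i j" if "i < n" "j < n" for i j
    using that by (simp add: v lf_sum[OF f] fs mm_def dg_def F_def sum_distrib_left algebra_simps)
  have "f (\<Sum>i<n. \<Sum>j<n. sc (P k i * cnj (P l j)) (v i j)) =
      mm n P (mm n (\<lambda>i j. f (v i j)) (dg P)) k l"
    by (simp add: lf_sum[OF f] fs mm_def dg_def sum_distrib_left algebra_simps)
  also have "\<dots> = mm n P (mm n (mm n (dg P) (mm n F P)) (dg P)) k l"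
    by (auto simp: mm_def[of n P] mm_def[of n "\<lambda>i j. f (v i j)"] fv mm_def[of n "mm n (dg P) (mm n F P)"])
  also have "\<dots> = mm n P (mm n (dg P) (mm n F (mm n P (dg P)))) k l"
    by (simp add: mm_assoc)
  also have "\<dots> = mm n F (mm n P (dg P)) k l"
    using P kl by (simp add: unitary_cmat_cancel_left')
  also have "\<dots> = F k l"
    using P kl by (intro mm_one_right) (auto simp: unitary_cmat_iff)
  finally show "f (u k l) = f (\<Sum>i<n. \<Sum>j<n. sc (P k i * cnj (P l j)) (v i j))"
    by (simp add: F_def)
qed

text \<open>Irreducibility for sets of coefficient functions on nat. By \<open>ext\<close> such a
  set ignores entries beyond the dimension, which is why the whole space appears as
  \<open>UNIV\<close>.\<close>

lemma irreducible_invariant: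
  assumes U: "irreducible_unitary_rep G U" and ne: "v0 \<in> W"
    and add: "\<And>v w. v \<in> W \<Longrightarrow> w \<in> W \<Longrightarrow> (\<lambda>i. v i + w i) \<in> W"
    and scale: "\<And>c v. v \<in> W \<Longrightarrow> (\<lambda>i. c * v i) \<in> W"
    and ext: "\<And>v w. v \<in> W \<Longrightarrow> (\<And>i. i < dim_row U \<Longrightarrow> v i = w i) \<Longrightarrow> w \<in> W"
    and slice: "\<And>f v. linear_form G f \<Longrightarrow> v \<in> W \<Longrightarrow>
      (\<lambda>i. \<Sum>l<dim_row U. f (U $$ (i, l)) * v l) \<in> W"
  shows "(\<forall>v\<in>W. \<forall>i<dim_row U. v i = 0) \<or> W = UNIV"
proof -
  define n where "n = dim_row U"
  have dc: "dim_col U = n"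
    using U by (auto simp: irreducible_unitary_rep_def unitary_rep_def unitary_over_def n_def)
  define X where "X = vec n ` W"
  have inX: "x \<in> X \<longleftrightarrow> x \<in> carrier_vec n \<and> (\<lambda>i. x $ i) \<in> W" for x
  proof
    assume "x \<in> X"
    then obtain w where "w \<in> W" "x = vec n w"
      by (auto simp: X_def)
    then show "x \<in> carrier_vec n \<and> (\<lambda>i. x $ i) \<in> W"
      using ext[of w "\<lambda>i. vec n w $ i"] by (auto simp: n_def)
  next
    assume "x \<in> carrier_vec n \<and> (\<lambda>i. x $ i) \<in> W"
    then show "x \<in> X"
      unfolding X_def by (intro image_eqI[of _ _ "\<lambda>i. x $ i"]) auto
  qed
  have "invariant_subspace G U X"
    unfolding invariant_subspace_def n_def[symmetric]
  proof (intro conjI ballI allI impI)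
    show "X \<subseteq> carrier_vec n"
      by (auto simp: X_def)
    show "0\<^sub>v n \<in> X"
      unfolding inX using ext[OF scale[OF ne, of 0]] by (auto simp: n_def)
    show "v + w \<in> X" if "v \<in> X" "w \<in> X" for v w
      using that ext[OF add[of "\<lambda>i. v $ i" "\<lambda>i. w $ i"]] unfolding inX by (auto simp: n_def)
    show "c \<cdot>\<^sub>v w \<in> X" if "w \<in> X" for c w
      using that ext[OF scale[of "\<lambda>i. w $ i" c]] unfolding inX by (auto simp: n_def)
    show "map_mat f U *\<^sub>v w \<in> X" if "linear_form G f" "w \<in> X" for f w
    proof -
      have w: "(\<lambda>i. w $ i) \<in> W" "dim_vec w = n"
        using that by (auto simp: inX)
      have "map_mat f U *\<^sub>v w \<in> carrier_vec n"
        unfolding carrier_vec_def n_def by simp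
      moreover have "(\<lambda>i. (map_mat f U *\<^sub>v w) $ i) \<in> W"
      proof (rule ext[OF slice[OF that(1) w(1)]])
        fix i assume "i < dim_row U"
        then show "(\<Sum>l<dim_row U. f (U $$ (i, l)) * w $ l) = (map_mat f U *\<^sub>v w) $ i"
          using dc w(2) by (simp add: scalar_prod_def lessThan_atLeast0 n_def)
      qed
      ultimately show ?thesis
        unfolding inX by blast
    qed
  qed
  then consider "X = {0\<^sub>v n}" | "X = carrier_vec n"
    using U by (auto simp: irreducible_unitary_rep_def n_def)
  then show ?thesis
  proof cases
    case 1
    have "v i = 0" if "v \<in> W" "i < n" for v i
    proof -
      have "vec n v \<in> X"
        using that by (auto simp: X_def)
      then show ?thesis
        using 1 that by (metis index_vec index_zero_vec(1) singletonD)
    qed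
    then show ?thesis
      by (auto simp: n_def)
  next
    case 2
    have "v \<in> W" for v
    proof -
      have "vec n v \<in> X"
        by (simp add: 2)
      then have "(\<lambda>i. vec n v $ i) \<in> W"
        by (simp add: inX)
      then show ?thesis
        by (rule ext) (simp add: n_def)
    qed
    then show ?thesis
      by auto
  qed
qed

lemma reducible_invariant:
  assumes u: "urep G {..<n} u" and n: "0 < n"
    and irr: "\<not> irreducible_unitary_rep G (Matrix.mat n n (\<lambda>(i, j). u i j))"
  obtains W v0 k v1 where "\<And>v w. v \<in> W \<Longrightarrow> w \<in> W \<Longrightarrow> (\<lambda>i. v i + w i) \<in> W"
    "\<And>c v. v \<in> W \<Longrightarrow> (\<lambda>i. c * v i) \<in> W"
    "\<And>v w. v \<in> W \<Longrightarrow> (\<And>i. i < n \<Longrightarrow> v i = w i) \<Longrightarrow> w \<in> W"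
    "\<And>f v. linear_form G f \<Longrightarrow> v \<in> W \<Longrightarrow> mv n (\<lambda>i l. f (u i l)) v \<in> W"
    "v0 \<in> W" "k < n" "v0 k \<noteq> 0" "v1 \<notin> W"
proof -
  let ?U = "Matrix.mat n n (\<lambda>(i, j). u i j)"
  obtain X where X: "invariant_subspace G ?U X" "X \<noteq> {0\<^sub>v n}" "X \<noteq> carrier_vec n"
    using irr n unitary_rep_mat[OF u] by (auto simp: irreducible_unitary_rep_def)
  have X0: "X \<subseteq> carrier_vec n" "0\<^sub>v n \<in> X" and Xa: "\<And>v w. v \<in> X \<Longrightarrow> w \<in> X \<Longrightarrow> v + w \<in> X"
    and Xs: "\<And>c w. w \<in> X \<Longrightarrow> c \<cdot>\<^sub>v w \<in> X"
    and Xf: "\<And>f w. linear_form G f \<Longrightarrow> w \<in> X \<Longrightarrow> map_mat f ?U *\<^sub>v w \<in> X"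
    using X(1) by (auto simp: invariant_subspace_def)
  define W where "W = {v. vec n v \<in> X}"
  obtain x0 where x0: "x0 \<in> X" "x0 \<noteq> 0\<^sub>v n"
    using X(2) X0(2) by auto
  then obtain k where k: "k < n" "x0 $ k \<noteq> 0"
    using X0(1) by (metis carrier_vecD eq_vecI index_zero_vec subsetD)
  obtain x1 where x1: "x1 \<in> carrier_vec n" "x1 \<notin> X"
    using X(3) X0(1) by auto
  have vid: "vec n (\<lambda>i. x $ i) = x" if "x \<in> carrier_vec n" for x :: "complex vec"
    using that by auto
  show thesis
  proof (rule that[of W "\<lambda>i. x0 $ i" k "\<lambda>i. x1 $ i"])
    show "(\<lambda>i. v i + w i) \<in> W" if "v \<in> W" "w \<in> W" for v w
    proof -
      have "vec n v + vec n w = vec n (\<lambda>i. v i + w i)"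
        by auto
      then show ?thesis
        using that Xa[of "vec n v" "vec n w"] by (auto simp: W_def)
    qed
    show "(\<lambda>i. c * v i) \<in> W" if "v \<in> W" for c v
    proof -
      have "c \<cdot>\<^sub>v vec n v = vec n (\<lambda>i. c * v i)"
        by auto
      then show ?thesis
        using that Xs[of "vec n v" c] by (auto simp: W_def)
    qed
    show "w \<in> W" if "v \<in> W" "\<And>i. i < n \<Longrightarrow> v i = w i" for v w
    proof -
      have "vec n v = vec n w"
        using that by auto
      then show ?thesis
        using that by (auto simp: W_def)
    qed
    show "mv n (\<lambda>i l. f (u i l)) v \<in> W" if "linear_form G f" "v \<in> W" for f v
    proof -
      have "map_mat f ?U *\<^sub>v vec n v = vec n (mv n (\<lambda>i l. f (u i l)) v)"
        by (auto simp: scalar_prod_def mv_def lessThan_atLeast0)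
      then show ?thesis
        using that Xf[of f "vec n v"] by (auto simp: W_def)
    qed
    show "(\<lambda>i. x0 $ i) \<in> W" "(\<lambda>i. x1 $ i) \<notin> W"
      using x0 x1 X0 vid by (auto simp: W_def)
  qed (use k in auto)
qed

abbreviation irr_coeffs where
  "irr_coeffs \<equiv> {U $$ (i, j) | U i j. irreducible_unitary_rep G U \<and> i < dim_row U \<and> j < dim_row U}"

text \<open>Complete reducibility by induction on the dimension: in a unitary basis adapted to a
  proper invariant subspace u becomes block diagonal with two smaller blocks, and the original
  entries are combinations of the entries of the blocks.\<close>

lemma coeff_in_span_irr:
  fixes n :: nat
  assumes "urep G {..<n} u" "i < n" "j < n"
  shows "u i j \<in> vs.span irr_coeffs"
  using assms
proof (induction n arbitrary: u i j rule: less_induct)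
  case (less n)
  let ?U = "Matrix.mat n n (\<lambda>(i, j). u i j)"
  show ?case
  proof (cases "irreducible_unitary_rep G ?U")
    case True
    then have "u i j \<in> irr_coeffs"
      unfolding mem_Collect_eq using less.prems
      by (intro exI[of _ ?U] exI[of _ i] exI[of _ j]) simp
    then show ?thesis
      by (rule vs.span_base)
  next
    case False
    have "0 < n"
      using less.prems by simp
    obtain W v0 k v1 where W: "\<And>v w. v \<in> W \<Longrightarrow> w \<in> W \<Longrightarrow> (\<lambda>i. v i + w i) \<in> W"
      "\<And>c v. v \<in> W \<Longrightarrow> (\<lambda>i. c * v i) \<in> W"
      "\<And>v w. v \<in> W \<Longrightarrow> (\<And>i. i < n \<Longrightarrow> v i = w i) \<Longrightarrow> w \<in> W"
      and Wf: "\<And>f v. linear_form G f \<Longrightarrow> v \<in> W \<Longrightarrow> mv n (\<lambda>i l. f (u i l)) v \<in> W"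
      and v0: "v0 \<in> W" "k < n" "v0 k \<noteq> 0" and v1: "v1 \<notin> W"
      by (rule reducible_invariant[OF less.prems(1) \<open>0 < n\<close> False], blast)
    obtain P r where P: "unitary_cmat n P" "r \<le> n" "\<And>j. j < r \<Longrightarrow> (\<lambda>i. P i j) \<in> W"
      "\<And>w j. w \<in> W \<Longrightarrow> r \<le> j \<Longrightarrow> j < n \<Longrightarrow> mv n (dg P) w j = 0"
      by (rule unitary_cmat_adapted[of W n, OF W], assumption+, blast)
    have PP: "mv n P (mv n (dg P) v) i = v i" if "i < n" for v i
      unfolding mv_mv using that P(1) by (intro mv_one) (auto simp: unitary_cmat_iff)
    have "r \<noteq> 0"
    proof
      assume "r = 0"
      then have "mv n (dg P) v0 j = 0" if "j < n" for j
        using that P(4) v0 by simp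
      then have "mv n P (mv n (dg P) v0) k = 0"
        by (simp add: mv_def[of n P])
      then show False
        using PP v0 by simp
    qed
    have "r \<noteq> n"
    proof
      assume r: "r = n"
      have "(\<lambda>i. \<Sum>k<m. x k * P i k) \<in> W" if "m \<le> n" for m x
        using that
      proof (induction m)
        case 0
        then show ?case
          using W(2)[OF v0(1), of 0] by simp
      next
        case (Suc m)
        then have "(\<lambda>i. x m * P i m) \<in> W"
          using P(3) r by (intro W(2)) auto
        then show ?case
          using Suc W(1)[of "\<lambda>i. \<Sum>k<m. x k * P i k" "\<lambda>i. x m * P i m"] by simp
      qed
      then have "(\<lambda>i. \<Sum>k<n. mv n (dg P) v1 k * P i k) \<in> W"
        by blast
      moreover have "mv n P (mv n (dg P) v1) = (\<lambda>i. \<Sum>k<n. mv n (dg P) v1 k * P i k)"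
        by (simp add: mv_def[of n P] mult.commute)
      ultimately have "mv n P (mv n (dg P) v1) \<in> W"
        by simp
      then show False
        using W(3)[of "mv n P (mv n (dg P) v1)" v1] PP v1 by simp
    qed
    define m where "m = n - r"
    have n: "n = r + m" and rm: "r < n" "m < n"
      using \<open>r \<noteq> 0\<close> \<open>r \<noteq> n\<close> P(2) by (auto simp: m_def)
    define v where "v i j = (\<Sum>k<n. \<Sum>l<n. sc (cnj (P k i) * P l j) (u k l))" for i j
    have v: "urep G {..<n} v"
      unfolding v_def by (rule urep_conj) (use less.prems P in auto)
    \<comment> \<open>One off-diagonal block vanishes because W is invariant and the last columns of
      P are orthogonal to W.\<close>
    have z1: "v i j = 0" if "j < r" "r \<le> i" "i < n" for i j
    proof (rule separating)
      fix f assume f: "linear_form G f"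
      have "f (v i j) = mv n (dg P) (mv n (\<lambda>i l. f (u i l)) (\<lambda>i. P i j)) i"
        using f by (simp add: v_def lf_sum mv_def dg_def sum_distrib_left) (simp add: lf_iff algebra_simps)
      also have "\<dots> = 0"
        using that Wf[OF f P(3)] by (intro P(4))
      finally show "f (v i j) = f 0"
        using f by (simp add: lf_zero)
    qed
    \<comment> \<open>The antipode exchanges the two off-diagonal blocks, since
      \<open>S (v j i) = st (v i j)\<close>.\<close>
    have z2: "v i j = 0" if "i < r" "r \<le> j" "j < n" for i j
      using urep_S[OF v, of j i] z1[of i j] that rm by (metis S_zero lessThan_iff less_trans st_st st_zero)
    have bl: "urep G {..<r} v" "urep G {..<m} (\<lambda>i j. v (r + i) (r + j))"
      by (rule urep_block[of r m v]; use v z1 z2 in \<open>simp add: n\<close>)+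
    have "v i j \<in> vs.span irr_coeffs" if "i < n" "j < n" for i j
    proof -
      consider "i < r" "j < r" | "r \<le> i" "r \<le> j" | "i < r" "r \<le> j" | "r \<le> i" "j < r"
        by linarith
      then show ?thesis
      proof cases
        case 1
        then show ?thesis
          using less.IH[OF rm(1) bl(1)] by blast
      next
        case 2
        then show ?thesis
          using less.IH[OF rm(2) bl(2), of "i - r" "j - r"] that n by simp
      next
        case 3
        then show ?thesis
          using z2 that by (simp add: vs.span_zero)
      next
        case 4
        then show ?thesis
          using z1 that by (simp add: vs.span_zero)
      qed
    qed
    then have "(\<Sum>a<n. \<Sum>b<n. sc (P i a * cnj (P j b)) (v a b)) \<in> vs.span irr_coeffs"
      by (intro vs.span_sum vs.span_scale) auto
    then show ?thesis
      using urep_conj_inverse[OF P(1) less.prems(2,3), of v u] by (simp add: v_def)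
  qed
qed

lemma span_irr_coeffs: "vs.span irr_coeffs = UNIV"
proof -
  have "a \<in> vs.span irr_coeffs" for a
    by (induction a rule: pol_induct)
      (auto intro: vs.span_add vs.span_scale coeff_in_span_irr simp del: mem_Collect_eq)
  then show ?thesis
    by auto
qed

lemma irr_rep_coeffs:
  assumes rep: "irr_representatives G u" and U: "irreducible_unitary_rep G U"
  obtains \<beta> where "\<beta> \<in> Irr G" "\<And>i j. i < dim_row U \<Longrightarrow> j < dim_row U \<Longrightarrow>
    U $$ (i, j) \<in> vs.span {u \<beta> $$ (i, j) | i j. i < dim_row (u \<beta>) \<and> j < dim_row (u \<beta>)}"
proof -
  let ?R = "{(U, V). irreducible_unitary_rep G U \<and> irreducible_unitary_rep G V \<and> equivalent_reps G U V}"
  define \<beta> where "\<beta> = ?R `` {U}"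
  have \<beta>: "\<beta> \<in> Irr G"
    using U by (auto simp: Irr_def \<beta>_def quotient_def)
  then have "u \<beta> \<in> \<beta>"
    using rep by (auto simp: irr_representatives_def)
  define n where "n = dim_row U"
  define V where "V = u \<beta>"
  have eq: "equivalent_reps G U V" and V: "irreducible_unitary_rep G V"
    using \<open>u \<beta> \<in> \<beta>\<close> by (auto simp: \<beta>_def V_def)
  have dims: "dim_row U = n" "dim_col U = n" "dim_row V = n" "dim_col V = n"
    using eq U V by (auto simp: equivalent_reps_def irreducible_unitary_rep_def unitary_rep_def unitary_over_def n_def)
  obtain T where T: "T \<in> carrier_mat n n" "invertible_mat T"
    "map_mat (\<lambda>c. sc c 1) T * U = V * map_mat (\<lambda>c. sc c 1) T"
    using eq by (auto simp: equivalent_reps_def n_def)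
  obtain B where B: "inverts_mat B T" "inverts_mat T B"
    using T(2) by (auto simp: invertible_mat_def)
  have Bd: "dim_col B = n" "dim_row B = n"
  proof -
    show "dim_col B = n"
      using B(2) T(1) by (metis inverts_mat_def index_mult_mat(3) index_one_mat(3) carrier_matD(1))
    show "dim_row B = n"
      using B(1) T(1) by (metis inverts_mat_def index_mult_mat(3) index_one_mat(3) carrier_matD(2))
  qed
  have BT: "(\<Sum>k<n. B $$ (i, k) * T $$ (k, j)) = of_bool (i = j)" if "i < n" "j < n" for i j
  proof -
    have "(B * T) $$ (i, j) = (\<Sum>k<n. B $$ (i, k) * T $$ (k, j))"
      using that T(1) Bd by (simp add: scalar_prod_def lessThan_atLeast0)
    then show ?thesis
      using B(1) that Bd by (auto simp: inverts_mat_def)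
  qed
  have TU: "(\<Sum>k<n. sc (T $$ (i, k)) (U $$ (k, j))) = (\<Sum>k<n. sc (T $$ (k, j)) (V $$ (i, k)))"
    if "i < n" "j < n" for i j
  proof -
    have "(map_mat (\<lambda>c. sc c 1) T * U) $$ (i, j) = (\<Sum>k<n. sc (T $$ (i, k)) (U $$ (k, j)))"
      using that T(1) dims by (simp add: scalar_prod_def lessThan_atLeast0 scl_mult_left)
    moreover have "(V * map_mat (\<lambda>c. sc c 1) T) $$ (i, j) = (\<Sum>k<n. sc (T $$ (k, j)) (V $$ (i, k)))"
      using that T(1) dims by (simp add: scalar_prod_def lessThan_atLeast0 scl_mult_right)
    ultimately show ?thesis
      by (simp add: T(3))
  qed
  have "U $$ (l, j) = (\<Sum>i<n. sc (B $$ (l, i)) (\<Sum>k<n. sc (T $$ (k, j)) (V $$ (i, k))))"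
    if "l < n" "j < n" for l j
  proof -
    have "(\<Sum>i<n. sc (B $$ (l, i)) (\<Sum>k<n. sc (T $$ (k, j)) (V $$ (i, k)))) =
        (\<Sum>i<n. sc (B $$ (l, i)) (\<Sum>k<n. sc (T $$ (i, k)) (U $$ (k, j))))"
      using that by (simp add: TU)
    also have "\<dots> = (\<Sum>k<n. sc (\<Sum>i<n. B $$ (l, i) * T $$ (i, k)) (U $$ (k, j)))"
      by (simp add: scl_sum_right scl_sum_left) (rule sum.swap)
    also have "\<dots> = (\<Sum>k<n. if k = l then U $$ (k, j) else 0)"
      using that by (intro sum.cong) (auto simp: BT)
    finally show ?thesis
      using that by simp
  qed
  moreover have "(\<Sum>i<n. sc (B $$ (l, i)) (\<Sum>k<n. sc (T $$ (k, j)) (V $$ (i, k)))) \<in>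
      vs.span {V $$ (i, j) | i j. i < dim_row V \<and> j < dim_row V}" for l j
    by (intro vs.span_sum vs.span_scale vs.span_base) (use dims in auto)
  ultimately show thesis
    using that[OF \<beta>] by (simp add: V_def n_def)
qed

text \<open>A spanning set indexed by \<open>Irr G\<close> and finitely many matrix positions for
  each class; once \<open>Irr G\<close> is known to be countable, it is a countable set on which
  convergence can be forced.\<close>

lemma span_representatives:
  assumes "irr_representatives G u"
  shows "vs.span {u \<beta> $$ (i, j) | \<beta> i j. \<beta> \<in> Irr G \<and> i < dim_row (u \<beta>) \<and> j < dim_row (u \<beta>)} = UNIV"
    (is "vs.span ?X = _")
proof -
  have "irr_coeffs \<subseteq> vs.span ?X"
  proof
    fix a assume "a \<in> irr_coeffs"
    then obtain U i j where U: "irreducible_unitary_rep G U" "i < dim_row U" "j < dim_row U" "a = U $$ (i, j)"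
      by auto
    obtain \<beta> where \<beta>: "\<beta> \<in> Irr G" and
      *: "\<And>i j. i < dim_row U \<Longrightarrow> j < dim_row U \<Longrightarrow>
        U $$ (i, j) \<in> vs.span {u \<beta> $$ (i, j) | i j. i < dim_row (u \<beta>) \<and> j < dim_row (u \<beta>)}"
      by (rule irr_rep_coeffs[OF assms U(1)], blast)
    have "{u \<beta> $$ (i, j) | i j. i < dim_row (u \<beta>) \<and> j < dim_row (u \<beta>)} \<subseteq> ?X"
      using \<beta> by auto
    from vs.span_mono[OF this] show "a \<in> vs.span ?X"
      unfolding U(4) using *[OF U(2,3)] by (rule subsetD)
  qed
  then have "vs.span irr_coeffs \<subseteq> vs.span ?X"
    by (rule vs.span_minimal[OF _ vs.subspace_span])
  then show ?thesis
    unfolding span_irr_coeffs by blast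
qed

end

section \<open>The square of the antipode\<close>

context cqg
begin

text \<open>An index (U, i) stands for row i of U. The span of a row of an irreducible
  representation is an irreducible comodule, which makes whole rows, rather than single
  coefficients, the units of linear independence.\<close>

definition row_comb :: "('a mat \<times> nat) set \<Rightarrow> ('a mat \<times> nat \<Rightarrow> nat \<Rightarrow> complex) \<Rightarrow> 'a" where
  "row_comb J c = (\<Sum>\<rho>\<in>J. \<Sum>p<dim_row (fst \<rho>). sc (c \<rho> p) (fst \<rho> $$ (snd \<rho>, p)))"

definition irr_rows :: "('a mat \<times> nat) set" where
  "irr_rows = {(U, i). irreducible_unitary_rep G U \<and> i < dim_row U}"

definition rows_independent :: "('a mat \<times> nat) set \<Rightarrow> bool" where
  "rows_independent J \<longleftrightarrow>
     (\<forall>c. row_comb J c = 0 \<longrightarrow> (\<forall>\<rho>\<in>J. \<forall>p<dim_row (fst \<rho>). c \<rho> p = 0))"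

lemma row_comb_add: "row_comb J c + row_comb J d = row_comb J (\<lambda>\<rho> p. c \<rho> p + d \<rho> p)"
  by (simp add: row_comb_def vs.scale_left_distrib sum.distrib)

lemma row_comb_scl: "sc k (row_comb J c) = row_comb J (\<lambda>\<rho> p. k * c \<rho> p)"
  by (simp add: row_comb_def scl_sum_right)

lemma row_comb_diff: "row_comb J c - row_comb J d = row_comb J (\<lambda>\<rho> p. c \<rho> p - d \<rho> p)"
  by (simp add: row_comb_def vs.scale_left_diff_distrib sum_subtractf)

lemma row_comb_sum:
  "(\<Sum>k<n. sc (h k) (row_comb J (c k))) = row_comb J (\<lambda>\<rho> p. \<Sum>k<(n::nat). h k * c k \<rho> p)"
  by (induction n) (simp_all add: row_comb_scl row_comb_add, simp add: row_comb_def)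

lemma bilinear_pair:
  "linear_form G g \<Longrightarrow> linear_form G f \<Longrightarrow> bilinear_form G (\<lambda>x y. g x * f y)"
  unfolding bilinear_iff lf_iff by (auto simp: algebra_simps)

text \<open>Applying \<open>f\<close> to the right leg of the comultiplication keeps the rows and
  multiplies each coefficient vector by the matrix f(U). The form \<open>g\<close> tests the left
  leg, an element of \<open>Pol(G)\<close> that is then recovered by
  \<open>separating\<close>.\<close>

lemma row_comb_slice:
  assumes J: "J \<subseteq> irr_rows" and f: "linear_form G f" and g: "linear_form G g"
  shows "comult G (row_comb J c) (\<lambda>x y. g x * f y) =
    g (row_comb J (\<lambda>\<rho> r. \<Sum>p<dim_row (fst \<rho>). f (fst \<rho> $$ (r, p)) * c \<rho> p))"
proof -
  have "comult G (fst \<rho> $$ (snd \<rho>, p)) (\<lambda>x y. g x * f y) =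
      (\<Sum>r<dim_row (fst \<rho>). g (fst \<rho> $$ (snd \<rho>, r)) * f (fst \<rho> $$ (r, p)))"
    if "\<rho> \<in> J" "p < dim_row (fst \<rho>)" for \<rho> p
  proof -
    have "unitary_rep G (fst \<rho>)" "snd \<rho> < dim_row (fst \<rho>)"
      using that J by (auto simp: irr_rows_def irreducible_unitary_rep_def)
    then show ?thesis
      using corep_comult[OF urep_corep[OF urep_mat] _ _ bilinear_pair[OF g f]] that by simp
  qed
  then have "comult G (row_comb J c) (\<lambda>x y. g x * f y) = (\<Sum>\<rho>\<in>J. \<Sum>p<dim_row (fst \<rho>).
      c \<rho> p * (\<Sum>r<dim_row (fst \<rho>). g (fst \<rho> $$ (snd \<rho>, r)) * f (fst \<rho> $$ (r, p))))"
    by (simp add: row_comb_def lf_sum[OF comult_lf] comult_scl)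
  also have "\<dots> = (\<Sum>\<rho>\<in>J. \<Sum>r<dim_row (fst \<rho>).
      (\<Sum>p<dim_row (fst \<rho>). f (fst \<rho> $$ (r, p)) * c \<rho> p) * g (fst \<rho> $$ (snd \<rho>, r)))"
    by (rule sum.cong[OF refl], simp add: sum_distrib_left sum_distrib_right, subst sum.swap, simp add: mult_ac)
  also have "\<dots> = g (row_comb J (\<lambda>\<rho> r. \<Sum>p<dim_row (fst \<rho>). f (fst \<rho> $$ (r, p)) * c \<rho> p))"
    using g by (simp add: row_comb_def lf_sum) (simp add: lf_iff)
  finally show ?thesis .
qed

text \<open>Rows are treated one at a time. The coefficient vectors of those combinations of the new
  row that already lie in the span of J form a subspace invariant under all slices of U. By
  irreducibility it is zero, and the row can be added, or it is everything, and the row is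
  redundant.\<close>

lemma independent_rows_exist:
  assumes "finite F" "F \<subseteq> irr_rows"
  obtains J where "J \<subseteq> F" "rows_independent J"
    "\<And>\<rho> p. \<rho> \<in> F \<Longrightarrow> p < dim_row (fst \<rho>) \<Longrightarrow> \<exists>c. fst \<rho> $$ (snd \<rho>, p) = row_comb J c"
proof -
  have "\<exists>J\<subseteq>F. rows_independent J \<and>
      (\<forall>\<rho>\<in>F. \<forall>p<dim_row (fst \<rho>). \<exists>c. fst \<rho> $$ (snd \<rho>, p) = row_comb J c)"
    using assms
  proof (induction F rule: finite_induct)
    case empty
    then show ?case
      by (auto simp: rows_independent_def)
  next
    case (insert \<rho> F)
    then have "F \<subseteq> irr_rows"
      by simp
    from insert.IH[OF this] obtain J where J: "J \<subseteq> F" "rows_independent J"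
      "\<And>\<sigma> p. \<sigma> \<in> F \<Longrightarrow> p < dim_row (fst \<sigma>) \<Longrightarrow> \<exists>c. fst \<sigma> $$ (snd \<sigma>, p) = row_comb J c"
      by blast
    have Jrows: "J \<subseteq> irr_rows" and rho: "\<rho> \<in> irr_rows" "\<rho> \<notin> J" and Jfin: "finite J"
      using J(1) insert.prems insert.hyps finite_subset by auto
    define U where "U = fst \<rho>"
    define i where "i = snd \<rho>"
    define W where "W = {v. \<exists>c. (\<Sum>p<dim_row U. sc (v p) (U $$ (i, p))) = row_comb J c}"
    have U: "irreducible_unitary_rep G U" "i < dim_row U"
      using rho by (auto simp: irr_rows_def U_def i_def)
    have W1: "(\<lambda>p. v p + w p) \<in> W" if vw: "v \<in> W" "w \<in> W" for v w
    proof -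
      obtain c d where "(\<Sum>p<dim_row U. sc (v p) (U $$ (i, p))) = row_comb J c"
        "(\<Sum>p<dim_row U. sc (w p) (U $$ (i, p))) = row_comb J d"
        using vw by (auto simp: W_def)
      then have "(\<Sum>p<dim_row U. sc (v p + w p) (U $$ (i, p))) = row_comb J (\<lambda>\<rho> p. c \<rho> p + d \<rho> p)"
        by (simp add: vs.scale_left_distrib sum.distrib row_comb_add)
      then show ?thesis
        by (auto simp: W_def)
    qed
    have W2: "(\<lambda>p. k * v p) \<in> W" if v: "v \<in> W" for k v
    proof -
      obtain c where "(\<Sum>p<dim_row U. sc (v p) (U $$ (i, p))) = row_comb J c"
        using v by (auto simp: W_def)
      then have "(\<Sum>p<dim_row U. sc (k * v p) (U $$ (i, p))) = row_comb J (\<lambda>\<rho> p. k * c \<rho> p)"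
        by (simp add: row_comb_scl[symmetric] scl_sum_right[symmetric] flip: vs.scale_scale)
      then show ?thesis
        by (auto simp: W_def)
    qed
    have W3: "w \<in> W" if vw: "v \<in> W" "\<And>p. p < dim_row U \<Longrightarrow> v p = w p" for v w
      using vw by (auto simp: W_def)
    have W4: "(\<lambda>r. \<Sum>p<dim_row U. f (U $$ (r, p)) * v p) \<in> W" if f: "linear_form G f" and v: "v \<in> W" for f v
    proof -
      obtain c where c: "(\<Sum>p<dim_row U. sc (v p) (U $$ (i, p))) = row_comb J c"
        using v by (auto simp: W_def)
      then have c': "row_comb {\<rho>} (\<lambda>_. v) = row_comb J c"
        by (simp add: row_comb_def U_def i_def)
      have "row_comb {\<rho>} (\<lambda>\<rho> r. \<Sum>p<dim_row (fst \<rho>). f (fst \<rho> $$ (r, p)) * v p) =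
          row_comb J (\<lambda>\<rho> r. \<Sum>p<dim_row (fst \<rho>). f (fst \<rho> $$ (r, p)) * c \<rho> p)"
      proof (rule separating)
        fix g assume g: "linear_form G g"
        show "g (row_comb {\<rho>} (\<lambda>\<rho> r. \<Sum>p<dim_row (fst \<rho>). f (fst \<rho> $$ (r, p)) * v p)) =
            g (row_comb J (\<lambda>\<rho> r. \<Sum>p<dim_row (fst \<rho>). f (fst \<rho> $$ (r, p)) * c \<rho> p))"
          using row_comb_slice[OF Jrows f g, of c] row_comb_slice[of "{\<rho>}", OF _ f g, of "\<lambda>_. v"] rho c'
          by simp
      qed
      then have "(\<Sum>r<dim_row U. sc (\<Sum>p<dim_row U. f (U $$ (r, p)) * v p) (U $$ (i, r))) =
          row_comb J (\<lambda>\<rho> r. \<Sum>p<dim_row (fst \<rho>). f (fst \<rho> $$ (r, p)) * c \<rho> p)"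
        by (simp add: row_comb_def[of "{\<rho>}"] U_def i_def)
      then show ?thesis
        by (auto simp: W_def)
    qed
    have "(\<lambda>_. 0) \<in> W"
      unfolding W_def mem_Collect_eq by (intro exI[of _ "\<lambda>_ _. 0"]) (simp add: row_comb_def)
    then have dich: "(\<forall>v\<in>W. \<forall>i<dim_row U. v i = 0) \<or> W = UNIV"
      by (rule irreducible_invariant[OF U(1) _ W1 W2 W3 W4])
    then consider "\<forall>v\<in>W. \<forall>i<dim_row U. v i = 0" | "W = UNIV"
      by blast
    then show ?case
    proof cases
      case 1
      have split: "row_comb (insert \<rho> J) c = (\<Sum>p<dim_row U. sc (c \<rho> p) (U $$ (i, p))) + row_comb J c" for c
        using rho(2) Jfin by (simp add: row_comb_def U_def i_def)
      have "rows_independent (insert \<rho> J)"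
        unfolding rows_independent_def
      proof (intro allI impI)
        fix c assume c: "row_comb (insert \<rho> J) c = 0"
        then have "(\<Sum>p<dim_row U. sc (c \<rho> p) (U $$ (i, p))) = - row_comb J c"
          by (simp add: split add_eq_0_iff2)
        also have "\<dots> = row_comb J (\<lambda>\<rho> p. - 1 * c \<rho> p)"
          by (simp only: row_comb_scl[symmetric] vs.scale_minus_left vs.scale_one)
        finally have "c \<rho> \<in> W"
          by (auto simp: W_def)
        then have "c \<rho> p = 0" if "p < dim_row U" for p
          using 1 that by blast
        moreover from this have "row_comb J c = 0"
          using c by (simp add: split)
        ultimately show "\<forall>\<sigma>\<in>insert \<rho> J. \<forall>p<dim_row (fst \<sigma>). c \<sigma> p = 0"
          using J(2) by (auto simp: rows_independent_def U_def)
      qed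
      moreover have "\<exists>c. fst \<sigma> $$ (snd \<sigma>, p) = row_comb (insert \<rho> J) c"
        if \<sigma>: "\<sigma> \<in> insert \<rho> F" "p < dim_row (fst \<sigma>)" for \<sigma> p
      proof (cases "\<sigma> = \<rho>")
        case True
        have "(\<Sum>q<dim_row U. sc (of_bool (q = p)) (U $$ (i, q))) = (\<Sum>q<dim_row U. if q = p then U $$ (i, q) else 0)"
          by (intro sum.cong) auto
        also have "\<dots> = U $$ (i, p)"
          using \<sigma> True by (simp add: U_def)
        finally have "U $$ (i, p) = row_comb (insert \<rho> J) (\<lambda>\<tau> q. if \<tau> = \<rho> then of_bool (q = p) else 0)"
          using rho(2) by (auto simp: split) (auto simp: row_comb_def intro!: sum.neutral)
        then show ?thesis
          using True by (auto simp: U_def i_def)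
      next
        case False
        then obtain c where c: "fst \<sigma> $$ (snd \<sigma>, p) = row_comb J c"
          using J(3) \<sigma> by blast
        \<comment> \<open>The coefficients of the new row are set to zero, because \<open>c\<close>
          is arbitrary outside J.\<close>
        define c' where "c' = c(\<rho> := \<lambda>_. 0)"
        have "c' \<tau> = c \<tau>" if "\<tau> \<in> J" for \<tau>
          using that rho(2) by (auto simp: c'_def)
        then have "row_comb J c' = row_comb J c"
          by (simp add: row_comb_def)
        moreover have "row_comb (insert \<rho> J) c' = row_comb J c'"
          by (simp add: split c'_def)
        ultimately have "fst \<sigma> $$ (snd \<sigma>, p) = row_comb (insert \<rho> J) c'"
          by (simp only: c)
        then show ?thesis
          by blast
      qed
      ultimately show ?thesis
        using J(1) by (intro exI[of _ "insert \<rho> J"]) auto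
    next
      case 2
      have "\<exists>c. fst \<sigma> $$ (snd \<sigma>, p) = row_comb J c"
        if \<sigma>: "\<sigma> \<in> insert \<rho> F" "p < dim_row (fst \<sigma>)" for \<sigma> p
      proof (cases "\<sigma> = \<rho>")
        case True
        have "(\<lambda>q. of_bool (q = p)) \<in> W"
          using 2 by simp
        then obtain c where "(\<Sum>q<dim_row U. sc (of_bool (q = p)) (U $$ (i, q))) = row_comb J c"
          by (auto simp: W_def)
        moreover have "(\<Sum>q<dim_row U. sc (of_bool (q = p)) (U $$ (i, q))) = (\<Sum>q<dim_row U. if q = p then U $$ (i, q) else 0)"
          by (intro sum.cong) auto
        ultimately have "U $$ (i, p) = row_comb J c"
          using \<sigma> True by (simp add: U_def)
        then show ?thesis
          using True by (auto simp: U_def i_def)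
      next
        case False
        then show ?thesis
          using J(3) \<sigma> by blast
      qed
      then show ?thesis
        using J(1,2) by (intro exI[of _ J]) auto
    qed
  qed
  then show thesis
    using that by blast
qed

lemma row_basis:
  assumes "finite A"
  obtains J where "finite J" "J \<subseteq> irr_rows" "rows_independent J" "\<And>a. a \<in> A \<Longrightarrow> \<exists>c. a = row_comb J c"
proof -
  let ?E = "\<lambda>F. {fst \<rho> $$ (snd \<rho>, p) | \<rho> p. \<rho> \<in> F \<and> p < dim_row (fst \<rho>)}"
  have ex: "\<exists>F. finite F \<and> F \<subseteq> irr_rows \<and> a \<in> vs.span (?E F)" for a
  proof -
    have "a \<in> vs.span irr_coeffs"
      by (simp only: span_irr_coeffs UNIV_I)
    then show ?thesis
    proof (induction rule: vs.span_induct_alt)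
      case base
      then show ?case
        by (intro exI[of _ "{}"]) (simp add: vs.span_zero)
    next
      case (step c x y)
      then obtain F where F: "finite F" "F \<subseteq> irr_rows" "y \<in> vs.span (?E F)"
        by blast
      obtain U i j where U: "x = U $$ (i, j)" "irreducible_unitary_rep G U" "i < dim_row U" "j < dim_row U"
        using step by blast
      let ?F = "insert (U, i) F"
      have "x \<in> ?E ?F"
        unfolding mem_Collect_eq using U by (intro exI[of _ "(U, i)"] exI[of _ j]) simp
      then have "x \<in> vs.span (?E ?F)"
        by (rule vs.span_base)
      moreover have "y \<in> vs.span (?E ?F)"
        using F(3) vs.span_mono[of "?E F" "?E ?F"] by blast
      ultimately have "sc c x + y \<in> vs.span (?E ?F)"
        by (intro vs.span_add vs.span_scale)
      then show ?case
        using F U by (intro exI[of _ ?F]) (auto simp: irr_rows_def)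
    qed
  qed
  define F where "F a = (SOME F. finite F \<and> F \<subseteq> irr_rows \<and> a \<in> vs.span (?E F))" for a
  have "finite (F a) \<and> F a \<subseteq> irr_rows \<and> a \<in> vs.span (?E (F a))" for a
    unfolding F_def by (rule someI_ex[OF ex])
  then have F: "\<And>a. finite (F a)" "\<And>a. F a \<subseteq> irr_rows" "\<And>a. a \<in> vs.span (?E (F a))"
    by blast+
  define T where "T = (\<Union>a\<in>A. F a)"
  have T: "finite T" "T \<subseteq> irr_rows"
    using assms F by (auto simp: T_def)
  obtain J where J: "J \<subseteq> T" "rows_independent J"
    "\<And>\<rho> p. \<rho> \<in> T \<Longrightarrow> p < dim_row (fst \<rho>) \<Longrightarrow> \<exists>c. fst \<rho> $$ (snd \<rho>, p) = row_comb J c"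
    by (rule independent_rows_exist[OF T], blast)
  have comb: "\<exists>c. a = row_comb J c" if a: "a \<in> A" for a
    using F(3)[of a]
  proof (induction rule: vs.span_induct_alt)
    case base
    show ?case
      by (rule exI[of _ "\<lambda>_ _. 0"]) (simp add: row_comb_def)
  next
    case (step c x y)
    then obtain d where d: "y = row_comb J d"
      by blast
    obtain \<rho> p where \<rho>: "x = fst \<rho> $$ (snd \<rho>, p)" "\<rho> \<in> F a" "p < dim_row (fst \<rho>)"
      using step by blast
    moreover have "\<rho> \<in> T"
      using \<rho>(2) a by (auto simp: T_def)
    ultimately obtain k where "x = row_comb J k"
      using J(3) by blast
    then show ?case
      by (auto simp: d row_comb_scl row_comb_add)
  qed
  show thesis
    by (rule that[OF finite_subset[OF J(1) T(1)] subset_trans[OF J(1) T(2)] J(2)]) (rule comb)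
qed

text \<open>The entrywise adjoint w of u need not be unitary. Expanding it in independent rows of
  irreducible unitary representations gives, for each row of w and each \<rho> with matrix U, a
  matrix C with C w = U C. The sum Q of all C^* C then satisfies w^* Q w = Q because every U is
  unitary. This replaces averaging an inner product with the Haar state.\<close>

lemma conjugate_invariant_form:
  fixes n :: nat
  assumes u: "urep G {..<n} u"
  obtains Q where "\<And>k l. Q k l = cnj (Q l k)"
    "\<And>v i. i < n \<Longrightarrow> v i \<noteq> 0 \<Longrightarrow> 0 < Re (\<Sum>k<n. \<Sum>l<n. cnj (v k) * Q k l * v l)"
    "\<And>i j. i < n \<Longrightarrow> j < n \<Longrightarrow> (\<Sum>k<n. \<Sum>l<n. sc (Q k l) (u k i * st (u l j))) = sc (Q i j) 1"
proof -
  define w where "w i j = st (u i j)" for i j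
  have w: "corep G {..<n} w"
    unfolding w_def by (rule corep_st[OF urep_corep[OF u]])
  obtain J where J: "finite J" "J \<subseteq> irr_rows" "rows_independent J"
    and "\<And>a. a \<in> (\<lambda>(i, j). w i j) ` ({..<n} \<times> {..<n}) \<Longrightarrow> \<exists>c. a = row_comb J c"
    by (rule row_basis[of "(\<lambda>(i, j). w i j) ` ({..<n} \<times> {..<n})"]) auto
  then have "\<exists>c. w i j = row_comb J c" if "i < n" "j < n" for i j
    using that by auto
  then obtain c where c: "\<And>i j. i < n \<Longrightarrow> j < n \<Longrightarrow> w i j = row_comb J (c i j)"
    by metis
  let ?d = "\<lambda>\<rho>. dim_row (fst \<rho>)"
  \<comment> \<open>The comultiplication of \<open>w i j\<close>, sliced by f, is computed in two
    ways: expand in rows and then comultiply, or comultiply and then expand the left factor.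
    Independence of the rows allows coefficients to be equated.\<close>
  have rel: "(\<Sum>k<n. sc (c i k \<rho> r) (w k j)) = (\<Sum>p<?d \<rho>. sc (c i j \<rho> p) (fst \<rho> $$ (r, p)))"
    if ij: "i < n" "j < n" and \<rho>: "\<rho> \<in> J" "r < ?d \<rho>" for i j \<rho> r
  proof (rule separating)
    fix f assume f: "linear_form G f"
    have "row_comb J (\<lambda>\<rho> r. \<Sum>p<?d \<rho>. f (fst \<rho> $$ (r, p)) * c i j \<rho> p) =
        row_comb J (\<lambda>\<rho> r. \<Sum>k<n. f (w k j) * c i k \<rho> r)"
    proof (rule separating)
      fix g assume g: "linear_form G g"
      have "g (row_comb J (\<lambda>\<rho> r. \<Sum>p<?d \<rho>. f (fst \<rho> $$ (r, p)) * c i j \<rho> p)) =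
          comult G (w i j) (\<lambda>x y. g x * f y)"
        using row_comb_slice[OF J(2) f g] c ij by simp
      also have "\<dots> = (\<Sum>k<n. f (w k j) * g (w i k))"
        using corep_comult[OF w _ _ bilinear_pair[OF g f]] ij by (simp add: mult.commute)
      also have "\<dots> = g (\<Sum>k<n. sc (f (w k j)) (row_comb J (c i k)))"
        using g c ij by (simp add: lf_sum) (simp add: lf_iff)
      finally show "g (row_comb J (\<lambda>\<rho> r. \<Sum>p<?d \<rho>. f (fst \<rho> $$ (r, p)) * c i j \<rho> p)) =
          g (row_comb J (\<lambda>\<rho> r. \<Sum>k<n. f (w k j) * c i k \<rho> r))"
        by (simp add: row_comb_sum)
    qed
    then have "row_comb J (\<lambda>\<rho> r. (\<Sum>p<?d \<rho>. f (fst \<rho> $$ (r, p)) * c i j \<rho> p) -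
        (\<Sum>k<n. f (w k j) * c i k \<rho> r)) = 0"
      by (simp add: row_comb_diff[symmetric])
    then have "(\<Sum>p<?d \<rho>. f (fst \<rho> $$ (r, p)) * c i j \<rho> p) = (\<Sum>k<n. f (w k j) * c i k \<rho> r)"
      using J(3) \<rho> by (auto simp: rows_independent_def)
    then show "f (\<Sum>k<n. sc (c i k \<rho> r) (w k j)) = f (\<Sum>p<?d \<rho>. sc (c i j \<rho> p) (fst \<rho> $$ (r, p)))"
      using f by (simp add: lf_sum) (simp add: lf_iff mult.commute)
  qed
  define Q where "Q k l = (\<Sum>i<n. \<Sum>\<rho>\<in>J. \<Sum>p<?d \<rho>. cnj (c i k \<rho> p) * c i l \<rho> p)" for k l
  show thesis
  proof (rule that[of Q])
    show "Q k l = cnj (Q l k)" for k l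
      by (simp add: Q_def mult.commute)
    show "0 < Re (\<Sum>k<n. \<Sum>l<n. cnj (v k) * Q k l * v l)" if v: "i < n" "v i \<noteq> 0" for v i
    proof -
      define z where "z i \<rho> p = (\<Sum>l<n. v l * c i l \<rho> p)" for i \<rho> p
      have "(\<Sum>k<n. \<Sum>l<n. cnj (v k) * Q k l * v l) =
          (\<Sum>k<n. \<Sum>l<n. \<Sum>i<n. \<Sum>\<rho>\<in>J. \<Sum>p<?d \<rho>. cnj (v k * c i k \<rho> p) * (v l * c i l \<rho> p))"
        by (simp add: Q_def sum_distrib_left sum_distrib_right mult_ac)
      also have "\<dots> = (\<Sum>k<n. \<Sum>i<n. \<Sum>\<rho>\<in>J. \<Sum>p<?d \<rho>. cnj (v k * c i k \<rho> p) * z i \<rho> p)"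
        unfolding z_def sum_distrib_left
        by (rule sum.cong[OF refl], subst sum.swap, rule sum.cong[OF refl], subst sum.swap,
            rule sum.cong[OF refl], rule sum.swap)
      also have "\<dots> = (\<Sum>i<n. \<Sum>\<rho>\<in>J. \<Sum>p<?d \<rho>. cnj (z i \<rho> p) * z i \<rho> p)"
        unfolding z_def cnj_sum sum_distrib_right
        by (subst sum.swap, rule sum.cong[OF refl], subst sum.swap, rule sum.cong[OF refl], rule sum.swap)
      also have "\<dots> = of_real (\<Sum>i<n. \<Sum>\<rho>\<in>J. \<Sum>p<?d \<rho>. (cmod (z i \<rho> p))\<^sup>2)"
        by (simp only: of_real_sum complex_norm_square mult.commute)
      finally have "(\<Sum>k<n. \<Sum>l<n. cnj (v k) * Q k l * v l) =
          of_real (\<Sum>i<n. \<Sum>\<rho>\<in>J. \<Sum>p<?d \<rho>. (cmod (z i \<rho> p))\<^sup>2)" .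
      then have Re: "Re (\<Sum>k<n. \<Sum>l<n. cnj (v k) * Q k l * v l) =
          (\<Sum>i<n. \<Sum>\<rho>\<in>J. \<Sum>p<?d \<rho>. (cmod (z i \<rho> p))\<^sup>2)"
        by (simp only: Re_complex_of_real)
      \<comment> \<open>If all coordinates vanished, the combination
        \<open>\<Sum>l<n. sc (v l) (w i l)\<close> would be zero, while the counit sends it to
        \<open>v i\<close>.\<close>
      have "\<exists>\<rho>\<in>J. \<exists>p<?d \<rho>. z i \<rho> p \<noteq> 0"
      proof (rule ccontr)
        assume "\<not> ?thesis"
        then have z: "z i \<rho> p = 0" if "\<rho> \<in> J" "p < ?d \<rho>" for \<rho> p
          using that by blast
        have "(\<Sum>l<n. sc (v l) (w i l)) = (\<Sum>l<n. sc (v l) (row_comb J (c i l)))"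
          using v c by simp
        also have "\<dots> = row_comb J (z i)"
          unfolding row_comb_sum z_def ..
        also have "\<dots> = 0"
          using z by (simp add: row_comb_def)
        finally have "eps (\<Sum>l<n. sc (v l) (w i l)) = 0"
          by simp
        moreover have "eps (w i l) = of_bool (i = l)" if "l < n" for l
          using v that by (cases "i = l") (simp_all add: w_def urep_eps[OF u])
        ultimately show False
          using v by (simp add: eps_sum)
      qed
      then obtain \<rho> p where \<rho>: "\<rho> \<in> J" "p < ?d \<rho>" "z i \<rho> p \<noteq> 0"
        by blast
      have "0 < (cmod (z i \<rho> p))\<^sup>2"
        using \<rho> by simp
      also have "\<dots> \<le> (\<Sum>p<?d \<rho>. (cmod (z i \<rho> p))\<^sup>2)"
        using \<rho> by (intro member_le_sum) auto
      also have "\<dots> \<le> (\<Sum>\<rho>\<in>J. \<Sum>p<?d \<rho>. (cmod (z i \<rho> p))\<^sup>2)"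
        using \<rho> J by (intro member_le_sum) (auto intro: sum_nonneg)
      also have "\<dots> \<le> (\<Sum>i<n. \<Sum>\<rho>\<in>J. \<Sum>p<?d \<rho>. (cmod (z i \<rho> p))\<^sup>2)"
        using v by (intro member_le_sum) (auto intro!: sum_nonneg)
      finally show ?thesis
        by (simp only: Re)
    qed
    show "(\<Sum>k<n. \<Sum>l<n. sc (Q k l) (u k i * st (u l j))) = sc (Q i j) 1" if ij: "i < n" "j < n" for i j
    proof -
      have "(\<Sum>k<n. \<Sum>l<n. sc (Q k l) (st (w k i) * w l j)) =
          (\<Sum>k<n. \<Sum>l<n. \<Sum>a<n. \<Sum>\<rho>\<in>J. \<Sum>r<?d \<rho>.
             sc (cnj (c a k \<rho> r) * c a l \<rho> r) (st (w k i) * w l j))"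
        by (simp only: Q_def scl_sum_left)
      also have "\<dots> = (\<Sum>k<n. \<Sum>a<n. \<Sum>\<rho>\<in>J. \<Sum>r<?d \<rho>. \<Sum>l<n.
             sc (cnj (c a k \<rho> r) * c a l \<rho> r) (st (w k i) * w l j))"
        by (rule sum.cong[OF refl], subst sum.swap, rule sum.cong[OF refl], subst sum.swap,
            rule sum.cong[OF refl], rule sum.swap)
      also have "\<dots> = (\<Sum>a<n. \<Sum>\<rho>\<in>J. \<Sum>r<?d \<rho>. \<Sum>k<n. \<Sum>l<n.
             sc (cnj (c a k \<rho> r) * c a l \<rho> r) (st (w k i) * w l j))"
        by (subst sum.swap, rule sum.cong[OF refl], subst sum.swap, rule sum.cong[OF refl], rule sum.swap)
      also have "\<dots> = (\<Sum>a<n. \<Sum>\<rho>\<in>J. \<Sum>r<?d \<rho>.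
          st (\<Sum>k<n. sc (c a k \<rho> r) (w k i)) * (\<Sum>l<n. sc (c a l \<rho> r) (w l j)))"
        by (simp only: st_scl_sum scl_sum_mult)
      also have "\<dots> = (\<Sum>a<n. \<Sum>\<rho>\<in>J. \<Sum>r<?d \<rho>.
          st (\<Sum>p<?d \<rho>. sc (c a i \<rho> p) (fst \<rho> $$ (r, p))) * (\<Sum>q<?d \<rho>. sc (c a j \<rho> q) (fst \<rho> $$ (r, q))))"
      proof (intro sum.cong[OF refl])
        fix a \<rho> r assume "a \<in> {..<n}" "\<rho> \<in> J" "r \<in> {..<?d \<rho>}"
        then have "(\<Sum>k<n. sc (c a k \<rho> r) (w k i)) = (\<Sum>p<?d \<rho>. sc (c a i \<rho> p) (fst \<rho> $$ (r, p)))"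
          "(\<Sum>k<n. sc (c a k \<rho> r) (w k j)) = (\<Sum>p<?d \<rho>. sc (c a j \<rho> p) (fst \<rho> $$ (r, p)))"
          using rel ij by auto
        then show "st (\<Sum>k<n. sc (c a k \<rho> r) (w k i)) * (\<Sum>l<n. sc (c a l \<rho> r) (w l j)) =
          st (\<Sum>p<?d \<rho>. sc (c a i \<rho> p) (fst \<rho> $$ (r, p))) * (\<Sum>q<?d \<rho>. sc (c a j \<rho> q) (fst \<rho> $$ (r, q)))"
          by (simp only:)
      qed
      also have "\<dots> = (\<Sum>a<n. \<Sum>\<rho>\<in>J. sc (\<Sum>p<?d \<rho>. cnj (c a i \<rho> p) * c a j \<rho> p) 1)"
      proof (intro sum.cong[OF refl])
        fix a \<rho> assume \<rho>: "\<rho> \<in> J"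
        then have U: "urep G {..<?d \<rho>} (\<lambda>i j. fst \<rho> $$ (i, j))"
          using J(2) by (intro urep_mat) (auto simp: irr_rows_def irreducible_unitary_rep_def)
        have "(\<Sum>r<?d \<rho>. st (\<Sum>p<?d \<rho>. sc (c a i \<rho> p) (fst \<rho> $$ (r, p))) * (\<Sum>q<?d \<rho>. sc (c a j \<rho> q) (fst \<rho> $$ (r, q)))) =
            (\<Sum>r<?d \<rho>. \<Sum>p<?d \<rho>. \<Sum>q<?d \<rho>. sc (cnj (c a i \<rho> p) * c a j \<rho> q) (st (fst \<rho> $$ (r, p)) * fst \<rho> $$ (r, q)))"
          by (simp only: st_scl_sum scl_sum_mult)
        also have "\<dots> = (\<Sum>p<?d \<rho>. \<Sum>q<?d \<rho>. sc (cnj (c a i \<rho> p) * c a j \<rho> q) (\<Sum>r<?d \<rho>. st (fst \<rho> $$ (r, p)) * fst \<rho> $$ (r, q)))"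
          unfolding scl_sum_right by (subst sum.swap, rule sum.cong[OF refl], rule sum.swap)
        also have "\<dots> = (\<Sum>p<?d \<rho>. \<Sum>q<?d \<rho>. if p = q then sc (cnj (c a i \<rho> p) * c a j \<rho> q) 1 else 0)"
          using urep_left[OF U] by (intro sum.cong[OF refl]) auto
        also have "\<dots> = sc (\<Sum>p<?d \<rho>. cnj (c a i \<rho> p) * c a j \<rho> p) 1"
          by (simp add: scl_sum_left)
        finally show "(\<Sum>r<?d \<rho>. st (\<Sum>p<?d \<rho>. sc (c a i \<rho> p) (fst \<rho> $$ (r, p))) * (\<Sum>q<?d \<rho>. sc (c a j \<rho> q) (fst \<rho> $$ (r, q)))) =
          sc (\<Sum>p<?d \<rho>. cnj (c a i \<rho> p) * c a j \<rho> p) 1" .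
      qed
      also have "\<dots> = sc (Q i j) 1"
        by (simp add: Q_def scl_sum_left)
      finally show ?thesis
        by (simp add: w_def)
    qed
  qed
qed

definition conj_rep :: "nat \<Rightarrow> (nat \<Rightarrow> nat \<Rightarrow> complex) \<Rightarrow> (nat \<Rightarrow> nat \<Rightarrow> 'a) \<Rightarrow> nat \<Rightarrow> nat \<Rightarrow> 'a" where
  "conj_rep n P u i j = (\<Sum>k<n. \<Sum>l<n. sc (cnj (P k i) * P l j) (u k l))"

text \<open>The conjugate representation has an inverse formed by the elements
  \<open>S (S (u m j))\<close>. Multiplying the invariance of Q by it turns Q into an intertwiner
  between u and its image under the squared antipode; in an eigenbasis of Q this is multiplication
  by quotients of eigenvalues.\<close>

lemma antipode_square_diagonal:
  fixes n :: nat
  assumes u: "urep G {..<n} u"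
  obtains P d where "unitary_cmat n P" "\<And>i. i < n \<Longrightarrow> (0::real) < d i"
    "\<And>i j. i < n \<Longrightarrow> j < n \<Longrightarrow> S (S (conj_rep n P u i j)) = sc (of_real (d i / d j)) (conj_rep n P u i j)"
proof -
  obtain Q where Qh: "\<And>k l. Q k l = cnj (Q l k)"
    and Qp: "\<And>v i. i < n \<Longrightarrow> v i \<noteq> 0 \<Longrightarrow> 0 < Re (\<Sum>k<n. \<Sum>l<n. cnj (v k) * Q k l * v l)"
    and Qu: "\<And>i j. i < n \<Longrightarrow> j < n \<Longrightarrow> (\<Sum>k<n. \<Sum>l<n. sc (Q k l) (u k i * st (u l j))) = sc (Q i j) 1"
    by (rule conjugate_invariant_form[OF u], blast)
  have SS: "(\<Sum>k<n. sc (Q k m) (u k i)) = (\<Sum>j<n. sc (Q i j) (S (S (u m j))))" if im: "i < n" "m < n" for i m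
  proof -
    have inv: "(\<Sum>j<n. st (u l j) * S (S (u m j))) = of_bool (l = m)" if "l < n" for l
    proof (rule separating)
      fix f assume f: "linear_form G f"
      have "bilinear_form G (\<lambda>x y. f (x * S y))"
        using f unfolding bilinear_iff lf_iff by (auto simp: algebra_simps scl_mult_left scl_mult_right)
      then have "comult G (st (u l m)) (\<lambda>x y. f (x * S y)) = (\<Sum>j<n. f (st (u l j) * S (st (u j m))))"
        using corep_comult[OF corep_st[OF urep_corep[OF u]]] that im by simp
      moreover have "comult G (st (u l m)) (\<lambda>x y. f (x * S y)) = eps (st (u l m)) * f 1"
        using antipode f by (simp add: antipode_def)
      moreover have "S (u m j) = st (u j m)" if "j < n" for j
        using urep_S[OF u] that im by simp
      ultimately show "f (\<Sum>j<n. st (u l j) * S (S (u m j))) = f (of_bool (l = m))"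
        using that im by (cases "l = m") (auto simp: lf_sum[OF f] urep_eps[OF u] lf_zero[OF f])
    qed
    have "(\<Sum>j<n. sc (Q i j) (S (S (u m j)))) = (\<Sum>j<n. sc (Q i j) 1 * S (S (u m j)))"
      by (simp add: scl_mult_left)
    also have "\<dots> = (\<Sum>j<n. \<Sum>k<n. \<Sum>l<n. sc (Q k l) (u k i * st (u l j)) * S (S (u m j)))"
      using im by (simp add: Qu[symmetric] sum_distrib_right)
    also have "\<dots> = (\<Sum>k<n. \<Sum>l<n. sc (Q k l) (u k i * (\<Sum>j<n. st (u l j) * S (S (u m j)))))"
      unfolding scl_mult_left mult.assoc sum_distrib_left scl_sum_right
      by (subst sum.swap, rule sum.cong[OF refl], rule sum.swap)
    also have "\<dots> = (\<Sum>k<n. \<Sum>l<n. if l = m then sc (Q k l) (u k i) else 0)"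
      by (intro sum.cong[OF refl]) (simp add: inv)
    finally show ?thesis
      using im by simp
  qed
  obtain P d where P: "unitary_cmat n P" and d: "\<And>i j. i < n \<Longrightarrow> j < n \<Longrightarrow> mm n Q P i j = d j * P i j"
    by (rule hermitian_diagonalize[of n Q], rule Qh, blast)
  have dpos: "0 < Re (d j)" and dreal: "Im (d j) = 0" if j: "j < n" for j
  proof -
    have one: "(\<Sum>k<n. cnj (P k j) * P k j) = 1"
      using P j by (simp add: unitary_cmat_def)
    have dj: "(\<Sum>k<n. \<Sum>l<n. cnj (P k j) * Q k l * P l j) = d j"
    proof -
      have "(\<Sum>k<n. \<Sum>l<n. cnj (P k j) * Q k l * P l j) = (\<Sum>k<n. cnj (P k j) * mm n Q P k j)"
        by (simp add: mm_def sum_distrib_left mult.assoc)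
      also have "\<dots> = d j * (\<Sum>k<n. cnj (P k j) * P k j)"
        using j by (simp add: d sum_distrib_left mult_ac)
      finally show ?thesis
        by (simp add: one)
    qed
    have "\<exists>k<n. P k j \<noteq> 0"
    proof (rule ccontr)
      assume "\<not> ?thesis"
      then have "(\<Sum>k<n. cnj (P k j) * P k j) = 0"
        by simp
      then show False
        using one by simp
    qed
    then show "0 < Re (d j)"
      using Qp[where v = "\<lambda>k. P k j"] dj by auto
    have "cnj (d j) = (\<Sum>k<n. \<Sum>l<n. P k j * Q l k * cnj (P l j))"
      unfolding dj[symmetric] cnj_sum by (simp add: Qh[symmetric])
    also have "\<dots> = d j"
      unfolding dj[symmetric] by (subst sum.swap) (simp add: mult_ac)
    finally show "Im (d j) = 0"
      by (simp add: complex_eq_iff)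
  qed
  \<comment> \<open>The relation \<open>SS\<close> involves u with rows and columns exchanged, hence
    \<open>F i k = f (u k i)\<close> below; the basis suited to u itself is the entrywise conjugate
    of the eigenbasis of Q.\<close>
  define P' where "P' i j = cnj (P i j)" for i j
  have "unitary_cmat n P'"
    unfolding unitary_cmat_def
  proof (intro conjI allI impI)
    fix i j assume "i < n" "j < n"
    then show "(\<Sum>k<n. cnj (P' k i) * P' k j) = of_bool (i = j)" "(\<Sum>k<n. P' i k * cnj (P' j k)) = of_bool (i = j)"
      using P by (auto simp: unitary_cmat_def P'_def mult.commute)
  qed
  moreover have "S (S (conj_rep n P' u m i)) = sc (of_real (Re (d m) / Re (d i))) (conj_rep n P' u m i)"
    if im: "i < n" "m < n" for i m
  proof (rule separating)
    fix f assume f: "linear_form G f"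
    have fs: "f (sc c a) = c * f a" for c a
      using f by (simp add: lf_iff)
    define F where "F i k = f (u k i)" for i k
    define F2 where "F2 i k = f (S (S (u k i)))" for i k
    have rel: "mm n F Q i m = mm n Q F2 i m" if "i < n" "m < n" for i m
      using arg_cong[OF SS[OF that], of f]
      by (simp add: lf_sum[OF f] fs mm_def F_def F2_def mult.commute)
    have e1: "f (conj_rep n P' u m i) = mm n (dg P) (mm n F P) i m"
      unfolding conj_rep_def lf_sum[OF f] fs mm_def dg_def F_def P'_def sum_distrib_left
      by (subst sum.swap) (simp add: mult_ac)
    have e2: "f (S (S (conj_rep n P' u m i))) = mm n (dg P) (mm n F2 P) i m"
      unfolding conj_rep_def S_sum S_scl lf_sum[OF f] fs mm_def dg_def F2_def P'_def sum_distrib_left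
      by (subst sum.swap) (simp add: mult_ac)
    have "mm n (dg P) (mm n F P) i m * d m = mm n (dg P) (mm n F (mm n Q P)) i m"
    proof -
      have "mm n F (mm n Q P) k m = mm n F P k m * d m" for k
        unfolding mm_def[of n F] using im by (simp add: d sum_distrib_left mult_ac)
      then show ?thesis
        by (simp add: mm_def[of n "dg P"] sum_distrib_left mult_ac)
    qed
    also have "\<dots> = mm n (dg P) (mm n (mm n F Q) P) i m"
      by (simp add: mm_assoc)
    also have "\<dots> = mm n (dg P) (mm n (mm n Q F2) P) i m"
      by (intro mm_cong) (simp add: mm_def[of n _ P] rel)
    also have "\<dots> = mm n (mm n (dg P) Q) (mm n F2 P) i m"
      by (simp add: mm_assoc)
    also have "\<dots> = d i * mm n (dg P) (mm n F2 P) i m"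
    proof -
      have "mm n (dg P) Q i k = d i * dg P i k" if "k < n" for k
      proof -
        have "mm n (dg P) Q i k = cnj (mm n Q P k i)"
          by (simp add: mm_def dg_def Qh[of k] mult.commute)
        also have "\<dots> = d i * dg P i k"
          using that im dreal[of i] by (simp add: d dg_def complex_eq_iff)
        finally show ?thesis .
      qed
      then show ?thesis
        by (simp add: mm_def[of n "mm n (dg P) Q"] mm_def[of n "dg P" "mm n F2 P"] sum_distrib_left mult_ac)
    qed
    finally have "f (conj_rep n P' u m i) * d m = d i * f (S (S (conj_rep n P' u m i)))"
      by (simp only: e1 e2)
    moreover have "d m = of_real (Re (d m))" "d i = of_real (Re (d i))"
      using im dreal by (auto simp: complex_eq_iff)
    moreover have "of_real (Re (d i)) \<noteq> (0::complex)"
      using dpos[of i] im by simp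
    ultimately show "f (S (S (conj_rep n P' u m i))) =
        f (sc (of_real (Re (d m) / Re (d i))) (conj_rep n P' u m i))"
      by (simp add: fs field_simps)
  qed
  ultimately show thesis
    using that[of P' "\<lambda>i. Re (d i)"] dpos by blast
qed

end

section \<open>Completion of a semi-inner product space\<close>

locale semi_inner_space = vector_space scale
  for scale :: "complex \<Rightarrow> 'v::ab_group_add \<Rightarrow> 'v" +
  fixes ip :: "'v \<Rightarrow> 'v \<Rightarrow> complex"
  assumes ip_add_right: "ip x (y + z) = ip x y + ip x z"
    and ip_scale_right: "ip x (scale c y) = c * ip x y"
    and ip_cnj: "ip y x = cnj (ip x y)"
    and ip_nonneg: "0 \<le> Re (ip x x)"
begin

section \<open>Semi-inner products: seminorm and Cauchy-Schwarz\<close>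

lemma ip_add_left: "ip (x + y) z = ip x z + ip y z"
  by (metis ip_add_right ip_cnj complex_cnj_add)

lemma ip_scale_left: "ip (scale c x) y = cnj c * ip x y"
  by (metis ip_scale_right ip_cnj complex_cnj_mult)

lemma ip_zero_right [simp]: "ip x 0 = 0" and ip_zero_left [simp]: "ip 0 x = 0"
  using ip_add_right[of x 0 0] ip_add_left[of 0 0 x] by auto

lemma ip_uminus_right: "ip x (- y) = - ip x y" and ip_uminus_left: "ip (- x) y = - ip x y"
  using ip_add_right[of x y "- y"] ip_add_left[of x "- x" y] by (auto simp: eq_neg_iff_add_eq_0 add.commute)

lemma ip_diff_right: "ip x (y - z) = ip x y - ip x z" and ip_diff_left: "ip (x - y) z = ip x z - ip y z"
  using ip_add_right[of x y "- z"] ip_add_left[of x "- y" z]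
  by (auto simp: ip_uminus_right ip_uminus_left)

lemma ip_sum_right: "ip x (sum f A) = (\<Sum>a\<in>A. ip x (f a))"
  by (induction A rule: infinite_finite_induct) (auto simp: ip_add_right)

lemma ip_sum_left: "ip (sum f A) x = (\<Sum>a\<in>A. ip (f a) x)"
  by (induction A rule: infinite_finite_induct) (auto simp: ip_add_left)

lemma ip_self: "ip x x = of_real (Re (ip x x))"
  using ip_cnj[of x x] by (simp add: complex_eq_iff)

definition nrm :: "'v \<Rightarrow> real" where "nrm x = sqrt (Re (ip x x))"

lemma nrm_nonneg [simp]: "0 \<le> nrm x"
  by (simp add: nrm_def ip_nonneg)

lemma nrm_power2: "(nrm x)\<^sup>2 = Re (ip x x)"
  by (simp add: nrm_def ip_nonneg)

lemma ip_eq_nrm: "ip x x = of_real ((nrm x)\<^sup>2)"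
  by (subst ip_self) (simp only: nrm_power2)

lemma nrm_zero [simp]: "nrm 0 = 0"
  by (simp add: nrm_def)

lemma nrm_scale: "nrm (scale c x) = cmod c * nrm x"
proof -
  have "ip (scale c x) (scale c x) = of_real ((cmod c)\<^sup>2) * ip x x"
    by (simp only: complex_norm_square) (simp add: ip_scale_left ip_scale_right)
  then have "Re (ip (scale c x) (scale c x)) = (cmod c)\<^sup>2 * Re (ip x x)"
    by (simp only: Re_complex_of_real Im_complex_of_real times_complex.sel mult_zero_left diff_zero)
  then show ?thesis
    by (simp add: nrm_def real_sqrt_mult)
qed

lemma nrm_minus_commute: "nrm (x - y) = nrm (y - x)"
proof -
  have "x - y = scale (-1) (y - x)"
    by simp
  then show ?thesis
    by (metis nrm_scale norm_minus_cancel norm_one mult_1)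
qed

lemma cauchy_schwarz: "cmod (ip x y) \<le> nrm x * nrm y"
proof -
  define a b c where "a = Re (ip x x)" and "b = cmod (ip x y)" and "c = Re (ip y y)"
  have ac: "0 \<le> a" "0 \<le> c" "0 \<le> b"
    by (auto simp: a_def b_def c_def ip_nonneg)
  have pos: "0 \<le> a - 2 * t * b\<^sup>2 + t\<^sup>2 * b\<^sup>2 * c" for t :: real
  proof -
    define z where "z = of_real t * ip y x"
    have zz: "ip x y * ip y x = of_real (b\<^sup>2)"
      unfolding b_def complex_norm_square by (simp add: ip_cnj[of y x])
    have "ip (x - scale z y) (x - scale z y) =
        ip x x - z * ip x y - cnj z * ip y x + cnj z * z * ip y y"
      by (simp add: ip_diff_left ip_diff_right ip_scale_left ip_scale_right algebra_simps)
    also have "z * ip x y = of_real (t * b\<^sup>2)"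
      using zz by (simp add: z_def mult_ac)
    also have "cnj z * ip y x = of_real (t * b\<^sup>2)"
      using zz by (simp add: z_def ip_cnj[of x y, symmetric])
    also have "cnj z * z = of_real (t\<^sup>2 * b\<^sup>2)"
      using zz by (simp add: z_def ip_cnj[of x y, symmetric] power2_eq_square mult_ac)
    finally have "Re (ip (x - scale z y) (x - scale z y)) = a - 2 * t * b\<^sup>2 + t\<^sup>2 * b\<^sup>2 * c"
      by (simp add: a_def c_def ip_eq_nrm[of y])
    then show ?thesis
      using ip_nonneg by metis
  qed
  have "b\<^sup>2 \<le> a * c"
  proof (cases "c = 0")
    case True
    show ?thesis
    proof (rule ccontr)
      assume "\<not> b\<^sup>2 \<le> a * c"
      then have "b\<^sup>2 > 0"
        using True by simp
      then show False
        \<comment> \<open>With c = 0 the expression is affine in t, and this t makes it equal to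
          -1.\<close>
        using pos[of "(a + 1) / (2 * b\<^sup>2)"] True by (simp add: field_simps)
    qed
  next
    case False
    have "a - 2 * (1 / c) * b\<^sup>2 + (1 / c)\<^sup>2 * b\<^sup>2 * c = a - b\<^sup>2 / c"
      using False by (simp add: field_simps power2_eq_square)
    then have "b\<^sup>2 / c \<le> a"
      using pos[of "1 / c"] by simp
    then show ?thesis
      using False ac by (simp add: field_simps)
  qed
  then have "b \<le> sqrt (a * c)"
    by (rule real_le_rsqrt)
  then show ?thesis
    by (simp add: b_def nrm_def a_def c_def real_sqrt_mult)
qed

lemma nrm_triangle: "nrm (x + y) \<le> nrm x + nrm y"
proof -
  have "(nrm (x + y))\<^sup>2 = (nrm x)\<^sup>2 + (nrm y)\<^sup>2 + 2 * Re (ip x y)"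
    using ip_cnj[of y x] by (simp add: nrm_power2 ip_add_left ip_add_right)
  also have "Re (ip x y) \<le> nrm x * nrm y"
    using cauchy_schwarz complex_Re_le_cmod order_trans by blast
  finally have "(nrm (x + y))\<^sup>2 \<le> (nrm x + nrm y)\<^sup>2"
    by (simp add: power2_sum)
  then show ?thesis
    by (rule power2_le_imp_le) simp
qed

lemma nrm_triangle_diff: "nrm (x - z) \<le> nrm (x - y) + nrm (y - z)"
  using nrm_triangle[of "x - y" "y - z"] by simp

section \<open>Cauchy sequences and their equivalence\<close>

definition cauchy :: "(nat \<Rightarrow> 'v) \<Rightarrow> bool" where
  "cauchy X \<longleftrightarrow> (\<forall>\<epsilon>>0. \<exists>N. \<forall>m\<ge>N. \<forall>n\<ge>N. nrm (X m - X n) < \<epsilon>)"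

definition eqv :: "(nat \<Rightarrow> 'v) \<Rightarrow> (nat \<Rightarrow> 'v) \<Rightarrow> bool" where
  "eqv X Y \<longleftrightarrow> (\<lambda>n. nrm (X n - Y n)) \<longlonglongrightarrow> 0"

lemma nrm_tendsto_0I:
  assumes "g \<longlonglongrightarrow> 0" "\<And>n. nrm (X n) \<le> g n" shows "(\<lambda>n. nrm (X n)) \<longlonglongrightarrow> 0"
  by (rule tendsto_sandwich[of "\<lambda>_. 0" _ _ g]) (use assms in auto)

lemma eqv_refl [simp]: "eqv X X"
  by (simp add: eqv_def)

lemma eqv_sym: "eqv X Y \<Longrightarrow> eqv Y X"
  by (simp add: eqv_def nrm_minus_commute)

lemma eqv_trans: "eqv X Y \<Longrightarrow> eqv Y Z \<Longrightarrow> eqv X Z"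
  unfolding eqv_def
  by (rule nrm_tendsto_0I[of "\<lambda>n. nrm (X n - Y n) + nrm (Y n - Z n)"])
    (auto intro: tendsto_add_zero nrm_triangle_diff)

lemma cauchy_const [simp]: "cauchy (\<lambda>_. x)"
  by (simp add: cauchy_def)

lemma cauchyD: "cauchy X \<Longrightarrow> 0 < \<epsilon> \<Longrightarrow> \<exists>N. \<forall>m\<ge>N. \<forall>n\<ge>N. nrm (X m - X n) < \<epsilon>"
  by (auto simp: cauchy_def)

lemma cauchy_lipschitz:
  assumes X: "cauchy X" and K: "\<And>m n. nrm (Y m - Y n) \<le> K * nrm (X m - X n)"
  shows "cauchy Y"
  unfolding cauchy_def
proof (intro allI impI)
  fix \<epsilon> :: real assume \<epsilon>: "\<epsilon> > 0"
  define L where "L = max K 1"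
  have L: "L > 0" "K \<le> L"
    by (auto simp: L_def)
  obtain N where N: "\<And>m n. m \<ge> N \<Longrightarrow> n \<ge> N \<Longrightarrow> nrm (X m - X n) < \<epsilon> / L"
    using cauchyD[OF X, of "\<epsilon> / L"] \<epsilon> L by auto
  show "\<exists>N. \<forall>m\<ge>N. \<forall>n\<ge>N. nrm (Y m - Y n) < \<epsilon>"
  proof (intro exI[of _ N] allI impI)
    fix m n assume "m \<ge> N" "n \<ge> N"
    then have "L * nrm (X m - X n) < \<epsilon>"
      using N[of m n] L by (simp add: field_simps)
    moreover have "K * nrm (X m - X n) \<le> L * nrm (X m - X n)"
      using L by (intro mult_right_mono) auto
    ultimately show "nrm (Y m - Y n) < \<epsilon>"
      using K[of m n] by linarith
  qed
qed

lemma cauchy_add: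
  assumes "cauchy X" "cauchy Y" shows "cauchy (\<lambda>n. X n + Y n)"
  unfolding cauchy_def
proof (intro allI impI)
  fix \<epsilon> :: real assume \<epsilon>: "\<epsilon> > 0"
  obtain M where M: "\<And>m n. m \<ge> M \<Longrightarrow> n \<ge> M \<Longrightarrow> nrm (X m - X n) < \<epsilon> / 2"
    using cauchyD[OF assms(1), of "\<epsilon> / 2"] \<epsilon> by auto
  obtain N where N: "\<And>m n. m \<ge> N \<Longrightarrow> n \<ge> N \<Longrightarrow> nrm (Y m - Y n) < \<epsilon> / 2"
    using cauchyD[OF assms(2), of "\<epsilon> / 2"] \<epsilon> by auto
  show "\<exists>N. \<forall>m\<ge>N. \<forall>n\<ge>N. nrm (X m + Y m - (X n + Y n)) < \<epsilon>"
  proof (intro exI[of _ "max M N"] allI impI)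
    fix m n assume "m \<ge> max M N" "n \<ge> max M N"
    then show "nrm (X m + Y m - (X n + Y n)) < \<epsilon>"
      using M[of m n] N[of m n] nrm_triangle[of "X m - X n" "Y m - Y n"] by (simp add: algebra_simps)
  qed
qed

lemma cauchy_scale: "cauchy X \<Longrightarrow> cauchy (\<lambda>n. scale c (X n))"
  by (rule cauchy_lipschitz[where X = X and K = "cmod c"]) (simp_all add: scale_right_diff_distrib[symmetric] nrm_scale)

lemma cauchy_uminus: "cauchy X \<Longrightarrow> cauchy (\<lambda>n. - X n)"
  using cauchy_scale[of X "-1"] by simp

lemma cauchy_diff: "cauchy X \<Longrightarrow> cauchy Y \<Longrightarrow> cauchy (\<lambda>n. X n - Y n)"
  using cauchy_add[OF _ cauchy_uminus] by simp

lemma cauchy_bounded: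
  assumes "cauchy X" obtains K where "K > 0" "\<And>n. nrm (X n) \<le> K"
proof -
  obtain N where N: "\<And>m n. m \<ge> N \<Longrightarrow> n \<ge> N \<Longrightarrow> nrm (X m - X n) < 1"
    using cauchyD[OF assms, of 1] by auto
  define K where "K = Max ((\<lambda>n. nrm (X n)) ` {..N}) + 1"
  have le: "nrm (X n) \<le> Max ((\<lambda>n. nrm (X n)) ` {..N})" if "n \<le> N" for n
    using that by (intro Max_ge) auto
  have "nrm (X n) \<le> K" for n
  proof (cases "n \<le> N")
    case True
    then show ?thesis
      using le[OF True] unfolding K_def by linarith
  next
    case False
    then have "nrm (X n - X N) < 1"
      using N by simp
    moreover have "nrm (X n) \<le> nrm (X n - X N) + nrm (X N)"
      using nrm_triangle[of "X n - X N" "X N"] by simp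
    ultimately show ?thesis
      using le[OF order_refl] unfolding K_def by linarith
  qed
  moreover have "K > 0"
    using le[of N] nrm_nonneg[of "X N"] unfolding K_def by linarith
  ultimately show thesis
    using that by blast
qed

lemma ip_convergent:
  assumes X: "cauchy X" and Y: "cauchy Y"
  shows "convergent (\<lambda>n. ip (X n) (Y n))"
proof -
  obtain K L where K: "K > 0" "\<And>n. nrm (X n) \<le> K" and L: "L > 0" "\<And>n. nrm (Y n) \<le> L"
    using cauchy_bounded[OF X] cauchy_bounded[OF Y] by metis
  have "Cauchy (\<lambda>n. ip (X n) (Y n))"
    unfolding Cauchy_def
  proof (intro allI impI)
    fix \<epsilon> :: real assume \<epsilon>: "\<epsilon> > 0"
    obtain M where M: "\<And>m n. m \<ge> M \<Longrightarrow> n \<ge> M \<Longrightarrow> nrm (X m - X n) < \<epsilon> / (2 * L)"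
      using cauchyD[OF X, of "\<epsilon> / (2 * L)"] \<epsilon> L by auto
    obtain N where N: "\<And>m n. m \<ge> N \<Longrightarrow> n \<ge> N \<Longrightarrow> nrm (Y m - Y n) < \<epsilon> / (2 * K)"
      using cauchyD[OF Y, of "\<epsilon> / (2 * K)"] \<epsilon> K by auto
    show "\<exists>M. \<forall>m\<ge>M. \<forall>n\<ge>M. dist (ip (X m) (Y m)) (ip (X n) (Y n)) < \<epsilon>"
    proof (intro exI[of _ "max M N"] allI impI)
      fix m n assume mn: "m \<ge> max M N" "n \<ge> max M N"
      have "ip (X m) (Y m) - ip (X n) (Y n) = ip (X m - X n) (Y m) + ip (X n) (Y m - Y n)"
        by (simp add: ip_diff_left ip_diff_right)
      then have "dist (ip (X m) (Y m)) (ip (X n) (Y n)) \<le> nrm (X m - X n) * nrm (Y m) + nrm (X n) * nrm (Y m - Y n)"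
        unfolding dist_norm using cauchy_schwarz[of "X m - X n" "Y m"] cauchy_schwarz[of "X n" "Y m - Y n"]
        by (smt (verit) norm_triangle_ineq)
      also have "\<dots> \<le> nrm (X m - X n) * L + K * nrm (Y m - Y n)"
        using K L by (intro add_mono mult_mono) (auto simp: less_imp_le)
      also have "\<dots> < \<epsilon> / (2 * L) * L + K * (\<epsilon> / (2 * K))"
        using M[of m n] N[of m n] mn K L by (intro add_strict_mono mult_strict_right_mono mult_strict_left_mono) auto
      also have "\<dots> = \<epsilon>"
        using K L by (simp add: field_simps)
      finally show "dist (ip (X m) (Y m)) (ip (X n) (Y n)) < \<epsilon>" .
    qed
  qed
  then show ?thesis
    by (rule Cauchy_convergent)
qed

lemma ip_eqv_tendsto:
  assumes X: "cauchy X" and Y: "cauchy Y" and "eqv X X'" "eqv Y Y'" and X': "cauchy X'"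
  shows "(\<lambda>n. ip (X n) (Y n) - ip (X' n) (Y' n)) \<longlonglongrightarrow> 0"
proof -
  obtain K L where K: "K > 0" "\<And>n. nrm (X' n) \<le> K" and L: "L > 0" "\<And>n. nrm (Y n) \<le> L"
    using cauchy_bounded[OF X'] cauchy_bounded[OF Y] by metis
  show ?thesis
  proof (rule tendsto_norm_zero_cancel)
    have g: "(\<lambda>n. nrm (X n - X' n) * L + K * nrm (Y n - Y' n)) \<longlonglongrightarrow> 0"
      using assms(3,4) unfolding eqv_def
      by (intro tendsto_add_zero tendsto_mult_left_zero tendsto_mult_right_zero)
    have b: "cmod (ip (X n) (Y n) - ip (X' n) (Y' n)) \<le> nrm (X n - X' n) * L + K * nrm (Y n - Y' n)" for n
    proof -
      have "ip (X n) (Y n) - ip (X' n) (Y' n) = ip (X n - X' n) (Y n) + ip (X' n) (Y n - Y' n)"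
        by (simp add: ip_diff_left ip_diff_right)
      then have "cmod (ip (X n) (Y n) - ip (X' n) (Y' n)) \<le> nrm (X n - X' n) * nrm (Y n) + nrm (X' n) * nrm (Y n - Y' n)"
        using cauchy_schwarz[of "X n - X' n" "Y n"] cauchy_schwarz[of "X' n" "Y n - Y' n"]
        by (smt (verit) norm_triangle_ineq)
      also have "\<dots> \<le> nrm (X n - X' n) * L + K * nrm (Y n - Y' n)"
        using K L by (intro add_mono mult_mono) (auto simp: less_imp_le)
      finally show ?thesis .
    qed
    show "(\<lambda>n. cmod (ip (X n) (Y n) - ip (X' n) (Y' n))) \<longlonglongrightarrow> 0"
    proof (rule tendsto_sandwich[OF _ _ tendsto_const g])
      show "\<forall>\<^sub>F n in sequentially. 0 \<le> cmod (ip (X n) (Y n) - ip (X' n) (Y' n))"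
        by simp
      show "\<forall>\<^sub>F n in sequentially. cmod (ip (X n) (Y n) - ip (X' n) (Y' n)) \<le>
          nrm (X n - X' n) * L + K * nrm (Y n - Y' n)"
        by (rule always_eventually) (rule allI, rule b)
    qed
  qed
qed

end

locale completion = semi_inner_space scale ip
  for scale :: "complex \<Rightarrow> 'v::ab_group_add \<Rightarrow> 'v" and ip +
  fixes e :: "(nat \<Rightarrow> 'v) \<Rightarrow> 'h"
  assumes inj_e: "inj e"
begin

text \<open>A point of the completion is the code under \<open>e\<close> of one chosen member of its
  class of Cauchy sequences. The choice depends only on the class, since equivalent sequences
  satisfy the same predicate, so equality of points is plain equality in the ambient type.\<close>

definition cl :: "(nat \<Rightarrow> 'v) \<Rightarrow> 'h" where "cl X = e (SOME Y. cauchy Y \<and> eqv X Y)"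

definition rep :: "'h \<Rightarrow> nat \<Rightarrow> 'v" where "rep x = inv_into UNIV e x"

definition H :: "'h hilbert" where
  "H = \<lparr>vecs = cl ` {X. cauchy X}, hzero = cl (\<lambda>_. 0), hadd = (\<lambda>x y. cl (\<lambda>n. rep x n + rep y n)),
     hscale = (\<lambda>c x. cl (\<lambda>n. scale c (rep x n))), hinner = (\<lambda>x y. lim (\<lambda>n. ip (rep x n) (rep y n)))\<rparr>"

lemma rep_cl: assumes "cauchy X" shows "cauchy (rep (cl X))" "eqv X (rep (cl X))"
proof -
  have "cauchy (SOME Y. cauchy Y \<and> eqv X Y) \<and> eqv X (SOME Y. cauchy Y \<and> eqv X Y)"
    by (rule someI[of "\<lambda>Y. cauchy Y \<and> eqv X Y" X]) (simp add: assms)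
  then show "cauchy (rep (cl X))" "eqv X (rep (cl X))"
    by (auto simp: rep_def cl_def inj_e)
qed

lemma cl_eqI:
  assumes "eqv X Y" shows "cl X = cl Y"
proof -
  have "(\<lambda>Z. cauchy Z \<and> eqv X Z) = (\<lambda>Z. cauchy Z \<and> eqv Y Z)"
    using assms eqv_sym eqv_trans by blast
  then show ?thesis
    by (simp add: cl_def)
qed

lemma vecs_H: "x \<in> vecs H \<longleftrightarrow> (\<exists>X. cauchy X \<and> x = cl X)"
  by (auto simp: H_def)

lemma vecsE: assumes "x \<in> vecs H" obtains X where "cauchy X" "x = cl X"
  using assms by (auto simp: vecs_H)

lemma eqv_add: "eqv X X' \<Longrightarrow> eqv Y Y' \<Longrightarrow> eqv (\<lambda>n. X n + Y n) (\<lambda>n. X' n + Y' n)"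
  unfolding eqv_def
  by (rule nrm_tendsto_0I[of "\<lambda>n. nrm (X n - X' n) + nrm (Y n - Y' n)"])
    (auto simp: add_diff_add intro: tendsto_add_zero nrm_triangle)

lemma eqv_lipschitz:
  assumes "eqv X X'" "\<And>n. nrm (Y n - Y' n) \<le> K * nrm (X n - X' n)" shows "eqv Y Y'"
  unfolding eqv_def
  by (rule nrm_tendsto_0I[OF tendsto_mult_right_zero[OF assms(1)[unfolded eqv_def]] assms(2)])

lemma eqv_scale: "eqv X X' \<Longrightarrow> eqv (\<lambda>n. scale c (X n)) (\<lambda>n. scale c (X' n))"
  by (rule eqv_lipschitz[where X = X and X' = X' and K = "cmod c"]) (simp_all add: scale_right_diff_distrib[symmetric] nrm_scale)

lemma hzero_H: "hzero H = cl (\<lambda>_. 0)"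
  by (simp add: H_def)

lemma hadd_cl:
  assumes X: "cauchy X" and Y: "cauchy Y"
  shows "hadd H (cl X) (cl Y) = cl (\<lambda>n. X n + Y n)"
proof -
  have "hadd H (cl X) (cl Y) = cl (\<lambda>n. rep (cl X) n + rep (cl Y) n)"
    by (simp add: H_def)
  also have "\<dots> = cl (\<lambda>n. X n + Y n)"
    by (rule cl_eqI[OF eqv_sym[OF eqv_add[OF rep_cl(2)[OF X] rep_cl(2)[OF Y]]]])
  finally show ?thesis .
qed

lemma hscale_cl:
  assumes X: "cauchy X"
  shows "hscale H c (cl X) = cl (\<lambda>n. scale c (X n))"
proof -
  have "hscale H c (cl X) = cl (\<lambda>n. scale c (rep (cl X) n))"
    by (simp add: H_def)
  also have "\<dots> = cl (\<lambda>n. scale c (X n))"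
    by (rule cl_eqI[OF eqv_sym[OF eqv_scale[OF rep_cl(2)[OF X]]]])
  finally show ?thesis .
qed

lemma hdiff_cl: "cauchy X \<Longrightarrow> cauchy Y \<Longrightarrow> hdiff H (cl X) (cl Y) = cl (\<lambda>n. X n - Y n)"
  by (simp add: hdiff_def hscale_cl hadd_cl cauchy_uminus)

lemma hinner_cl_tendsto:
  assumes X: "cauchy X" and Y: "cauchy Y"
  shows "(\<lambda>n. ip (X n) (Y n)) \<longlonglongrightarrow> hinner H (cl X) (cl Y)"
proof -
  have "(\<lambda>n. ip (rep (cl X) n) (rep (cl Y) n)) \<longlonglongrightarrow> hinner H (cl X) (cl Y)"
    using ip_convergent[OF rep_cl(1)[OF X] rep_cl(1)[OF Y]] by (simp add: H_def convergent_LIMSEQ_iff)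
  from tendsto_add[OF this ip_eqv_tendsto[OF X Y rep_cl(2)[OF X] rep_cl(2)[OF Y] rep_cl(1)[OF X]]]
  show ?thesis
    by simp
qed

lemma hnorm_cl_tendsto: "cauchy X \<Longrightarrow> (\<lambda>n. nrm (X n)) \<longlonglongrightarrow> hnorm H (cl X)"
  unfolding nrm_def hnorm_def by (intro tendsto_real_sqrt tendsto_Re hinner_cl_tendsto)

section \<open>The completion as a Hilbert space\<close>

lemma complex_vector_space_H: "complex_vector_space H"
  unfolding complex_vector_space_def
proof (intro conjI ballI allI)
  show "hzero H \<in> vecs H"
    unfolding hzero_H vecs_H using cauchy_const by blast
next
  fix x y assume "x \<in> vecs H" "y \<in> vecs H"
  then obtain X Y where XY: "cauchy X" "cauchy Y" and x: "x = cl X" "y = cl Y"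
    by (auto simp: vecs_H)
  show "hadd H x y \<in> vecs H"
    unfolding x using XY by (auto simp: hadd_cl vecs_H intro: cauchy_add)
  show "hadd H x y = hadd H y x"
    unfolding x using XY by (simp add: hadd_cl add.commute)
  fix c
  show "hscale H c (hadd H x y) = hadd H (hscale H c x) (hscale H c y)"
    unfolding x using XY by (simp add: hadd_cl hscale_cl cauchy_add cauchy_scale scale_right_distrib)
  fix z assume "z \<in> vecs H"
  then obtain Z where Z: "cauchy Z" "z = cl Z"
    by (auto simp: vecs_H)
  show "hadd H (hadd H x y) z = hadd H x (hadd H y z)"
    unfolding x using XY Z by (simp add: hadd_cl cauchy_add add.assoc)
next
  fix x assume "x \<in> vecs H"
  then obtain X where X: "cauchy X" "x = cl X"
    by (auto simp: vecs_H)
  show "hadd H (hzero H) x = x"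
    using X by (simp add: hzero_H hadd_cl)
  show "\<exists>y\<in>vecs H. hadd H x y = hzero H"
  proof
    show "cl (\<lambda>n. - X n) \<in> vecs H"
      using X cauchy_uminus by (auto simp: vecs_H)
    show "hadd H x (cl (\<lambda>n. - X n)) = hzero H"
      using X by (simp add: hadd_cl cauchy_uminus hzero_H)
  qed
  show "hscale H 1 x = x"
    using X by (simp add: hscale_cl)
  fix c show "hscale H c x \<in> vecs H"
    using X by (auto simp: hscale_cl vecs_H intro: cauchy_scale)
  fix d show "hscale H (c + d) x = hadd H (hscale H c x) (hscale H d x)"
    using X by (simp add: hscale_cl hadd_cl cauchy_scale scale_left_distrib)
  show "hscale H (c * d) x = hscale H c (hscale H d x)"
    using X by (simp add: hscale_cl cauchy_scale)
qed

lemma inner_product_H: "inner_product H"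
  unfolding inner_product_def
proof (intro conjI ballI allI impI)
  fix x y assume "x \<in> vecs H" "y \<in> vecs H"
  then obtain X Y where XY: "cauchy X" "cauchy Y" and x: "x = cl X" "y = cl Y"
    by (auto simp: vecs_H)
  show "hinner H y x = cnj (hinner H x y)"
  proof (rule LIMSEQ_unique)
    show "(\<lambda>n. ip (Y n) (X n)) \<longlonglongrightarrow> hinner H y x"
      unfolding x by (rule hinner_cl_tendsto[OF XY(2,1)])
    show "(\<lambda>n. ip (Y n) (X n)) \<longlonglongrightarrow> cnj (hinner H x y)"
      unfolding x ip_cnj[of "Y n" "X n" for n] by (intro tendsto_cnj hinner_cl_tendsto[OF XY])
  qed
  fix c
  show "hinner H x (hscale H c y) = c * hinner H x y"
  proof (rule LIMSEQ_unique)
    show "(\<lambda>n. ip (X n) (scale c (Y n))) \<longlonglongrightarrow> hinner H x (hscale H c y)"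
      unfolding x using XY by (simp add: hscale_cl) (intro hinner_cl_tendsto cauchy_scale)
    show "(\<lambda>n. ip (X n) (scale c (Y n))) \<longlonglongrightarrow> c * hinner H x y"
      unfolding x ip_scale_right by (intro tendsto_mult_left hinner_cl_tendsto[OF XY])
  qed
  fix z assume "z \<in> vecs H"
  then obtain Z where Z: "cauchy Z" "z = cl Z"
    by (auto simp: vecs_H)
  show "hinner H x (hadd H y z) = hinner H x y + hinner H x z"
  proof (rule LIMSEQ_unique)
    show "(\<lambda>n. ip (X n) (Y n + Z n)) \<longlonglongrightarrow> hinner H x (hadd H y z)"
      unfolding x using XY Z by (simp add: hadd_cl) (intro hinner_cl_tendsto cauchy_add)
    show "(\<lambda>n. ip (X n) (Y n + Z n)) \<longlonglongrightarrow> hinner H x y + hinner H x z"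
      unfolding x Z ip_add_right using XY Z by (intro tendsto_add hinner_cl_tendsto)
  qed
next
  fix x assume "x \<in> vecs H"
  then obtain X where X: "cauchy X" "x = cl X"
    by (auto simp: vecs_H)
  have lim: "(\<lambda>n. ip (X n) (X n)) \<longlonglongrightarrow> hinner H x x"
    unfolding X by (rule hinner_cl_tendsto[OF X(1) X(1)])
  have "0 \<le> Re (hinner H x x)"
    by (rule LIMSEQ_le_const[OF tendsto_Re[OF lim]]) (auto simp: ip_nonneg)
  moreover have "Im (hinner H x x) = 0"
  proof (rule LIMSEQ_unique[OF tendsto_Im[OF lim]])
    have "Im (ip y y) = 0" for y
      by (subst ip_self) simp
    then show "(\<lambda>n. Im (ip (X n) (X n))) \<longlonglongrightarrow> 0"
      by simp
  qed
  ultimately show "0 \<le> hinner H x x"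
    by (simp add: less_eq_complex_def)
  assume "hinner H x x = 0"
  then have "(\<lambda>n. nrm (X n)) \<longlonglongrightarrow> 0"
    using hnorm_cl_tendsto[OF X(1)] X(2) by (simp add: hnorm_def)
  then have "eqv X (\<lambda>_. 0)"
    by (simp add: eqv_def)
  then show "x = hzero H"
    by (simp add: X(2) hzero_H cl_eqI)
qed

lemma hnorm_hdiff_cl: "cauchy X \<Longrightarrow> cauchy Y \<Longrightarrow> (\<lambda>n. nrm (X n - Y n)) \<longlonglongrightarrow> hnorm H (hdiff H (cl X) (cl Y))"
  by (simp add: hdiff_cl hnorm_cl_tendsto cauchy_diff)

lemma dense_const:
  assumes x: "x \<in> vecs H" and "\<epsilon> > 0"
  obtains v where "hnorm H (hdiff H x (cl (\<lambda>_. v))) < \<epsilon>"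
proof -
  obtain X where X: "cauchy X" "x = cl X"
    using x by (auto simp: vecs_H)
  obtain N where N: "\<And>m n. m \<ge> N \<Longrightarrow> n \<ge> N \<Longrightarrow> nrm (X m - X n) < \<epsilon> / 2"
    using cauchyD[OF X(1), of "\<epsilon> / 2"] \<open>\<epsilon> > 0\<close> by auto
  have "(\<lambda>n. nrm (X n - X N)) \<longlonglongrightarrow> hnorm H (hdiff H x (cl (\<lambda>_. X N)))"
    unfolding X(2) by (rule hnorm_hdiff_cl[OF X(1) cauchy_const])
  then have "hnorm H (hdiff H x (cl (\<lambda>_. X N))) \<le> \<epsilon> / 2"
    by (rule LIMSEQ_le_const2) (use N in \<open>auto intro!: exI[of _ N] simp: less_imp_le\<close>)
  then show thesis
    using that[of "X N"] \<open>\<epsilon> > 0\<close> by simp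
qed

lemma hnorm_const_diff: "hnorm H (hdiff H (cl (\<lambda>_. v)) (cl (\<lambda>_. w))) = nrm (v - w)"
  using hnorm_hdiff_cl[OF cauchy_const cauchy_const, of v w] by (simp only: LIMSEQ_const_iff)

lemma hnorm_triangle_cl:
  assumes "cauchy X" "cauchy Y" "cauchy Z"
  shows "hnorm H (hdiff H (cl X) (cl Z)) \<le> hnorm H (hdiff H (cl X) (cl Y)) + hnorm H (hdiff H (cl Y) (cl Z))"
  by (rule LIMSEQ_le[OF hnorm_hdiff_cl[OF assms(1,3)]
        tendsto_add[OF hnorm_hdiff_cl[OF assms(1,2)] hnorm_hdiff_cl[OF assms(2,3)]]])
    (intro exI allI impI nrm_triangle_diff)

lemma hnorm_hdiff_commute:
  assumes "cauchy X" "cauchy Y"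
  shows "hnorm H (hdiff H (cl X) (cl Y)) = hnorm H (hdiff H (cl Y) (cl X))"
proof (rule LIMSEQ_unique[OF hnorm_hdiff_cl[OF assms]])
  have "(\<lambda>n. nrm (Y n - X n)) = (\<lambda>n. nrm (X n - Y n))"
    by (rule ext) (rule nrm_minus_commute)
  then show "(\<lambda>n. nrm (X n - Y n)) \<longlonglongrightarrow> hnorm H (hdiff H (cl Y) (cl X))"
    by (rule subst[where P = "\<lambda>f. f \<longlonglongrightarrow> _"]) (rule hnorm_hdiff_cl[OF assms(2,1)])
qed

text \<open>Each X n lies within 1 / (n + 1) of the constant sequence at some vector Y n; the Y n
  form a Cauchy sequence of vectors, and its class is the limit.\<close>

lemma complete_H: "complete_space_on H"
  unfolding complete_space_on_def
proof (intro allI impI, elim conjE)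
  fix X :: "nat \<Rightarrow> 'h"
  assume X: "\<forall>n. X n \<in> vecs H"
    and C: "\<forall>e>0. \<exists>N. \<forall>m\<ge>N. \<forall>n\<ge>N. hnorm H (hdiff H (X m) (X n)) < e"
  have "\<forall>n. \<exists>Z. cauchy Z \<and> X n = cl Z"
    using X unfolding vecs_H .
  from choice[OF this] obtain R where R: "\<And>n. cauchy (R n)" "\<And>n. X n = cl (R n)"
    by blast
  have ex: "\<forall>n. \<exists>v. hnorm H (hdiff H (X n) (cl (\<lambda>_. v))) < inverse (real (Suc n))"
  proof
    fix n
    have "X n \<in> vecs H" "0 < inverse (real (Suc n))"
      using X by auto
    then show "\<exists>v. hnorm H (hdiff H (X n) (cl (\<lambda>_. v))) < inverse (real (Suc n))"
      using dense_const by blast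
  qed
  from choice[OF ex] obtain Y where
    Y: "\<And>n. hnorm H (hdiff H (X n) (cl (\<lambda>_. Y n))) < inverse (real (Suc n))"
    by blast
  have small: "\<exists>N. \<forall>n\<ge>N. inverse (real (Suc n)) < \<epsilon>" if "\<epsilon> > 0" for \<epsilon>
    using LIMSEQ_D[OF LIMSEQ_inverse_real_of_nat that] by auto
  have cY: "cauchy Y"
    unfolding cauchy_def
  proof (intro allI impI)
    fix \<epsilon> :: real assume \<epsilon>: "\<epsilon> > 0"
    obtain M where M: "\<And>n. n \<ge> M \<Longrightarrow> inverse (real (Suc n)) < \<epsilon> / 3"
      using small[of "\<epsilon> / 3"] \<epsilon> by auto
    obtain N where N: "\<And>m n. m \<ge> N \<Longrightarrow> n \<ge> N \<Longrightarrow> hnorm H (hdiff H (X m) (X n)) < \<epsilon> / 3"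
      using C[rule_format, of "\<epsilon> / 3"] \<epsilon> by auto
    show "\<exists>N. \<forall>m\<ge>N. \<forall>n\<ge>N. nrm (Y m - Y n) < \<epsilon>"
    proof (intro exI[of _ "max M N"] allI impI)
      fix m n assume mn: "m \<ge> max M N" "n \<ge> max M N"
      let ?d = "\<lambda>x y. hnorm H (hdiff H x y)"
      have "nrm (Y m - Y n) = ?d (cl (\<lambda>_. Y m)) (cl (\<lambda>_. Y n))"
        by (simp add: hnorm_const_diff)
      also have "\<dots> \<le> ?d (cl (\<lambda>_. Y m)) (X m) + ?d (X m) (cl (\<lambda>_. Y n))"
        unfolding R(2) by (intro hnorm_triangle_cl R cauchy_const)
      also have "?d (X m) (cl (\<lambda>_. Y n)) \<le> ?d (X m) (X n) + ?d (X n) (cl (\<lambda>_. Y n))"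
        unfolding R(2) by (intro hnorm_triangle_cl R cauchy_const)
      also have "?d (cl (\<lambda>_. Y m)) (X m) = ?d (X m) (cl (\<lambda>_. Y m))"
        unfolding R(2) by (intro hnorm_hdiff_commute R cauchy_const)
      finally show "nrm (Y m - Y n) < \<epsilon>"
        using Y[of m] Y[of n] M[of m] M[of n] N[of m n] mn by simp
    qed
  qed
  have "(\<lambda>n. hnorm H (hdiff H (X n) (cl Y))) \<longlonglongrightarrow> 0"
  proof (rule LIMSEQ_I)
    fix \<epsilon> :: real assume \<epsilon>: "\<epsilon> > 0"
    obtain M where M: "\<And>n. n \<ge> M \<Longrightarrow> inverse (real (Suc n)) < \<epsilon> / 3"
      using small[of "\<epsilon> / 3"] \<epsilon> by auto
    obtain N where N: "\<And>m n. m \<ge> N \<Longrightarrow> n \<ge> N \<Longrightarrow> nrm (Y m - Y n) < \<epsilon> / 3"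
      using cauchyD[OF cY, of "\<epsilon> / 3"] \<epsilon> by auto
    show "\<exists>N. \<forall>n\<ge>N. norm (hnorm H (hdiff H (X n) (cl Y)) - 0) < \<epsilon>"
    proof (intro exI[of _ "max M N"] allI impI)
      fix n assume n: "n \<ge> max M N"
      let ?d = "\<lambda>x y. hnorm H (hdiff H x y)"
      have "?d (X n) (cl Y) \<le> ?d (X n) (cl (\<lambda>_. Y n)) + ?d (cl (\<lambda>_. Y n)) (cl Y)"
        unfolding R(2) by (intro hnorm_triangle_cl R cauchy_const cY)
      moreover have "?d (cl (\<lambda>_. Y n)) (cl Y) \<le> \<epsilon> / 3"
        by (rule LIMSEQ_le_const2[OF hnorm_hdiff_cl[OF cauchy_const cY]])
          (use N n in \<open>auto intro!: exI[of _ N] simp: less_imp_le\<close>)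
      moreover have "0 \<le> ?d (X n) (cl Y)"
        unfolding R(2) by (rule LIMSEQ_le_const[OF hnorm_hdiff_cl[OF R(1) cY]]) auto
      ultimately show "norm (?d (X n) (cl Y) - 0) < \<epsilon>"
        using Y[of n] M[of n] n \<epsilon> by simp
    qed
  qed
  moreover have "cl Y \<in> vecs H"
    unfolding vecs_H using cY by blast
  ultimately show "\<exists>x\<in>vecs H. (\<lambda>n. hnorm H (hdiff H (X n) x)) \<longlonglongrightarrow> 0"
    by blast
qed

lemma hilbert_space_H: "hilbert_space H"
  by (simp add: hilbert_space_def complex_vector_space_H inner_product_H complete_H)

section \<open>Extension of bounded linear maps\<close>

definition lift :: "('v \<Rightarrow> 'v) \<Rightarrow> 'h \<Rightarrow> 'h" where "lift T x = cl (\<lambda>n. T (rep x n))"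

context
  fixes T K
  assumes T_add: "\<And>x y. T (x + y) = T x + T y" and T_scale: "\<And>c x. T (scale c x) = scale c (T x)"
    and T_bound: "\<And>x. nrm (T x) \<le> K * nrm x"
begin

lemma T_diff: "T (x - y) = T x - T y"
  by (simp add: eq_diff_eq flip: T_add)

lemma T_lipschitz: "nrm (T x - T y) \<le> K * nrm (x - y)"
  using T_bound[of "x - y"] by (simp add: T_diff)

lemma cauchy_T: "cauchy X \<Longrightarrow> cauchy (\<lambda>n. T (X n))"
  by (rule cauchy_lipschitz[OF _ T_lipschitz])

lemma lift_cl:
  assumes "cauchy X" shows "lift T (cl X) = cl (\<lambda>n. T (X n))"
  unfolding lift_def by (rule cl_eqI[OF eqv_sym[OF eqv_lipschitz[OF rep_cl(2)[OF assms] T_lipschitz]]])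

lemma bounded_operator_lift: "bounded_operator H (lift T)"
  unfolding bounded_operator_def
proof (intro conjI ballI allI)
  fix x y assume "x \<in> vecs H" "y \<in> vecs H"
  then obtain X Y where XY: "cauchy X" "cauchy Y" "x = cl X" "y = cl Y"
    by (auto simp: vecs_H)
  show "lift T x \<in> vecs H"
    using XY cauchy_T by (auto simp: lift_cl vecs_H)
  show "lift T (hadd H x y) = hadd H (lift T x) (lift T y)"
    using XY by (simp add: lift_cl hadd_cl cauchy_add cauchy_T T_add)
  show "lift T (hscale H c x) = hscale H c (lift T x)" for c
    using XY by (simp add: lift_cl hscale_cl cauchy_scale cauchy_T T_scale)
next
  have "hnorm H (lift T x) \<le> K * hnorm H x" if x: "x \<in> vecs H" for x
  proof -
    obtain X where X: "cauchy X" "x = cl X"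
      using x by (auto simp: vecs_H)
    show ?thesis
      unfolding X(2) lift_cl[OF X(1)]
      by (rule LIMSEQ_le[OF hnorm_cl_tendsto[OF cauchy_T[OF X(1)]] tendsto_mult_left[OF hnorm_cl_tendsto[OF X(1)]]])
        (auto intro: T_bound)
  qed
  then show "\<exists>C. \<forall>x\<in>vecs H. hnorm H (lift T x) \<le> C * hnorm H x"
    by blast
qed

end

end

section \<open>Generating functionals from cocycles\<close>

context cqg
begin

text \<open>The eigenspaces of the squared antipode form a multiplicative grading: degrees multiply
  under products, are kept by \<open>S\<close> and inverted by \<open>st\<close>, and the counit
  vanishes outside degree 1.\<close>

definition hom :: "real \<Rightarrow> 'a \<Rightarrow> bool" where
  "hom l a \<longleftrightarrow> S (S a) = sc (of_real l) a"

section \<open>Antipode, involution and the eigenvalue grading\<close>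

lemma S_one [simp]: "S 1 = 1"
proof (rule separating)
  fix f assume f: "linear_form G f"
  have "bilinear_form G (\<lambda>x y. f (S x * y))"
    using f unfolding bilinear_iff lf_iff by (auto simp: algebra_simps scl_mult_left scl_mult_right)
  moreover have "comult G 1 = pure_tensor G 1 1"
    using hopf(2) by (simp add: comult_star_hom_def)
  moreover have "comult G 1 (\<lambda>x y. f (S x * y)) = eps 1 * f 1"
    using antipode f by (simp add: antipode_def)
  ultimately show "f (S 1) = f 1"
    by (simp add: pure_tensor_def)
qed

text \<open>By bilinearity it is enough to take coefficients of two representations, and there the
  claim is \<open>urep_S\<close> for their tensor product.\<close>

lemma S_mult: "S (a * b) = S b * S a"
proof (induction a rule: pol_induct)
  case (coeff n u i j)
  show ?case
  proof (induction b rule: pol_induct)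
    case (coeff m v k l)
    have "S ((\<lambda>(i, k) (j, l). u i j * v k l) (i, k) (j, l)) = st ((\<lambda>(i, k) (j, l). u i j * v k l) (j, l) (i, k))"
      by (rule urep_S[OF urep_tensor[OF \<open>urep G {..<n} u\<close> coeff(1)]]) (use \<open>i < n\<close> \<open>j < n\<close> coeff in auto)
    then show ?case
      using urep_S[OF \<open>urep G {..<n} u\<close>, of i j] urep_S[OF coeff(1), of k l] \<open>i < n\<close> \<open>j < n\<close> coeff by simp
  qed (simp_all add: distrib_left distrib_right scl_mult_left scl_mult_right)
qed (simp_all add: distrib_left distrib_right scl_mult_left scl_mult_right)

lemma S_st_S: "S (st (S a)) = st a"
proof (induction a rule: pol_induct)
  case (coeff n u i j)
  then show ?case
    using urep_S[OF coeff(1), of i j] urep_S[OF coeff(1), of j i] by simp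
qed simp_all

lemma eps_S [simp]: "eps (S a) = eps a"
proof (induction a rule: pol_induct)
  case (coeff n u i j)
  then show ?case
    using urep_S[OF coeff(1), of i j] urep_eps[OF coeff(1)] by auto
qed simp_all

lemma hom_one: "hom 1 1" and hom_S: "hom l a \<Longrightarrow> hom l (S a)"
  and hom_mult: "hom l a \<Longrightarrow> hom m b \<Longrightarrow> hom (l * m) (a * b)"
  by (simp_all add: hom_def S_mult scl_mult_left scl_mult_right mult.commute)

text \<open>In general \<open>S\<close> and \<open>st\<close> do not commute; on an eigenspace of
  the squared antipode the two orders differ exactly by the eigenvalue, because of
  \<open>S_st_S\<close>.\<close>

lemma hom_st_S:
  assumes "hom l a" "l > 0"
  shows "S (st a) = sc (of_real (1 / l)) (st (S a))"
proof -
  have "st (S a) = S (st (S (S a)))"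
    by (simp add: S_st_S)
  also have "\<dots> = sc (of_real l) (S (st a))"
    using assms by (simp add: hom_def)
  finally show ?thesis
    using assms(2) by simp
qed

lemma hom_st:
  assumes "hom l a" "l > 0"
  shows "hom (1 / l) (st a)"
  by (simp add: hom_def hom_st_S[OF assms] S_st_S)

lemma hom_eps: "hom l a \<Longrightarrow> l \<noteq> 1 \<Longrightarrow> eps a = 0"
proof -
  assume a: "hom l a" "l \<noteq> 1"
  have "eps a = eps (S (S a))"
    by simp
  also have "\<dots> = l * eps a"
    using a(1) by (simp add: hom_def)
  finally show ?thesis
    using a(2) by auto
qed

lemma pol_hom_induct [case_names add scl hom]:
  assumes add: "\<And>a b. P a \<Longrightarrow> P b \<Longrightarrow> P (a + b)" and scl: "\<And>c a. P a \<Longrightarrow> P (sc c a)"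
    and hom: "\<And>l a. l > 0 \<Longrightarrow> hom l a \<Longrightarrow> P a"
  shows "P a"
proof (induction a rule: pol_induct)
  case (coeff n u k l)
  obtain Q d where Q: "unitary_cmat n Q" "\<And>i. i < n \<Longrightarrow> (0::real) < d i"
    "\<And>i j. i < n \<Longrightarrow> j < n \<Longrightarrow> S (S (conj_rep n Q u i j)) = sc (of_real (d i / d j)) (conj_rep n Q u i j)"
    by (rule antipode_square_diagonal[OF coeff(1)], blast)
  have c: "P (conj_rep n Q u i j)" if "i < n" "j < n" for i j
    using that Q(2,3) by (intro hom[of "d i / d j"]) (auto simp: hom_def)
  have P0: "P 0"
    by (rule hom[of 1]) (simp_all add: hom_def)
  have Psum: "P (sum f A)" if "\<And>x. x \<in> A \<Longrightarrow> P (f x)" for f and A :: "nat set"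
    using that by (induction A rule: infinite_finite_induct) (auto intro: P0 add)
  have "u k l = (\<Sum>i<n. \<Sum>j<n. sc (Q k i * cnj (Q l j)) (conj_rep n Q u i j))"
    by (rule urep_conj_inverse[OF Q(1) coeff(2,3)]) (simp add: conj_rep_def)
  also have "P \<dots>"
    by (intro Psum scl c) auto
  finally show ?case .
qed (fact add scl)+

text \<open>The projections onto the eigenspaces, defined on a basis of homogeneous elements. An
  element of degree m involves only basis elements of degree m: its image under the squared antipode
  minus m times the element is a vanishing combination of independent vectors.\<close>

lemma components:
  obtains E :: "real \<Rightarrow> 'a \<Rightarrow> 'a" where "\<And>l a b. E l (a + b) = E l a + E l b"
    "\<And>l c a. E l (sc c a) = sc c (E l a)"
    "\<And>l m a. 0 < m \<Longrightarrow> hom m a \<Longrightarrow> E l a = (if l = m then a else 0)"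
proof -
  interpret p: vector_space_pair "scl G" "scl G"
    by unfold_locales
  let ?Hs = "{a. \<exists>l>0. hom l a}"
  obtain B where B: "B \<subseteq> ?Hs" "vs.independent B" "?Hs \<subseteq> vs.span B"
    by (rule vs.maximal_independent_subset[of ?Hs])
  define dgr where "dgr b = (SOME l. 0 < l \<and> hom l b)" for b
  have dgr: "hom (dgr b) b" if "b \<in> B" for b
  proof -
    have "\<exists>l. 0 < l \<and> hom l b"
      using that B(1) by auto
    then show ?thesis
      unfolding dgr_def by (rule someI2_ex) blast
  qed
  have "\<forall>l. \<exists>g. Vector_Spaces.linear (scl G) (scl G) g \<and> (\<forall>b\<in>B. g b = (if dgr b = l then b else 0))"
    by (rule allI) (rule p.linear_independent_extend[OF B(2)])
  from choice[OF this] obtain E where E: "\<And>l. Vector_Spaces.linear (scl G) (scl G) (E l)"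
    "\<And>l b. b \<in> B \<Longrightarrow> E l b = (if dgr b = l then b else 0)"
    by blast
  have Eadd: "E l (a + b) = E l a + E l b" and Escl: "E l (sc c a) = sc c (E l a)" for l a b c
    using E(1)[of l] by (auto simp: Vector_Spaces.linear_iff)
  have E0: "E l 0 = 0" for l
    using Eadd[of l 0 0] by simp
  have Esum: "E l (sum f A) = (\<Sum>x\<in>A. E l (f x))" for l f and A :: "'a set"
    by (induction A rule: infinite_finite_induct) (auto simp: E0 Eadd)
  have "E l a = (if l = m then a else 0)" if m: "0 < m" "hom m a" for l m a
  proof -
    have "a \<in> vs.span B"
      using m B(3) by auto
    then obtain t r where t: "finite t" "t \<subseteq> B" and a: "a = (\<Sum>b\<in>t. sc (r b) b)"
      unfolding vs.span_explicit by blast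
    have Sb: "S (S b) = sc (of_real (dgr b)) b" if "b \<in> t" for b
      using dgr t that by (auto simp: hom_def)
    have "(\<Sum>b\<in>t. sc (r b * (of_real (dgr b) - of_real m)) b) =
        (\<Sum>b\<in>t. sc (r b) (S (S b))) - (\<Sum>b\<in>t. sc (of_real m) (sc (r b) b))"
      by (simp add: Sb sum_subtractf[symmetric] right_diff_distrib vs.scale_left_diff_distrib mult.commute)
    also have "\<dots> = S (S a) - sc (of_real m) a"
      by (simp add: a S_sum scl_sum_right)
    also have "\<dots> = 0"
      using m by (simp add: hom_def)
    finally have dep: "(\<Sum>b\<in>t. sc (r b * (of_real (dgr b) - of_real m)) b) = 0" .
    have "r b * (of_real (dgr b) - of_real m) = 0" if "b \<in> t" for b
      by (rule vs.independentD[OF B(2) t dep that])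
    then have rb: "r b = 0 \<or> dgr b = m" if "b \<in> t" for b
      using that by fastforce
    have "E l a = (\<Sum>b\<in>t. sc (r b) (if dgr b = l then b else 0))"
      unfolding a Esum Escl using E(2) t by (intro sum.cong) auto
    also have "\<dots> = (\<Sum>b\<in>t. if l = m then sc (r b) b else 0)"
      using rb by (intro sum.cong) auto
    finally show ?thesis
      by (simp add: a)
  qed
  then show thesis
    using that Eadd Escl by blast
qed

text \<open>What a cocycle leaves in q(a, b) = <\<eta> a, \<eta> b>. The last identity says that
  \<open>\<pi> (st a)\<close> is the adjoint of \<open>\<pi> a\<close>, with \<pi> a (\<eta> b)
  written as \<eta> (a b) - eps b \<eta> a. The cocycle is recovered by completing
  \<open>Pol(G)\<close> for q.\<close>

definition cocycle_form :: "('a \<Rightarrow> 'a \<Rightarrow> complex) \<Rightarrow> bool" where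
  "cocycle_form q \<longleftrightarrow> semi_inner_space sc q \<and> (\<forall>a. q 1 a = 0) \<and>
     (\<forall>a b c. q (a * b) c - cnj (eps b) * q a c = q b (st a * c) - eps c * q b (st a))"

lemma hom_decomposition:
  obtains T and e :: "real \<Rightarrow> 'a" where "finite T" "\<And>l. l \<in> T \<Longrightarrow> 0 < l \<and> hom l (e l)" "a = (\<Sum>l\<in>T. e l)"
proof -
  have "\<exists>T e. finite T \<and> (\<forall>l\<in>T. 0 < l \<and> hom l (e l)) \<and> a = (\<Sum>l\<in>T. e l)"
  proof (induction a rule: pol_hom_induct)
    case (add a b)
    then obtain T e T' e' where T: "finite T" "\<forall>l\<in>T. 0 < l \<and> hom l (e l)" "a = (\<Sum>l\<in>T. e l)"
      and T': "finite T'" "\<forall>l\<in>T'. 0 < l \<and> hom l (e' l)" "b = (\<Sum>l\<in>T'. e' l)"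
      by blast
    define f where "f l = (if l \<in> T then e l else 0) + (if l \<in> T' then e' l else 0)" for l
    have "(\<Sum>l\<in>T \<union> T'. if l \<in> T then e l else 0) = (\<Sum>l\<in>T. e l)"
      "(\<Sum>l\<in>T \<union> T'. if l \<in> T' then e' l else 0) = (\<Sum>l\<in>T'. e' l)"
      using T(1) T'(1) by (auto intro!: sum.mono_neutral_cong_right)
    then have "a + b = (\<Sum>l\<in>T \<union> T'. f l)"
      by (simp add: T(3) T'(3) f_def sum.distrib)
    moreover have "\<forall>l\<in>T \<union> T'. 0 < l \<and> hom l (f l)"
      using T(2) T'(2) by (auto simp: f_def hom_def vs.scale_right_distrib)
    ultimately show ?case
      using T(1) T'(1) by blast
  next
    case (scl c a)
    then obtain T e where T: "finite T" "\<forall>l\<in>T. 0 < l \<and> hom l (e l)" "a = (\<Sum>l\<in>T. e l)"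
      by blast
    then show ?case
      by (intro exI[of _ T] exI[of _ "\<lambda>l. sc c (e l)"]) (auto simp: hom_def scl_sum_right mult.commute)
  next
    case (hom l a)
    then show ?case
      by (intro exI[of _ "{l}"] exI[of _ "\<lambda>_. a"]) auto
  qed
  then show thesis
    using that by blast
qed

lemma semi_innerI:
  assumes "\<And>x y z. q x (y + z) = q x y + q x z" "\<And>x c y. q x (sc c y) = c * q x y"
    "\<And>x y. q y x = cnj (q x y)" "\<And>x. 0 \<le> Re (q x x)"
  shows "semi_inner_space sc q"
  by unfold_locales (fact assms)+

text \<open>The pinched form sums q (E l a) (E l b) over all degrees l. For a, b, c of degrees l, m,
  k all four terms of the cocycle identity are subject to the same condition l m = k, two of them
  because the counit vanishes outside degree 1; so they survive or vanish together.\<close>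

lemma graded_form:
  assumes q: "cocycle_form q"
  obtains q' where "cocycle_form q'"
    "\<And>l m a b. 0 < l \<Longrightarrow> 0 < m \<Longrightarrow> hom l a \<Longrightarrow> hom m b \<Longrightarrow> q' a b = (if l = m then q a b else 0)"
proof -
  obtain E where Ea: "\<And>l a b. E l (a + b) = E l a + E l b" and Es: "\<And>l c a. E l (sc c a) = sc c (E l a)"
    and Eh: "\<And>l m a. 0 < m \<Longrightarrow> hom m a \<Longrightarrow> E l a = (if l = m then a else 0)"
    by (rule components, blast)
  interpret q: semi_inner_space sc q
    using q by (simp add: cocycle_form_def)
  have E0: "E l 0 = 0" for l
    using Ea[of l 0 0] by simp
  define supp where "supp a = {l. E l a \<noteq> 0}" for a
  have fin: "finite (supp a)" for a
  proof (induction a rule: pol_hom_induct)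
    case (add a b)
    then show ?case
      by (rule finite_subset[rotated, OF finite_UnI]) (auto simp: supp_def Ea)
  next
    case (scl c a)
    then show ?case
      by (rule finite_subset[rotated]) (auto simp: supp_def Es)
  next
    case (hom l a)
    then show ?case
      by (intro finite_subset[of "supp a" "{l}"]) (auto simp: supp_def Eh)
  qed
  define q' where "q' a b = (\<Sum>l\<in>supp a. q (E l a) (E l b))" for a b
  have q'T: "q' a b = (\<Sum>l\<in>T. q (E l a) (E l b))" if "finite T" "supp a \<subseteq> T" for a b T
    unfolding q'_def using that by (intro sum.mono_neutral_left) (auto simp: supp_def)
  have cnj: "q' b a = cnj (q' a b)" for a b
  proof -
    have "q' b a = (\<Sum>l\<in>supp a \<union> supp b. q (E l b) (E l a))" "q' a b = (\<Sum>l\<in>supp a \<union> supp b. q (E l a) (E l b))"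
      by (rule q'T; simp add: fin)+
    then show ?thesis
      by (simp add: q.ip_cnj[of "E l b" "E l a" for l])
  qed
  have semi: "semi_inner_space sc q'"
  proof (rule semi_innerI)
    show "q' x (y + z) = q' x y + q' x z" "q' x (sc c y) = c * q' x y" for x y z c
      by (simp_all add: q'_def Ea Es q.ip_add_right q.ip_scale_right sum.distrib sum_distrib_left)
    show "q' y x = cnj (q' x y)" for x y
      by (rule cnj)
    show "0 \<le> Re (q' x x)" for x
      unfolding q'_def Re_sum by (intro sum_nonneg q.ip_nonneg)
  qed
  interpret q': semi_inner_space sc q'
    by (rule semi)
  have hq: "q' a b = (if l = m then q a b else 0)" if "0 < l" "0 < m" "hom l a" "hom m b" for l m a b
  proof -
    have "q' a b = (\<Sum>k\<in>{l}. q (E k a) (E k b))"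
      using that by (intro q'T) (auto simp: supp_def Eh)
    then show ?thesis
      using that by (simp add: Eh)
  qed
  have q1: "q 1 c = 0" and q_id: "q (a * b) c - cnj (eps b) * q a c = q b (st a * c) - eps c * q b (st a)" for a b c
    using q by (auto simp: cocycle_form_def)
  have "q' 1 a = 0" for a
  proof (induction a rule: pol_hom_induct)
    case (hom l a)
    then show ?case
      using hq[of 1 l 1 a] hom_one q1 by simp
  qed (simp_all add: q'.ip_add_right q'.ip_scale_right)
  moreover have "q' (a * b) c - cnj (eps b) * q' a c = q' b (st a * c) - eps c * q' b (st a)" for a b c
  proof (induction a rule: pol_hom_induct)
    case a: (hom l a)
    show ?case
    proof (induction b rule: pol_hom_induct)
      case b: (hom m b)
      show ?case
      proof (induction c rule: pol_hom_induct)
        case c: (hom k c)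
        have "q' (a * b) c = (if l * m = k then q (a * b) c else 0)"
          using a b c by (intro hq hom_mult) auto
        moreover have "cnj (eps b) * q' a c = (if l * m = k then cnj (eps b) * q a c else 0)"
          using hq[OF a(1) c(1) a(2) c(2)] hom_eps[OF b(2)] by (cases "m = 1") auto
        moreover have "q' b (st a * c) = (if l * m = k then q b (st a * c) else 0)"
        proof -
          have "hom (1 / l * k) (st a * c)"
            using a c by (intro hom_mult hom_st)
          then have "q' b (st a * c) = (if m = 1 / l * k then q b (st a * c) else 0)"
            using a(1) b c(1) by (intro hq) auto
          moreover have "m = 1 / l * k \<longleftrightarrow> l * m = k"
            using a(1) by (auto simp: field_simps)
          ultimately show ?thesis
            by simp
        qed
        moreover have "eps c * q' b (st a) = (if l * m = k then eps c * q b (st a) else 0)"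
        proof (cases "k = 1")
          case True
          have "q' b (st a) = (if m = 1 / l then q b (st a) else 0)"
            using a b by (intro hq hom_st) auto
          moreover have "m = 1 / l \<longleftrightarrow> l * m = k"
            using a(1) True by (auto simp: field_simps)
          ultimately show ?thesis
            by simp
        next
          case False
          then show ?thesis
            using hom_eps[OF c(2)] by simp
        qed
        ultimately show ?case
          using q_id[of a b c] by simp
      next
        case (add c d)
        then show ?case
          by (simp add: distrib_left q'.ip_add_right algebra_simps)
      next
        case (scl k c)
        have "k * (q' (a * b) c - cnj (eps b) * q' a c) = k * (q' b (st a * c) - eps c * q' b (st a))"
          using scl by simp
        then show ?case
          by (simp add: scl_mult_right q'.ip_scale_right algebra_simps)
      qed
    next
      case (add b d)
      have "(q' (a * b) c - cnj (eps b) * q' a c) + (q' (a * d) c - cnj (eps d) * q' a c) =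
          (q' b (st a * c) - eps c * q' b (st a)) + (q' d (st a * c) - eps c * q' d (st a))"
        using add by simp
      then show ?case
        by (simp add: distrib_left q'.ip_add_left algebra_simps)
    next
      case (scl k b)
      have "cnj k * (q' (a * b) c - cnj (eps b) * q' a c) = cnj k * (q' b (st a * c) - eps c * q' b (st a))"
        using scl by simp
      then show ?case
        by (simp add: scl_mult_right q'.ip_scale_left algebra_simps)
    qed
  next
    case (add a d)
    have "(q' (a * b) c - cnj (eps b) * q' a c) + (q' (d * b) c - cnj (eps b) * q' d c) =
        (q' b (st a * c) - eps c * q' b (st a)) + (q' b (st d * c) - eps c * q' b (st d))"
      using add by simp
    then show ?case
      by (simp add: distrib_right q'.ip_add_left q'.ip_add_right algebra_simps)
  next
    case (scl k a)
    have "cnj k * (q' (a * b) c - cnj (eps b) * q' a c) = cnj k * (q' b (st a * c) - eps c * q' b (st a))"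
      using scl by simp
    then show ?case
      by (simp add: scl_mult_left q'.ip_scale_left q'.ip_scale_right algebra_simps)
  qed
  ultimately have "cocycle_form q'"
    using semi by (simp add: cocycle_form_def)
  then show thesis
    using that hq by blast
qed

section \<open>Quadratic forms of Gram matrices\<close>

lemma unitary_sum_ip:
  fixes n :: nat
  assumes q: "semi_inner_space sc q" and P: "unitary_cmat n P"
  shows "(\<Sum>k<n. q (\<Sum>i<n. sc (P k i) (x i)) (\<Sum>i<n. sc (P k i) (x i))) = (\<Sum>i<n. q (x i) (x i))"
proof -
  interpret q: semi_inner_space sc q by (rule q)
  have "(\<Sum>k<n. q (\<Sum>i<n. sc (P k i) (x i)) (\<Sum>i<n. sc (P k i) (x i))) =
      (\<Sum>k<n. \<Sum>a<n. \<Sum>c<n. dg P a k * cnj (dg P c k) * q (x a) (x c))"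
    by (simp add: q.ip_sum_left q.ip_sum_right q.ip_scale_left q.ip_scale_right dg_def sum_distrib_left mult_ac)
      (intro sum.cong refl sum.swap)
  then show ?thesis
    by (simp add: unitary_contract[OF unitary_cmat_dg[OF P]])
qed

lemma unitary_sum_norm:
  assumes P: "unitary_cmat n P"
  shows "(\<Sum>k<n. (cmod (mv n (dg P) v k))\<^sup>2) = (\<Sum>k<n. (cmod (v k))\<^sup>2)"
proof -
  have "of_real (\<Sum>k<n. (cmod (mv n (dg P) v k))\<^sup>2) =
      (\<Sum>k<n. \<Sum>a<n. \<Sum>c<n. P c k * cnj (P a k) * (v a * cnj (v c)))"
    unfolding of_real_sum complex_norm_square mv_def dg_def cnj_sum sum_product
    by (simp add: mult_ac)
  also have "\<dots> = (\<Sum>k<n. \<Sum>c<n. \<Sum>a<n. P c k * cnj (P a k) * (v a * cnj (v c)))"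
    by (rule sum.cong[OF refl], rule sum.swap)
  also have "\<dots> = (\<Sum>a<n. v a * cnj (v a))"
    by (rule unitary_contract[OF P])
  also have "\<dots> = of_real (\<Sum>k<n. (cmod (v k))\<^sup>2)"
    by (simp only: of_real_sum complex_norm_square)
  finally show ?thesis
    by (simp only: of_real_eq_iff)
qed

text \<open>If q is the form of a cocycle \<eta>, this is the quadratic form at v of the matrix
  whose entries are the sums \<open>\<Sum>k<n. q (u k i) (u k j)\<close>.\<close>

definition gram_norm :: "('a \<Rightarrow> 'a \<Rightarrow> complex) \<Rightarrow> nat \<Rightarrow> (nat \<Rightarrow> nat \<Rightarrow> 'a) \<Rightarrow> (nat \<Rightarrow> complex) \<Rightarrow> complex" where
  "gram_norm q n u v = (\<Sum>k<n. q (\<Sum>j<n. sc (v j) (u k j)) (\<Sum>j<n. sc (v j) (u k j)))"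

text \<open>A unitary change of basis on the left preserves the sum of squared lengths over the
  rows; on the right it only moves v.\<close>

lemma gram_norm_conj:
  assumes q: "semi_inner_space sc q" and P: "unitary_cmat n P"
  shows "gram_norm q n u v = gram_norm q n (conj_rep n P u) (mv n (dg P) v)"
proof -
  have "(\<Sum>j<n. sc (v j) (u k j)) =
      (\<Sum>i<n. sc (P k i) (\<Sum>j<n. sc (mv n (dg P) v j) (conj_rep n P u i j)))" if k: "k < n" for k
  proof -
    have "(\<Sum>j<n. sc (v j) (u k j)) = (\<Sum>l<n. \<Sum>i<n. \<Sum>j<n. sc (v l * (P k i * cnj (P l j))) (conj_rep n P u i j))"
    proof (rule sum.cong[OF refl])
      fix l assume "l \<in> {..<n}"
      then have ul: "u k l = (\<Sum>i<n. \<Sum>j<n. sc (P k i * cnj (P l j)) (conj_rep n P u i j))"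
        by (intro urep_conj_inverse[OF P k]) (simp_all add: conj_rep_def)
      show "sc (v l) (u k l) = (\<Sum>i<n. \<Sum>j<n. sc (v l * (P k i * cnj (P l j))) (conj_rep n P u i j))"
        by (simp only: ul scl_sum_right vs.scale_scale)
    qed
    also have "\<dots> = (\<Sum>i<n. \<Sum>j<n. sc (\<Sum>l<n. v l * (P k i * cnj (P l j))) (conj_rep n P u i j))"
      unfolding scl_sum_left by (subst sum.swap, rule sum.cong[OF refl], rule sum.swap)
    also have "\<dots> = (\<Sum>i<n. \<Sum>j<n. sc (P k i * mv n (dg P) v j) (conj_rep n P u i j))"
      by (simp add: mv_def dg_def sum_distrib_left mult_ac)
    finally show ?thesis
      by (simp add: scl_sum_right)
  qed
  then have "gram_norm q n u v = (\<Sum>k<n. q (\<Sum>i<n. sc (P k i) (\<Sum>j<n. sc (mv n (dg P) v j) (conj_rep n P u i j)))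
      (\<Sum>i<n. sc (P k i) (\<Sum>j<n. sc (mv n (dg P) v j) (conj_rep n P u i j))))"
    by (simp add: gram_norm_def)
  also have "\<dots> = gram_norm q n (conj_rep n P u) (mv n (dg P) v)"
    unfolding gram_norm_def by (rule unitary_sum_ip[OF q P])
  finally show ?thesis .
qed

text \<open>In a basis diagonalizing the square of the antipode, passing to the graded form pinches the
  Gram matrix to its diagonal blocks; this preserves lower bounds.\<close>

lemma graded_gram_bound:
  fixes n :: nat
  assumes q: "semi_inner_space sc q" and q': "semi_inner_space sc q'"
    and hq: "\<And>l m a b. 0 < l \<Longrightarrow> 0 < m \<Longrightarrow> hom l a \<Longrightarrow> hom m b \<Longrightarrow> q' a b = (if l = m then q a b else 0)"
    and u: "urep G {..<n} u"
    and bound: "\<And>v. M * (\<Sum>j<n. (cmod (v j))\<^sup>2) \<le> Re (gram_norm q n u v)"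
  shows "M * (\<Sum>j<n. (cmod (v j))\<^sup>2) \<le> Re (gram_norm q' n u v)"
proof -
  interpret q: semi_inner_space sc q by (rule q)
  interpret q': semi_inner_space sc q' by (rule q')
  obtain P d where P: "unitary_cmat n P" and d: "\<And>i. i < n \<Longrightarrow> (0::real) < d i"
    "\<And>i j. i < n \<Longrightarrow> j < n \<Longrightarrow> S (S (conj_rep n P u i j)) = sc (of_real (d i / d j)) (conj_rep n P u i j)"
    by (rule antipode_square_diagonal[OF u], blast)
  define U where "U = conj_rep n P u"
  define w where "w = mv n (dg P) v"
  have hU: "hom (d i / d j) (U i j)" if "i < n" "j < n" for i j
    using d that by (simp add: hom_def U_def)
  have boundU: "M * (\<Sum>j<n. (cmod (x j))\<^sup>2) \<le> Re (gram_norm q n U x)" for x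
  proof -
    have eq: "mv n (dg P) (mv n P x) k = x k" if "k < n" for k
      unfolding mv_mv using P that by (intro mv_one) (auto simp: unitary_cmat_iff)
    have "gram_norm q n u (mv n P x) = gram_norm q n U (mv n (dg P) (mv n P x))"
      unfolding U_def by (rule gram_norm_conj[OF q P])
    also have "\<dots> = gram_norm q n U x"
      by (simp add: gram_norm_def eq)
    moreover have "(\<Sum>j<n. (cmod (mv n P x j))\<^sup>2) = (\<Sum>j<n. (cmod (x j))\<^sup>2)"
      using unitary_sum_norm[OF P, of "mv n P x"] by (simp add: eq)
    ultimately show ?thesis
      using bound[of "mv n P x"] by simp
  qed
  \<comment> \<open>The entry in row k and column j has degree \<open>d k / d j\<close>, so in a
    fixed row two columns have equal degree exactly when their values of d agree. Splitting w by the
    values of d therefore accounts for all products that the pinching keeps.\<close>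
  define D where "D = d ` {..<n}"
  define wd where "wd \<delta> j = (if d j = \<delta> then w j else 0)" for \<delta> j
  have part: "(\<Sum>\<delta>\<in>D. if d j = \<delta> then f j else 0) = f j" if "j < n" for j and f :: "nat \<Rightarrow> complex"
    using that by (simp add: D_def)
  have qe: "q (\<Sum>j<n. sc (x j) (U k j)) (\<Sum>j<n. sc (x j) (U k j)) =
      (\<Sum>j<n. \<Sum>l<n. cnj (x j) * x l * q (U k j) (U k l))" for x k
    by (simp add: q.ip_sum_left q.ip_sum_right q.ip_scale_left q.ip_scale_right sum_distrib_left mult_ac)
      (rule sum.swap)
  have q'e: "q' (\<Sum>j<n. sc (x j) (U k j)) (\<Sum>j<n. sc (x j) (U k j)) =
      (\<Sum>j<n. \<Sum>l<n. cnj (x j) * x l * q' (U k j) (U k l))" for x k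
    by (simp add: q'.ip_sum_left q'.ip_sum_right q'.ip_scale_left q'.ip_scale_right sum_distrib_left mult_ac)
      (rule sum.swap)
  have "gram_norm q' n U w = (\<Sum>\<delta>\<in>D. gram_norm q n U (wd \<delta>))"
  proof -
    have "(\<Sum>\<delta>\<in>D. gram_norm q n U (wd \<delta>)) =
        (\<Sum>\<delta>\<in>D. \<Sum>k<n. \<Sum>j<n. \<Sum>l<n. cnj (wd \<delta> j) * wd \<delta> l * q (U k j) (U k l))"
      by (simp add: gram_norm_def qe)
    also have "\<dots> = (\<Sum>k<n. \<Sum>j<n. \<Sum>l<n. \<Sum>\<delta>\<in>D. cnj (wd \<delta> j) * wd \<delta> l * q (U k j) (U k l))"
      by (subst sum.swap, rule sum.cong[OF refl], subst sum.swap, rule sum.cong[OF refl], rule sum.swap)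
    also have "\<dots> = (\<Sum>k<n. \<Sum>j<n. \<Sum>l<n. cnj (w j) * w l * q' (U k j) (U k l))"
    proof (intro sum.cong[OF refl])
      fix k j l assume kjl: "k \<in> {..<n}" "j \<in> {..<n}" "l \<in> {..<n}"
      have "(\<Sum>\<delta>\<in>D. cnj (wd \<delta> j) * wd \<delta> l * q (U k j) (U k l)) =
          (\<Sum>\<delta>\<in>D. if d j = \<delta> then (if d l = d j then cnj (w j) * w l * q (U k j) (U k l) else 0) else 0)"
        by (intro sum.cong) (auto simp: wd_def)
      also have "\<dots> = (if d l = d j then cnj (w j) * w l * q (U k j) (U k l) else 0)"
        using part[of j "\<lambda>j. if d l = d j then cnj (w j) * w l * q (U k j) (U k l) else 0"] kjl by simp
      also have "\<dots> = cnj (w j) * w l * q' (U k j) (U k l)"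
      proof -
        have "q' (U k j) (U k l) = (if d k / d j = d k / d l then q (U k j) (U k l) else 0)"
          using kjl d(1) by (intro hq hU divide_pos_pos) auto
        moreover have "d k / d j = d k / d l \<longleftrightarrow> d l = d j"
          using kjl d(1)[of k] d(1)[of j] d(1)[of l] by (auto simp: field_simps)
        ultimately show ?thesis
          by auto
      qed
      finally show "(\<Sum>\<delta>\<in>D. cnj (wd \<delta> j) * wd \<delta> l * q (U k j) (U k l)) = cnj (w j) * w l * q' (U k j) (U k l)" .
    qed
    finally show ?thesis
      by (simp add: gram_norm_def q'e)
  qed
  then have "Re (gram_norm q' n u v) = (\<Sum>\<delta>\<in>D. Re (gram_norm q n U (wd \<delta>)))"
    using gram_norm_conj[OF q' P, of u v] by (simp add: U_def w_def)
  moreover have "(\<Sum>\<delta>\<in>D. M * (\<Sum>j<n. (cmod (wd \<delta> j))\<^sup>2)) \<le> (\<Sum>\<delta>\<in>D. Re (gram_norm q n U (wd \<delta>)))"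
    by (intro sum_mono boundU)
  moreover have "(\<Sum>\<delta>\<in>D. M * (\<Sum>j<n. (cmod (wd \<delta> j))\<^sup>2)) = M * (\<Sum>j<n. (cmod (v j))\<^sup>2)"
  proof -
    have "(\<Sum>\<delta>\<in>D. \<Sum>j<n. (cmod (wd \<delta> j))\<^sup>2) = (\<Sum>j<n. \<Sum>\<delta>\<in>D. if d j = \<delta> then (cmod (w j))\<^sup>2 else 0)"
      by (subst sum.swap) (intro sum.cong refl, auto simp: wd_def)
    also have "\<dots> = (\<Sum>j<n. (cmod (w j))\<^sup>2)"
      by (intro sum.cong refl) (simp add: D_def)
    finally show ?thesis
      using unitary_sum_norm[OF P, of v] by (simp add: w_def flip: sum_distrib_left)
  qed
  ultimately show ?thesis
    by simp
qed

text \<open>The Gram matrix entries of all representations assembled into one linear functional: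
  \<open>st (S (u i k)) = u k i\<close> turns the value at \<open>u i j\<close> into
  \<open>\<Sum>k\<in>I. q (u k i) (u k j)\<close>.\<close>

definition energy :: "('a \<Rightarrow> 'a \<Rightarrow> complex) \<Rightarrow> 'a \<Rightarrow> complex" where
  "energy q a = comult G a (\<lambda>x y. q (st (S x)) y)"

lemma energy_urep:
  assumes q: "semi_inner_space sc q" and u: "urep G I u" and ij: "i \<in> I" "j \<in> I"
  shows "energy q (u i j) = (\<Sum>k\<in>I. q (u k i) (u k j))"
proof -
  interpret q: semi_inner_space sc q by (rule q)
  have "bilinear_form G (\<lambda>x y. q (st (S x)) y)"
    unfolding bilinear_iff by (simp add: q.ip_add_left q.ip_add_right q.ip_scale_left q.ip_scale_right)
  then show ?thesis
    using corep_comult[OF urep_corep[OF u] ij] urep_S[OF u] ij by (simp add: energy_def)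
qed

lemma energy_add: "energy q (a + b) = energy q a + energy q b"
  and energy_scl: "energy q (sc c a) = c * energy q a"
  by (simp_all add: energy_def comult_add comult_scl)

text \<open>Computed on a tensor product of two representations from the cocycle identity and
  unitarity. The defect from an \<epsilon>-derivation consists of q and of its reflection under the
  antipode; the sign of the reflected term is what the grading controls.\<close>

lemma energy_mult:
  assumes q: "cocycle_form q"
  shows "energy q (a * b) = eps a * energy q b + energy q a * eps b - q (st a) b - q (st (S b)) (S a)"
proof -
  have q0: "semi_inner_space sc q" and q1: "q 1 c = 0"
    and q_id: "q (a * b) c - cnj (eps b) * q a c = q b (st a * c) - eps c * q b (st a)" for a b c
    using q by (auto simp: cocycle_form_def)
  interpret q: semi_inner_space sc q by (rule q0)
  show ?thesis
  proof (induction a rule: pol_induct)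
    case u: (coeff n u i j)
    show ?case
    proof (induction b rule: pol_induct)
      case v: (coeff m v k l)
      have "energy q (u i j * v k l) = (\<Sum>(p, r)\<in>{..<n} \<times> {..<m}. q (u p i * v r k) (u p j * v r l))"
        using energy_urep[OF q0 urep_tensor[OF u(1) v(1)], of "(i, k)" "(j, l)"] u v
        by (simp add: case_prod_unfold)
      also have "\<dots> = (\<Sum>p<n. \<Sum>r<m. q (u p i * v r k) (u p j * v r l))"
        by (simp add: sum.cartesian_product)
      also have "\<dots> = (\<Sum>p<n. \<Sum>r<m. of_bool (r = k) * q (u p i) (u p j * v r l)
          + q (v r k) (st (u p i) * u p j * v r l) - of_bool (p = j) * (of_bool (r = l) * q (v r k) (st (u p i))))"
      proof (intro sum.cong[OF refl])
        fix p r assume "p \<in> {..<n}" "r \<in> {..<m}"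
        then have "eps (v r k) = of_bool (r = k)" "eps (u p j * v r l) = of_bool (p = j) * of_bool (r = l)"
          using urep_eps[OF u(1)] urep_eps[OF v(1)] u v by auto
        then show "q (u p i * v r k) (u p j * v r l) = of_bool (r = k) * q (u p i) (u p j * v r l)
          + q (v r k) (st (u p i) * u p j * v r l) - of_bool (p = j) * (of_bool (r = l) * q (v r k) (st (u p i)))"
          using q_id[of "u p i" "v r k" "u p j * v r l"] by (simp add: mult.assoc algebra_simps)
      qed
      also have "\<dots> = (\<Sum>p<n. q (u p i) (u p j * v k l)) + (\<Sum>r<m. q (v r k) ((\<Sum>p<n. st (u p i) * u p j) * v r l))
          - q (v l k) (st (u j i))"
      proof -
        have "(\<Sum>p<n. \<Sum>r<m. q (v r k) (st (u p i) * u p j * v r l)) =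
            (\<Sum>r<m. q (v r k) ((\<Sum>p<n. st (u p i) * u p j) * v r l))"
          by (subst sum.swap) (simp add: sum_distrib_right q.ip_sum_right)
        then show ?thesis
          using u v by (simp add: sum.distrib sum_subtractf flip: sum_distrib_left)
      qed
      also have "(\<Sum>r<m. q (v r k) ((\<Sum>p<n. st (u p i) * u p j) * v r l)) = eps (u i j) * energy q (v k l)"
        using urep_left[OF u(1), of i j] urep_eps[OF u(1), of i j] energy_urep[OF q0 v(1), of k l] u v
        by (cases "i = j") auto
      also have "(\<Sum>p<n. q (u p i) (u p j * v k l)) = energy q (u i j) * eps (v k l) - q (st (u i j)) (v k l)"
      proof -
        have "(\<Sum>p<n. q (u p i) (u p j * v k l)) =
            (\<Sum>p<n. q (st (u p j) * u p i) (v k l) - of_bool (p = i) * q (st (u p j)) (v k l) + eps (v k l) * q (u p i) (u p j))"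
        proof (rule sum.cong[OF refl])
          fix p assume "p \<in> {..<n}"
          then have "eps (u p i) = of_bool (p = i)"
            using urep_eps[OF u(1)] u by auto
          then show "q (u p i) (u p j * v k l) =
              q (st (u p j) * u p i) (v k l) - of_bool (p = i) * q (st (u p j)) (v k l) + eps (v k l) * q (u p i) (u p j)"
            using q_id[of "st (u p j)" "u p i" "v k l"] by (simp add: algebra_simps)
        qed
        also have "\<dots> = q (\<Sum>p<n. st (u p j) * u p i) (v k l) - q (st (u i j)) (v k l)
            + eps (v k l) * (\<Sum>p<n. q (u p i) (u p j))"
          using u by (simp add: sum.distrib sum_subtractf q.ip_sum_left sum_distrib_left)
        also have "(\<Sum>p<n. q (u p i) (u p j)) = energy q (u i j)"
          using energy_urep[OF q0 u(1), of i j] u by simp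
        also have "q (\<Sum>p<n. st (u p j) * u p i) (v k l) = 0"
          using urep_left[OF u(1), of j i] u q1 by (cases "j = i") auto
        finally show ?thesis
          by simp
      qed
      also have "q (v l k) (st (u j i)) = q (st (S (v k l))) (S (u i j))"
        using urep_S[OF u(1), of i j] urep_S[OF v(1), of k l] u v by simp
      finally show ?case
        by simp
    qed (simp_all add: distrib_left scl_mult_right energy_add energy_scl
        q.ip_add_left q.ip_add_right q.ip_scale_left q.ip_scale_right, (simp add: algebra_simps)+)
  qed (simp_all add: distrib_right scl_mult_left energy_add energy_scl
      q.ip_add_left q.ip_add_right q.ip_scale_left q.ip_scale_right, (simp add: algebra_simps)+)
qed

text \<open>On a graded form the sesquilinear form \<open>q (S(b)\<^sup>*) (S(a\<^sup>*))\<close> is positive because \<open>S(a\<^sup>*)\<close> is a positive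
  multiple of \<open>S(a)\<^sup>*\<close> for homogeneous \<open>a\<close>. Without grading this fails, and the cocycle need not admit a
  generating functional.\<close>

lemma generating_functional:
  assumes q: "cocycle_form q"
    and hq: "\<And>l m a b. 0 < l \<Longrightarrow> 0 < m \<Longrightarrow> hom l a \<Longrightarrow> hom m b \<Longrightarrow> l \<noteq> m \<Longrightarrow> q a b = 0"
  obtains L Q where "linear_form G L" "L 1 = 0" "\<And>a. L (st a) = cnj (L a)"
    "semi_inner_space sc Q" "\<And>a. Re (q a a) \<le> 2 * Re (Q a a)"
    "\<And>a b. L (st a * b) = cnj (eps a) * L b + cnj (L a) * eps b + Q a b"
proof -
  have q0: "semi_inner_space sc q" and q1: "q 1 a = 0" for a
    using q by (auto simp: cocycle_form_def)
  interpret q: semi_inner_space sc q by (rule q0)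
  define r where "r a b = q (st (S b)) (S (st a))" for a b
  have r_hom: "r a b = of_real (1 / l) * q (st (S b)) (st (S a))" if "l > 0" "hom l a" for l a b
    using that by (simp add: r_def hom_st_S q.ip_scale_right)
  have r_bil: "r (a + b) c = r a c + r b c" "r (sc k a) c = cnj k * r a c"
    "r c (a + b) = r c a + r c b" "r c (sc k a) = k * r c a" for a b c k
    by (simp_all add: r_def q.ip_add_left q.ip_add_right q.ip_scale_left q.ip_scale_right)
  have r_diag: "r a b = 0" if "l > 0" "m > 0" "hom l a" "hom m b" "l \<noteq> m" for l m a b
  proof -
    have "hom (1 / m) (st (S b))" "hom (1 / l) (st (S a))"
      using that by (auto intro: hom_st hom_S)
    then have "q (st (S b)) (st (S a)) = 0"
      using that by (intro hq[of "1 / m" "1 / l"]) auto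
    then show ?thesis
      using r_hom[OF that(1,3)] by simp
  qed
  have r_cnj: "r b a = cnj (r a b)" for a b
  proof (induction a rule: pol_hom_induct)
    case a: (hom l a)
    show ?case
    proof (induction b rule: pol_hom_induct)
      case b: (hom m b)
      show ?case
      proof (cases "l = m")
        case True
        then show ?thesis
          using r_hom[OF a, of b] r_hom[OF b, of a] q.ip_cnj[of "st (S a)" "st (S b)"] by simp
      next
        case False
        then show ?thesis
          using r_diag[OF a(1) b(1) a(2) b(2)] r_diag[OF b(1) a(1) b(2) a(2)] by simp
      qed
    qed (simp_all add: r_bil)
  qed (simp_all add: r_bil)
  have r_nonneg: "0 \<le> Re (r a a)" for a
  proof -
    obtain T and e :: "real \<Rightarrow> 'a" where T: "finite T" "\<And>l. l \<in> T \<Longrightarrow> 0 < l \<and> hom l (e l)" "a = (\<Sum>l\<in>T. e l)"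
      by (rule hom_decomposition[of a], blast)
    have r0: "r 0 b = 0" "r b 0 = 0" for b
      by (simp_all add: r_def)
    have rs: "r (\<Sum>l\<in>T. e l) b = (\<Sum>l\<in>T. r (e l) b)" "r b (\<Sum>l\<in>T. e l) = (\<Sum>l\<in>T. r b (e l))" for b
      using T(1) by (induction T rule: finite_induct) (simp_all add: r_bil r0)
    have "r a a = (\<Sum>l\<in>T. \<Sum>m\<in>T. r (e l) (e m))"
      by (simp only: T(3) rs) (rule sum.swap)
    also have "\<dots> = (\<Sum>l\<in>T. \<Sum>m\<in>T. if m = l then r (e l) (e l) else 0)"
    proof (intro sum.cong refl)
      fix l m assume "l \<in> T" "m \<in> T"
      then show "r (e l) (e m) = (if m = l then r (e l) (e l) else 0)"
        using r_diag[of l m "e l" "e m"] T(2) by auto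
    qed
    also have "\<dots> = (\<Sum>l\<in>T. r (e l) (e l))"
      using T(1) by simp
    finally have "Re (r a a) = (\<Sum>l\<in>T. Re (r (e l) (e l)))"
      by simp
    also have "\<dots> \<ge> 0"
    proof (intro sum_nonneg)
      fix l assume "l \<in> T"
      then have l: "0 < l" "hom l (e l)"
        using T(2) by auto
      have "Re (r (e l) (e l)) = 1 / l * Re (q (st (S (e l))) (st (S (e l))))"
        unfolding r_hom[OF l] by (simp del: of_real_divide)
      then show "0 \<le> Re (r (e l) (e l))"
        using l(1) q.ip_nonneg by simp
    qed
    finally show ?thesis .
  qed
  \<comment> \<open>The energy and its adjoint functional each contribute -(q + r) to the
    coboundary, so dividing by -4 leaves (q + r) / 2, and r \<ge> 0 yields q \<le> 2 Q on the
    diagonal. The averaging makes L hermitian.\<close>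
  define L where "L a = - (energy q a + cnj (energy q (st a))) / 4" for a
  define Q where "Q a b = (q a b + r a b) / 2" for a b
  have sym: "q (st (S b)) (S a) = cnj (q (st (S (st a))) (S (st b)))" for a b
    using r_cnj[of b "st a"] q.ip_cnj[of "S (st b)" "st (S (st a))"] by (simp add: r_def)
  show thesis
  proof (rule that[of L Q])
    show "linear_form G L"
      by (simp add: lf_iff L_def energy_add energy_scl algebra_simps add_divide_distrib diff_divide_distrib)
    show "L 1 = 0"
      using energy_mult[OF q, of 1 1] q1 by (simp add: L_def)
    show "L (st a) = cnj (L a)" for a
      by (simp add: L_def algebra_simps)
    show "semi_inner_space sc Q"
    proof (rule semi_innerI)
      show "Q y x = cnj (Q x y)" for x y
        using q.ip_cnj[of y x] r_cnj[of y x] by (simp add: Q_def)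
      show "0 \<le> Re (Q x x)" for x
        using q.ip_nonneg[of x] r_nonneg[of x] by (simp add: Q_def)
    qed (simp_all add: Q_def r_bil q.ip_add_right q.ip_scale_right add_divide_distrib algebra_simps)
    show "Re (q a a) \<le> 2 * Re (Q a a)" for a
      using r_nonneg[of a] by (simp add: Q_def)
    show "L (st a * b) = cnj (eps a) * L b + cnj (L a) * eps b + Q a b" for a b
    proof -
      have 1: "energy q (st a * b) = cnj (eps a) * energy q b + energy q (st a) * eps b - q a b - r a b"
        using energy_mult[OF q, of "st a" b] by (simp add: r_def)
      have 2: "energy q (st b * a) = cnj (eps b) * energy q a + energy q (st b) * eps a - q b a - r b a"
        using energy_mult[OF q, of "st b" a] by (simp add: r_def)
      have 3: "cnj (energy q (st b * a)) = eps b * cnj (energy q a) + cnj (energy q (st b)) * cnj (eps a) - q a b - r a b"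
        unfolding 2 using q.ip_cnj[of a b] r_cnj[of a b] by simp
      have "L (st a * b) = - (energy q (st a * b) + cnj (energy q (st b * a))) / 4"
        by (simp only: L_def st_mult st_st)
      also have "\<dots> = cnj (eps a) * L b + cnj (L a) * eps b + Q a b"
        unfolding 1 3 by (simp add: L_def Q_def field_simps)
      finally show ?thesis .
    qed
  qed
qed

end

section \<open>Exponentials of matrices over a finite index set\<close>

primrec mpow :: "'i set \<Rightarrow> ('i \<Rightarrow> 'i \<Rightarrow> complex) \<Rightarrow> nat \<Rightarrow> 'i \<Rightarrow> 'i \<Rightarrow> complex" where
  "mpow I A 0 = (\<lambda>i j. of_bool (i = j))"
| "mpow I A (Suc k) = (\<lambda>i j. \<Sum>l\<in>I. mpow I A k i l * A l j)"

definition mexp :: "'i set \<Rightarrow> ('i \<Rightarrow> 'i \<Rightarrow> complex) \<Rightarrow> 'i \<Rightarrow> 'i \<Rightarrow> complex" where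
  "mexp I A i j = (\<Sum>k. mpow I A k i j / fact k)"

lemma mpow_bound:
  assumes "finite I" "\<And>i j. i \<in> I \<Longrightarrow> j \<in> I \<Longrightarrow> cmod (A i j) \<le> d" "0 \<le> d" "j \<in> I"
  shows "cmod (mpow I A k i j) \<le> (real (card I) * d) ^ k"
  using assms(4)
proof (induction k arbitrary: j)
  case (Suc k)
  have "cmod (mpow I A (Suc k) i j) \<le> (\<Sum>l\<in>I. cmod (mpow I A k i l) * cmod (A l j))"
    by (simp add: norm_mult[symmetric] norm_sum)
  also have "\<dots> \<le> (\<Sum>l\<in>I. (real (card I) * d) ^ k * d)"
    using assms Suc by (intro sum_mono mult_mono) auto
  also have "\<dots> = (real (card I) * d) ^ Suc k"
    by (simp add: algebra_simps)
  finally show ?case .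
qed auto

lemma matrix_entries_bounded:
  fixes A :: "'i \<Rightarrow> 'i \<Rightarrow> complex"
  assumes "finite I" obtains d where "0 \<le> d" "\<And>i j. i \<in> I \<Longrightarrow> j \<in> I \<Longrightarrow> cmod (A i j) \<le> d"
proof
  show "0 \<le> (\<Sum>i\<in>I. \<Sum>j\<in>I. cmod (A i j))"
    by (intro sum_nonneg) auto
  fix i j assume ij: "i \<in> I" "j \<in> I"
  have "cmod (A i j) \<le> (\<Sum>j\<in>I. cmod (A i j))"
    using assms ij by (intro member_le_sum) auto
  also have "\<dots> \<le> (\<Sum>i\<in>I. \<Sum>j\<in>I. cmod (A i j))"
    using assms ij by (intro member_le_sum[of i I "\<lambda>i. \<Sum>j\<in>I. cmod (A i j)"]) (auto intro: sum_nonneg)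
  finally show "cmod (A i j) \<le> (\<Sum>i\<in>I. \<Sum>j\<in>I. cmod (A i j))" .
qed

lemma summable_power_fact: "summable (\<lambda>k. x ^ k / fact k :: real)"
  using summable_exp[of x] by (simp add: field_simps inverse_eq_divide)

lemma mexp_summable:
  assumes "finite I" "j \<in> I"
  shows "summable (\<lambda>k. cmod (mpow I A k i j / fact k))"
proof -
  obtain d where d: "0 \<le> d" "\<And>i j. i \<in> I \<Longrightarrow> j \<in> I \<Longrightarrow> cmod (A i j) \<le> d"
    by (rule matrix_entries_bounded[OF assms(1), where A = A], blast)
  show ?thesis
  proof (rule summable_comparison_test'[OF summable_power_fact])
    fix k :: nat
    show "norm (cmod (mpow I A k i j / fact k)) \<le> (real (card I) * d) ^ k / fact k"
      using mpow_bound[OF assms(1) d(2,1) assms(2), where k = k and i = i] by (simp add: norm_divide divide_right_mono)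
  qed
qed

lemma mexp_sums:
  assumes "finite I" "j \<in> I"
  shows "(\<lambda>k. mpow I A k i j / fact k) sums mexp I A i j"
  unfolding mexp_def by (rule summable_sums[OF summable_norm_cancel[OF mexp_summable[OF assms]]])

lemma binomial_shift:
  fixes X :: "nat \<Rightarrow> complex"
  shows "(\<Sum>m\<le>k. of_nat (k choose m) * c ^ (k - m) * (X (Suc m) + c * X m)) =
    (\<Sum>m\<le>Suc k. of_nat (Suc k choose m) * c ^ (Suc k - m) * X m)"
proof -
  have 1: "(\<Sum>m\<le>k. of_nat (k choose m) * c ^ (k - m) * (c * X m)) =
      c ^ Suc k * X 0 + (\<Sum>m\<le>k. of_nat (k choose Suc m) * c ^ (k - m) * X (Suc m))"
  proof -
    have "(\<Sum>m\<le>k. of_nat (k choose m) * c ^ (k - m) * (c * X m)) =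
        (\<Sum>m\<le>k. of_nat (k choose m) * c ^ (Suc k - m) * X m)"
      by (intro sum.cong) (auto simp: Suc_diff_le)
    also have "\<dots> = (\<Sum>m\<le>Suc k. of_nat (k choose m) * c ^ (Suc k - m) * X m)"
      by simp
    also have "\<dots> = c ^ Suc k * X 0 + (\<Sum>m\<le>k. of_nat (k choose Suc m) * c ^ (k - m) * X (Suc m))"
      by (subst sum.atMost_Suc_shift) simp
    finally show ?thesis .
  qed
  have "(\<Sum>m\<le>Suc k. of_nat (Suc k choose m) * c ^ (Suc k - m) * X m) =
      c ^ Suc k * X 0 + (\<Sum>m\<le>k. of_nat (Suc k choose Suc m) * c ^ (k - m) * X (Suc m))"
    by (subst sum.atMost_Suc_shift) simp
  also have "(\<Sum>m\<le>k. of_nat (Suc k choose Suc m) * c ^ (k - m) * X (Suc m)) =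
      (\<Sum>m\<le>k. of_nat (k choose m) * c ^ (k - m) * X (Suc m)) +
      (\<Sum>m\<le>k. of_nat (k choose Suc m) * c ^ (k - m) * X (Suc m))"
    by (simp only: binomial_Suc_Suc of_nat_add distrib_right sum.distrib)
  finally show ?thesis
    unfolding distrib_left sum.distrib 1 by simp
qed

lemma mpow_shift:
  assumes "finite I" "j \<in> I"
  shows "mpow I (\<lambda>i j. A i j + c * of_bool (i = j)) k i j =
    (\<Sum>m\<le>k. of_nat (k choose m) * c ^ (k - m) * mpow I A m i j)"
  using assms(2)
proof (induction k arbitrary: j)
  case (Suc k)
  let ?X = "\<lambda>m. mpow I A m i j"
  have "mpow I (\<lambda>i j. A i j + c * of_bool (i = j)) (Suc k) i j =
      (\<Sum>l\<in>I. (\<Sum>m\<le>k. of_nat (k choose m) * c ^ (k - m) * mpow I A m i l) * (A l j + c * of_bool (l = j)))"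
    using Suc by simp
  also have "\<dots> = (\<Sum>m\<le>k. of_nat (k choose m) * c ^ (k - m) *
      (\<Sum>l\<in>I. mpow I A m i l * (A l j + c * of_bool (l = j))))"
    by (simp add: sum_distrib_left sum_distrib_right mult.assoc) (rule sum.swap)
  also have "\<dots> = (\<Sum>m\<le>k. of_nat (k choose m) * c ^ (k - m) * (?X (Suc m) + c * ?X m))"
  proof (rule sum.cong[OF refl])
    fix m
    have "(\<Sum>l\<in>I. mpow I A m i l * (A l j + c * of_bool (l = j))) =
        (\<Sum>l\<in>I. mpow I A m i l * A l j) + (\<Sum>l\<in>I. if l = j then c * mpow I A m i l else 0)"
      unfolding sum.distrib[symmetric] by (intro sum.cong) (auto simp: algebra_simps)
    then show "of_nat (k choose m) * c ^ (k - m) * (\<Sum>l\<in>I. mpow I A m i l * (A l j + c * of_bool (l = j))) =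
        of_nat (k choose m) * c ^ (k - m) * (?X (Suc m) + c * ?X m)"
      using assms(1) Suc.prems by simp
  qed
  also have "\<dots> = (\<Sum>m\<le>Suc k. of_nat (Suc k choose m) * c ^ (Suc k - m) * ?X m)"
    by (rule binomial_shift)
  finally show ?case .
qed auto

text \<open>A scalar matrix commutes with everything, so the exponential splits as a Cauchy product.
  Shifts by a large scalar serve twice: they turn dissipativity into a norm bound and conditional
  positivity into complete positivity.\<close>

lemma mexp_shift:
  assumes I: "finite I" "j \<in> I"
  shows "mexp I (\<lambda>i j. A i j + c * of_bool (i = j)) i j = exp c * mexp I A i j"
proof -
  let ?a = "\<lambda>k. mpow I A k i j / fact k" and ?b = "\<lambda>k. c ^ k / fact k :: complex"
  have b: "summable (\<lambda>k. norm (?b k))"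
    using summable_power_fact[of "cmod c"] by (simp add: norm_divide norm_power)
  have "(\<lambda>k. \<Sum>m\<le>k. ?a m * ?b (k - m)) sums (suminf ?a * suminf ?b)"
    by (rule Cauchy_product_sums[OF _ b]) (use mexp_summable[OF I] in auto)
  moreover have "(\<Sum>m\<le>k. ?a m * ?b (k - m)) = mpow I (\<lambda>i j. A i j + c * of_bool (i = j)) k i j / fact k" for k
    unfolding mpow_shift[OF I] sum_divide_distrib
    by (intro sum.cong) (auto simp: binomial_fact field_simps)
  moreover have "suminf ?b = exp c"
    by (simp add: exp_def scaleR_conv_of_real field_simps)
  ultimately show ?thesis
    unfolding mexp_def by (simp add: sums_iff mult.commute)
qed

section \<open>Contraction estimates for exponentials\<close>

definition n2 :: "'i set \<Rightarrow> ('i \<Rightarrow> complex) \<Rightarrow> real" where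
  "n2 I v = (\<Sum>i\<in>I. (cmod (v i))\<^sup>2)"

definition mvec :: "'i set \<Rightarrow> ('i \<Rightarrow> 'i \<Rightarrow> complex) \<Rightarrow> ('i \<Rightarrow> complex) \<Rightarrow> 'i \<Rightarrow> complex" where
  "mvec I A v = (\<lambda>i. \<Sum>j\<in>I. A i j * v j)"

definition mform :: "'i set \<Rightarrow> ('i \<Rightarrow> 'i \<Rightarrow> complex) \<Rightarrow> ('i \<Rightarrow> complex) \<Rightarrow> ('i \<Rightarrow> complex) \<Rightarrow> complex" where
  "mform I A x v = (\<Sum>i\<in>I. cnj (x i) * mvec I A v i)"

lemma n2_nonneg [simp]: "0 \<le> n2 I v"
  by (simp add: n2_def sum_nonneg)

lemma cauchy_schwarz_n2: "cmod (\<Sum>i\<in>I. cnj (x i) * y i) \<le> sqrt (n2 I x) * sqrt (n2 I y)"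
proof -
  have "cmod (\<Sum>i\<in>I. cnj (x i) * y i) \<le> (\<Sum>i\<in>I. \<bar>cmod (x i)\<bar> * \<bar>cmod (y i)\<bar>)"
    by (rule order_trans[OF norm_sum]) (simp add: norm_mult)
  also have "\<dots> \<le> L2_set (\<lambda>i. cmod (x i)) I * L2_set (\<lambda>i. cmod (y i)) I"
    by (rule L2_set_mult_ineq)
  finally show ?thesis
    by (simp add: L2_set_def n2_def)
qed

lemma mvec_mpow_Suc: "mvec I (mpow I A (Suc k)) v = mvec I (mpow I A k) (mvec I A v)"
  by (rule ext) (simp add: mvec_def sum_distrib_left sum_distrib_right mult.assoc, rule sum.swap)

lemma n2_mpow:
  assumes b: "\<And>v. n2 I (mvec I A v) \<le> b\<^sup>2 * n2 I v" and fin: "finite I"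
  shows "n2 I (mvec I (mpow I A k) v) \<le> (b ^ k)\<^sup>2 * n2 I v"
proof (induction k arbitrary: v)
  case 0
  have "mvec I (mpow I A 0) v i = v i" if "i \<in> I" for i
    using fin that by (simp add: mvec_def)
  then show ?case
    by (simp add: n2_def)
next
  case (Suc k)
  have "n2 I (mvec I (mpow I A (Suc k)) v) \<le> (b ^ k)\<^sup>2 * n2 I (mvec I A v)"
    unfolding mvec_mpow_Suc by (rule Suc.IH)
  also have "\<dots> \<le> (b ^ k)\<^sup>2 * (b\<^sup>2 * n2 I v)"
    by (intro mult_left_mono b) auto
  finally show ?case
    by (simp add: power_mult_distrib algebra_simps)
qed

lemma mform_mexp_sums:
  assumes "finite I"
  shows "(\<lambda>k. mform I (mpow I A k) x v / fact k) sums mform I (mexp I A) x v"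
proof -
  have "(\<lambda>k. \<Sum>i\<in>I. cnj (x i) * (\<Sum>j\<in>I. mpow I A k i j / fact k * v j)) sums mform I (mexp I A) x v"
    unfolding mform_def mvec_def
    by (intro sums_sum sums_mult sums_mult2 mexp_sums[OF assms])
  moreover have "(\<Sum>i\<in>I. cnj (x i) * (\<Sum>j\<in>I. mpow I A k i j / fact k * v j)) = mform I (mpow I A k) x v / fact k" for k
    by (simp add: mform_def mvec_def sum_divide_distrib sum_distrib_left)
  ultimately show ?thesis
    by simp
qed

lemma mform_mexp_bound:
  assumes b: "\<And>v. n2 I (mvec I A v) \<le> b\<^sup>2 * n2 I v" "0 \<le> b" and fin: "finite I"
  shows "cmod (mform I (mexp I A) x v) \<le> exp b * (sqrt (n2 I x) * sqrt (n2 I v))"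
proof -
  let ?N = "sqrt (n2 I x) * sqrt (n2 I v)"
  have le: "cmod (mform I (mpow I A k) x v / fact k) \<le> b ^ k / fact k * ?N" for k
  proof -
    have "sqrt (n2 I (mvec I (mpow I A k) v)) \<le> sqrt ((b ^ k)\<^sup>2 * n2 I v)"
      using n2_mpow[OF b(1) fin] by (rule real_sqrt_le_mono)
    also have "\<dots> = b ^ k * sqrt (n2 I v)"
      using b(2) by (simp add: real_sqrt_mult)
    finally have "sqrt (n2 I x) * sqrt (n2 I (mvec I (mpow I A k) v)) \<le> sqrt (n2 I x) * (b ^ k * sqrt (n2 I v))"
      by (intro mult_left_mono) auto
    then have "cmod (mform I (mpow I A k) x v) \<le> b ^ k * ?N"
      using cauchy_schwarz_n2[of x "mvec I (mpow I A k) v" I] by (simp add: mform_def mult_ac)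
    then show ?thesis
      by (simp add: norm_divide divide_right_mono)
  qed
  have s: "(\<lambda>k. b ^ k / fact k * ?N) sums (exp b * ?N)"
    using exp_converges[of b] by (intro sums_mult2) (simp add: field_simps inverse_eq_divide)
  have "cmod (suminf (\<lambda>k. mform I (mpow I A k) x v / fact k)) \<le> suminf (\<lambda>k. b ^ k / fact k * ?N)"
  proof (rule order_trans[OF summable_norm suminf_le])
    show "summable (\<lambda>k. norm (mform I (mpow I A k) x v / fact k))"
      by (rule summable_comparison_test'[OF sums_summable[OF s]]) (use le in simp)
  qed (use le sums_summable[OF s] in \<open>auto intro: summable_comparison_test'[OF sums_summable[OF s]]\<close>)
  then show ?thesis
    using mform_mexp_sums[OF fin, of A x v] s by (simp add: sums_iff)
qed

text \<open>Since \<open>exp A = e\<^sup>-\<^sup>c exp (A + c)\<close>, it suffices that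
  \<open>\<parallel>A + c\<parallel>\<^sup>2 \<le> c\<^sup>2 - 2cM + K \<le> (c - M + K/(2c))\<^sup>2\<close> and to let \<open>c\<close> tend to infinity.\<close>

lemma mform_mexp_decay:
  assumes fin: "finite I" and diss: "\<And>v. Re (mform I A v v) \<le> - M * n2 I v"
  shows "cmod (mform I (mexp I A) x v) \<le> exp (- M) * (sqrt (n2 I x) * sqrt (n2 I v))"
proof -
  \<comment> \<open>Besides bounding A, K is taken at least \<open>M\<^sup>2\<close>, so that X
    below is nonnegative for every c.\<close>
  obtain K where K: "M\<^sup>2 \<le> K" "\<And>v. n2 I (mvec I A v) \<le> K * n2 I v"
  proof -
    define K where "K = (\<Sum>i\<in>I. (\<Sum>j\<in>I. cmod (A i j))\<^sup>2)"
    have "n2 I (mvec I A v) \<le> K * n2 I v" for v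
    proof -
      have v: "cmod (v j) \<le> sqrt (n2 I v)" if "j \<in> I" for j
        unfolding n2_def using fin that by (intro real_le_rsqrt member_le_sum) auto
      have "(cmod (mvec I A v i))\<^sup>2 \<le> (\<Sum>j\<in>I. cmod (A i j))\<^sup>2 * n2 I v" if "i \<in> I" for i
      proof -
        have "cmod (mvec I A v i) \<le> (\<Sum>j\<in>I. cmod (A i j) * sqrt (n2 I v))"
          unfolding mvec_def using v
          by (intro order_trans[OF norm_sum] sum_mono) (simp add: norm_mult mult_left_mono)
        then have "(cmod (mvec I A v i))\<^sup>2 \<le> ((\<Sum>j\<in>I. cmod (A i j)) * sqrt (n2 I v))\<^sup>2"
          by (intro power_mono) (simp_all add: sum_distrib_right)
        then show ?thesis
          by (simp add: power_mult_distrib)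
      qed
      then show ?thesis
        unfolding n2_def[of I "mvec I A v"] K_def sum_distrib_right by (intro sum_mono)
    qed
    then have "n2 I (mvec I A v) \<le> max K (M\<^sup>2) * n2 I v" for v
      by (rule order_trans) (simp add: mult_right_mono)
    then show thesis
      by (intro that[of "max K (M\<^sup>2)"]) auto
  qed
  let ?N = "sqrt (n2 I x) * sqrt (n2 I v)"
  have le: "cmod (mform I (mexp I A) x v) \<le> exp (- M + K / (2 * c)) * ?N" if c: "c > 0" for c :: real
  proof -
    define X where "X = c\<^sup>2 - 2 * c * M + K"
    \<comment> \<open>The mean of X / c and c, whose product is X, hence
      \<open>X \<le> b\<^sup>2\<close>; explicitly b = c - M + K / (2 c).\<close>
    define b where "b = (X / c + c) / 2"
    have "0 \<le> (c - M)\<^sup>2"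
      by simp
    also have "\<dots> \<le> X"
      using K(1) by (simp add: X_def power2_diff)
    finally have X: "0 \<le> X" .
    have b0: "0 \<le> b"
      using X c by (simp add: b_def)
    have "b\<^sup>2 - X = ((X / c - c) / 2)\<^sup>2"
      using c by (simp add: b_def power2_eq_square field_simps)
    then have Xb: "X \<le> b\<^sup>2"
      by (metis diff_ge_0_iff_ge zero_le_power2)
    define Ac where "Ac i j = A i j + of_real c * of_bool (i = j)" for i j
    have bound: "n2 I (mvec I Ac w) \<le> b\<^sup>2 * n2 I w" for w
    proof -
      have Ac: "mvec I Ac w i = mvec I A w i + of_real c * w i" if "i \<in> I" for i
      proof -
        have "mvec I Ac w i = mvec I A w i + (\<Sum>j\<in>I. if i = j then of_real c * w j else 0)"
          unfolding mvec_def Ac_def sum.distrib[symmetric] by (intro sum.cong) (auto simp: algebra_simps)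
        then show ?thesis
          using fin that by simp
      qed
      have sq: "(cmod (mvec I Ac w i))\<^sup>2 = (cmod (mvec I A w i))\<^sup>2 + 2 * c * Re (cnj (w i) * mvec I A w i) + c\<^sup>2 * (cmod (w i))\<^sup>2"
        if "i \<in> I" for i
        unfolding Ac[OF that] cmod_power2 by (simp add: power2_eq_square algebra_simps)
      have "n2 I (mvec I Ac w) = (\<Sum>i\<in>I. (cmod (mvec I A w i))\<^sup>2 + 2 * c * Re (cnj (w i) * mvec I A w i) + c\<^sup>2 * (cmod (w i))\<^sup>2)"
        unfolding n2_def by (intro sum.cong refl sq)
      also have "\<dots> = n2 I (mvec I A w) + 2 * c * Re (mform I A w w) + c\<^sup>2 * n2 I w"
        by (simp only: n2_def mform_def Re_sum sum.distrib sum_distrib_left)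
      also have "\<dots> \<le> K * n2 I w + 2 * c * (- M * n2 I w) + c\<^sup>2 * n2 I w"
        using c by (intro add_mono mult_left_mono diss K) auto
      also have "\<dots> = X * n2 I w"
        by (simp add: X_def algebra_simps)
      also have "\<dots> \<le> b\<^sup>2 * n2 I w"
        by (intro mult_right_mono Xb) auto
      finally show ?thesis .
    qed
    have "mexp I Ac i j = exp (of_real c) * mexp I A i j" if "j \<in> I" for i j
      unfolding Ac_def by (rule mexp_shift[OF fin that])
    then have "mform I (mexp I Ac) x v = exp (of_real c) * mform I (mexp I A) x v"
      by (simp add: mform_def mvec_def sum_distrib_left mult_ac)
    then have "exp c * cmod (mform I (mexp I A) x v) \<le> exp b * ?N"
      using mform_mexp_bound[OF bound b0 fin, of x v] by (simp add: norm_mult)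
    then have "cmod (mform I (mexp I A) x v) \<le> exp b * ?N / exp c"
      by (simp add: pos_le_divide_eq mult.commute)
    also have "\<dots> = exp (b - c) * ?N"
      by (simp add: exp_diff)
    also have "b - c = - M + K / (2 * c)"
      using c by (simp add: b_def X_def field_simps power2_eq_square)
    finally show ?thesis .
  qed
  show ?thesis
  proof (rule LIMSEQ_le_const)
    have eq: "K / (2 * real (Suc n)) = K / 2 * inverse (real (Suc n))" for n
      by (simp only: divide_inverse inverse_mult_distrib mult.assoc)
    have "(\<lambda>n. K / 2 * inverse (real (Suc n))) \<longlonglongrightarrow> K / 2 * 0"
      by (rule tendsto_mult_left[OF LIMSEQ_inverse_real_of_nat])
    from tendsto_mult_right[OF tendsto_exp[OF tendsto_add[OF tendsto_const[of "- M"] this]], of ?N]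
    show "(\<lambda>n. exp (- M + K / (2 * real (Suc n))) * ?N) \<longlonglongrightarrow> exp (- M) * ?N"
      unfolding eq by (simp only: mult_zero_right add_0_right)
    show "\<exists>N. \<forall>n\<ge>N. cmod (mform I (mexp I A) x v) \<le> exp (- M + K / (2 * real (Suc n))) * ?N"
      by (intro exI allI impI le) simp
  qed
qed

text \<open>Complete positivity: \<open>CP I M\<close> says that the form
  \<open>((i, j), (k, l)) \<mapsto> M (i, k) (j, l)\<close> lies in the cone generated by rank one forms on \<open>I \<times> I\<close>.\<close>

inductive CP :: "'i set \<Rightarrow> ('i \<times> 'i \<Rightarrow> 'i \<times> 'i \<Rightarrow> complex) \<Rightarrow> bool" for I where
  rank1: "CP I (\<lambda>(i, k) (j, l). cnj (f i j) * f k l)"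
| zero: "CP I (\<lambda>_ _. 0)"
| add: "CP I M \<Longrightarrow> CP I N \<Longrightarrow> CP I (\<lambda>x y. M x y + N x y)"
| cong: "CP I M \<Longrightarrow> (\<And>x y. x \<in> I \<times> I \<Longrightarrow> y \<in> I \<times> I \<Longrightarrow> M x y = N x y) \<Longrightarrow> CP I N"

text \<open>As a matrix to be multiplied and exponentiated, M has rows (i, k) and columns (j, l); as
  a sesquilinear form it pairs (i, j) with (k, l). Positivity refers to the second reading.\<close>

definition cp_form :: "'i set \<Rightarrow> ('i \<Rightarrow> 'i \<Rightarrow> complex) \<Rightarrow> ('i \<times> 'i \<Rightarrow> 'i \<times> 'i \<Rightarrow> complex) \<Rightarrow> complex" where
  "cp_form I c M = (\<Sum>i\<in>I. \<Sum>j\<in>I. \<Sum>k\<in>I. \<Sum>l\<in>I. cnj (c i j) * c k l * M (i, k) (j, l))"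

lemma CP_nonneg: "CP I M \<Longrightarrow> 0 \<le> Re (cp_form I c M)"
proof (induction rule: CP.induct)
  case (rank1 f)
  define z where "z = (\<Sum>i\<in>I. \<Sum>j\<in>I. c i j * f i j)"
  have "cp_form I c (\<lambda>(i, k) (j, l). cnj (f i j) * f k l) = (\<Sum>i\<in>I. \<Sum>j\<in>I. cnj (c i j * f i j) * z)"
    by (simp add: cp_form_def z_def sum_distrib_left mult_ac)
  also have "\<dots> = (\<Sum>i\<in>I. \<Sum>j\<in>I. cnj (c i j * f i j)) * z"
    by (simp only: sum_distrib_right)
  also have "\<dots> = cnj z * z"
    by (simp add: z_def)
  also have "Re \<dots> = (cmod z)\<^sup>2"
    by (simp only: cmod_power2) (simp add: power2_eq_square)
  finally show ?case
    by simp
next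
  case (add M N)
  then show ?case
    by (simp add: cp_form_def distrib_left sum.distrib)
next
  case (cong M N)
  have "cp_form I c N = cp_form I c M"
    unfolding cp_form_def using cong(2) by (intro sum.cong refl) auto
  then show ?case
    using cong by simp
qed (simp add: cp_form_def)

text \<open>A rank one element is \<open>cnj f\<close> \<otimes> f, the matrix of a map with a
  single Kraus operator, and the product of two such elements belongs to the matrix product f g. The
  rest is bilinearity.\<close>

lemma CP_mult:
  assumes M: "CP I M" and N: "CP I N" and fin: "finite I"
  shows "CP I (\<lambda>x y. \<Sum>z\<in>I \<times> I. M x z * N z y)"
  using M
proof (induction rule: CP.induct)
  case (rank1 f)
  show ?case
    using N
  proof (induction rule: CP.induct)
    case (rank1 g)
    define h where "h i j = (\<Sum>p\<in>I. f i p * g p j)" for i j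
    have "CP I (\<lambda>(i, k) (j, l). cnj (h i j) * h k l)"
      by (rule CP.rank1)
    moreover have "(\<lambda>(i, k) (j, l). cnj (h i j) * h k l) = (\<lambda>x y. \<Sum>z\<in>I \<times> I.
        (case x of (i, k) \<Rightarrow> \<lambda>(j, l). cnj (f i j) * f k l) z * (case z of (i, k) \<Rightarrow> \<lambda>(j, l). cnj (g i j) * g k l) y)"
      by (auto simp: fun_eq_iff h_def sum.cartesian_product' sum_product mult_ac intro: sum.swap)
    ultimately show ?case
      by (simp only:)
  next
    case zero
    then show ?case
      by (simp add: CP.zero)
  next
    case (add M N)
    then show ?case
      using CP.add[OF add.IH] by (simp add: distrib_left sum.distrib)
  next
    case (cong M N)
    show ?case
      by (rule CP.cong[OF cong.IH]) (auto intro!: sum.cong simp: cong(2))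
  qed
next
  case zero
  then show ?case
    by (simp add: CP.zero)
next
  case (add M N)
  then show ?case
    using CP.add[OF add.IH] by (simp add: distrib_right sum.distrib)
next
  case (cong M N)
  show ?case
    by (rule CP.cong[OF cong.IH]) (auto intro!: sum.cong simp: cong(2))
qed

lemma CP_mpow: "CP I M \<Longrightarrow> finite I \<Longrightarrow> CP I (mpow (I \<times> I) M k)"
proof (induction k)
  case 0
  have "CP I (\<lambda>(i, k) (j, l). cnj (of_bool (i = j)) * of_bool (k = l))"
    by (rule CP.rank1)
  then show ?case
    by (rule CP.cong) auto
next
  case (Suc k)
  then show ?case
    using CP_mult[of I "mpow (I \<times> I) M k" M] by simp
qed

lemma cp_form_sums:
  assumes "finite I"
  shows "(\<lambda>k. cp_form I c (mpow (I \<times> I) M k) / fact k) sums cp_form I c (mexp (I \<times> I) M)"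
proof -
  have "(\<lambda>n. \<Sum>i\<in>I. \<Sum>j\<in>I. \<Sum>k\<in>I. \<Sum>l\<in>I. cnj (c i j) * c k l * (mpow (I \<times> I) M n (i, k) (j, l) / fact n)) sums
      cp_form I c (mexp (I \<times> I) M)"
    unfolding cp_form_def using assms by (intro sums_sum sums_mult mexp_sums) auto
  then show ?thesis
    by (simp add: cp_form_def sum_divide_distrib)
qed

lemma CP_mexp:
  assumes "CP I M" "finite I"
  shows "0 \<le> Re (cp_form I c (mexp (I \<times> I) M))"
proof -
  have s: "(\<lambda>k. Re (cp_form I c (mpow (I \<times> I) M k) / fact k)) sums Re (cp_form I c (mexp (I \<times> I) M))"
    by (rule sums_Re[OF cp_form_sums[OF assms(2)]])
  have "Re (z / fact k) = Re z / fact k" for z :: complex and k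
    by (metis Re_divide_of_real of_real_fact)
  then have "0 \<le> Re (cp_form I c (mpow (I \<times> I) M k) / fact k)" for k
    using CP_nonneg[OF CP_mpow[OF assms], of c k] by simp
  then show ?thesis
    using sums_le[OF _ sums_zero s] by simp
qed

text \<open>Tannery's theorem: the terms are dominated, uniformly in n, by those of the exponential
  series at \<open>real (card I) * d\<close>.\<close>

lemma mexp_tendsto:
  fixes A :: "nat \<Rightarrow> 'i \<Rightarrow> 'i \<Rightarrow> complex"
  assumes fin: "finite I" "j \<in> I" and lim: "\<And>i j. i \<in> I \<Longrightarrow> j \<in> I \<Longrightarrow> (\<lambda>n. A n i j) \<longlonglongrightarrow> B i j"
    and bound: "\<And>n i j. i \<in> I \<Longrightarrow> j \<in> I \<Longrightarrow> cmod (A n i j) \<le> d" "0 \<le> d"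
  shows "(\<lambda>n. mexp I (A n) i j) \<longlonglongrightarrow> mexp I B i j"
proof -
  have pow: "(\<lambda>n. mpow I (A n) k i j) \<longlonglongrightarrow> mpow I B k i j" if "j \<in> I" for k j
    using that
  proof (induction k arbitrary: j)
    case (Suc k)
    then show ?case
      by (auto intro!: tendsto_sum tendsto_mult lim)
  qed auto
  have "((\<lambda>n. \<Sum>k. mpow I (A n) k i j / fact k) \<longlongrightarrow> (\<Sum>k. mpow I B k i j / fact k)) sequentially"
  proof (rule tannerys_theorem[where M = "\<lambda>k. (real (card I) * d) ^ k / fact k", THEN conjunct2, THEN conjunct2])
    show "((\<lambda>n. mpow I (A n) k i j / fact k) \<longlongrightarrow> mpow I B k i j / fact k) sequentially" for k
      by (intro tendsto_divide pow fin tendsto_const) auto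
    show "\<forall>\<^sub>F (k, n) in sequentially \<times>\<^sub>F sequentially. norm (mpow I (A n) k i j / fact k) \<le> (real (card I) * d) ^ k / fact k"
    proof (rule always_eventually, clarify)
      fix k n :: nat
      show "norm (mpow I (A n) k i j / fact k) \<le> (real (card I) * d) ^ k / fact k"
        using mpow_bound[OF fin(1) bound(1)[where n = n] bound(2) fin(2), where k = k and i = i] by (simp add: norm_divide divide_right_mono)
    qed
    show "summable (\<lambda>k. (real (card I) * d) ^ k / fact k)"
      by (rule summable_power_fact)
  qed simp
  then show ?thesis
    by (simp add: mexp_def)
qed

section \<open>Convolution exponentials of generating functionals\<close>

context cqg
begin

text \<open>Convolution powers of L. On the coefficients of a representation u they are the powers
  of the matrix \<open>L (u i j)\<close>, so all convergence questions concern finite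
  matrices.\<close>

primrec cpow :: "('a \<Rightarrow> complex) \<Rightarrow> nat \<Rightarrow> 'a \<Rightarrow> complex" where
  "cpow L 0 = eps"
| "cpow L (Suc k) = (\<lambda>a. comult G a (\<lambda>x y. cpow L k x * L y))"

definition cexp :: "('a \<Rightarrow> complex) \<Rightarrow> 'a \<Rightarrow> complex" where
  "cexp L a = (\<Sum>k. cpow L k a / fact k)"

lemma cpow_lf: "linear_form G (cpow L k)"
  by (cases k) (simp_all add: eps_lf comult_lf)

lemma cpow_corep:
  assumes w: "corep G I w" and ew: "\<And>i j. i \<in> I \<Longrightarrow> j \<in> I \<Longrightarrow> eps (w i j) = of_bool (i = j)"
    and L: "linear_form G L" and ij: "i \<in> I" "j \<in> I"
  shows "cpow L k (w i j) = mpow I (\<lambda>i j. L (w i j)) k i j"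
  using ij(2)
proof (induction k arbitrary: j)
  case 0
  then show ?case
    using ew ij by simp
next
  case (Suc k)
  then show ?case
    using corep_comult[OF w ij(1) Suc.prems bilinear_pair[OF cpow_lf[of L k] L]] by simp
qed

lemma cexp_corep:
  assumes "corep G I w" "\<And>i j. i \<in> I \<Longrightarrow> j \<in> I \<Longrightarrow> eps (w i j) = of_bool (i = j)"
    "linear_form G L" "i \<in> I" "j \<in> I"
  shows "cexp L (w i j) = mexp I (\<lambda>i j. L (w i j)) i j"
  by (simp add: cexp_def mexp_def cpow_corep[OF assms])

lemma cexp_urep:
  assumes u: "urep G I u" and "linear_form G L" "i \<in> I" "j \<in> I"
  shows "cexp L (u i j) = mexp I (\<lambda>i j. L (u i j)) i j"
  using assms by (intro cexp_corep urep_corep urep_eps)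

lemma cexp_summable:
  assumes L: "linear_form G L"
  shows "summable (\<lambda>k. cpow L k a / fact k)"
proof (induction a rule: pol_induct)
  case (coeff n u i j)
  have "cpow L k (u i j) = mpow {..<n} (\<lambda>i j. L (u i j)) k i j" for k
    using coeff by (intro cpow_corep[OF urep_corep[OF coeff(1)] urep_eps[OF coeff(1)] L]) auto
  then show ?case
    using summable_norm_cancel[OF mexp_summable[of "{..<n}" j "\<lambda>i j. L (u i j)" i]] coeff by simp
next
  case (add a b)
  then show ?case
    using cpow_lf[of L] by (simp add: lf_iff add_divide_distrib summable_add)
next
  case (scl c a)
  have "(\<lambda>k. cpow L k (sc c a) / fact k) = (\<lambda>k. c * (cpow L k a / fact k))"
    using cpow_lf[of L] by (simp add: lf_iff)
  then show ?case
    using summable_mult[OF scl] by simp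
qed

lemma cexp_sums: "linear_form G L \<Longrightarrow> (\<lambda>k. cpow L k a / fact k) sums cexp L a"
  unfolding cexp_def by (rule summable_sums[OF cexp_summable])

lemma cexp_lf:
  assumes L: "linear_form G L"
  shows "linear_form G (cexp L)"
  unfolding lf_iff
proof (intro conjI allI)
  fix a b c
  have "(\<lambda>k. cpow L k (a + b) / fact k) sums (cexp L a + cexp L b)"
    using sums_add[OF cexp_sums[OF L] cexp_sums[OF L], of a b] cpow_lf[of L]
    by (simp add: lf_iff add_divide_distrib)
  then show "cexp L (a + b) = cexp L a + cexp L b"
    using cexp_sums[OF L] sums_unique2 by blast
  have "(\<lambda>k. cpow L k (sc c a) / fact k) sums (c * cexp L a)"
    using sums_mult[OF cexp_sums[OF L], of c a] cpow_lf[of L] by (simp add: lf_iff)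
  then show "cexp L (sc c a) = c * cexp L a"
    using cexp_sums[OF L] sums_unique2 by blast
qed

lemma cpow_st:
  assumes L: "linear_form G L" and herm: "\<And>a. L (st a) = cnj (L a)"
  shows "cpow L k (st a) = cnj (cpow L k a)"
proof (induction a rule: pol_induct)
  case (coeff n u i j)
  have st: "corep G {..<n} (\<lambda>i j. st (u i j))"
    by (rule corep_st[OF urep_corep[OF coeff(1)]])
  have e: "eps (st (u i j)) = of_bool (i = j)" if "i \<in> {..<n}" "j \<in> {..<n}" for i j
    using urep_eps[OF coeff(1)] that by simp
  have "mpow {..<n} (\<lambda>i j. L (st (u i j))) k i j = cnj (mpow {..<n} (\<lambda>i j. L (u i j)) k i j)" for j
    by (induction k arbitrary: j) (simp_all add: herm)
  then show ?case
    using cpow_corep[OF st e L, of i j k] cpow_corep[OF urep_corep[OF coeff(1)] urep_eps[OF coeff(1)] L, of i j k] coeff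
    by simp
next
  case (add a b)
  then show ?case
    using cpow_lf[of L k] by (simp add: lf_iff)
next
  case (scl c a)
  then show ?case
    using cpow_lf[of L k] by (simp add: lf_iff)
qed

lemma cexp_st:
  assumes L: "linear_form G L" and herm: "\<And>a. L (st a) = cnj (L a)"
  shows "cexp L (st a) = cnj (cexp L a)"
proof -
  have "cnj (x / fact k) = cnj x / fact k" for x :: complex and k
    by simp
  then have "(\<lambda>k. cpow L k (st a) / fact k) sums cnj (cexp L a)"
    using cexp_sums[OF L, of a] unfolding sums_cnj[symmetric, of "\<lambda>k. cpow L k a / fact k"]
    by (simp add: cpow_st[OF L herm])
  then show ?thesis
    using cexp_sums[OF L] sums_unique2 by blast
qed

lemma cexp_one:
  assumes L: "linear_form G L" and L1: "L 1 = 0"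
  shows "cexp L 1 = 1"
proof -
  have "comult G 1 = pure_tensor G 1 1"
    using hopf(2) by (simp add: comult_star_hom_def)
  then have "cpow L (Suc k) 1 = 0" for k
    using L1 by (simp add: pure_tensor_def)
  then have "cpow L k 1 / fact k = (if k = 0 then 1 else 0)" for k
    by (cases k) simp_all
  then have "(\<lambda>k. cpow L k 1 / fact k) sums 1"
    using sums_single[of 0 "\<lambda>_. 1 :: complex"] by (simp only:)
  then show ?thesis
    using cexp_sums[OF L] sums_unique2 by blast
qed

text \<open>Q is the coboundary of L. On the kernel of the counit
  \<open>L (st a * b) = Q a b\<close>, so positivity of Q is conditional positivity of L.\<close>

definition generating :: "('a \<Rightarrow> complex) \<Rightarrow> ('a \<Rightarrow> 'a \<Rightarrow> complex) \<Rightarrow> bool" where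
  "generating L Q \<longleftrightarrow> linear_form G L \<and> L 1 = 0 \<and> (\<forall>a. L (st a) = cnj (L a)) \<and> semi_inner_space sc Q \<and>
     (\<forall>a b. L (st a * b) = cnj (eps a) * L b + cnj (L a) * eps b + Q a b)"

lemma generating_scale:
  assumes "generating L Q" "0 \<le> t"
  shows "generating (\<lambda>a. of_real t * L a) (\<lambda>a b. of_real t * Q a b)"
proof -
  interpret Q: semi_inner_space sc Q
    using assms by (simp add: generating_def)
  have "semi_inner_space sc (\<lambda>a b. of_real t * Q a b)"
  proof (rule semi_innerI)
    show "of_real t * Q y x = cnj (of_real t * Q x y)" for x y
      by (simp add: Q.ip_cnj[of y x])
    show "0 \<le> Re (of_real t * Q x x)" for x
      using assms(2) Q.ip_nonneg by simp
  qed (simp_all add: Q.ip_add_right Q.ip_scale_right distrib_left)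
  then show ?thesis
    using assms by (auto simp: generating_def lf_iff algebra_simps)
qed

text \<open>Cholesky decomposition: split off one vector at a time.\<close>

lemma CP_gram:
  assumes Q: "semi_inner_space sc Q" and X: "finite X" "X \<subseteq> I \<times> I"
  shows "CP I (\<lambda>(i, k) (j, l). if (i, j) \<in> X \<and> (k, l) \<in> X then Q (a i j) (a k l) else 0)"
  using X
proof (induction X arbitrary: a rule: finite_induct)
  case empty
  show ?case
    by (rule CP.cong[OF CP.zero]) auto
next
  case (insert x X)
  interpret Q: semi_inner_space sc Q by (rule Q)
  obtain i0 j0 where x: "x = (i0, j0)"
    by (cases x)
  let ?y = "a i0 j0"
  have X: "X \<subseteq> I \<times> I"
    using insert.prems by simp
  show ?case
  proof (cases "Q.nrm ?y = 0")
    case True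
    then have 0: "Q ?y b = 0" "Q b ?y = 0" for b
      using Q.cauchy_schwarz[of ?y b] Q.cauchy_schwarz[of b ?y] by auto
    show ?thesis
      by (rule CP.cong[OF insert.IH[OF X, of a]]) (use insert.hyps in \<open>auto simp: x 0\<close>)
  next
    case False
    define N where "N = complex_of_real (Q.nrm ?y)"
    have N: "N \<noteq> 0" "cnj N = N" "Q ?y ?y = N * N"
      using False by (auto simp: N_def Q.ip_eq_nrm power2_eq_square)
    define f where "f i j = (if (i, j) \<in> insert x X then Q ?y (a i j) / N else 0)" for i j
    \<comment> \<open>Removing the component along y leaves a Gram matrix in which the vector at
      (i0, j0) is zero, so only the indices in X remain.\<close>
    define a' where "a' i j = a i j - sc (Q ?y (a i j) / (N * N)) ?y" for i j
    have dec: "Q (a i j) (a k l) = cnj (Q ?y (a i j) / N) * (Q ?y (a k l) / N) + Q (a' i j) (a' k l)" for i j k l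
      using N by (simp add: a'_def Q.ip_diff_left Q.ip_diff_right Q.ip_scale_left Q.ip_scale_right
          Q.ip_cnj[of "a i j" ?y] field_simps)
    have y0: "Q (a' i0 j0) b = 0" "Q b (a' i0 j0) = 0" for b
      using N by (auto simp: a'_def)
    have "CP I (\<lambda>(i, k) (j, l). cnj (f i j) * f k l)"
      by (rule CP.rank1)
    from CP.add[OF this insert.IH[OF X, of a']]
    show ?thesis
    proof (rule CP.cong)
      fix z w :: "'b \<times> 'b"
      obtain i k j l where [simp]: "z = (i, k)" "w = (j, l)"
        by (cases z, cases w)
      have "Q (a' i j) (a' k l) = (if (i, j) \<in> X \<and> (k, l) \<in> X then Q (a' i j) (a' k l) else 0)"
        if "(i, j) \<in> insert x X" "(k, l) \<in> insert x X"
        using that y0 by (auto simp: x)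
      then show "(case z of (i, k) \<Rightarrow> \<lambda>(j, l). cnj (f i j) * f k l) w +
          (case z of (i, k) \<Rightarrow> \<lambda>(j, l). if (i, j) \<in> X \<and> (k, l) \<in> X then Q (a' i j) (a' k l) else 0) w =
          (case z of (i, k) \<Rightarrow> \<lambda>(j, l). if (i, j) \<in> insert x X \<and> (k, l) \<in> insert x X then Q (a i j) (a k l) else 0) w"
        using dec[of i j k l] by (auto simp: f_def)
    qed
  qed
qed

text \<open>With \<open>X = L(u)\<close> one has \<open>L(u\<^sub>i\<^sub>j\<^sup>* u\<^sub>k\<^sub>l) + c \<delta>\<^sub>i\<^sub>j \<delta>\<^sub>k\<^sub>l + cnj X\<^sub>i\<^sub>j X\<^sub>k\<^sub>l / c = cnj (\<surd>c \<delta>\<^sub>i\<^sub>j + X\<^sub>i\<^sub>j / \<surd>c) (\<surd>c \<delta>\<^sub>k\<^sub>l + X\<^sub>k\<^sub>l / \<surd>c) + Q(u\<^sub>i\<^sub>j, u\<^sub>k\<^sub>l)\<close>,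
  which is completely positive, and the last term on the left disappears as \<open>c\<close> tends to infinity.\<close>

lemma cexp_nonneg:
  assumes "generating L Q"
  shows "0 \<le> Re (cexp L (st a * a))"
proof -
  have L: "linear_form G L" and Q: "semi_inner_space sc Q"
    and LQ: "L (st a * b) = cnj (eps a) * L b + cnj (L a) * eps b + Q a b" for a b
    using assms by (auto simp: generating_def)
  obtain n :: nat and u c where u: "urep G {..<n} u" and a: "a = (\<Sum>i<n. \<Sum>j<n. sc (c i j) (u i j))"
    by (rule pol_expand[of a], blast)
  define I where "I = {..<n}"
  have fin: "finite I"
    by (simp add: I_def)
  \<comment> \<open>The numbers \<open>L (st (u i j) * u k l)\<close> are the matrix of L on this
    corepresentation, in the index order that \<open>CP\<close> requires; hence the exponential of
    that matrix gives the values of \<open>cexp L\<close> on the products.\<close>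
  define w where "w = (\<lambda>(i, k) (j, l). st (u i j) * u k l)"
  have w: "corep G (I \<times> I) w"
    unfolding w_def I_def by (rule corep_tensor[OF corep_st[OF urep_corep[OF u]] urep_corep[OF u]])
  have ue: "eps (u i j) = of_bool (i = j)" if "i \<in> I" "j \<in> I" for i j
    using urep_eps[OF u] that by (simp add: I_def)
  have we: "eps (w x y) = of_bool (x = y)" if "x \<in> I \<times> I" "y \<in> I \<times> I" for x y
    using that ue by (auto simp: w_def)
  define A where "A x y = L (w x y)" for x y
  define Y where "Y = (\<lambda>(i, k) (j, l). cnj (L (u i j)) * L (u k l))"
  have pos: "0 \<le> Re (cp_form I c (mexp (I \<times> I) (\<lambda>x y. A x y + Y x y / of_real r)))" if r: "0 < r" for r
  proof -
    define s where "s = complex_of_real (sqrt r)"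
    have s: "s * s = of_real r" "cnj s = s" "s \<noteq> 0"
      using r by (auto simp: s_def simp flip: of_real_mult)
    define f where "f i j = s * of_bool (i = j) + L (u i j) / s" for i j
    define B where "B x y = (A x y + Y x y / of_real r) + of_real r * of_bool (x = y)" for x y
    have "CP I B"
    proof (rule CP.cong[OF CP.add[OF CP.rank1[of I f] CP_gram[OF Q, of "I \<times> I" I u]]])
      fix x y assume xy: "x \<in> I \<times> I" "y \<in> I \<times> I"
      obtain i k j l where [simp]: "x = (i, k)" "y = (j, l)"
        by (cases x, cases y)
      have ijkl: "i \<in> I" "j \<in> I" "k \<in> I" "l \<in> I"
        using xy by auto
      have "cnj (f i j) * f k l = of_real r * (of_bool (i = j) * of_bool (k = l)) + of_bool (i = j) * L (u k l)
          + cnj (L (u i j)) * of_bool (k = l) + cnj (L (u i j)) * L (u k l) / of_real r"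
        using s(3) unfolding f_def s(1)[symmetric] by (simp add: s(2) field_simps)
      moreover have "A x y = of_bool (i = j) * L (u k l) + cnj (L (u i j)) * of_bool (k = l) + Q (u i j) (u k l)"
        using ue ijkl by (simp add: A_def w_def LQ)
      ultimately show "(case x of (i, k) \<Rightarrow> \<lambda>(j, l). cnj (f i j) * f k l) y +
          (case x of (i, k) \<Rightarrow> \<lambda>(j, l). if (i, j) \<in> I \<times> I \<and> (k, l) \<in> I \<times> I then Q (u i j) (u k l) else 0) y = B x y"
        using ijkl by (auto simp: B_def Y_def)
    qed (use fin in auto)
    then have "0 \<le> Re (cp_form I c (mexp (I \<times> I) B))"
      by (rule CP_mexp[OF _ fin])
    also have "cp_form I c (mexp (I \<times> I) B) = exp (of_real r) * cp_form I c (mexp (I \<times> I) (\<lambda>x y. A x y + Y x y / of_real r))"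
    proof -
      have "mexp (I \<times> I) B (i, k) (j, l) = exp (of_real r) * mexp (I \<times> I) (\<lambda>x y. A x y + Y x y / of_real r) (i, k) (j, l)"
        if "j \<in> I" "l \<in> I" for i j k l
        unfolding B_def by (rule mexp_shift) (use fin that in auto)
      then show ?thesis
        by (simp add: cp_form_def sum_distrib_left mult_ac)
    qed
    also have "exp (of_real r) = complex_of_real (exp r)"
      by (simp add: exp_of_real)
    finally show ?thesis
      by (simp add: zero_le_mult_iff)
  qed
  obtain d1 where d1: "0 \<le> d1" "\<And>x y. x \<in> I \<times> I \<Longrightarrow> y \<in> I \<times> I \<Longrightarrow> cmod (A x y) \<le> d1"
    by (rule matrix_entries_bounded[of "I \<times> I" A]) (use fin in auto)
  obtain d2 where d2: "0 \<le> d2" "\<And>x y. x \<in> I \<times> I \<Longrightarrow> y \<in> I \<times> I \<Longrightarrow> cmod (Y x y) \<le> d2"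
    by (rule matrix_entries_bounded[of "I \<times> I" Y]) (use fin in auto)
  have lim: "(\<lambda>m. mexp (I \<times> I) (\<lambda>x y. A x y + Y x y / of_real (real (Suc m))) x y) \<longlonglongrightarrow> mexp (I \<times> I) A x y"
    if "y \<in> I \<times> I" for x y
  proof (rule mexp_tendsto[where d = "d1 + d2"])
    show "(\<lambda>m. A x y + Y x y / of_real (real (Suc m))) \<longlonglongrightarrow> A x y" for x y
    proof -
      have "(\<lambda>m. Y x y * of_real (inverse (real (Suc m)))) \<longlonglongrightarrow> Y x y * of_real 0"
        by (intro tendsto_mult_left tendsto_of_real LIMSEQ_inverse_real_of_nat)
      from tendsto_add[OF tendsto_const[of "A x y"] this] show ?thesis
        by (simp add: divide_inverse del: of_nat_Suc)
    qed
    show "cmod (A x y + Y x y / of_real (real (Suc m))) \<le> d1 + d2" if "x \<in> I \<times> I" "y \<in> I \<times> I" for m x y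
    proof -
      have "cmod (Y x y / of_real (real (Suc m))) \<le> cmod (Y x y)"
        by (simp add: norm_divide divide_le_eq mult_le_cancel_left1 del: of_nat_Suc)
      then show ?thesis
        using d1(2)[OF that] d2(2)[OF that] norm_triangle_ineq[of "A x y" "Y x y / of_real (real (Suc m))"] by linarith
    qed
  qed (use fin that d1 d2 in auto)
  have "(\<lambda>m. Re (cp_form I c (mexp (I \<times> I) (\<lambda>x y. A x y + Y x y / of_real (real (Suc m)))))) \<longlonglongrightarrow>
      Re (cp_form I c (mexp (I \<times> I) A))"
    unfolding cp_form_def by (intro tendsto_Re tendsto_sum tendsto_mult_left lim) auto
  then have "0 \<le> Re (cp_form I c (mexp (I \<times> I) A))"
    by (rule LIMSEQ_le_const) (intro exI allI impI pos, simp)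
  also have "cp_form I c (mexp (I \<times> I) A) = cexp L (st a * a)"
  proof -
    have lf: "linear_form G (cexp L)"
      by (rule cexp_lf[OF L])
    have w_exp: "mexp (I \<times> I) A (i, k) (j, l) = cexp L (st (u i j) * u k l)" if "i \<in> I" "j \<in> I" "k \<in> I" "l \<in> I" for i j k l
      using cexp_corep[OF w we L, of "(i, k)" "(j, l)"] that by (simp add: A_def[abs_def]) (simp add: w_def)
    have "st a * a = (\<Sum>i\<in>I. \<Sum>j\<in>I. \<Sum>k\<in>I. \<Sum>l\<in>I. sc (cnj (c i j) * c k l) (st (u i j) * u k l))"
    proof -
      have "st a = (\<Sum>i\<in>I. \<Sum>j\<in>I. sc (cnj (c i j)) (st (u i j)))"
        by (simp add: a st_sum I_def)
      then have "st a * a = (\<Sum>i\<in>I. \<Sum>j\<in>I. sc (cnj (c i j)) (st (u i j)) * a)"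
        by (simp only: sum_distrib_right)
      moreover have each: "sc (cnj (c i j)) (st (u i j)) * a =
          (\<Sum>k\<in>I. \<Sum>l\<in>I. sc (cnj (c i j) * c k l) (st (u i j) * u k l))" for i j
        by (simp add: a I_def sum_distrib_left scl_mult_left scl_mult_right scl_sum_right mult.commute)
      ultimately show ?thesis
        by (simp only: each)
    qed
    then have "cexp L (st a * a) = (\<Sum>i\<in>I. \<Sum>j\<in>I. \<Sum>k\<in>I. \<Sum>l\<in>I. cnj (c i j) * c k l * cexp L (st (u i j) * u k l))"
      using lf by (simp add: lf_sum) (simp add: lf_iff)
    also have "\<dots> = cp_form I c (mexp (I \<times> I) A)"
      unfolding cp_form_def by (intro sum.cong refl) (simp add: w_exp)
    finally show ?thesis ..
  qed
  finally show ?thesis .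
qed

text \<open>The form \<open>gram_norm\<close> over any finite index set, as tensor products
  require.\<close>

definition gram :: "('a \<Rightarrow> 'a \<Rightarrow> complex) \<Rightarrow> 'i set \<Rightarrow> ('i \<Rightarrow> 'i \<Rightarrow> 'a) \<Rightarrow> ('i \<Rightarrow> complex) \<Rightarrow> complex" where
  "gram q I w v = (\<Sum>k\<in>I. q (\<Sum>j\<in>I. sc (v j) (w k j)) (\<Sum>j\<in>I. sc (v j) (w k j)))"

text \<open>Apply L to the unitarity relation
  \<open>(\<Sum>k\<in>I. st (w k i) * w k j) = of_bool (i = j)\<close>. With X the matrix of values
  of L on w it says that X, its adjoint and the Gram matrix of Q add up to zero.\<close>

lemma generating_dissipative:
  assumes LQ: "generating L Q" and w: "urep G I w"
  shows "2 * Re (mform I (\<lambda>i j. L (w i j)) v v) = - Re (gram Q I w v)"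
proof -
  have L: "linear_form G L" "L 1 = 0" and Q: "semi_inner_space sc Q"
    and LQ': "L (st a * b) = cnj (eps a) * L b + cnj (L a) * eps b + Q a b" for a b
    using LQ by (auto simp: generating_def)
  interpret Q: semi_inner_space sc Q by (rule Q)
  have fin: "finite I"
    by (rule urep_finite[OF w])
  have id: "L (w i j) + cnj (L (w j i)) + (\<Sum>k\<in>I. Q (w k i) (w k j)) = 0" if "i \<in> I" "j \<in> I" for i j
  proof -
    have "0 = L (\<Sum>k\<in>I. st (w k i) * w k j)"
      using urep_left[OF w that] L by (cases "i = j") (auto simp: lf_zero)
    also have "\<dots> = (\<Sum>k\<in>I. of_bool (k = i) * L (w k j) + cnj (L (w k i)) * of_bool (k = j) + Q (w k i) (w k j))"
      unfolding lf_sum[OF L(1)] using urep_eps[OF w] that by (intro sum.cong) (auto simp: LQ')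
    also have "\<dots> = L (w i j) + cnj (L (w j i)) + (\<Sum>k\<in>I. Q (w k i) (w k j))"
      using fin that by (simp add: sum.distrib)
    finally show ?thesis
      by simp
  qed
  define Z where "Z = mform I (\<lambda>i j. L (w i j)) v v"
  have Z: "Z = (\<Sum>i\<in>I. \<Sum>j\<in>I. cnj (v i) * v j * L (w i j))"
    by (simp add: Z_def mform_def mvec_def sum_distrib_left mult_ac)
  have "cnj Z = (\<Sum>i\<in>I. \<Sum>j\<in>I. cnj (v i) * v j * cnj (L (w j i)))"
    unfolding Z cnj_sum by (subst sum.swap) (simp add: mult_ac)
  moreover have "gram Q I w v = (\<Sum>i\<in>I. \<Sum>j\<in>I. cnj (v i) * v j * (\<Sum>k\<in>I. Q (w k i) (w k j)))"
  proof -
    have "gram Q I w v = (\<Sum>k\<in>I. \<Sum>i\<in>I. \<Sum>j\<in>I. cnj (v i) * v j * Q (w k i) (w k j))"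
      unfolding gram_def
      by (simp add: Q.ip_sum_left Q.ip_sum_right Q.ip_scale_left Q.ip_scale_right sum_distrib_left mult_ac)
        (intro sum.cong refl sum.swap)
    also have "\<dots> = (\<Sum>i\<in>I. \<Sum>j\<in>I. \<Sum>k\<in>I. cnj (v i) * v j * Q (w k i) (w k j))"
      by (subst sum.swap, rule sum.cong[OF refl], rule sum.swap)
    finally show ?thesis
      by (simp add: sum_distrib_left)
  qed
  ultimately have "Z + cnj Z + gram Q I w v =
      (\<Sum>i\<in>I. \<Sum>j\<in>I. cnj (v i) * v j * (L (w i j) + cnj (L (w j i)) + (\<Sum>k\<in>I. Q (w k i) (w k j))))"
    unfolding Z by (simp add: distrib_left sum.distrib)
  also have "\<dots> = 0"
    by (intro sum.neutral ballI) (simp add: id)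
  finally have "Re (Z + cnj Z + gram Q I w v) = 0"
    by simp
  then show ?thesis
    by (simp add: Z_def)
qed

text \<open>On the kernel of the counit left multiplication by a is the action of a on the Hilbert
  space, and the operators of a unitary representation x form a unitary matrix.\<close>

lemma cocycle_isometry:
  assumes q: "cocycle_form q" and x: "urep G A x" and b: "\<And>p. p \<in> A \<Longrightarrow> eps (b p) = 0"
  shows "(\<Sum>p\<in>A. q (\<Sum>r\<in>A. x p r * b r) (\<Sum>r\<in>A. x p r * b r)) = (\<Sum>p\<in>A. q (b p) (b p))"
proof -
  interpret q: semi_inner_space sc q
    using q by (simp add: cocycle_form_def)
  have q_id: "q (a * b) c = q b (st a * c)" if "eps b = 0" "eps c = 0" for a b c
  proof -
    have "q (a * b) c - cnj (eps b) * q a c = q b (st a * c) - eps c * q b (st a)"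
      using q unfolding cocycle_form_def by blast
    then show ?thesis
      using that by simp
  qed
  have "(\<Sum>p\<in>A. q (\<Sum>r\<in>A. x p r * b r) (\<Sum>r\<in>A. x p r * b r)) =
      (\<Sum>p\<in>A. \<Sum>r\<in>A. \<Sum>s\<in>A. q (b r) (st (x p r) * x p s * b s))"
    unfolding q.ip_sum_left unfolding q.ip_sum_right
    by (intro sum.cong refl) (simp add: q_id b mult.assoc)
  also have "\<dots> = (\<Sum>r\<in>A. \<Sum>s\<in>A. \<Sum>p\<in>A. q (b r) (st (x p r) * x p s * b s))"
    by (subst sum.swap, rule sum.cong[OF refl], rule sum.swap)
  also have "\<dots> = (\<Sum>r\<in>A. \<Sum>s\<in>A. q (b r) ((\<Sum>p\<in>A. st (x p r) * x p s) * b s))"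
    by (simp add: q.ip_sum_right sum_distrib_right)
  also have "\<dots> = (\<Sum>r\<in>A. \<Sum>s\<in>A. if s = r then q (b r) (b s) else 0)"
    using urep_left[OF x] by (intro sum.cong refl) auto
  finally show ?thesis
    using urep_finite[OF x] by simp
qed

text \<open>A crude bound that depends on w; it is applied to the two outer tensor factors, which
  stay fixed while the middle one varies.\<close>

lemma gram_bounded:
  assumes q: "semi_inner_space sc q" and fin: "finite I"
  obtains C where "0 \<le> C" "\<And>v. Re (gram q I w v) \<le> C\<^sup>2 * n2 I v"
proof -
  interpret q: semi_inner_space sc q by (rule q)
  define D where "D = (\<Sum>k\<in>I. (\<Sum>j\<in>I. q.nrm (w k j))\<^sup>2)"
  have "Re (gram q I w v) \<le> D * n2 I v" for v
  proof -
    have v: "cmod (v j) \<le> sqrt (n2 I v)" if "j \<in> I" for j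
      unfolding n2_def using fin that by (intro real_le_rsqrt member_le_sum) auto
    have "q.nrm (\<Sum>j\<in>J. sc (v j) (w k j)) \<le> (\<Sum>j\<in>J. cmod (v j) * q.nrm (w k j))" if "finite J" for J k
      using that
    proof (induction J rule: finite_induct)
      case (insert j J)
      then show ?case
        using q.nrm_triangle[of "sc (v j) (w k j)" "\<Sum>j\<in>J. sc (v j) (w k j)"] by (simp add: q.nrm_scale)
    qed simp
    from this[OF fin] have "q.nrm (\<Sum>j\<in>I. sc (v j) (w k j)) \<le> (\<Sum>j\<in>I. q.nrm (w k j)) * sqrt (n2 I v)" for k
    proof (rule order_trans)
      show "(\<Sum>j\<in>I. cmod (v j) * q.nrm (w k j)) \<le> (\<Sum>j\<in>I. q.nrm (w k j)) * sqrt (n2 I v)"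
        unfolding sum_distrib_right
      proof (rule sum_mono)
        fix j assume "j \<in> I"
        then have "q.nrm (w k j) * cmod (v j) \<le> q.nrm (w k j) * sqrt (n2 I v)"
          by (intro mult_left_mono v) auto
        then show "cmod (v j) * q.nrm (w k j) \<le> q.nrm (w k j) * sqrt (n2 I v)"
          by (simp add: mult.commute)
      qed
    qed
    then have "(q.nrm (\<Sum>j\<in>I. sc (v j) (w k j)))\<^sup>2 \<le> ((\<Sum>j\<in>I. q.nrm (w k j)) * sqrt (n2 I v))\<^sup>2" for k
      by (intro power_mono) auto
    then have "(q.nrm (\<Sum>j\<in>I. sc (v j) (w k j)))\<^sup>2 \<le> (\<Sum>j\<in>I. q.nrm (w k j))\<^sup>2 * n2 I v" for k
      by (simp add: power_mult_distrib)
    then have "(\<Sum>k\<in>I. (q.nrm (\<Sum>j\<in>I. sc (v j) (w k j)))\<^sup>2) \<le> (\<Sum>k\<in>I. (\<Sum>j\<in>I. q.nrm (w k j))\<^sup>2 * n2 I v)"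
      by (intro sum_mono)
    then show ?thesis
      by (simp add: gram_def q.nrm_power2 D_def sum_distrib_right)
  qed
  moreover have "0 \<le> D"
    by (simp add: D_def sum_nonneg)
  ultimately show thesis
    using that[of "sqrt D"] by simp
qed

text \<open>The element \<open>\<Sum> v x\<^sub>p\<^sub>q u\<^sub>i\<^sub>j y\<^sub>r\<^sub>s\<close> is split as \<open>\<Sum> x\<^sub>p\<^sub>q u\<^sub>i\<^sub>j (y\<^sub>r\<^sub>s - \<epsilon>(y\<^sub>r\<^sub>s)) v +
  \<Sum> x\<^sub>p\<^sub>q (u\<^sub>i\<^sub>j - \<epsilon>(u\<^sub>i\<^sub>j)) v + \<Sum> x\<^sub>p\<^sub>q v\<close>; the middle part is large and the other two are bounded independently
  of \<open>u\<close>.\<close>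

lemma gram_tensor_lower:
  assumes q: "cocycle_form q" and x: "urep G A x" and u: "urep G I u" and y: "urep G B y"
    and Cx: "0 \<le> Cx" "\<And>v. Re (gram q A x v) \<le> Cx\<^sup>2 * n2 A v"
    and Cy: "0 \<le> Cy" "\<And>v. Re (gram q B y v) \<le> Cy\<^sup>2 * n2 B v"
    and M: "Cx + Cy \<le> M" "\<And>v. M\<^sup>2 * n2 I v \<le> Re (gram q I u v)"
  shows "(M - Cx - Cy)\<^sup>2 * n2 ((A \<times> I) \<times> B) v \<le>
    Re (gram q ((A \<times> I) \<times> B) (\<lambda>(i, k) (j, l). (\<lambda>(i, k) (j, l). x i j * u k l) i j * y k l) v)"
proof -
  interpret q: semi_inner_space sc q
    using q by (simp add: cocycle_form_def)
  have q1: "q 1 a = 0" "q a 1 = 0" for a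
    using q q.ip_cnj[of a 1] by (auto simp: cocycle_form_def)
  have fin: "finite A" "finite I" "finite B"
    using x u y by (auto intro: urep_finite)
  let ?J = "(A \<times> I) \<times> B"
  let ?W = "\<lambda>(i, k) (j, l). (\<lambda>(i, k) (j, l). x i j * u k l) i j * y k l"
  have flat: "(\<Sum>z\<in>?J. f z) = (\<Sum>p\<in>A. \<Sum>i\<in>I. \<Sum>r\<in>B. f ((p, i), r))" for f :: "('b \<times> 'c) \<times> 'd \<Rightarrow> 'e::comm_monoid_add"
    by (simp add: sum.cartesian_product')
  define b where "b p i r = (\<Sum>s\<in>B. sc (v ((p, i), s)) (y r s)) - sc (v ((p, i), r)) 1" for p i r
  define c where "c p i r = (\<Sum>j\<in>I. sc (v ((p, j), r)) (u i j)) - sc (v ((p, i), r)) 1" for p i r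
  define E where "E = (\<lambda>((p, i), r). \<Sum>z\<in>?J. sc (v z) (?W ((p, i), r) z))"
  define E1 where "E1 = (\<lambda>((p, i), r). \<Sum>t\<in>A. x p t * (\<Sum>j\<in>I. u i j * b t j r))"
  define E2 where "E2 = (\<lambda>((p, i), r). \<Sum>t\<in>A. x p t * c t i r)"
  define E3 where "E3 = (\<lambda>((p, i), r). \<Sum>t\<in>A. sc (v ((t, i), r)) (x p t))"
  have E: "E z = E1 z + E2 z + E3 z" for z
  proof -
    obtain p i r where z: "z = ((p, i), r)"
      by (metis surj_pair)
    have "E1 z = E z - (\<Sum>t\<in>A. \<Sum>j\<in>I. sc (v ((t, j), r)) (x p t * u i j))"
      unfolding z E1_def E_def flat
      by (simp add: b_def right_diff_distrib sum_subtractf sum_distrib_left scl_mult_right mult.assoc)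
    moreover have "E2 z = (\<Sum>t\<in>A. \<Sum>j\<in>I. sc (v ((t, j), r)) (x p t * u i j)) - E3 z"
      unfolding z E2_def E3_def
      by (simp add: c_def right_diff_distrib sum_subtractf sum_distrib_left scl_mult_right)
    ultimately show ?thesis
      by simp
  qed
  have beps: "eps (b p i r) = 0" if "r \<in> B" for p i r
  proof -
    have "(\<Sum>s\<in>B. v ((p, i), s) * eps (y r s)) = (\<Sum>s\<in>B. if s = r then v ((p, i), s) else 0)"
      using urep_eps[OF y] that by (intro sum.cong) auto
    then show ?thesis
      using that fin by (simp add: b_def eps_sum)
  qed
  have ceps: "eps (c p i r) = 0" if "i \<in> I" for p i r
  proof -
    have "(\<Sum>j\<in>I. v ((p, j), r) * eps (u i j)) = (\<Sum>j\<in>I. if j = i then v ((p, j), r) else 0)"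
      using urep_eps[OF u] that by (intro sum.cong) auto
    then show ?thesis
      using that fin by (simp add: c_def eps_sum)
  qed
  \<comment> \<open>Subtracting a multiple of 1 moves an element into the kernel of the counit
    without changing its length for q, so these lengths add up to the Gram form of y.\<close>
  have qb: "q (b p i r) (b p i r) = q (\<Sum>s\<in>B. sc (v ((p, i), s)) (y r s)) (\<Sum>s\<in>B. sc (v ((p, i), s)) (y r s))" for p i r
    by (simp add: b_def q.ip_diff_left q.ip_diff_right q.ip_scale_left q.ip_scale_right q1)
  have qc: "q (c p i r) (c p i r) = q (\<Sum>j\<in>I. sc (v ((p, j), r)) (u i j)) (\<Sum>j\<in>I. sc (v ((p, j), r)) (u i j))" for p i r
    by (simp add: c_def q.ip_diff_left q.ip_diff_right q.ip_scale_left q.ip_scale_right q1)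
  let ?n = "\<lambda>F. (\<Sum>z\<in>?J. Re (q (F z) (F z)))"
  have n2J: "n2 ?J v = (\<Sum>p\<in>A. \<Sum>i\<in>I. \<Sum>r\<in>B. (cmod (v ((p, i), r)))\<^sup>2)"
    by (simp add: n2_def flat)
  have "?n E1 \<le> Cy\<^sup>2 * n2 ?J v"
  proof -
    have "(\<Sum>z\<in>?J. q (E1 z) (E1 z)) = (\<Sum>i\<in>I. \<Sum>r\<in>B. \<Sum>p\<in>A. q (E1 ((p, i), r)) (E1 ((p, i), r)))"
      unfolding flat by (subst sum.swap, rule sum.cong[OF refl], rule sum.swap)
    also have "\<dots> = (\<Sum>i\<in>I. \<Sum>r\<in>B. \<Sum>t\<in>A. q (\<Sum>j\<in>I. u i j * b t j r) (\<Sum>j\<in>I. u i j * b t j r))"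
      unfolding E1_def by (simp add: cocycle_isometry[OF q x] eps_sum beps)
    also have "\<dots> = (\<Sum>r\<in>B. \<Sum>t\<in>A. \<Sum>i\<in>I. q (\<Sum>j\<in>I. u i j * b t j r) (\<Sum>j\<in>I. u i j * b t j r))"
      by (subst sum.swap, rule sum.cong[OF refl], rule sum.swap)
    also have "\<dots> = (\<Sum>r\<in>B. \<Sum>t\<in>A. \<Sum>i\<in>I. q (b t i r) (b t i r))"
      by (intro sum.cong refl cocycle_isometry[OF q u]) (simp add: beps)
    also have "\<dots> = (\<Sum>t\<in>A. \<Sum>i\<in>I. \<Sum>r\<in>B. q (b t i r) (b t i r))"
      by (subst sum.swap, rule sum.cong[OF refl], rule sum.swap)
    also have "\<dots> = (\<Sum>t\<in>A. \<Sum>i\<in>I. gram q B y (\<lambda>s. v ((t, i), s)))"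
      by (simp add: qb gram_def)
    finally have "?n E1 = (\<Sum>t\<in>A. \<Sum>i\<in>I. Re (gram q B y (\<lambda>s. v ((t, i), s))))"
      by (simp only: Re_sum[symmetric])
    also have "\<dots> \<le> (\<Sum>t\<in>A. \<Sum>i\<in>I. Cy\<^sup>2 * n2 B (\<lambda>s. v ((t, i), s)))"
      by (intro sum_mono Cy)
    also have "\<dots> = Cy\<^sup>2 * n2 ?J v"
      unfolding n2J by (simp only: n2_def sum_distrib_left)
    finally show ?thesis .
  qed
  moreover have "M\<^sup>2 * n2 ?J v \<le> ?n E2"
  proof -
    have "(\<Sum>z\<in>?J. q (E2 z) (E2 z)) = (\<Sum>i\<in>I. \<Sum>r\<in>B. \<Sum>p\<in>A. q (E2 ((p, i), r)) (E2 ((p, i), r)))"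
      unfolding flat by (subst sum.swap, rule sum.cong[OF refl], rule sum.swap)
    also have "\<dots> = (\<Sum>i\<in>I. \<Sum>r\<in>B. \<Sum>t\<in>A. q (c t i r) (c t i r))"
      unfolding E2_def by (simp add: cocycle_isometry[OF q x] ceps)
    also have "\<dots> = (\<Sum>r\<in>B. \<Sum>t\<in>A. \<Sum>i\<in>I. q (c t i r) (c t i r))"
      by (subst sum.swap, rule sum.cong[OF refl], rule sum.swap)
    also have "\<dots> = (\<Sum>r\<in>B. \<Sum>t\<in>A. gram q I u (\<lambda>j. v ((t, j), r)))"
      by (simp add: qc gram_def)
    finally have e: "?n E2 = (\<Sum>r\<in>B. \<Sum>t\<in>A. Re (gram q I u (\<lambda>j. v ((t, j), r))))"
      by (simp only: Re_sum[symmetric])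
    have "M\<^sup>2 * n2 ?J v = (\<Sum>r\<in>B. \<Sum>t\<in>A. M\<^sup>2 * n2 I (\<lambda>j. v ((t, j), r)))"
    proof -
      have "(\<Sum>p\<in>A. \<Sum>i\<in>I. \<Sum>r\<in>B. (cmod (v ((p, i), r)))\<^sup>2) = (\<Sum>r\<in>B. \<Sum>p\<in>A. \<Sum>i\<in>I. (cmod (v ((p, i), r)))\<^sup>2)"
        by (subst (2) sum.swap, rule sum.cong[OF refl], rule sum.swap)
      then show ?thesis
        unfolding n2J by (simp only: n2_def sum_distrib_left)
    qed
    also have "\<dots> \<le> (\<Sum>r\<in>B. \<Sum>t\<in>A. Re (gram q I u (\<lambda>j. v ((t, j), r))))"
      by (intro sum_mono M)
    finally show ?thesis
      by (simp only: e)
  qed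
  moreover have "?n E3 \<le> Cx\<^sup>2 * n2 ?J v"
  proof -
    have "(\<Sum>z\<in>?J. q (E3 z) (E3 z)) = (\<Sum>i\<in>I. \<Sum>r\<in>B. \<Sum>p\<in>A. q (E3 ((p, i), r)) (E3 ((p, i), r)))"
      unfolding flat by (subst sum.swap, rule sum.cong[OF refl], rule sum.swap)
    also have "\<dots> = (\<Sum>i\<in>I. \<Sum>r\<in>B. gram q A x (\<lambda>t. v ((t, i), r)))"
      by (simp add: E3_def gram_def)
    finally have "?n E3 = (\<Sum>i\<in>I. \<Sum>r\<in>B. Re (gram q A x (\<lambda>t. v ((t, i), r))))"
      by (simp only: Re_sum[symmetric])
    also have "\<dots> \<le> (\<Sum>i\<in>I. \<Sum>r\<in>B. Cx\<^sup>2 * n2 A (\<lambda>t. v ((t, i), r)))"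
      by (intro sum_mono Cx)
    also have "\<dots> = Cx\<^sup>2 * n2 ?J v"
    proof -
      have "(\<Sum>p\<in>A. \<Sum>i\<in>I. \<Sum>r\<in>B. (cmod (v ((p, i), r)))\<^sup>2) = (\<Sum>i\<in>I. \<Sum>r\<in>B. \<Sum>p\<in>A. (cmod (v ((p, i), r)))\<^sup>2)"
        by (subst sum.swap, rule sum.cong[OF refl], rule sum.swap)
      then show ?thesis
        unfolding n2J by (simp only: n2_def sum_distrib_left)
    qed
    finally show ?thesis .
  qed
  ultimately have b: "sqrt (?n E1) \<le> Cy * sqrt (n2 ?J v)" "M * sqrt (n2 ?J v) \<le> sqrt (?n E2)"
    "sqrt (?n E3) \<le> Cx * sqrt (n2 ?J v)"
    using Cx(1) Cy(1) M(1) real_sqrt_le_mono[of "?n E1" "Cy\<^sup>2 * n2 ?J v"]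
      real_sqrt_le_mono[of "M\<^sup>2 * n2 ?J v" "?n E2"] real_sqrt_le_mono[of "?n E3" "Cx\<^sup>2 * n2 ?J v"]
    by (simp_all add: real_sqrt_mult)
  let ?N = "\<lambda>F. L2_set (\<lambda>z. q.nrm (F z)) ?J"
  have N: "?N F = sqrt (?n F)" for F
    by (simp add: L2_set_def q.nrm_power2)
  have tri: "?N (\<lambda>z. F z + F' z) \<le> ?N F + ?N F'" for F F'
  proof -
    have "?N (\<lambda>z. F z + F' z) \<le> L2_set (\<lambda>z. q.nrm (F z) + q.nrm (F' z)) ?J"
      by (intro L2_set_mono q.nrm_triangle q.nrm_nonneg)
    also have "\<dots> \<le> ?N F + ?N F'"
      by (rule L2_set_triangle_ineq)
    finally show ?thesis .
  qed
  \<comment> \<open>By the triangle inequality the length of E is at least that of E2 less those of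
    E1 and E3, so the outer factors cost only the constants Cy and Cx.\<close>
  have "E2 = (\<lambda>z. E z + (- E1 z + - E3 z))"
    by (rule ext) (simp add: E)
  then have "?N E2 \<le> ?N E + (?N (\<lambda>z. - E1 z) + ?N (\<lambda>z. - E3 z))"
    using tri[of E "\<lambda>z. - E1 z + - E3 z"] tri[of "\<lambda>z. - E1 z" "\<lambda>z. - E3 z"] by simp
  moreover have "q.nrm (- a) = q.nrm a" for a
    by (simp add: q.nrm_def q.ip_uminus_left q.ip_uminus_right)
  ultimately have "?N E2 \<le> ?N E + (?N E1 + ?N E3)"
    by simp
  then have "(M - Cx - Cy) * sqrt (n2 ?J v) \<le> sqrt (?n E)"
    using b by (simp add: N left_diff_distrib)
  then have "((M - Cx - Cy) * sqrt (n2 ?J v))\<^sup>2 \<le> (sqrt (?n E))\<^sup>2"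
    using M(1) by (intro power_mono) auto
  then have "(M - Cx - Cy)\<^sup>2 * n2 ?J v \<le> ?n E"
    by (simp add: power_mult_distrib sum_nonneg q.ip_nonneg)
  also have "?n E = Re (gram q ?J ?W v)"
    unfolding gram_def Re_sum by (intro sum.cong refl) (auto simp: E_def)
  finally show ?thesis .
qed

lemma slice_sum:
  assumes "p \<in> A" "r \<in> B" "finite A" "finite I" "finite B"
    and h: "\<And>p' i r'. (p', r') \<noteq> (p, r) \<Longrightarrow> h ((p', i), r') = 0"
  shows "(\<Sum>z\<in>(A \<times> I) \<times> B. h z) = (\<Sum>i\<in>I. h ((p, i), r))"
proof -
  have "(\<Sum>z\<in>(A \<times> I) \<times> B. h z) = (\<Sum>z\<in>(\<lambda>i. ((p, i), r)) ` I. h z)"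
    using assms by (intro sum.mono_neutral_right) auto
  also have "\<dots> = (\<Sum>i\<in>I. h ((p, i), r))"
    by (subst sum.reindex) (auto simp: inj_on_def)
  finally show ?thesis .
qed

text \<open>For coefficients b and c of representations x and y the elements b u_ij c are entries of
  x \<otimes> u \<otimes> y with outer indices fixed. Their matrix is a compression of an
  exponential whose generator is strongly dissipative by \<open>gram_tensor_lower\<close>. General b
  and c follow by bilinearity; the threshold M depends on them, on t and on \<delta>, but not on
  u.\<close>

lemma cexp_mixing:
  assumes q: "cocycle_form q" and LQ: "generating L Q" and qQ: "\<And>a. Re (q a a) \<le> 2 * Re (Q a a)"
    and t: "0 < t" and \<delta>: "0 < \<delta>"
  shows "\<exists>M\<ge>0. \<forall>(n::nat) u. urep G {..<n} u \<longrightarrow> (\<forall>v. M\<^sup>2 * n2 {..<n} v \<le> Re (gram q {..<n} u v)) \<longrightarrow>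
    (\<forall>x v. cmod (\<Sum>i<n. \<Sum>j<n. cnj (x i) * v j * cexp (\<lambda>a. of_real t * L a) (b * u i j * c)) \<le>
      \<delta> * (sqrt (n2 {..<n} x) * sqrt (n2 {..<n} v)))"
proof -
  let ?L = "\<lambda>a. of_real t * L a" and ?Q = "\<lambda>a b. of_real t * Q a b"
  define good where "good M n u \<longleftrightarrow> urep G {..<n} u \<and> (\<forall>v. M\<^sup>2 * n2 {..<n} v \<le> Re (gram q {..<n} u v))"
    for M and n :: nat and u
  define est where "est \<delta> b c n u \<longleftrightarrow> (\<forall>x v. cmod (\<Sum>i<n. \<Sum>j<n. cnj (x i) * v j * cexp ?L (b * u i j * c)) \<le>
      \<delta> * (sqrt (n2 {..<n} x) * sqrt (n2 {..<n} v)))" for \<delta> b c and n :: nat and u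
  have good_mono: "good M n u" if "good M' n u" "0 \<le> M" "M \<le> M'" for M M' n u
  proof -
    have "M\<^sup>2 * n2 {..<n} v \<le> M'\<^sup>2 * n2 {..<n} v" for v
      using that by (intro mult_right_mono power_mono) auto
    then show ?thesis
      using that unfolding good_def by (meson order_trans)
  qed
  have gL: "generating ?L ?Q"
    using generating_scale[OF LQ] t by simp
  have L: "linear_form G ?L" and Q: "semi_inner_space sc Q"
    using gL LQ by (auto simp: generating_def)
  have lf: "linear_form G (cexp ?L)"
    by (rule cexp_lf[OF L])
  \<comment> \<open>Each summand gets half of \<delta>, and the larger threshold serves both. Stated
    for pairs, this covers additivity in b as well as in c.\<close>
  have est_add: "\<forall>\<delta>>0. \<exists>M\<ge>0. \<forall>n u. good M n u \<longrightarrow> est \<delta> b' c' n u"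
    if 1: "\<forall>\<delta>>0. \<exists>M\<ge>0. \<forall>n u. good M n u \<longrightarrow> est \<delta> b1 c1 n u"
      and 2: "\<forall>\<delta>>0. \<exists>M\<ge>0. \<forall>n u. good M n u \<longrightarrow> est \<delta> b2 c2 n u"
      and eq: "\<And>z. b' * z * c' = b1 * z * c1 + b2 * z * c2" for b' c' b1 b2 c1 c2
  proof (intro allI impI)
    fix \<delta> :: real assume "0 < \<delta>"
    then have "0 < \<delta> / 2"
      by simp
    then obtain M1 M2 where M: "M1 \<ge> 0" "\<And>n u. good M1 n u \<Longrightarrow> est (\<delta> / 2) b1 c1 n u"
      "M2 \<ge> 0" "\<And>n u. good M2 n u \<Longrightarrow> est (\<delta> / 2) b2 c2 n u"
      using 1 2 by blast
    have "est \<delta> b' c' n u" if "good (max M1 M2) n u" for n u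
      unfolding est_def
    proof (intro allI)
      fix x v
      have "good M1 n u" "good M2 n u"
        using good_mono[OF that] M by auto
      then have e: "est (\<delta> / 2) b1 c1 n u" "est (\<delta> / 2) b2 c2 n u"
        using M by auto
      have "(\<Sum>i<n. \<Sum>j<n. cnj (x i) * v j * cexp ?L (b' * u i j * c')) =
          (\<Sum>i<n. \<Sum>j<n. cnj (x i) * v j * cexp ?L (b1 * u i j * c1)) + (\<Sum>i<n. \<Sum>j<n. cnj (x i) * v j * cexp ?L (b2 * u i j * c2))"
        using lf by (simp add: eq lf_iff distrib_left sum.distrib)
      also have "cmod \<dots> \<le> \<delta> / 2 * (sqrt (n2 {..<n} x) * sqrt (n2 {..<n} v)) + \<delta> / 2 * (sqrt (n2 {..<n} x) * sqrt (n2 {..<n} v))"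
        using e unfolding est_def by (intro order_trans[OF norm_triangle_ineq] add_mono) auto
      also have "\<dots> = \<delta> * (sqrt (n2 {..<n} x) * sqrt (n2 {..<n} v))"
        by simp
      finally show "cmod (\<Sum>i<n. \<Sum>j<n. cnj (x i) * v j * cexp ?L (b' * u i j * c')) \<le>
          \<delta> * (sqrt (n2 {..<n} x) * sqrt (n2 {..<n} v))" .
    qed
    then show "\<exists>M\<ge>0. \<forall>n u. good M n u \<longrightarrow> est \<delta> b' c' n u"
      using M by (intro exI[of _ "max M1 M2"]) auto
  qed
  have est_scl: "\<forall>\<delta>>0. \<exists>M\<ge>0. \<forall>n u. good M n u \<longrightarrow> est \<delta> b' c' n u"
    if 1: "\<forall>\<delta>>0. \<exists>M\<ge>0. \<forall>n u. good M n u \<longrightarrow> est \<delta> b1 c1 n u"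
      and eq: "\<And>z. b' * z * c' = sc k (b1 * z * c1)" for k b' c' b1 c1
  proof (intro allI impI)
    fix \<delta> :: real assume "0 < \<delta>"
    \<comment> \<open>The added 1 covers k = 0.\<close>
    then have "0 < \<delta> / (cmod k + 1)"
      by (simp add: add_nonneg_pos)
    then obtain M where M: "M \<ge> 0" "\<And>n u. good M n u \<Longrightarrow> est (\<delta> / (cmod k + 1)) b1 c1 n u"
      using 1 by blast
    have "est \<delta> b' c' n u" if "good M n u" for n u
      unfolding est_def
    proof (intro allI)
      fix x v
      have "(\<Sum>i<n. \<Sum>j<n. cnj (x i) * v j * cexp ?L (b' * u i j * c')) =
          k * (\<Sum>i<n. \<Sum>j<n. cnj (x i) * v j * cexp ?L (b1 * u i j * c1))"
        using lf by (simp only: eq lf_iff sum_distrib_left mult.left_commute)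
      also have "cmod \<dots> \<le> cmod k * (\<delta> / (cmod k + 1) * (sqrt (n2 {..<n} x) * sqrt (n2 {..<n} v)))"
        unfolding norm_mult using M(2)[OF that] by (intro mult_left_mono) (auto simp: est_def)
      also have "\<dots> = (cmod k / (cmod k + 1)) * (\<delta> * (sqrt (n2 {..<n} x) * sqrt (n2 {..<n} v)))"
        by simp
      also have "\<dots> \<le> 1 * (\<delta> * (sqrt (n2 {..<n} x) * sqrt (n2 {..<n} v)))"
        using \<open>0 < \<delta>\<close> by (intro mult_right_mono) (auto simp: divide_le_eq_1 add_nonneg_pos)
      finally show "cmod (\<Sum>i<n. \<Sum>j<n. cnj (x i) * v j * cexp ?L (b' * u i j * c')) \<le>
          \<delta> * (sqrt (n2 {..<n} x) * sqrt (n2 {..<n} v))"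
        by simp
    qed
    then show "\<exists>M\<ge>0. \<forall>n u. good M n u \<longrightarrow> est \<delta> b' c' n u"
      using M(1) by blast
  qed
  have "\<forall>\<delta>>0. \<exists>M\<ge>0. \<forall>n u. good M n u \<longrightarrow> est \<delta> b c n u"
  proof (induction b rule: pol_induct)
    case x: (coeff nx x p p')
    show ?case
    proof (induction c rule: pol_induct)
      case y: (coeff ny y r r')
      let ?A = "{..<nx}" and ?B = "{..<ny}"
      have q0: "semi_inner_space sc q"
        using q by (simp add: cocycle_form_def)
      obtain Cx where Cx: "0 \<le> Cx" "\<And>v. Re (gram q ?A x v) \<le> Cx\<^sup>2 * n2 ?A v"
        by (rule gram_bounded[OF q0 finite_lessThan, of nx x], blast)
      obtain Cy where Cy: "0 \<le> Cy" "\<And>v. Re (gram q ?B y v) \<le> Cy\<^sup>2 * n2 ?B v"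
        by (rule gram_bounded[OF q0 finite_lessThan, of ny y], blast)
      show ?case
      proof (intro allI impI)
        fix \<delta> :: real assume \<delta>: "0 < \<delta>"
        \<comment> \<open>exp (- K) = \<delta>. The factor 4 in M compensates two halvings, one from
          q \<le> 2 Q and one from 2 Re L = - Q in \<open>generating_dissipative\<close>; the
          absolute value covers \<delta> > 1.\<close>
        define K where "K = - ln \<delta>"
        define M where "M = Cx + Cy + sqrt (4 * \<bar>K\<bar> / t)"
        have M: "0 \<le> M" "Cx + Cy \<le> M" "(M - Cx - Cy)\<^sup>2 = 4 * \<bar>K\<bar> / t"
          using Cx(1) Cy(1) t by (auto simp: M_def)
        have "est \<delta> (x p p') (y r r') n u" if g: "good M n u" for n u
          unfolding est_def
        proof (intro allI)
          fix \<xi> \<eta> :: "nat \<Rightarrow> complex"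
          let ?I = "{..<n}"
          let ?J = "(?A \<times> ?I) \<times> ?B"
          let ?W = "\<lambda>(i, k) (j, l). (\<lambda>(i, k) (j, l). x i j * u k l) i j * y k l"
          have u: "urep G ?I u"
            using g by (simp add: good_def)
          have W: "urep G ?J ?W"
            by (rule urep_tensor[OF urep_tensor[OF x(1) u] y(1)])
          have diss: "Re (mform ?J (\<lambda>i j. ?L (?W i j)) v v) \<le> - K * n2 ?J v" for v
          proof -
            have "(M - Cx - Cy)\<^sup>2 * n2 ?J v \<le> Re (gram q ?J ?W v)"
              using g by (intro gram_tensor_lower[OF q x(1) u y(1) Cx Cy M(2)]) (auto simp: good_def)
            also have "\<dots> \<le> 2 * Re (gram Q ?J ?W v)"
              unfolding gram_def Re_sum sum_distrib_left by (intro sum_mono qQ)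
            finally have "t * ((M - Cx - Cy)\<^sup>2 * n2 ?J v) \<le> t * (2 * Re (gram Q ?J ?W v))"
              using t by (intro mult_left_mono) auto
            moreover have "Re (gram ?Q ?J ?W v) = t * Re (gram Q ?J ?W v)"
              by (simp add: gram_def sum_distrib_left)
            ultimately have "t * (M - Cx - Cy)\<^sup>2 * n2 ?J v \<le> - 4 * Re (mform ?J (\<lambda>i j. ?L (?W i j)) v v)"
              using generating_dissipative[OF gL W, of v] by simp
            moreover have "t * (M - Cx - Cy)\<^sup>2 = 4 * \<bar>K\<bar>"
              using t by (simp add: M(3))
            ultimately have "4 * \<bar>K\<bar> * n2 ?J v \<le> - 4 * Re (mform ?J (\<lambda>i j. ?L (?W i j)) v v)"
              by simp
            moreover have "K * n2 ?J v \<le> \<bar>K\<bar> * n2 ?J v"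
              by (intro mult_right_mono) auto
            ultimately show ?thesis
              by simp
          qed
          \<comment> \<open>Vectors supported on the slices with outer indices (p, r) and (p', r')
            pick out the required block of the exponential.\<close>
          define X where "X = (\<lambda>((p0, i), r0). if p0 = p \<and> r0 = r then \<xi> i else 0)"
          define Y where "Y = (\<lambda>((p0, i), r0). if p0 = p' \<and> r0 = r' then \<eta> i else 0)"
          have pr: "p \<in> ?A" "p' \<in> ?A" "r \<in> ?B" "r' \<in> ?B"
            using x y by auto
          have fin: "finite ?A" "finite ?I" "finite ?B"
            by auto
          have nX: "n2 ?J X = n2 ?I \<xi>" "n2 ?J Y = n2 ?I \<eta>"
            unfolding n2_def using pr by (subst slice_sum[OF _ _ fin, of p r] slice_sum[OF _ _ fin, of p' r'];
                auto simp: X_def Y_def)+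
          have entry: "mexp ?J (\<lambda>i j. ?L (?W i j)) ((p, i), r) ((p', j), r') = cexp ?L (x p p' * u i j * y r r')"
            if "i \<in> ?I" "j \<in> ?I" for i j
            using cexp_urep[OF W L, of "((p, i), r)" "((p', j), r')"] that pr by simp
          have mv: "mvec ?J (mexp ?J (\<lambda>i j. ?L (?W i j))) Y z = (\<Sum>j\<in>?I. mexp ?J (\<lambda>i j. ?L (?W i j)) z ((p', j), r') * \<eta> j)" for z
            unfolding mvec_def using pr by (subst slice_sum[OF _ _ fin, of p' r']) (auto simp: Y_def)
          have "mform ?J (mexp ?J (\<lambda>i j. ?L (?W i j))) X Y =
              (\<Sum>i\<in>?I. cnj (\<xi> i) * (\<Sum>j\<in>?I. mexp ?J (\<lambda>i j. ?L (?W i j)) ((p, i), r) ((p', j), r') * \<eta> j))"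
            unfolding mform_def mv using pr by (subst slice_sum[OF _ _ fin, of p r]) (auto simp: X_def)
          also have "\<dots> = (\<Sum>i<n. \<Sum>j<n. cnj (\<xi> i) * \<eta> j * cexp ?L (x p p' * u i j * y r r'))"
            unfolding sum_distrib_left by (intro sum.cong refl) (simp only: entry mult_ac)
          finally have eq: "mform ?J (mexp ?J (\<lambda>i j. ?L (?W i j))) X Y =
              (\<Sum>i<n. \<Sum>j<n. cnj (\<xi> i) * \<eta> j * cexp ?L (x p p' * u i j * y r r'))" .
          have "finite ?J"
            by auto
          from mform_mexp_decay[OF this diss, of X Y]
          show "cmod (\<Sum>i<n. \<Sum>j<n. cnj (\<xi> i) * \<eta> j * cexp ?L (x p p' * u i j * y r r')) \<le>
              \<delta> * (sqrt (n2 {..<n} \<xi>) * sqrt (n2 {..<n} \<eta>))"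
            unfolding eq nX using \<delta> by (simp add: K_def)
        qed
        then show "\<exists>M\<ge>0. \<forall>n u. good M n u \<longrightarrow> est \<delta> (x p p') (y r r') n u"
          using M(1) by blast
      qed
    next
      case (add c d)
      then show ?case
        by (rule est_add) (simp add: distrib_left)
    next
      case (scl k c)
      then show ?case
        by (rule est_scl) (simp only: scl_mult_right)
    qed
  next
    case (add b d)
    then show ?case
      by (rule est_add) (simp add: distrib_right)
  next
    case (scl k b)
    then show ?case
      by (rule est_scl) (simp only: scl_mult_left)
  qed
  then show ?thesis
    using \<delta> unfolding good_def est_def by blast
qed

lemma cexp_tendsto_eps:
  assumes L: "linear_form G L"
  shows "(\<lambda>n. cexp (\<lambda>a. of_real (inverse (real (Suc n))) * L a) b) \<longlonglongrightarrow> eps b"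
proof -
  have Ln: "linear_form G (\<lambda>a. of_real t * L a)" for t
    using L by (auto simp: lf_iff algebra_simps)
  show ?thesis
  proof (induction b rule: pol_induct)
    case (coeff m u i j)
    obtain d where d: "0 \<le> d" "\<And>i j. i \<in> {..<m} \<Longrightarrow> j \<in> {..<m} \<Longrightarrow> cmod (L (u i j)) \<le> d"
      by (rule matrix_entries_bounded[of "{..<m}" "\<lambda>i j. L (u i j)"]) auto
    have "(\<lambda>n. mexp {..<m} (\<lambda>i j. of_real (inverse (real (Suc n))) * L (u i j)) i j) \<longlonglongrightarrow> mexp {..<m} (\<lambda>_ _. 0) i j"
    proof (rule mexp_tendsto[where d = d])
      show "(\<lambda>n. of_real (inverse (real (Suc n))) * L (u i j)) \<longlonglongrightarrow> 0" for i j
      proof -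
        have "(\<lambda>n. of_real (inverse (real (Suc n))) * L (u i j)) \<longlonglongrightarrow> of_real 0 * L (u i j)"
          by (intro tendsto_mult_right tendsto_of_real LIMSEQ_inverse_real_of_nat)
        then show ?thesis
          by simp
      qed
      show "cmod (of_real (inverse (real (Suc n))) * L (u i j)) \<le> d" if "i \<in> {..<m}" "j \<in> {..<m}" for n i j
      proof -
        have "cmod (of_real (inverse (real (Suc n))) * L (u i j)) = inverse (real (Suc n)) * cmod (L (u i j))"
          by (simp only: norm_mult norm_of_real) simp
        also have "\<dots> \<le> 1 * d"
          using d(2)[OF that] by (intro mult_mono) (auto simp: field_simps)
        finally show ?thesis
          by simp
      qed
    qed (use coeff d in auto)
    moreover have "mexp {..<m} (\<lambda>_ _. 0) i j = eps (u i j)"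
    proof -
      have "mpow {..<m} (\<lambda>_ _. 0) k i j / fact k = (if k = 0 then of_bool (i = j) else 0)" for k
        by (cases k) auto
      then have "(\<lambda>k. mpow {..<m} (\<lambda>_ _. 0) k i j / fact k) sums of_bool (i = j)"
        using sums_single[of 0 "\<lambda>_. of_bool (i = j) :: complex"] by (simp only:)
      then show ?thesis
        using urep_eps[OF coeff(1)] coeff unfolding mexp_def by (simp add: sums_iff)
    qed
    ultimately show ?case
      using coeff by (simp only: cexp_urep[OF coeff(1) Ln] lessThan_iff)
  next
    case (add a b)
    then show ?case
      using tendsto_add[OF add] cexp_lf[OF Ln] by (simp only: lf_iff eps_add)
  next
    case (scl c a)
    then show ?case
      using tendsto_mult_left[OF scl, of c] cexp_lf[OF Ln] by (simp only: lf_iff eps_scl)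
  qed
qed

end

section \<open>Representations on completions\<close>

lemma irr_representative:
  assumes "irr_representatives G u" "\<beta> \<in> Irr G" shows "irreducible_unitary_rep G (u \<beta>)"
proof -
  have "u \<beta> \<in> \<beta>"
    using assms by (auto simp: irr_representatives_def)
  then show ?thesis
    using assms(2) by (auto simp: Irr_def quotient_def)
qed

section \<open>Operator norm and sesquilinear forms\<close>

lemma sqrt_n2: "sqrt (n2 {..<dim_vec v} (\<lambda>i. v $ i)) = vec_norm2 v"
  by (simp add: n2_def vec_norm2_def)

lemma mult_mat_vec_entry:
  "A \<in> carrier_mat m n \<Longrightarrow> v \<in> carrier_vec n \<Longrightarrow> i < m \<Longrightarrow> (A *\<^sub>v v) $ i = (\<Sum>j<n. A $$ (i, j) * v $ j)"
  by (auto simp: scalar_prod_def lessThan_atLeast0 intro!: sum.cong)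

text \<open>Testing the form with x = A v bounds the squared length of A v by \<delta> times the
  lengths of A v and v.\<close>

lemma mat_opnorm_le:
  assumes A: "A \<in> carrier_mat n n" and \<delta>: "0 \<le> \<delta>"
    and bound: "\<And>x v. cmod (\<Sum>i<n. \<Sum>j<n. cnj (x i) * v j * A $$ (i, j)) \<le> \<delta> * (sqrt (n2 {..<n} x) * sqrt (n2 {..<n} v))"
  shows "mat_opnorm A \<le> \<delta>"
  unfolding mat_opnorm_def
proof (rule cSup_least)
  have "vec_norm2 (0\<^sub>v (dim_col A) :: complex vec) \<le> 1"
    by (simp add: vec_norm2_def)
  then show "{vec_norm2 (A *\<^sub>v v) |v. v \<in> carrier_vec (dim_col A) \<and> vec_norm2 v \<le> 1} \<noteq> {}"
    using zero_carrier_vec[of "dim_col A"] by blast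
next
  fix y assume "y \<in> {vec_norm2 (A *\<^sub>v v) |v. v \<in> carrier_vec (dim_col A) \<and> vec_norm2 v \<le> 1}"
  then obtain v where v: "v \<in> carrier_vec n" "vec_norm2 v \<le> 1" and y: "y = vec_norm2 (A *\<^sub>v v)"
    using A by auto
  define w where "w = A *\<^sub>v v"
  have w: "dim_vec w = n" "dim_vec v = n"
    using A v by (auto simp: w_def)
  have "(\<Sum>i<n. \<Sum>j<n. cnj (w $ i) * v $ j * A $$ (i, j)) = (\<Sum>i<n. cnj (w $ i) * w $ i)"
  proof (rule sum.cong[OF refl])
    fix i assume "i \<in> {..<n}"
    then have "w $ i = (\<Sum>j<n. A $$ (i, j) * v $ j)"
      using mult_mat_vec_entry[OF A v(1)] by (simp add: w_def)
    then have "cnj (w $ i) * w $ i = cnj (w $ i) * (\<Sum>j<n. A $$ (i, j) * v $ j)"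
      by (simp only:)
    then show "(\<Sum>j<n. cnj (w $ i) * v $ j * A $$ (i, j)) = cnj (w $ i) * w $ i"
      by (simp add: sum_distrib_left mult_ac)
  qed
  also have "\<dots> = of_real (n2 {..<n} (\<lambda>i. w $ i))"
    by (simp add: n2_def complex_norm_square mult.commute del: of_real_power)
  finally have "n2 {..<n} (\<lambda>i. w $ i) \<le> \<delta> * (sqrt (n2 {..<n} (\<lambda>i. w $ i)) * sqrt (n2 {..<n} (\<lambda>j. v $ j)))"
    using bound[of "\<lambda>i. w $ i" "\<lambda>j. v $ j"] by simp
  then have "vec_norm2 w * vec_norm2 w \<le> \<delta> * vec_norm2 v * vec_norm2 w"
    using sqrt_n2[of v] sqrt_n2[of w] w by (simp add: mult_ac) (metis n2_nonneg real_sqrt_mult_self abs_of_nonneg)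
  moreover have "0 \<le> vec_norm2 w" "0 \<le> vec_norm2 v"
    by (simp_all add: vec_norm2_def sum_nonneg)
  ultimately have "vec_norm2 w \<le> \<delta> * vec_norm2 v"
    using \<delta> by (cases "vec_norm2 w = 0") auto
  also have "\<dots> \<le> \<delta> * 1"
    using v \<delta> by (intro mult_left_mono)
  finally show "y \<le> \<delta>"
    by (simp add: y w_def)
qed

lemma mat_opnorm_form_le:
  assumes A: "A \<in> carrier_mat n n"
  shows "cmod (\<Sum>i<n. \<Sum>j<n. cnj (v i) * v j * A $$ (i, j)) \<le> mat_opnorm A * n2 {..<n} v"
proof (cases "n2 {..<n} v = 0")
  case True
  then have "v i = 0" if "i < n" for i
    using that by (auto simp: n2_def sum_nonneg_eq_0_iff)
  then show ?thesis
    by (simp add: True)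
next
  case False
  define r where "r = sqrt (n2 {..<n} v)"
  have r: "0 < r" "r\<^sup>2 = n2 {..<n} v"
    using False n2_nonneg[of "{..<n}" v] by (auto simp: r_def less_le)
  define w where "w = vec n (\<lambda>i. v i / of_real r)"
  have w: "w \<in> carrier_vec n"
    by (simp add: w_def)
  have "vec_norm2 w = sqrt (n2 {..<n} v / r\<^sup>2)"
    using r(1) by (simp add: vec_norm2_def n2_def w_def norm_divide power_divide sum_divide_distrib)
  then have w1: "vec_norm2 w = 1"
    using r False by simp
  have "vec_norm2 (A *\<^sub>v w) \<le> mat_opnorm A"
    unfolding mat_opnorm_def
  proof (rule cSup_upper)
    \<comment> \<open>The operator norm is a supremum of reals, so it dominates its members only
      once boundedness is known; the sum of the moduli of all entries is a bound.\<close>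
    show "bdd_above {vec_norm2 (A *\<^sub>v v) |v. v \<in> carrier_vec (dim_col A) \<and> vec_norm2 v \<le> 1}"
    proof (rule bdd_aboveI)
      fix y assume "y \<in> {vec_norm2 (A *\<^sub>v v) |v. v \<in> carrier_vec (dim_col A) \<and> vec_norm2 v \<le> 1}"
      then obtain v where v: "v \<in> carrier_vec n" "vec_norm2 v \<le> 1" and y: "y = vec_norm2 (A *\<^sub>v v)"
        using A by auto
      have vj: "cmod (v $ j) \<le> 1" if "j < n" for j
      proof -
        have "cmod (v $ j) \<le> vec_norm2 v"
          unfolding vec_norm2_def using v that by (intro real_le_rsqrt member_le_sum) auto
        then show ?thesis
          using v by simp
      qed
      have "y = L2_set (\<lambda>i. cmod ((A *\<^sub>v v) $ i)) {..<n}"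
        using A by (simp add: y vec_norm2_def L2_set_def)
      also have "\<dots> \<le> (\<Sum>i<n. cmod ((A *\<^sub>v v) $ i))"
        by (rule L2_set_le_sum) simp
      also have "\<dots> \<le> (\<Sum>i<n. \<Sum>j<n. cmod (A $$ (i, j)))"
      proof (rule sum_mono)
        fix i assume "i \<in> {..<n}"
        then have "cmod ((A *\<^sub>v v) $ i) = cmod (\<Sum>j<n. A $$ (i, j) * v $ j)"
          using mult_mat_vec_entry[OF A v(1)] by simp
        also have "\<dots> \<le> (\<Sum>j<n. cmod (A $$ (i, j) * v $ j))"
          by (rule norm_sum)
        also have "\<dots> \<le> (\<Sum>j<n. cmod (A $$ (i, j)))"
          using vj by (intro sum_mono) (simp add: norm_mult mult_left_le)
        finally show "cmod ((A *\<^sub>v v) $ i) \<le> (\<Sum>j<n. cmod (A $$ (i, j)))" .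
      qed
      finally show "y \<le> (\<Sum>i<n. \<Sum>j<n. cmod (A $$ (i, j)))" .
    qed
    show "vec_norm2 (A *\<^sub>v w) \<in> {vec_norm2 (A *\<^sub>v v) |v. v \<in> carrier_vec (dim_col A) \<and> vec_norm2 v \<le> 1}"
      using A w w1 by auto
  qed
  moreover have "(\<Sum>i<n. \<Sum>j<n. cnj (v i) * v j * A $$ (i, j)) = of_real r * (\<Sum>i<n. cnj (v i) * (A *\<^sub>v w) $ i)"
    using r(1) mult_mat_vec_entry[OF A w] by (simp add: sum_distrib_left w_def mult_ac)
  then have "cmod (\<Sum>i<n. \<Sum>j<n. cnj (v i) * v j * A $$ (i, j)) \<le> r * (r * vec_norm2 (A *\<^sub>v w))"
    using cauchy_schwarz_n2[of v "\<lambda>i. (A *\<^sub>v w) $ i" "{..<n}"] r(1) sqrt_n2[of "A *\<^sub>v w"] A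
    by (simp add: norm_mult r_def)
  moreover have "r * (r * vec_norm2 (A *\<^sub>v w)) = vec_norm2 (A *\<^sub>v w) * n2 {..<n} v"
    unfolding r(2)[symmetric] power2_eq_square by (simp only: mult_ac)
  ultimately show ?thesis
    using mult_right_mono[OF _ n2_nonneg[of "{..<n}" v], of "vec_norm2 (A *\<^sub>v w)" "mat_opnorm A"] by linarith
qed

text \<open>\<open>act_one\<close> is an equation modulo null vectors: for a cocycle form the action
  is \<open>a * centre x\<close>, and \<open>centre x\<close> differs from x by a multiple of 1,
  which has length zero. Boundedness of the action follows from the relations.\<close>

locale star_action = cqg G S + semi_inner_space scale ip
  for G :: "('a::ring_1) cqg" and S and scale :: "complex \<Rightarrow> 'v::ab_group_add \<Rightarrow> 'v" and ip +
  fixes \<rho> :: "'a \<Rightarrow> 'v \<Rightarrow> 'v"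
  assumes act_add: "\<rho> a (x + y) = \<rho> a x + \<rho> a y" and act_scale: "\<rho> a (scale c x) = scale c (\<rho> a x)"
    and act_plus: "\<rho> (a + b) x = \<rho> a x + \<rho> b x" and act_scl: "\<rho> (scl G c a) x = scale c (\<rho> a x)"
    and act_star: "ip (\<rho> (star G a) x) y = ip x (\<rho> a y)"
    and act_mult: "\<rho> (a * b) x = \<rho> a (\<rho> b x)"
    and act_one: "ip y (\<rho> 1 x) = ip y x"
begin

lemma act_zero: "\<rho> 0 x = 0"
  using act_plus[of 0 0 x] by simp

lemma act_sum: "\<rho> (sum f A) x = (\<Sum>i\<in>A. \<rho> (f i) x)"
  by (induction A rule: infinite_finite_induct) (simp_all add: act_zero act_plus)

lemma act_urep:
  assumes u: "urep G I u" and "i \<in> I" "j \<in> I"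
  shows "(\<Sum>k\<in>I. ip (\<rho> (u k i) x) (\<rho> (u k j) y)) = of_bool (i = j) * ip x y"
proof -
  have "(\<Sum>k\<in>I. ip (\<rho> (u k i) x) (\<rho> (u k j) y)) = (\<Sum>k\<in>I. ip x (\<rho> (st (u k i) * u k j) y))"
    using act_star[of "st (u _ i)"] by (simp add: act_mult)
  also have "\<dots> = ip x (\<rho> (\<Sum>k\<in>I. st (u k i) * u k j) y)"
    by (simp add: act_sum ip_sum_right)
  also have "\<dots> = of_bool (i = j) * ip x y"
    using urep_left[OF assms] by (simp add: act_one act_zero)
  finally show ?thesis .
qed

lemma act_urep_norm:
  assumes u: "urep G I u"
  shows "(\<Sum>k\<in>I. (nrm (\<Sum>j\<in>I. scale (v j) (\<rho> (u k j) x)))\<^sup>2) = n2 I v * (nrm x)\<^sup>2"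
proof -
  have fin: "finite I"
    by (rule urep_finite[OF u])
  have "(\<Sum>k\<in>I. ip (\<Sum>j\<in>I. scale (v j) (\<rho> (u k j) x)) (\<Sum>j\<in>I. scale (v j) (\<rho> (u k j) x))) =
      (\<Sum>k\<in>I. \<Sum>i\<in>I. \<Sum>j\<in>I. cnj (v i) * v j * ip (\<rho> (u k i) x) (\<rho> (u k j) x))"
    by (simp add: ip_sum_left ip_scale_left) (simp add: ip_sum_right ip_scale_right sum_distrib_left mult_ac)
  also have "\<dots> = (\<Sum>i\<in>I. \<Sum>k\<in>I. \<Sum>j\<in>I. cnj (v i) * v j * ip (\<rho> (u k i) x) (\<rho> (u k j) x))"
    by (rule sum.swap)
  also have "\<dots> = (\<Sum>i\<in>I. \<Sum>j\<in>I. cnj (v i) * v j * (\<Sum>k\<in>I. ip (\<rho> (u k i) x) (\<rho> (u k j) x)))"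
    unfolding sum_distrib_left by (rule sum.cong[OF refl], rule sum.swap)
  also have "\<dots> = (\<Sum>i\<in>I. \<Sum>j\<in>I. cnj (v i) * v j * (of_bool (i = j) * ip x x))"
    by (intro sum.cong refl) (simp only: act_urep[OF u])
  also have "\<dots> = (\<Sum>i\<in>I. cnj (v i) * v i * ip x x)"
    using fin by (simp add: of_bool_def if_distrib if_distribR cong: if_cong)
  also have "\<dots> = of_real (n2 I v) * ip x x"
    unfolding n2_def of_real_sum complex_norm_square sum_distrib_right by (simp add: mult_ac)
  finally have "Re (\<Sum>k\<in>I. ip (\<Sum>j\<in>I. scale (v j) (\<rho> (u k j) x)) (\<Sum>j\<in>I. scale (v j) (\<rho> (u k j) x))) = n2 I v * Re (ip x x)"
    by simp
  then show ?thesis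
    by (simp add: nrm_power2)
qed

text \<open>The operators of u form a unitary matrix, so the coefficient matrix at p and r has norm
  at most the product of their lengths, whatever u is.\<close>

lemma act_urep_bound:
  assumes u: "urep G I u"
  shows "cmod (\<Sum>i\<in>I. \<Sum>j\<in>I. cnj (x i) * v j * ip p (\<rho> (u i j) r)) \<le>
    nrm p * nrm r * (sqrt (n2 I x) * sqrt (n2 I v))"
proof -
  define z where "z i = ip p (\<Sum>j\<in>I. scale (v j) (\<rho> (u i j) r))" for i
  have "n2 I z \<le> (\<Sum>i\<in>I. (nrm p)\<^sup>2 * (nrm (\<Sum>j\<in>I. scale (v j) (\<rho> (u i j) r)))\<^sup>2)"
    unfolding n2_def z_def power_mult_distrib[symmetric] by (intro sum_mono power_mono cauchy_schwarz) auto
  also have "\<dots> = (nrm p * nrm r)\<^sup>2 * n2 I v"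
    unfolding sum_distrib_left[symmetric] act_urep_norm[OF u] by (simp add: power_mult_distrib)
  finally have "sqrt (n2 I z) \<le> nrm p * nrm r * sqrt (n2 I v)"
    using real_sqrt_le_mono by (fastforce simp: real_sqrt_mult)
  then have "sqrt (n2 I x) * sqrt (n2 I z) \<le> sqrt (n2 I x) * (nrm p * nrm r * sqrt (n2 I v))"
    by (intro mult_left_mono) auto
  moreover have "(\<Sum>i\<in>I. \<Sum>j\<in>I. cnj (x i) * v j * ip p (\<rho> (u i j) r)) = (\<Sum>i\<in>I. cnj (x i) * z i)"
    by (simp add: z_def ip_sum_right ip_scale_right sum_distrib_left mult.assoc)
  ultimately show ?thesis
    using cauchy_schwarz_n2[of x z I] by (simp add: mult_ac)
qed

text \<open>A coefficient of a unitary representation acts contractively, since the squared lengths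
  of the images of x under one column of u add up to the squared length of x.\<close>

lemma act_bounded: "\<exists>K. \<forall>x. nrm (\<rho> a x) \<le> K * nrm x"
proof (induction a rule: pol_induct)
  case (add a b)
  then obtain K L where "\<And>x. nrm (\<rho> a x) \<le> K * nrm x" "\<And>x. nrm (\<rho> b x) \<le> L * nrm x"
    by blast
  then have "nrm (\<rho> (a + b) x) \<le> (K + L) * nrm x" for x
    unfolding act_plus distrib_right by (intro order_trans[OF nrm_triangle] add_mono)
  then show ?case
    by blast
next
  case (scl c a)
  then obtain K where "\<And>x. nrm (\<rho> a x) \<le> K * nrm x"
    by blast
  then have "nrm (\<rho> (sc c a) x) \<le> (cmod c * K) * nrm x" for x
    unfolding act_scl nrm_scale mult.assoc by (intro mult_left_mono) auto
  then show ?case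
    by blast
next
  case (coeff n u i j)
  have "nrm (\<rho> (u i j) x) \<le> 1 * nrm x" for x
  proof -
    have "(nrm (\<rho> (u i j) x))\<^sup>2 \<le> (\<Sum>k<n. (nrm (\<rho> (u k j) x))\<^sup>2)"
      using coeff by (intro member_le_sum) auto
    also have "\<dots> = Re (\<Sum>k<n. ip (\<rho> (u k j) x) (\<rho> (u k j) x))"
      by (simp add: nrm_power2)
    also have "\<dots> = (nrm x)\<^sup>2"
      using act_urep[OF coeff(1), of j j x x] coeff by (simp add: nrm_power2)
    finally show ?thesis
      using power2_le_imp_le[OF _ nrm_nonneg] by simp
  qed
  then show ?case
    by blast
qed

end

locale star_completion = star_action G S scale ip \<rho> + completion scale ip e
  for G :: "('a::ring_1) cqg" and S and scale :: "complex \<Rightarrow> 'v::ab_group_add \<Rightarrow> 'v" and ip \<rho>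
    and e :: "(nat \<Rightarrow> 'v) \<Rightarrow> 'h"
begin

lemma cauchy_act: "cauchy X \<Longrightarrow> cauchy (\<lambda>n. \<rho> a (X n))"
  using act_bounded[of a] cauchy_T[where T = "\<rho> a", OF act_add act_scale] by blast

lemma lift_act: "cauchy X \<Longrightarrow> lift (\<rho> a) (cl X) = cl (\<lambda>n. \<rho> a (X n))"
  using act_bounded[of a] lift_cl[where T = "\<rho> a", OF act_add act_scale] by blast

lemma star_rep_lift: "star_rep G H (\<lambda>a. lift (\<rho> a))"
  unfolding star_rep_def
proof (intro conjI allI ballI)
  show "bounded_operator H (lift (\<rho> a))" for a
    using act_bounded[of a] bounded_operator_lift[where T = "\<rho> a", OF act_add act_scale] by blast
next
  fix a b x assume "x \<in> vecs H"
  then obtain X where X: "cauchy X" "x = cl X"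
    by (rule vecsE)
  show "lift (\<rho> (a + b)) x = hadd H (lift (\<rho> a) x) (lift (\<rho> b) x)"
    by (simp add: X lift_act hadd_cl cauchy_act act_plus)
  show "lift (\<rho> (a * b)) x = lift (\<rho> a) (lift (\<rho> b) x)"
    by (simp add: X lift_act cauchy_act act_mult)
next
  fix c a x assume "x \<in> vecs H"
  then obtain X where X: "cauchy X" "x = cl X"
    by (rule vecsE)
  show "lift (\<rho> (scl G c a)) x = hscale H c (lift (\<rho> a) x)"
    by (simp add: X lift_act hscale_cl cauchy_act act_scl)
next
  fix x assume "x \<in> vecs H"
  then obtain X where X: "cauchy X" "x = cl X"
    by (rule vecsE)
  have "nrm (\<rho> 1 y - y) = 0" for y
    using act_one[of "\<rho> 1 y - y" y] by (simp add: nrm_def ip_diff_right)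
  then have "eqv (\<lambda>n. \<rho> 1 (X n)) X"
    by (simp add: eqv_def)
  then show "lift (\<rho> 1) x = x"
    by (simp add: X lift_act cl_eqI)
next
  fix a x y assume "x \<in> vecs H" "y \<in> vecs H"
  then obtain X Y where X: "cauchy X" "x = cl X" and Y: "cauchy Y" "y = cl Y"
    by (meson vecsE)
  show "hinner H (lift (\<rho> (star G a)) x) y = hinner H x (lift (\<rho> a) y)"
    unfolding X(2) Y(2) lift_act[OF X(1)] lift_act[OF Y(1)]
  proof (rule LIMSEQ_unique)
    show "(\<lambda>n. ip (\<rho> (st a) (X n)) (Y n)) \<longlonglongrightarrow> hinner H (cl (\<lambda>n. \<rho> (st a) (X n))) (cl Y)"
      by (intro hinner_cl_tendsto cauchy_act X Y)
    show "(\<lambda>n. ip (\<rho> (st a) (X n)) (Y n)) \<longlonglongrightarrow> hinner H (cl X) (cl (\<lambda>n. \<rho> a (Y n)))"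
      unfolding act_star by (intro hinner_cl_tendsto cauchy_act X Y)
  qed
qed

text \<open>The estimate of \<^term>\<open>act_urep_bound\<close> is uniform in the representation, so smallness of the
  coefficient matrices passes from the dense subspace to its completion.\<close>

lemma mixing_lift:
  assumes u: "irr_representatives G u"
    and mix: "\<And>p r \<epsilon>. 0 < \<epsilon> \<Longrightarrow> \<exists>F. finite F \<and> (\<forall>\<beta>\<in>Irr G - F. \<forall>x v.
      cmod (\<Sum>i<dim_row (u \<beta>). \<Sum>j<dim_row (u \<beta>). cnj (x i) * v j * ip p (\<rho> (u \<beta> $$ (i, j)) r)) \<le>
      \<epsilon> * (sqrt (n2 {..<dim_row (u \<beta>)} x) * sqrt (n2 {..<dim_row (u \<beta>)} v)))"
  shows "mixing G u H (\<lambda>a. lift (\<rho> a))"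
  unfolding mixing_def
proof (intro ballI allI impI)
  fix \<xi> \<zeta> and \<epsilon> :: real assume "\<xi> \<in> vecs H" "\<zeta> \<in> vecs H" and \<epsilon>: "0 < \<epsilon>"
  then obtain X Z where X: "cauchy X" "\<xi> = cl X" and Z: "cauchy Z" "\<zeta> = cl Z"
    by (meson vecsE)
  obtain KX where KX: "0 < KX" "\<And>n. nrm (X n) \<le> KX"
    by (rule cauchy_bounded[OF X(1)], blast)
  obtain KZ where KZ: "0 < KZ" "\<And>n. nrm (Z n) \<le> KZ"
    by (rule cauchy_bounded[OF Z(1)], blast)
  \<comment> \<open>Three errors of size \<epsilon> / 6 add up to \<epsilon> / 2, which leaves room
    for a strict inequality after passing to the limit.\<close>
  have "0 < \<epsilon> / (6 * KZ)" "0 < \<epsilon> / (6 * KX)"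
    using \<epsilon> KX KZ by simp_all
  then obtain N1 N2 where N: "\<And>m n. m \<ge> N1 \<Longrightarrow> n \<ge> N1 \<Longrightarrow> nrm (X m - X n) < \<epsilon> / (6 * KZ)"
    "\<And>m n. m \<ge> N2 \<Longrightarrow> n \<ge> N2 \<Longrightarrow> nrm (Z m - Z n) < \<epsilon> / (6 * KX)"
    using cauchyD[OF X(1)] cauchyD[OF Z(1)] by meson
  define m where "m = max N1 N2"
  have "0 < \<epsilon> / 6"
    using \<epsilon> by simp
  from mix[OF this, of "X m" "Z m"] obtain F where F: "finite F" "\<And>\<beta> x v. \<beta> \<in> Irr G - F \<Longrightarrow>
      cmod (\<Sum>i<dim_row (u \<beta>). \<Sum>j<dim_row (u \<beta>). cnj (x i) * v j * ip (X m) (\<rho> (u \<beta> $$ (i, j)) (Z m))) \<le>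
      \<epsilon> / 6 * (sqrt (n2 {..<dim_row (u \<beta>)} x) * sqrt (n2 {..<dim_row (u \<beta>)} v))"
    by blast
  have "mat_opnorm (map_mat (\<lambda>a. hinner H \<xi> (lift (\<rho> a) \<zeta>)) (u \<beta>)) < \<epsilon>" if \<beta>: "\<beta> \<in> Irr G - F" for \<beta>
  proof -
    define n where "n = dim_row (u \<beta>)"
    have rep: "unitary_rep G (u \<beta>)"
      using irr_representative[OF u] \<beta> by (simp add: irreducible_unitary_rep_def)
    have ur: "urep G {..<n} (\<lambda>i j. u \<beta> $$ (i, j))"
      unfolding n_def by (rule urep_mat[OF rep])
    have n: "u \<beta> \<in> carrier_mat n n"
      using rep by (auto simp: unitary_rep_def unitary_over_def n_def)
    have "mat_opnorm (map_mat (\<lambda>a. hinner H \<xi> (lift (\<rho> a) \<zeta>)) (u \<beta>)) \<le> \<epsilon> / 2"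
    proof (rule mat_opnorm_le)
      show "map_mat (\<lambda>a. hinner H \<xi> (lift (\<rho> a) \<zeta>)) (u \<beta>) \<in> carrier_mat n n"
        using n by simp
      fix x v :: "nat \<Rightarrow> complex"
      let ?c = "sqrt (n2 {..<n} x) * sqrt (n2 {..<n} v)"
      define B where "B p r = (\<Sum>i<n. \<Sum>j<n. cnj (x i) * v j * ip p (\<rho> (u \<beta> $$ (i, j)) r))" for p r
      have six: "\<epsilon> / 6 * c + \<epsilon> / 6 * c + \<epsilon> / 6 * c = \<epsilon> / 2 * c" for c
        by simp
      have actd: "\<rho> a (y - z) = \<rho> a y - \<rho> a z" for a y z
        by (simp add: eq_diff_eq flip: act_add)
      have Bd: "B (p - p') r = B p r - B p' r" "B p (r - r') = B p r - B p r'" for p p' r r'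
        by (simp_all add: B_def actd ip_diff_left ip_diff_right right_diff_distrib sum_subtractf)
      have B: "cmod (B p r) \<le> nrm p * nrm r * ?c" for p r
        unfolding B_def by (rule act_urep_bound[OF ur])
      have lim: "(\<lambda>k. B (X k) (Z k)) \<longlonglongrightarrow> (\<Sum>i<n. \<Sum>j<n. cnj (x i) * v j * hinner H \<xi> (lift (\<rho> (u \<beta> $$ (i, j))) \<zeta>))"
        unfolding B_def X(2) Z(2) lift_act[OF Z(1)]
        by (intro tendsto_sum tendsto_mult_left hinner_cl_tendsto X cauchy_act Z)
      have "cmod (B (X k) (Z k)) \<le> \<epsilon> / 2 * ?c" if k: "k \<ge> m" for k
      proof -
        have "B (X k) (Z k) = B (X k - X m) (Z k) + B (X m) (Z k - Z m) + B (X m) (Z m)"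
          by (simp add: Bd)
        also have "cmod \<dots> \<le> cmod (B (X k - X m) (Z k)) + cmod (B (X m) (Z k - Z m)) + cmod (B (X m) (Z m))"
          by (intro order_trans[OF norm_triangle_ineq] add_mono norm_triangle_ineq order_refl)
        also have "\<dots> \<le> \<epsilon> / 6 * ?c + \<epsilon> / 6 * ?c + \<epsilon> / 6 * ?c"
        proof (intro add_mono)
          have "nrm (X k - X m) * nrm (Z k) \<le> \<epsilon> / (6 * KZ) * KZ"
            using N(1)[of k m] k KZ \<epsilon> by (intro mult_mono) (auto simp: m_def)
          then have "nrm (X k - X m) * nrm (Z k) * ?c \<le> \<epsilon> / 6 * ?c"
            using KZ by (intro mult_right_mono) auto
          then show "cmod (B (X k - X m) (Z k)) \<le> \<epsilon> / 6 * ?c"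
            by (rule order_trans[OF B])
          have "nrm (X m) * nrm (Z k - Z m) \<le> KX * (\<epsilon> / (6 * KX))"
            using N(2)[of k m] k KX \<epsilon> by (intro mult_mono) (auto simp: m_def)
          then have "nrm (X m) * nrm (Z k - Z m) * ?c \<le> \<epsilon> / 6 * ?c"
            using KX by (intro mult_right_mono) auto
          then show "cmod (B (X m) (Z k - Z m)) \<le> \<epsilon> / 6 * ?c"
            by (rule order_trans[OF B])
          show "cmod (B (X m) (Z m)) \<le> \<epsilon> / 6 * ?c"
            using F(2)[OF \<beta>] by (simp add: B_def n_def)
        qed
        finally show ?thesis
          using six[of ?c] by (simp only:)
      qed
      then have "cmod (\<Sum>i<n. \<Sum>j<n. cnj (x i) * v j * hinner H \<xi> (lift (\<rho> (u \<beta> $$ (i, j))) \<zeta>)) \<le> \<epsilon> / 2 * ?c"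
        by (intro LIMSEQ_le_const2[OF tendsto_norm[OF lim]]) blast
      then show "cmod (\<Sum>i<n. \<Sum>j<n. cnj (x i) * v j * map_mat (\<lambda>a. hinner H \<xi> (lift (\<rho> a) \<zeta>)) (u \<beta>) $$ (i, j)) \<le> \<epsilon> / 2 * ?c"
        using n by simp
    qed (use \<epsilon> in simp)
    then show ?thesis
      using \<epsilon> by simp
  qed
  then show "finite {\<beta> \<in> Irr G. \<not> mat_opnorm (map_mat (\<lambda>a. hinner H \<xi> (lift (\<rho> a) \<zeta>)) (u \<beta>)) < \<epsilon>}"
    by (intro finite_subset[OF _ F(1)]) auto
qed

end

section \<open>From almost invariant vectors to a proper cocycle\<close>

lemma mat_opnorm_diag:
  assumes A: "A \<in> carrier_mat n n" and i: "i < n"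
  shows "cmod (A $$ (i, i)) \<le> mat_opnorm A"
proof -
  define v where "v a = (if a = i then 1 else 0 :: complex)" for a
  have "(\<Sum>a<n. \<Sum>b<n. cnj (v a) * v b * A $$ (a, b)) = (\<Sum>a<n. if a = i then A $$ (i, i) else 0)"
  proof (rule sum.cong[OF refl])
    fix a
    have "(\<Sum>b<n. cnj (v a) * v b * A $$ (a, b)) = (\<Sum>b<n. if b = i then cnj (v a) * A $$ (a, i) else 0)"
      by (rule sum.cong[OF refl]) (simp add: v_def)
    then show "(\<Sum>b<n. cnj (v a) * v b * A $$ (a, b)) = (if a = i then A $$ (i, i) else 0)"
      using i by (simp add: v_def)
  qed
  moreover have "n2 {..<n} v = (\<Sum>a<n. if a = i then 1 else 0)"
    unfolding n2_def by (rule sum.cong[OF refl]) (simp add: v_def)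
  ultimately show ?thesis
    using mat_opnorm_form_le[OF A, of v] i by simp
qed

context cqg
begin

text \<open>The order on the complex numbers also demands that the form be real, which holds because
  a Gram form is a sum of inner products of vectors with themselves.\<close>

lemma mat_ge_cocycle_gram:
  fixes H :: "'h hilbert" and \<eta> :: "'a \<Rightarrow> 'h"
  defines "q \<equiv> \<lambda>a b. hinner H (\<eta> a) (\<eta> b)"
  assumes q: "semi_inner_space sc q"
  shows "mat_ge (cocycle_gram H \<eta> U) (of_real M \<cdot>\<^sub>m 1\<^sub>m (dim_row U)) \<longleftrightarrow>
    (\<forall>v. M * n2 {..<dim_row U} v \<le> Re (gram q {..<dim_row U} (\<lambda>i j. U $$ (i, j)) v))"
proof -
  interpret q: semi_inner_space sc q by (rule q)
  define n where "n = dim_row U"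
  let ?g = "gram q {..<n} (\<lambda>i j. U $$ (i, j))"
  define A where "A = cocycle_gram H \<eta> U - of_real M \<cdot>\<^sub>m 1\<^sub>m n"
  have A: "A \<in> carrier_mat n n"
    by (auto simp: A_def cocycle_gram_def n_def)
  have entry: "A $$ (i, j) = (\<Sum>k<n. q (U $$ (k, i)) (U $$ (k, j))) - of_real M * of_bool (i = j)" if "i < n" "j < n" for i j
    using that by (auto simp: A_def cocycle_gram_def n_def q_def)
  have g: "?g v = (\<Sum>i<n. \<Sum>j<n. cnj (v i) * v j * (\<Sum>k<n. q (U $$ (k, i)) (U $$ (k, j))))" for v
  proof -
    have "?g v = (\<Sum>k<n. \<Sum>i<n. \<Sum>j<n. cnj (v i) * v j * q (U $$ (k, i)) (U $$ (k, j)))"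
      by (simp add: gram_def q.ip_sum_left q.ip_scale_left)
        (simp add: q.ip_sum_right q.ip_scale_right sum_distrib_left mult_ac)
    also have "\<dots> = (\<Sum>i<n. \<Sum>k<n. \<Sum>j<n. cnj (v i) * v j * q (U $$ (k, i)) (U $$ (k, j)))"
      by (rule sum.swap)
    also have "\<dots> = (\<Sum>i<n. \<Sum>j<n. cnj (v i) * v j * (\<Sum>k<n. q (U $$ (k, i)) (U $$ (k, j))))"
      unfolding sum_distrib_left by (rule sum.cong[OF refl], rule sum.swap)
    finally show ?thesis .
  qed
  have g_real: "Im (?g v) = 0" for v
    unfolding gram_def Im_sum by (intro sum.neutral ballI) (subst q.ip_self, simp)
  have form: "(A *\<^sub>v v) \<bullet>c v = ?g (\<lambda>i. v $ i) - of_real (M * n2 {..<n} (\<lambda>i. v $ i))" if v: "v \<in> carrier_vec n" for v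
  proof -
    have "(A *\<^sub>v v) \<bullet>c v = (\<Sum>i<n. (A *\<^sub>v v) $ i * cnj (v $ i))"
      using v by (simp add: scalar_prod_def lessThan_atLeast0)
    also have "\<dots> = (\<Sum>i<n. \<Sum>j<n. cnj (v $ i) * v $ j * A $$ (i, j))"
      using mult_mat_vec_entry[OF A v] by (intro sum.cong refl) (simp add: sum_distrib_left sum_distrib_right mult_ac)
    also have "\<dots> = (\<Sum>i<n. \<Sum>j<n. cnj (v $ i) * v $ j * (\<Sum>k<n. q (U $$ (k, i)) (U $$ (k, j))) -
        (if i = j then of_real M * (cnj (v $ i) * v $ i) else 0))"
      by (intro sum.cong refl) (auto simp: entry right_diff_distrib)
    also have "\<dots> = ?g (\<lambda>i. v $ i) - of_real M * (\<Sum>i<n. cnj (v $ i) * v $ i)"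
      by (simp add: g sum_subtractf sum_distrib_left)
    also have "(\<Sum>i<n. cnj (v $ i) * v $ i) = of_real (n2 {..<n} (\<lambda>i. v $ i))"
      unfolding n2_def of_real_sum complex_norm_square by (simp add: mult.commute)
    finally show ?thesis
      by simp
  qed
  have "mat_ge (cocycle_gram H \<eta> U) (of_real M \<cdot>\<^sub>m 1\<^sub>m n) \<longleftrightarrow>
      (\<forall>v\<in>carrier_vec n. M * n2 {..<n} (\<lambda>i. v $ i) \<le> Re (?g (\<lambda>i. v $ i)))"
    using A form g_real by (simp add: A_def[symmetric] mat_ge_def psd_mat_def less_eq_complex_def)
  also have "\<dots> \<longleftrightarrow> (\<forall>v. M * n2 {..<n} v \<le> Re (?g v))"
  proof safe
    fix v assume *: "\<forall>v\<in>carrier_vec n. M * n2 {..<n} (\<lambda>i. v $ i) \<le> Re (?g (\<lambda>i. v $ i))"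
    have "M * n2 {..<n} (\<lambda>i. vec n v $ i) \<le> Re (?g (\<lambda>i. vec n v $ i))"
      using * vec_carrier by blast
    then show "M * n2 {..<n} v \<le> Re (?g v)"
      by (simp add: n2_def g)
  qed auto
  finally show ?thesis
    by (simp add: n_def)
qed

section \<open>States and their coboundaries\<close>

definition state :: "('a \<Rightarrow> complex) \<Rightarrow> bool" where
  "state \<phi> \<longleftrightarrow> linear_form G \<phi> \<and> \<phi> 1 = 1 \<and> (\<forall>a. \<phi> (st a) = cnj (\<phi> a)) \<and> (\<forall>a. 0 \<le> Re (\<phi> (st a * a)))"

definition centre :: "'a \<Rightarrow> 'a" where
  "centre a = a - sc (eps a) 1"

lemma eps_centre [simp]: "eps (centre a) = 0"
  using eps_add[of "centre a" "sc (eps a) 1"] by (simp add: centre_def)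

lemma centre_add: "centre (a + b) = centre a + centre b" and centre_scl: "centre (sc c a) = sc c (centre a)"
  by (simp_all add: centre_def vs.scale_left_distrib vs.scale_right_diff_distrib)

text \<open>For the vector state of \<xi> this is the inner product of (\<pi>(a) - \<epsilon>(a))
  \<xi> and (\<pi>(b) - \<epsilon>(b)) \<xi>, the form of the coboundary given by \<xi>.\<close>

definition state_form :: "('a \<Rightarrow> complex) \<Rightarrow> 'a \<Rightarrow> 'a \<Rightarrow> complex" where
  "state_form \<phi> a b = \<phi> (st (centre a) * centre b)"

lemma state_semi_inner:
  assumes "state \<phi>" shows "semi_inner_space sc (\<lambda>a b. \<phi> (st a * b))"
proof (rule semi_innerI)
  fix x y
  have "st (st x * y) = st y * x"
    by simp
  then show "\<phi> (st y * x) = cnj (\<phi> (st x * y))"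
    using assms unfolding state_def by metis
qed (use assms in \<open>auto simp: state_def lf_iff distrib_left scl_mult_right\<close>)

lemma state_form_eq:
  assumes "state \<phi>"
  shows "state_form \<phi> a b = \<phi> (st a * b) - cnj (eps a) * \<phi> b - cnj (\<phi> a) * eps b + cnj (eps a) * eps b"
proof -
  interpret p: semi_inner_space sc "\<lambda>a b. \<phi> (st a * b)"
    by (rule state_semi_inner[OF assms])
  have "\<phi> (st 1 * b) = \<phi> b" "\<phi> (st a * 1) = cnj (\<phi> a)" "\<phi> (st 1 * 1) = 1"
    using assms by (auto simp: state_def)
  then show ?thesis
    unfolding state_form_def centre_def
    by (simp only: p.ip_diff_left p.ip_diff_right p.ip_scale_left p.ip_scale_right) (simp add: algebra_simps)
qed

lemma state_form_semi_inner:
  assumes "state \<phi>" shows "semi_inner_space sc (state_form \<phi>)"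
proof -
  interpret p: semi_inner_space sc "\<lambda>a b. \<phi> (st a * b)"
    by (rule state_semi_inner[OF assms])
  show ?thesis
  proof (rule semi_innerI)
    show "state_form \<phi> y x = cnj (state_form \<phi> x y)" for x y
      unfolding state_form_def by (rule p.ip_cnj)
    show "0 \<le> Re (state_form \<phi> x x)" for x
      unfolding state_form_def by (rule p.ip_nonneg)
  qed (simp_all only: state_form_def centre_add centre_scl p.ip_add_right p.ip_scale_right)
qed

lemma cocycle_form_state:
  assumes "state \<phi>" shows "cocycle_form (state_form \<phi>)"
  unfolding cocycle_form_def
proof (intro conjI allI)
  show "semi_inner_space sc (state_form \<phi>)"
    by (rule state_form_semi_inner[OF assms])
  show "state_form \<phi> 1 a = 0" for a
    using assms by (simp add: state_form_eq state_def)
  show "state_form \<phi> (a * b) c - cnj (eps b) * state_form \<phi> a c =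
      state_form \<phi> b (st a * c) - eps c * state_form \<phi> b (st a)" for a b c
  proof -
    have "\<phi> (st b * st a) = cnj (\<phi> (a * b))"
      using assms unfolding state_def by (metis st_mult)
    moreover have "\<phi> (st a) = cnj (\<phi> a)"
      using assms by (simp add: state_def)
    ultimately show ?thesis
      by (simp add: state_form_eq[OF assms] algebra_simps)
  qed
qed

text \<open>Through this, \<open>generating_dissipative\<close> expresses the Gram matrix of a
  coboundary by the coefficient matrix of \<phi>.\<close>

lemma generating_state:
  assumes "state \<phi>" shows "generating (\<lambda>a. \<phi> a - eps a) (state_form \<phi>)"
  using assms state_form_semi_inner[OF assms] state_form_eq[OF assms]
  by (auto simp: generating_def state_def lf_iff algebra_simps)

text \<open>The Gram form at v is twice the difference of the squared length of v and Re <v,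
  \<phi>(U) v>; a norm of at most 1/2 for \<phi>(U) leaves at least the squared length of v.\<close>

lemma state_gram_lower:
  assumes \<phi>: "state \<phi>" and u: "urep G {..<n} (\<lambda>i j. U $$ (i, j))" and U: "U \<in> carrier_mat n n"
    and small: "mat_opnorm (map_mat \<phi> U) \<le> 1 / 2"
  shows "n2 {..<n} v \<le> Re (gram (state_form \<phi>) {..<n} (\<lambda>i j. U $$ (i, j)) v)"
proof -
  let ?B = "\<Sum>i<n. \<Sum>j<n. cnj (v i) * v j * map_mat \<phi> U $$ (i, j)"
  have "mform {..<n} (\<lambda>i j. \<phi> (U $$ (i, j)) - eps (U $$ (i, j))) v v =
      (\<Sum>i<n. \<Sum>j<n. cnj (v i) * v j * map_mat \<phi> U $$ (i, j) - (if i = j then cnj (v i) * v i else 0))"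
    unfolding mform_def mvec_def sum_distrib_left
    using U urep_eps[OF u] by (intro sum.cong refl) (auto simp: algebra_simps)
  also have "\<dots> = ?B - (\<Sum>i<n. cnj (v i) * v i)"
    by (simp add: sum_subtractf)
  also have "(\<Sum>i<n. cnj (v i) * v i) = of_real (n2 {..<n} v)"
    unfolding n2_def of_real_sum complex_norm_square by (simp add: mult.commute)
  finally have gram: "Re (gram (state_form \<phi>) {..<n} (\<lambda>i j. U $$ (i, j)) v) = 2 * (n2 {..<n} v - Re ?B)"
    using generating_dissipative[OF generating_state[OF \<phi>] u, of v] by simp
  have "cmod ?B \<le> mat_opnorm (map_mat \<phi> U) * n2 {..<n} v"
    by (rule mat_opnorm_form_le) (use U in simp)
  moreover have "mat_opnorm (map_mat \<phi> U) * n2 {..<n} v \<le> 1 / 2 * n2 {..<n} v"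
    using small by (intro mult_right_mono) auto
  ultimately have "Re ?B \<le> 1 / 2 * n2 {..<n} v"
    using order_trans complex_Re_le_cmod by meson
  with gram show ?thesis
    by simp
qed

lemma vector_state:
  assumes K: "hilbert_space K" and \<pi>: "star_rep G K \<pi>" and \<xi>: "\<xi> \<in> vecs K" "hnorm K \<xi> = 1"
  defines "\<phi> \<equiv> \<lambda>a. hinner K \<xi> (\<pi> a \<xi>)"
  shows "state \<phi>" and "Re (state_form \<phi> a a) = (hnorm K (hdiff K (\<pi> a \<xi>) (hscale K (eps a) \<xi>)))\<^sup>2"
proof -
  have ip_add: "hinner K x (hadd K y z) = hinner K x y + hinner K x z"
    if "x \<in> vecs K" "y \<in> vecs K" "z \<in> vecs K" for x y z
    using K that unfolding hilbert_space_def inner_product_def by blast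
  have ip: "hinner K x (hscale K c y) = c * hinner K x y" "hinner K y x = cnj (hinner K x y)" "0 \<le> hinner K x x"
    if "x \<in> vecs K" "y \<in> vecs K" for x y c
    using K that unfolding hilbert_space_def inner_product_def by blast+
  have vs: "hscale K c x \<in> vecs K" "hscale K (c * d) x = hscale K c (hscale K d x)" if "x \<in> vecs K" for x c d
    using K that unfolding hilbert_space_def complex_vector_space_def by blast+
  have rep: "\<pi> (a + b) x = hadd K (\<pi> a x) (\<pi> b x)" "\<pi> (sc c a) x = hscale K c (\<pi> a x)" "\<pi> (a * b) x = \<pi> a (\<pi> b x)"
    "\<pi> 1 x = x" "\<pi> a x \<in> vecs K" if "x \<in> vecs K" for a b c x
    using \<pi> that unfolding star_rep_def bounded_operator_def by blast+
  have adj: "hinner K (\<pi> (st a) x) y = hinner K x (\<pi> a y)" if "x \<in> vecs K" "y \<in> vecs K" for a x y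
    using \<pi> that unfolding star_rep_def by blast
  have mult: "\<phi> (st a * b) = hinner K (\<pi> a \<xi>) (\<pi> b \<xi>)" for a b
  proof -
    have "\<phi> (st a * b) = hinner K \<xi> (\<pi> (st a) (\<pi> b \<xi>))"
      by (simp add: \<phi>_def rep \<xi>)
    also have "\<dots> = hinner K (\<pi> (st (st a)) \<xi>) (\<pi> b \<xi>)"
      by (subst adj) (simp_all add: rep \<xi>)
    finally show ?thesis
      by simp
  qed
  have self: "hinner K \<xi> \<xi> = 1"
    using ip(3)[OF \<xi>(1) \<xi>(1)] \<xi>(2) by (auto simp: hnorm_def less_eq_complex_def complex_eq_iff)
  show st: "state \<phi>"
    unfolding state_def
  proof (intro conjI allI)
    show "linear_form G \<phi>"
      by (simp add: lf_iff \<phi>_def rep \<xi> ip_add ip(1))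
    show "\<phi> 1 = 1"
      by (simp add: \<phi>_def rep \<xi> self)
    show "\<phi> (st a) = cnj (\<phi> a)" for a
      using mult[of a 1] ip(2)[OF \<xi>(1) rep(5)[OF \<xi>(1)], of a] by (simp add: rep \<xi> \<phi>_def)
    show "0 \<le> Re (\<phi> (st a * a))" for a
      using ip(3)[OF rep(5) rep(5), OF \<xi>(1) \<xi>(1), of a] by (simp add: mult less_eq_complex_def)
  qed
  have "centre a = a + sc (- 1) (sc (eps a) 1)"
    by (simp add: centre_def)
  then have "\<pi> (centre a) \<xi> = hdiff K (\<pi> a \<xi>) (hscale K (eps a) \<xi>)"
    by (simp only: rep hdiff_def \<xi>)
  then show "Re (state_form \<phi> a a) = (hnorm K (hdiff K (\<pi> a \<xi>) (hscale K (eps a) \<xi>)))\<^sup>2"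
    using ip(3)[OF rep(5) rep(5), OF \<xi>(1) \<xi>(1), of "centre a"]
    by (simp add: state_form_def mult hnorm_def less_eq_complex_def)
qed

text \<open>The difference is \<open>\<phi> (st 1 * centre a)\<close>, so Cauchy-Schwarz against 1
  applies.\<close>

lemma state_eps_bound:
  assumes "state \<phi>" shows "cmod (\<phi> a - eps a) \<le> sqrt (Re (state_form \<phi> a a))"
proof -
  interpret p: semi_inner_space sc "\<lambda>a b. \<phi> (st a * b)"
    by (rule state_semi_inner[OF assms])
  have "\<phi> a - eps a = \<phi> (st 1 * centre a)"
    using assms p.ip_diff_right[of 1 a "sc (eps a) 1"] p.ip_scale_right[of 1 "eps a" 1] by (simp add: centre_def state_def)
  then show ?thesis
    using p.cauchy_schwarz[of 1 "centre a"] assms by (simp add: p.nrm_def state_form_def state_def)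
qed

text \<open>The converse of extracting the form. Constant sequences give \<eta>, and a has to send x
  to \<open>a * centre x\<close> because \<pi>(a) \<eta>(x) must be \<eta>(a x) - \<epsilon>(x)
  \<eta>(a).\<close>

lemma cocycle_completion:
  fixes e :: "(nat \<Rightarrow> 'a) \<Rightarrow> 'h"
  assumes q: "cocycle_form q" and e: "inj e"
  obtains H :: "'h hilbert" and \<eta> where "hilbert_space H" "cocycle G H \<eta>" "\<And>a b. hinner H (\<eta> a) (\<eta> b) = q a b"
proof -
  interpret q: semi_inner_space sc q
    using q by (simp add: cocycle_form_def)
  have q1: "q 1 x = 0" "q x 1 = 0" for x
    using q q.ip_cnj[of x 1] by (auto simp: cocycle_form_def)
  have qc: "q (a * b) c - cnj (eps b) * q a c = q b (st a * c) - eps c * q b (st a)" for a b c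
    using q by (simp add: cocycle_form_def)
  have centre_1: "q x (centre y) = q x y" for x y
    by (simp add: centre_def q.ip_diff_right q.ip_scale_right q1)
  interpret c: star_completion G S sc q "\<lambda>a x. a * centre x" e
  proof unfold_locales
    show "a * centre (x + y) = a * centre x + a * centre y" for a x y
      by (simp add: centre_add distrib_left)
    show "a * centre (sc c x) = sc c (a * centre x)" for a c x
      by (simp add: centre_scl scl_mult_right)
    show "(a + b) * centre x = a * centre x + b * centre x" for a b x
      by (simp add: distrib_right)
    show "sc c a * centre x = sc c (a * centre x)" for a c x
      by (simp add: scl_mult_left)
    show "q (st a * centre x) y = q x (a * centre y)" for a x y
      using qc[of "st a" x y]
      by (simp add: centre_def right_diff_distrib scl_mult_right q.ip_diff_left q.ip_diff_right q.ip_scale_left q.ip_scale_right)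
    show "a * b * centre x = a * centre (b * centre x)" for a b x
      by (simp add: centre_def[of "b * centre x"] mult.assoc)
    show "q y (1 * centre x) = q y x" for x y
      by (simp add: centre_1)
    show "inj e"
      by (rule e)
  qed
  define \<eta> where "\<eta> a = c.cl (\<lambda>_. a)" for a
  have "cocycle G c.H \<eta>"
    unfolding cocycle_def
  proof (intro conjI allI ballI impI)
    show "\<eta> a \<in> vecs c.H" for a
      unfolding \<eta>_def c.vecs_H using q.cauchy_const by blast
    show "\<eta> (a + b) = hadd c.H (\<eta> a) (\<eta> b)" for a b
      by (simp add: \<eta>_def c.hadd_cl)
    show "\<eta> (sc k a) = hscale c.H k (\<eta> a)" for k a
      by (simp add: \<eta>_def c.hscale_cl)
    show "\<exists>a. hnorm c.H (hdiff c.H x (\<eta> a)) < \<epsilon>" if "x \<in> vecs c.H" "0 < \<epsilon>" for x \<epsilon>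
      unfolding \<eta>_def by (rule c.dense_const[OF that]) blast
    have "\<eta> (a * b) = hadd c.H (c.lift (\<lambda>x. a * centre x) (\<eta> b)) (hscale c.H (eps b) (\<eta> a))" for a b
      by (simp add: \<eta>_def c.lift_act c.hscale_cl c.hadd_cl) (simp add: centre_def right_diff_distrib scl_mult_right)
    then show "\<exists>\<pi>. star_rep G c.H \<pi> \<and>
        (\<forall>a b. \<eta> (a * b) = hadd c.H (\<pi> a (\<eta> b)) (hscale c.H (eps b) (\<eta> a)))"
      using c.star_rep_lift by blast
  qed
  moreover have "hinner c.H (\<eta> a) (\<eta> b) = q a b" for a b
    using c.hinner_cl_tendsto[OF q.cauchy_const q.cauchy_const, of a b] unfolding \<eta>_def by (simp only: LIMSEQ_const_iff)
  ultimately show thesis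
    using that c.hilbert_space_H by blast
qed

text \<open>The direct sum of cocycles at the level of forms. Cauchy-Schwarz reduces convergence to
  the diagonal, and the cocycle identity is linear in q.\<close>

lemma cocycle_form_series:
  assumes q: "\<And>m. cocycle_form (q m)" and conv: "\<And>a. summable (\<lambda>m. Re (q m a a))"
  shows "\<And>a b. summable (\<lambda>m. q m a b)" and "cocycle_form (\<lambda>a b. \<Sum>m. q m a b)"
proof -
  have semi: "semi_inner_space sc (q m)" for m
    using q by (simp add: cocycle_form_def)
  show sum: "summable (\<lambda>m. q m a b)" for a b
  proof (rule summable_comparison_test'[OF summable_add[OF conv[of a] conv[of b]]])
    fix m
    interpret q: semi_inner_space sc "q m" by (rule semi)
    have "cmod (q m a b) \<le> q.nrm a * q.nrm b"
      by (rule q.cauchy_schwarz)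
    also have "\<dots> \<le> (q.nrm a)\<^sup>2 + (q.nrm b)\<^sup>2"
      using sum_squares_bound[of "q.nrm a" "q.nrm b"] q.nrm_nonneg[of a] q.nrm_nonneg[of b] mult_nonneg_nonneg[of "q.nrm a" "q.nrm b"] by linarith
    finally show "norm (q m a b) \<le> Re (q m a a) + Re (q m b b)"
      by (simp add: q.nrm_power2)
  qed
  show "cocycle_form (\<lambda>a b. \<Sum>m. q m a b)"
    unfolding cocycle_form_def
  proof (intro conjI allI)
    show "semi_inner_space sc (\<lambda>a b. \<Sum>m. q m a b)"
    proof (rule semi_innerI)
      show "(\<Sum>m. q m x (y + z)) = (\<Sum>m. q m x y) + (\<Sum>m. q m x z)" for x y z
        using semi_inner_space.ip_add_right[OF semi] by (simp add: suminf_add[OF sum sum])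
      show "(\<Sum>m. q m x (sc c y)) = c * (\<Sum>m. q m x y)" for x c y
        using semi_inner_space.ip_scale_right[OF semi] by (simp add: suminf_mult[OF sum])
      show "(\<Sum>m. q m y x) = cnj (\<Sum>m. q m x y)" for x y
      proof -
        have "(\<lambda>m. cnj (q m x y)) sums cnj (\<Sum>m. q m x y)"
          using summable_sums[OF sum[of x y]] by (simp only: sums_cnj)
        then show ?thesis
          using semi_inner_space.ip_cnj[OF semi, of _ y x] by (simp add: sums_iff)
      qed
      show "0 \<le> Re (\<Sum>m. q m x x)" for x
      proof -
        have "(\<lambda>m. Re (q m x x)) sums Re (\<Sum>m. q m x x)"
          by (rule sums_Re[OF summable_sums[OF sum]])
        then show ?thesis
          using semi_inner_space.ip_nonneg[OF semi] by (simp add: sums_iff) (metis suminf_nonneg)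
      qed
    qed
    show "(\<Sum>m. q m 1 a) = 0" for a
      using q by (simp add: cocycle_form_def)
    show "(\<Sum>m. q m (a * b) c) - cnj (eps b) * (\<Sum>m. q m a c) =
        (\<Sum>m. q m b (st a * c)) - eps c * (\<Sum>m. q m b (st a))" for a b c
    proof -
      have 1: "(\<lambda>m. q m (a * b) c - cnj (eps b) * q m a c) sums ((\<Sum>m. q m (a * b) c) - cnj (eps b) * (\<Sum>m. q m a c))"
        by (intro sums_diff sums_mult summable_sums sum)
      have 2: "(\<lambda>m. q m b (st a * c) - eps c * q m b (st a)) sums ((\<Sum>m. q m b (st a * c)) - eps c * (\<Sum>m. q m b (st a)))"
        by (intro sums_diff sums_mult summable_sums sum)
      have "(\<lambda>m. q m (a * b) c - cnj (eps b) * q m a c) = (\<lambda>m. q m b (st a * c) - eps c * q m b (st a))"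
        using q by (simp add: cocycle_form_def)
      from 1[unfolded this] 2 show ?thesis
        by (rule sums_unique2)
    qed
  qed
qed

text \<open>The condition is quadratic in a, but the squared length of a sum is at most twice the
  sum of the squared lengths, so it passes from a set to its span.\<close>

lemma summable_forms_span:
  assumes q: "\<And>m. semi_inner_space sc (q m)" and X: "\<And>x. x \<in> X \<Longrightarrow> summable (\<lambda>m. Re (q m x x))"
    and a: "a \<in> vs.span X"
  shows "summable (\<lambda>m. Re (q m a a))"
  using a
proof (induction rule: vs.span_induct_alt)
  case base
  then show ?case
    by (simp add: semi_inner_space.ip_zero_right[OF q])
next
  case (step c x y)
  have "summable (\<lambda>m. 2 * (cmod c)\<^sup>2 * Re (q m x x) + 2 * Re (q m y y))"
    using X[OF step(1)] step(2) by (intro summable_add summable_mult)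
  then show ?case
  proof (rule summable_comparison_test'[where N = 0])
    fix m
    interpret q: semi_inner_space sc "q m" by (rule q)
    have "(q.nrm (sc c x + y))\<^sup>2 \<le> (q.nrm (sc c x) + q.nrm y)\<^sup>2"
      by (intro power_mono q.nrm_triangle) simp
    also have "\<dots> \<le> 2 * (q.nrm (sc c x))\<^sup>2 + 2 * (q.nrm y)\<^sup>2"
      using sum_squares_bound[of "q.nrm (sc c x)" "q.nrm y"] by (simp add: power2_sum)
    finally show "norm (Re (q m (sc c x + y) (sc c x + y))) \<le> 2 * (cmod c)\<^sup>2 * Re (q m x x) + 2 * Re (q m y y)"
      using q.ip_nonneg by (simp add: q.nrm_scale power_mult_distrib flip: q.nrm_power2)
  qed
qed

lemma proper_cocycle_if_haagerup:
  fixes e :: "(nat \<Rightarrow> 'a) \<Rightarrow> 'h" and u :: "'a mat set \<Rightarrow> 'a mat"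
  assumes u: "irr_representatives G u" and e: "inj e" and haagerup: "dual_haagerup TYPE('k) G u"
  shows "admits_proper_cocycle TYPE('h) G u"
proof -
  obtain K :: "'k hilbert" and \<pi> where K: "hilbert_space K" and \<pi>: "star_rep G K \<pi>"
    and mix: "mixing G u K \<pi>" and inv: "almost_invariant_vectors G K \<pi>"
    using haagerup unfolding dual_haagerup_def by blast
  obtain \<xi> where \<xi>: "\<And>n. \<xi> n \<in> vecs K" "\<And>n. hnorm K (\<xi> n) = 1"
    and lim: "\<And>a. (\<lambda>n. hnorm K (hdiff K (\<pi> a (\<xi> n)) (hscale K (eps a) (\<xi> n)))) \<longlonglongrightarrow> 0"
    using inv unfolding almost_invariant_vectors_def by blast
  define \<phi> where "\<phi> n = (\<lambda>a. hinner K (\<xi> n) (\<pi> a (\<xi> n)))" for n :: nat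
  have state: "state (\<phi> n)" for n
    unfolding \<phi>_def by (rule vector_state(1)[OF K \<pi> \<xi>])
  have "Re (state_form (\<phi> n) a a) = (hnorm K (hdiff K (\<pi> a (\<xi> n)) (hscale K (eps a) (\<xi> n))))\<^sup>2" for n a
    unfolding \<phi>_def by (rule vector_state(2)[OF K \<pi> \<xi>])
  then have form_lim: "(\<lambda>n. Re (state_form (\<phi> n) a a)) \<longlonglongrightarrow> 0" for a
    using tendsto_power[OF lim, of a 2] by simp
  have \<phi>_lim: "(\<lambda>n. \<phi> n a) \<longlonglongrightarrow> eps a" for a
  proof -
    have "(\<lambda>n. \<phi> n a - eps a) \<longlonglongrightarrow> 0"
    proof (rule Lim_null_comparison)
      show "eventually (\<lambda>n. norm (\<phi> n a - eps a) \<le> sqrt (Re (state_form (\<phi> n) a a))) sequentially"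
        by (intro always_eventually allI state_eps_bound state)
      show "(\<lambda>n. sqrt (Re (state_form (\<phi> n) a a))) \<longlonglongrightarrow> 0"
        using tendsto_real_sqrt[OF form_lim[of a]] by simp
    qed
    then show ?thesis
      by (simp add: LIM_zero_iff)
  qed
  \<comment> \<open>The classes on which the n-th coefficient matrix is not yet small: a finite set
    by mixing, outside of which \<open>state_gram_lower\<close> applies.\<close>
  define large where "large n = {\<beta> \<in> Irr G. \<not> mat_opnorm (map_mat (\<phi> n) (u \<beta>)) < 1 / 2}" for n
  have fin: "finite (large n)" for n
    unfolding large_def \<phi>_def
    by (rule mix[unfolded mixing_def, THEN bspec, OF \<xi>(1), THEN bspec, OF \<xi>(1), THEN spec, THEN mp]) simp
  have irr: "urep G {..<dim_row (u \<beta>)} (\<lambda>i j. u \<beta> $$ (i, j))" "u \<beta> \<in> carrier_mat (dim_row (u \<beta>)) (dim_row (u \<beta>))"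
    "0 < dim_row (u \<beta>)" if "\<beta> \<in> Irr G" for \<beta>
  proof -
    have rep: "unitary_rep G (u \<beta>)" and pos: "0 < dim_row (u \<beta>)"
      using irr_representative[OF u that] unfolding irreducible_unitary_rep_def by blast+
    show "urep G {..<dim_row (u \<beta>)} (\<lambda>i j. u \<beta> $$ (i, j))" "0 < dim_row (u \<beta>)"
      by (rule urep_mat[OF rep], rule pos)
    have "square_mat (u \<beta>)"
      using rep unfolding unitary_rep_def unitary_over_def by blast
    then show "u \<beta> \<in> carrier_mat (dim_row (u \<beta>)) (dim_row (u \<beta>))"
      by auto
  qed
  \<comment> \<open>This makes \<open>Irr G\<close> countable. For fixed \<beta> the value of \<phi>
    n at the entry (0, 0) tends to the counit value 1, so it exceeds 1/2 for some n, and \<beta>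
    lies in the corresponding finite set.\<close>
  have "\<exists>n. \<beta> \<in> large n" if \<beta>: "\<beta> \<in> Irr G" for \<beta>
  proof -
    let ?x = "u \<beta> $$ (0, 0)"
    have "eps ?x = 1"
      using urep_eps[OF irr(1)[OF \<beta>], of 0 0] irr(3)[OF \<beta>] by (simp del: One_nat_def)
    then have "(\<lambda>n. cmod (\<phi> n ?x)) \<longlonglongrightarrow> 1"
      using tendsto_norm[OF \<phi>_lim[of ?x]] by simp
    then have "eventually (\<lambda>n. 1 / 2 < cmod (\<phi> n ?x)) sequentially"
      by (rule order_tendstoD) simp
    then obtain n where n: "1 / 2 < cmod (\<phi> n ?x)"
      by (auto simp: eventually_sequentially)
    have U: "map_mat (\<phi> n) (u \<beta>) \<in> carrier_mat (dim_row (u \<beta>)) (dim_row (u \<beta>))"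
      by (rule map_carrier_mat[THEN iffD2, OF irr(2)[OF \<beta>]])
    have "map_mat (\<phi> n) (u \<beta>) $$ (0, 0) = \<phi> n ?x"
      by (rule index_map_mat(1)) (simp_all only: carrier_matD(2)[OF irr(2)[OF \<beta>]] irr(3)[OF \<beta>])
    then have "cmod (\<phi> n ?x) \<le> mat_opnorm (map_mat (\<phi> n) (u \<beta>))"
      using mat_opnorm_diag[OF U irr(3)[OF \<beta>]] by (simp only:)
    with n have "\<beta> \<in> large n"
      using \<beta> by (simp add: large_def)
    then show ?thesis ..
  qed
  then have "Irr G \<subseteq> (\<Union>n. large n)"
    by blast
  then have countable: "countable (Irr G)"
    by (rule countable_subset) (rule countable_UN, simp, rule countable_finite, rule fin)
  define X where "X = {u \<beta> $$ (i, j) | \<beta> i j. \<beta> \<in> Irr G \<and> i < dim_row (u \<beta>) \<and> j < dim_row (u \<beta>)}"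
  have "X \<subseteq> (\<Union>\<beta>\<in>Irr G. (\<lambda>(i, j). u \<beta> $$ (i, j)) ` ({..<dim_row (u \<beta>)} \<times> {..<dim_row (u \<beta>)}))"
  proof
    fix x assume "x \<in> X"
    then obtain \<beta> i j where "\<beta> \<in> Irr G" "i < dim_row (u \<beta>)" "j < dim_row (u \<beta>)" "x = u \<beta> $$ (i, j)"
      unfolding X_def by blast
    then show "x \<in> (\<Union>\<beta>\<in>Irr G. (\<lambda>(i, j). u \<beta> $$ (i, j)) ` ({..<dim_row (u \<beta>)} \<times> {..<dim_row (u \<beta>)}))"
      by (intro UN_I[of \<beta>] image_eqI[of _ _ "(i, j)"]) simp_all
  qed
  then have X: "countable X"
    by (rule countable_subset) (rule countable_UN[OF countable], rule countable_finite, simp)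
  \<comment> \<open>Stage m controls only the first m + 1 members of the countable spanning set;
    each member is then dominated by a geometric series from its own index on.\<close>
  have "\<exists>n. \<forall>k\<le>m. Re (state_form (\<phi> n) (from_nat_into X k) (from_nat_into X k)) < (1 / 2) ^ m" for m
  proof -
    have "eventually (\<lambda>n. \<forall>k\<in>{..m}. Re (state_form (\<phi> n) (from_nat_into X k) (from_nat_into X k)) < (1 / 2) ^ m) sequentially"
      by (intro eventually_ball_finite ballI order_tendstoD(2)[OF form_lim]) auto
    then show ?thesis
      by (auto simp: eventually_sequentially)
  qed
  then obtain \<sigma> where \<sigma>: "\<And>m k. k \<le> m \<Longrightarrow> Re (state_form (\<phi> (\<sigma> m)) (from_nat_into X k) (from_nat_into X k)) < (1 / 2) ^ m"
    using choice[of "\<lambda>m n. \<forall>k\<le>m. Re (state_form (\<phi> n) (from_nat_into X k) (from_nat_into X k)) < (1 / 2) ^ m"] by blast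
  define q where "q m = state_form (\<phi> (\<sigma> m))" for m
  have q: "cocycle_form (q m)" "semi_inner_space sc (q m)" for m
    unfolding q_def by (rule cocycle_form_state[OF state], rule state_form_semi_inner[OF state])
  have sumX: "summable (\<lambda>m. Re (q m x x))" if "x \<in> X" for x
  proof -
    obtain k where k: "x = from_nat_into X k"
      using from_nat_into_surj[OF X \<open>x \<in> X\<close>] by metis
    show ?thesis
    proof (rule summable_comparison_test')
      show "summable (\<lambda>m. (1 / 2 :: real) ^ m)"
        by (rule summable_geometric) simp
      show "norm (Re (q m x x)) \<le> (1 / 2) ^ m" if "k \<le> m" for m
        using \<sigma>[OF that] semi_inner_space.ip_nonneg[OF q(2), of m x] by (simp add: k q_def)
    qed
  qed
  have span: "vs.span X = UNIV"
    unfolding X_def by (rule span_representatives[OF u])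
  have "summable (\<lambda>m. Re (q m a a))" for a
    by (rule summable_forms_span[OF q(2) sumX]) (assumption, unfold span, rule UNIV_I)
  note conv = cocycle_form_series[OF q(1) this]
  define Q where "Q a b = (\<Sum>m. q m a b)" for a b
  have Q: "cocycle_form Q"
    unfolding Q_def by (rule conv(2))
  obtain H :: "'h hilbert" and \<eta> where H: "hilbert_space H" "cocycle G H \<eta>"
    and \<eta>: "\<And>a b. hinner H (\<eta> a) (\<eta> b) = Q a b"
    by (rule cocycle_completion[OF Q e], blast)
  have Q_eq: "(\<lambda>a b. hinner H (\<eta> a) (\<eta> b)) = Q"
    by (intro ext) (rule \<eta>)
  have "\<exists>F. finite F \<and> F \<subseteq> Irr G \<and> (\<forall>\<beta>\<in>Irr G - F.
      mat_ge (cocycle_gram H \<eta> (u \<beta>)) (of_real M \<cdot>\<^sub>m 1\<^sub>m (dim_row (u \<beta>))))" for M :: real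
  proof -
    obtain N :: nat where N: "M \<le> real N"
      using real_arch_simple by blast
    let ?F = "\<Union>m<N. large (\<sigma> m)"
    have "finite ?F" "?F \<subseteq> Irr G"
      using fin by (auto simp: large_def)
    moreover have "mat_ge (cocycle_gram H \<eta> (u \<beta>)) (of_real M \<cdot>\<^sub>m 1\<^sub>m (dim_row (u \<beta>)))"
      if \<beta>: "\<beta> \<in> Irr G - ?F" for \<beta>
    proof -
      let ?g = "\<lambda>q. gram q {..<dim_row (u \<beta>)} (\<lambda>i j. u \<beta> $$ (i, j))"
      have "M * n2 {..<dim_row (u \<beta>)} v \<le> Re (?g Q v)" for v
      proof -
        have "(\<lambda>m. Re (?g (q m) v)) sums Re (?g Q v)"
          unfolding gram_def Q_def by (intro sums_Re sums_sum summable_sums conv(1))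
        moreover have "0 \<le> Re (?g (q m) v)" for m
          unfolding gram_def Re_sum by (intro sum_nonneg semi_inner_space.ip_nonneg[OF q(2)])
        ultimately have "(\<Sum>m<N. Re (?g (q m) v)) \<le> Re (?g Q v)"
          using sum_le_suminf[of "\<lambda>m. Re (?g (q m) v)" "{..<N}"] by (simp add: sums_iff)
        moreover have "n2 {..<dim_row (u \<beta>)} v \<le> Re (?g (q m) v)" if "m < N" for m
        proof -
          have "\<beta> \<in> Irr G" "mat_opnorm (map_mat (\<phi> (\<sigma> m)) (u \<beta>)) < 1 / 2"
            using \<beta> that by (auto simp: large_def)
          then show ?thesis
            unfolding q_def by (intro state_gram_lower[OF state irr(1,2)]) auto
        qed
        then have "(\<Sum>m<N. n2 {..<dim_row (u \<beta>)} v) \<le> (\<Sum>m<N. Re (?g (q m) v))"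
          by (intro sum_mono) simp
        moreover have "M * n2 {..<dim_row (u \<beta>)} v \<le> real N * n2 {..<dim_row (u \<beta>)} v"
          using N by (intro mult_right_mono) auto
        ultimately show ?thesis
          by simp
      qed
      then show ?thesis
        using Q by (subst mat_ge_cocycle_gram) (auto simp: Q_eq cocycle_form_def)
    qed
    ultimately show ?thesis
      by (intro exI[of _ ?F] conjI ballI)
  qed
  then have "proper_cocycle G u H \<eta>"
    unfolding proper_cocycle_def by (intro conjI allI impI H(2))
  then show ?thesis
    unfolding admits_proper_cocycle_def by (intro exI conjI) (rule H(1))
qed

end

section \<open>From a proper cocycle to almost invariant vectors\<close>

context cqg
begin

lemma cocycle_form_cocycle:
  assumes H: "hilbert_space H" and \<eta>: "cocycle G H \<eta>"
  shows "cocycle_form (\<lambda>a b. hinner H (\<eta> a) (\<eta> b))"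
proof -
  obtain \<pi> where \<pi>: "star_rep G H \<pi>" and mult: "\<And>a b. \<eta> (a * b) = hadd H (\<pi> a (\<eta> b)) (hscale H (eps b) (\<eta> a))"
    using \<eta> unfolding cocycle_def by blast
  have \<eta>_vecs: "\<eta> a \<in> vecs H" and \<eta>_add: "\<eta> (a + b) = hadd H (\<eta> a) (\<eta> b)" and \<eta>_scl: "\<eta> (sc c a) = hscale H c (\<eta> a)"
    for a b c
    using \<eta> unfolding cocycle_def by blast+
  have ip_add: "hinner H x (hadd H y z) = hinner H x y + hinner H x z"
    if "x \<in> vecs H" "y \<in> vecs H" "z \<in> vecs H" for x y z
    using H that unfolding hilbert_space_def inner_product_def by blast
  have ip_scale: "hinner H x (hscale H c y) = c * hinner H x y" and ip_cnj: "hinner H y x = cnj (hinner H x y)"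
    and ip_nonneg: "0 \<le> hinner H x x"
    if "x \<in> vecs H" "y \<in> vecs H" for x y c
    using H that unfolding hilbert_space_def inner_product_def by blast+
  have scale_vecs: "hscale H c x \<in> vecs H" if "x \<in> vecs H" for x c
    using H that unfolding hilbert_space_def complex_vector_space_def by blast
  have \<pi>_vecs: "\<pi> a x \<in> vecs H" and \<pi>_one: "\<pi> 1 x = x" if "x \<in> vecs H" for a x
    using \<pi> that unfolding star_rep_def bounded_operator_def by blast+
  have adj: "hinner H (\<pi> (st a) x) y = hinner H x (\<pi> a y)" if "x \<in> vecs H" "y \<in> vecs H" for a x y
    using \<pi> that unfolding star_rep_def by blast
  let ?q = "\<lambda>a b. hinner H (\<eta> a) (\<eta> b)"
  have semi: "semi_inner_space sc ?q"
  proof (rule semi_innerI)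
    show "?q x (y + z) = ?q x y + ?q x z" for x y z
      unfolding \<eta>_add by (intro ip_add \<eta>_vecs)
    show "?q x (sc c y) = c * ?q x y" for x c y
      unfolding \<eta>_scl by (intro ip_scale \<eta>_vecs)
    show "?q y x = cnj (?q x y)" for x y
      by (intro ip_cnj \<eta>_vecs)
    show "0 \<le> Re (?q x x)" for x
      using ip_nonneg[OF \<eta>_vecs \<eta>_vecs, of x] by (simp add: less_eq_complex_def)
  qed
  have right: "?q x (a * b) = hinner H (\<eta> x) (\<pi> a (\<eta> b)) + eps b * ?q x a" for x a b
    unfolding mult by (simp only: ip_add ip_scale \<eta>_vecs \<pi>_vecs scale_vecs)
  \<comment> \<open>The cocycle rule for the product of 1 with itself produces the same inner
    product twice, hence it is zero.\<close>
  have zero: "?q x 1 = 0" for x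
    using right[of x 1 1] \<pi>_one[OF \<eta>_vecs, of 1] by simp
  show ?thesis
    unfolding cocycle_form_def
  proof (intro conjI allI semi)
    show "?q 1 a = 0" for a
      using ip_cnj[OF \<eta>_vecs \<eta>_vecs, of a 1] zero[of a] by simp
    show "?q (a * b) c - cnj (eps b) * ?q a c = ?q b (st a * c) - eps c * ?q b (st a)" for a b c
    proof -
      have "hinner H (\<pi> a (\<eta> b)) (\<eta> c) = hinner H (\<eta> b) (\<pi> (st a) (\<eta> c))"
        using adj[OF \<eta>_vecs \<eta>_vecs, of "st a" b c] by simp
      moreover have "?q (a * b) c = hinner H (\<pi> a (\<eta> b)) (\<eta> c) + cnj (eps b) * ?q a c"
      proof -
        have "?q (a * b) c = cnj (?q c (a * b))"
          by (rule ip_cnj[OF \<eta>_vecs \<eta>_vecs])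
        also have "\<dots> = cnj (hinner H (\<eta> c) (\<pi> a (\<eta> b))) + cnj (eps b) * cnj (?q c a)"
          by (simp add: right)
        also have "cnj (hinner H (\<eta> c) (\<pi> a (\<eta> b))) = hinner H (\<pi> a (\<eta> b)) (\<eta> c)"
          by (rule ip_cnj[OF \<eta>_vecs \<pi>_vecs[OF \<eta>_vecs], symmetric])
        also have "cnj (?q c a) = ?q a c"
          by (rule ip_cnj[OF \<eta>_vecs \<eta>_vecs, symmetric])
        finally show ?thesis .
      qed
      ultimately show ?thesis
        by (simp add: right)
    qed
  qed
qed

lemma state_cexp:
  assumes "generating L Q" shows "state (cexp L)"
proof -
  have L: "linear_form G L" "L 1 = 0" "\<And>a. L (st a) = cnj (L a)"
    using assms by (auto simp: generating_def)
  show ?thesis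
    unfolding state_def using cexp_lf[OF L(1)] cexp_one[OF L(1,2)] cexp_st[OF L(1,3)] cexp_nonneg[OF assms] by blast
qed

text \<open>Finitely supported sequences in \<open>Pol(\<G>)\<close> are encoded as coefficients of polynomials; only the
  additive structure of polynomials matters. The form is the orthogonal direct sum of the GNS forms of
  the states \<open>\<phi> i\<close>.\<close>

definition seq_form :: "(nat \<Rightarrow> 'a \<Rightarrow> complex) \<Rightarrow> 'a poly \<Rightarrow> 'a poly \<Rightarrow> complex" where
  "seq_form \<phi> p r = (\<Sum>i\<le>degree r. \<phi> i (st (poly.coeff p i) * poly.coeff r i))"

lemma seq_form_eq:
  assumes "\<And>i. linear_form G (\<phi> i)" "degree r \<le> N"
  shows "seq_form \<phi> p r = (\<Sum>i\<le>N. \<phi> i (st (poly.coeff p i) * poly.coeff r i))"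
  unfolding seq_form_def
  using assms by (intro sum.mono_neutral_left) (auto simp: coeff_eq_0 lf_zero)

lemma coeff_act: "poly.coeff (map_poly ((*) a) p) i = a * poly.coeff p i"
  and coeff_scl: "poly.coeff (map_poly (sc c) p) i = sc c (poly.coeff p i)"
  by (simp_all add: coeff_map_poly)

text \<open>The degree of a sum may drop, so the form is evaluated over a common upper bound N of
  the degrees, where it is additive term by term.\<close>

lemma star_completion_seq:
  assumes \<phi>: "\<And>n. state (\<phi> n)" and e: "inj e"
  shows "star_completion G S (\<lambda>c. map_poly (sc c)) (seq_form \<phi>) (\<lambda>a. map_poly ((*) a)) e"
proof -
  have lf: "linear_form G (\<phi> i)" for i
    using \<phi> by (simp add: state_def)
  have form: "seq_form \<phi> p r = (\<Sum>i\<le>N. \<phi> i (st (poly.coeff p i) * poly.coeff r i))" if "degree r \<le> N" for p r N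
    by (rule seq_form_eq[OF lf that])
  have deg: "degree (map_poly (sc c) p) \<le> degree p" "degree (map_poly ((*) a) p) \<le> degree p" for c a p
    by (rule degree_map_poly_le)+
  show ?thesis
  proof unfold_locales
    fix x y z :: "'a poly" and a b c d
    show "map_poly (sc c) (x + y) = map_poly (sc c) x + map_poly (sc c) y"
      "map_poly (sc (c + d)) x = map_poly (sc c) x + map_poly (sc d) x"
      "map_poly (sc c) (map_poly (sc d) x) = map_poly (sc (c * d)) x"
      "map_poly (sc 1) x = x"
      by (intro poly_eqI; simp add: coeff_scl vs.scale_right_distrib vs.scale_left_distrib)+
    show "map_poly ((*) a) (x + y) = map_poly ((*) a) x + map_poly ((*) a) y"
      "map_poly ((*) a) (map_poly (sc c) x) = map_poly (sc c) (map_poly ((*) a) x)"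
      "map_poly ((*) (a + b)) x = map_poly ((*) a) x + map_poly ((*) b) x"
      "map_poly ((*) (sc c a)) x = map_poly (sc c) (map_poly ((*) a) x)"
      "map_poly ((*) (a * b)) x = map_poly ((*) a) (map_poly ((*) b) x)"
      by (intro poly_eqI; simp add: coeff_scl coeff_act distrib_left distrib_right scl_mult_left scl_mult_right mult.assoc)+
    have "map_poly ((*) 1) x = x"
      by (intro poly_eqI) (simp add: coeff_act)
    then show "seq_form \<phi> y (map_poly ((*) 1) x) = seq_form \<phi> y x"
      by (simp only:)
    show "seq_form \<phi> x (y + z) = seq_form \<phi> x y + seq_form \<phi> x z"
    proof -
      define N where "N = max (degree y) (degree z)"
      have N: "degree y \<le> N" "degree z \<le> N" "degree (y + z) \<le> N"
        unfolding N_def by (simp_all add: degree_add_le)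
      show ?thesis
        using lf by (simp add: form[OF N(1)] form[OF N(2)] form[OF N(3)] distrib_left lf_iff sum.distrib)
    qed
    show "seq_form \<phi> x (map_poly (sc c) y) = c * seq_form \<phi> x y"
      using lf by (simp add: form[OF deg(1)[of c y]] form[OF order_refl[of "degree y"]] coeff_scl scl_mult_right lf_iff sum_distrib_left)
    show "seq_form \<phi> y x = cnj (seq_form \<phi> x y)"
    proof -
      define N where "N = max (degree x) (degree y)"
      have N: "degree x \<le> N" "degree y \<le> N"
        by (simp_all add: N_def)
      have "\<phi> i (st b * a) = cnj (\<phi> i (st a * b))" for i a b
        using semi_inner_space.ip_cnj[OF state_semi_inner[OF \<phi>]] .
      then show ?thesis
        unfolding form[OF N(1)] form[OF N(2)] cnj_sum by (intro sum.cong refl)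
    qed
    show "0 \<le> Re (seq_form \<phi> x x)"
      using \<phi> unfolding seq_form_def Re_sum by (intro sum_nonneg) (simp add: state_def)
    show "seq_form \<phi> (map_poly ((*) (st a)) x) y = seq_form \<phi> x (map_poly ((*) a) y)"
      by (simp add: form[OF deg(2)[of a y]] form[OF order_refl[of "degree y"]] coeff_act mult.assoc)
    show "inj e"
      by (rule e)
  qed
qed

lemma seq_form_monom:
  assumes "\<And>i. linear_form G (\<phi> i)"
  shows "seq_form \<phi> (monom a n) (monom b n) = \<phi> n (st a * b)"
proof -
  have "seq_form \<phi> (monom a n) (monom b n) = (\<Sum>i\<le>n. \<phi> i (st (poly.coeff (monom a n) i) * poly.coeff (monom b n) i))"
    using assms degree_monom_le by (rule seq_form_eq)
  also have "\<dots> = (\<Sum>i\<le>n. if i = n then \<phi> n (st a * b) else 0)"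
    using assms by (intro sum.cong refl) (auto simp: lf_zero)
  finally show ?thesis
    by simp
qed

lemma haagerup_if_proper_cocycle:
  fixes e :: "(nat \<Rightarrow> 'a) \<Rightarrow> 'k" and u :: "'a mat set \<Rightarrow> 'a mat"
  assumes u: "irr_representatives G u" and e: "inj e" and proper: "admits_proper_cocycle TYPE('h) G u"
  shows "dual_haagerup TYPE('k) G u"
proof -
  obtain H :: "'h hilbert" and \<eta> where H: "hilbert_space H" and \<eta>: "proper_cocycle G u H \<eta>"
    using proper unfolding admits_proper_cocycle_def by blast
  define q where "q = (\<lambda>a b. hinner H (\<eta> a) (\<eta> b))"
  have q: "cocycle_form q"
    unfolding q_def using \<eta> by (intro cocycle_form_cocycle[OF H]) (simp add: proper_cocycle_def)
  obtain q' where q': "cocycle_form q'"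
    and q'_hom: "\<And>l m a b. 0 < l \<Longrightarrow> 0 < m \<Longrightarrow> hom l a \<Longrightarrow> hom m b \<Longrightarrow> q' a b = (if l = m then q a b else 0)"
    by (rule graded_form[OF q], blast)
  have q0: "semi_inner_space sc q" "semi_inner_space sc q'"
    using q q' by (simp_all add: cocycle_form_def)
  obtain L Q where L: "linear_form G L" "L 1 = 0" "\<And>a. L (st a) = cnj (L a)" "semi_inner_space sc Q"
    and qQ: "\<And>a. Re (q' a a) \<le> 2 * Re (Q a a)"
    and LQ: "\<And>a b. L (st a * b) = cnj (eps a) * L b + cnj (L a) * eps b + Q a b"
  proof (rule generating_functional[OF q'])
    show "q' a b = 0" if "0 < l" "0 < m" "hom l a" "hom m b" "l \<noteq> m" for l m a b
      using q'_hom[OF that(1-4)] that(5) by simp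
  qed (rule that)
  have gen: "generating L Q"
    unfolding generating_def by (intro conjI allI L LQ)
  define \<phi> where "\<phi> n = cexp (\<lambda>a. of_real (inverse (real (Suc n))) * L a)" for n
  have \<phi>: "state (\<phi> n)" for n
    unfolding \<phi>_def by (rule state_cexp, rule generating_scale[OF gen]) simp
  have \<phi>_lf: "linear_form G (\<phi> n)" for n
    using \<phi> by (simp add: state_def)
  have \<phi>_lim: "(\<lambda>n. \<phi> n a) \<longlonglongrightarrow> eps a" for a
    unfolding \<phi>_def by (rule cexp_tendsto_eps[OF L(1)])
  \<comment> \<open>The completion needs codes for sequences of polynomials. Such a sequence is a
    doubly indexed family in \<open>Pol(G)\<close>, and \<open>prod_decode\<close> flattens it to a
    single sequence that \<open>e\<close> can code.\<close>
  define E where "E X = e (\<lambda>n. poly.coeff (X (fst (prod_decode n)) :: 'a poly) (snd (prod_decode n)))" for X :: "nat \<Rightarrow> 'a poly"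
  have E: "inj E"
  proof (rule injI)
    fix X Y assume "E X = E Y"
    then have eq: "(\<lambda>n. poly.coeff (X (fst (prod_decode n))) (snd (prod_decode n))) =
        (\<lambda>n. poly.coeff (Y (fst (prod_decode n))) (snd (prod_decode n)))"
      unfolding E_def by (rule injD[OF e])
    have "poly.coeff (X i) k = poly.coeff (Y i) k" for i k
      using fun_cong[OF eq, of "prod_encode (i, k)"] by simp
    then show "X = Y"
      by (intro ext poly_eqI)
  qed
  interpret c: star_completion G S "\<lambda>c. map_poly (sc c)" "seq_form \<phi>" "\<lambda>a. map_poly ((*) a)" E
    by (rule star_completion_seq[OF \<phi> E])
  have mixing: "mixing G u c.H (\<lambda>a. c.lift (map_poly ((*) a)))"
  proof (rule c.mixing_lift[OF u])
    fix p r :: "'a poly" and \<epsilon> :: real assume \<epsilon>: "0 < \<epsilon>"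
    \<comment> \<open>The number of GNS summands that can contribute, as the form has no terms
      beyond the degree of r.\<close>
    define D where "D = real (Suc (degree r))"
    have D: "0 < D"
      by (simp add: D_def)
    have "\<exists>M\<ge>0. \<forall>(n::nat) u. urep G {..<n} u \<longrightarrow> (\<forall>v. M\<^sup>2 * n2 {..<n} v \<le> Re (gram q' {..<n} u v)) \<longrightarrow>
        (\<forall>x v. cmod (\<Sum>i<n. \<Sum>j<n. cnj (x i) * v j * \<phi> k (st (poly.coeff p k) * u i j * poly.coeff r k)) \<le>
          \<epsilon> / D * (sqrt (n2 {..<n} x) * sqrt (n2 {..<n} v)))" for k
      unfolding \<phi>_def using \<epsilon> D by (intro cexp_mixing[OF q' gen qQ]) auto
    then have "\<forall>k. \<exists>M. M \<ge> 0 \<and> (\<forall>(n::nat) u. urep G {..<n} u \<longrightarrow> (\<forall>v. M\<^sup>2 * n2 {..<n} v \<le> Re (gram q' {..<n} u v)) \<longrightarrow>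
        (\<forall>x v. cmod (\<Sum>i<n. \<Sum>j<n. cnj (x i) * v j * \<phi> k (st (poly.coeff p k) * u i j * poly.coeff r k)) \<le>
          \<epsilon> / D * (sqrt (n2 {..<n} x) * sqrt (n2 {..<n} v))))"
      by (intro allI)
    from choice[OF this] obtain M where M: "\<And>k. 0 \<le> M k"
      "\<And>k n u x v. urep G {..<n::nat} u \<Longrightarrow> (\<And>v. (M k)\<^sup>2 * n2 {..<n} v \<le> Re (gram q' {..<n} u v)) \<Longrightarrow>
        cmod (\<Sum>i<n. \<Sum>j<n. cnj (x i) * v j * \<phi> k (st (poly.coeff p k) * u i j * poly.coeff r k)) \<le>
          \<epsilon> / D * (sqrt (n2 {..<n} x) * sqrt (n2 {..<n} v))"
      by blast
    \<comment> \<open>\<open>N\<^sup>2 + 1\<close> dominates the squares of all thresholds M k that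
      matter and is positive, as properness demands of its constant.\<close>
    define N where "N = (\<Sum>k\<le>degree r. M k)"
    have MN: "(M k)\<^sup>2 \<le> N\<^sup>2 + 1" if "k \<le> degree r" for k
    proof -
      have "M k \<le> N"
        unfolding N_def using that M(1) by (intro member_le_sum) auto
      then have "(M k)\<^sup>2 \<le> N\<^sup>2"
        using M(1) by (intro power_mono)
      then show ?thesis
        by simp
    qed
    have all_M: "\<forall>M>0. \<exists>F. finite F \<and> F \<subseteq> Irr G \<and> (\<forall>\<beta>\<in>Irr G - F.
        mat_ge (cocycle_gram H \<eta> (u \<beta>)) (of_real M \<cdot>\<^sub>m 1\<^sub>m (dim_row (u \<beta>))))"
      using \<eta> unfolding proper_cocycle_def by (rule conjunct2)
    have "0 < N\<^sup>2 + 1"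
      by (simp add: add_nonneg_pos)
    with all_M[THEN spec, of "N\<^sup>2 + 1"] have "\<exists>F. finite F \<and> F \<subseteq> Irr G \<and> (\<forall>\<beta>\<in>Irr G - F.
        mat_ge (cocycle_gram H \<eta> (u \<beta>)) (of_real (N\<^sup>2 + 1) \<cdot>\<^sub>m 1\<^sub>m (dim_row (u \<beta>))))"
      by (rule mp)
    then obtain F where F: "finite F \<and> F \<subseteq> Irr G \<and> (\<forall>\<beta>\<in>Irr G - F.
        mat_ge (cocycle_gram H \<eta> (u \<beta>)) (of_real (N\<^sup>2 + 1) \<cdot>\<^sub>m 1\<^sub>m (dim_row (u \<beta>))))"
      by (rule exE)
    show "\<exists>F. finite F \<and> (\<forall>\<beta>\<in>Irr G - F. \<forall>x v.
        cmod (\<Sum>i<dim_row (u \<beta>). \<Sum>j<dim_row (u \<beta>). cnj (x i) * v j * seq_form \<phi> p (map_poly ((*) (u \<beta> $$ (i, j))) r)) \<le>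
        \<epsilon> * (sqrt (n2 {..<dim_row (u \<beta>)} x) * sqrt (n2 {..<dim_row (u \<beta>)} v)))"
    proof (intro exI conjI ballI allI)
      show "finite F"
        by (rule F[THEN conjunct1])
      fix \<beta> x v assume \<beta>: "\<beta> \<in> Irr G - F"
      define n where "n = dim_row (u \<beta>)"
      define w where "w i j = u \<beta> $$ (i, j)" for i j
      let ?c = "sqrt (n2 {..<n} x) * sqrt (n2 {..<n} v)"
      have rep: "unitary_rep G (u \<beta>)"
        using irr_representative[OF u, of \<beta>] \<beta> unfolding irreducible_unitary_rep_def by blast
      have w: "urep G {..<n} w"
        unfolding n_def w_def[abs_def] by (rule urep_mat[OF rep])
      have "(N\<^sup>2 + 1) * n2 {..<n} v \<le> Re (gram q {..<n} w v)" for v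
        unfolding q_def n_def w_def[abs_def]
        by (rule mat_ge_cocycle_gram[OF q0(1)[unfolded q_def], THEN iffD1, THEN spec,
              OF F[THEN conjunct2, THEN conjunct2, THEN bspec, OF \<beta>]])
      then have q_bound: "(N\<^sup>2 + 1) * (\<Sum>j<n. (cmod (v j))\<^sup>2) \<le> Re (gram_norm q n w v)" for v
        unfolding gram_norm_def gram_def n2_def .
      \<comment> \<open>Properness bounds the Gram matrix of q, whereas L was built from the graded
        form q'; the pinching estimate carries the bound over.\<close>
      have "(N\<^sup>2 + 1) * (\<Sum>j<n. (cmod (v j))\<^sup>2) \<le> Re (gram_norm q' n w v)" for v
      proof (rule graded_gram_bound[OF q0])
        show "q' a b = (if l = m then q a b else 0)" if "0 < l" "0 < m" "hom l a" "hom m b" for l m a b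
          by (rule q'_hom[OF that])
      qed (rule w q_bound)+
      then have gr: "(N\<^sup>2 + 1) * n2 {..<n} v \<le> Re (gram q' {..<n} w v)" for v
        unfolding gram_norm_def gram_def n2_def .
      have each: "cmod (\<Sum>i<n. \<Sum>j<n. cnj (x i) * v j * \<phi> k (st (poly.coeff p k) * w i j * poly.coeff r k)) \<le> \<epsilon> / D * ?c"
        if "k \<le> degree r" for k
      proof (rule M(2)[OF w])
        fix v
        have "(M k)\<^sup>2 * n2 {..<n} v \<le> (N\<^sup>2 + 1) * n2 {..<n} v"
          using MN[OF that] by (intro mult_right_mono) auto
        then show "(M k)\<^sup>2 * n2 {..<n} v \<le> Re (gram q' {..<n} w v)"
          using gr[of v] by linarith
      qed
      have "(\<Sum>i<n. \<Sum>j<n. cnj (x i) * v j * seq_form \<phi> p (map_poly ((*) (w i j)) r)) =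
          (\<Sum>i<n. \<Sum>j<n. \<Sum>k\<le>degree r. cnj (x i) * v j * \<phi> k (st (poly.coeff p k) * w i j * poly.coeff r k))"
        by (simp add: seq_form_eq[OF \<phi>_lf degree_map_poly_le] coeff_act sum_distrib_left mult.assoc)
      also have "\<dots> = (\<Sum>i<n. \<Sum>k\<le>degree r. \<Sum>j<n. cnj (x i) * v j * \<phi> k (st (poly.coeff p k) * w i j * poly.coeff r k))"
        by (rule sum.cong[OF refl], rule sum.swap)
      also have "\<dots> = (\<Sum>k\<le>degree r. \<Sum>i<n. \<Sum>j<n. cnj (x i) * v j * \<phi> k (st (poly.coeff p k) * w i j * poly.coeff r k))"
        by (rule sum.swap)
      also have "cmod \<dots> \<le> (\<Sum>k\<le>degree r. \<epsilon> / D * ?c)"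
        by (rule sum_norm_le) (use each in auto)
      also have "\<dots> = D * (\<epsilon> / D * ?c)"
        by (simp add: D_def)
      also have "\<dots> = \<epsilon> * ?c"
        using D by simp
      finally show "cmod (\<Sum>i<dim_row (u \<beta>). \<Sum>j<dim_row (u \<beta>). cnj (x i) * v j * seq_form \<phi> p (map_poly ((*) (u \<beta> $$ (i, j))) r)) \<le>
          \<epsilon> * (sqrt (n2 {..<dim_row (u \<beta>)} x) * sqrt (n2 {..<dim_row (u \<beta>)} v))"
        unfolding n_def w_def .
    qed
  qed
  \<comment> \<open>The cyclic vector of the n-th GNS summand. The squared length of its
    displacement by a is \<open>\<phi> n (st (centre a) * centre a)\<close>, which tends to the
    counit value 0.\<close>
  define \<xi> where "\<xi> n = c.cl (\<lambda>_. monom 1 n)" for n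
  have cl_norm: "hnorm c.H (c.cl (\<lambda>_. monom a n)) = sqrt (Re (\<phi> n (st a * a)))" for a n
    using c.hnorm_cl_tendsto[OF c.cauchy_const, of "monom a n"]
    by (simp add: LIMSEQ_const_iff c.nrm_def seq_form_monom[OF \<phi>_lf])
  have "almost_invariant_vectors G c.H (\<lambda>a. c.lift (map_poly ((*) a)))"
    unfolding almost_invariant_vectors_def
  proof (intro exI[of _ \<xi>] conjI allI)
    show "\<xi> n \<in> vecs c.H" for n
      unfolding \<xi>_def c.vecs_H using c.cauchy_const by blast
    show "hnorm c.H (\<xi> n) = 1" for n
      using \<phi>[of n] unfolding \<xi>_def cl_norm by (simp add: state_def)
    fix a
    have "map_poly ((*) a) (monom 1 n) - map_poly (sc (eps a)) (monom 1 n) = monom (centre a) n" for n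
      by (rule poly_eqI) (simp add: coeff_act coeff_scl centre_def)
    then have "hdiff c.H (c.lift (map_poly ((*) a)) (\<xi> n)) (hscale c.H (eps a) (\<xi> n)) = c.cl (\<lambda>_. monom (centre a) n)" for n
      unfolding \<xi>_def by (simp add: c.lift_act c.hscale_cl c.hdiff_cl)
    then have "hnorm c.H (hdiff c.H (c.lift (map_poly ((*) a)) (\<xi> n)) (hscale c.H (eps a) (\<xi> n))) =
        sqrt (Re (\<phi> n (st (centre a) * centre a)))" for n
      by (simp only: cl_norm)
    moreover have "(\<lambda>n. sqrt (Re (\<phi> n (st (centre a) * centre a)))) \<longlonglongrightarrow> sqrt (Re (eps (st (centre a) * centre a)))"
      by (intro tendsto_real_sqrt tendsto_Re \<phi>_lim)
    ultimately show "(\<lambda>n. hnorm c.H (hdiff c.H (c.lift (map_poly ((*) a)) (\<xi> n)) (hscale c.H (eps a) (\<xi> n)))) \<longlonglongrightarrow> 0"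
      by simp
  qed
  then show ?thesis
    unfolding dual_haagerup_def
    by (intro exI[of _ c.H] exI[of _ "\<lambda>a. c.lift (map_poly ((*) a))"] conjI c.hilbert_space_H c.star_rep_lift mixing)
qed

end

theorem theorem3p6:
  fixes G :: "('a::ring_1) cqg" and u :: "'a mat set \<Rightarrow> 'a mat"
  assumes "compact_quantum_group G"
    and "irr_representatives G u"
    and "large_universe TYPE('k) TYPE('a)"
    and "large_universe TYPE('h) TYPE('a)"
  shows "dual_haagerup TYPE('k) G u \<longleftrightarrow> admits_proper_cocycle TYPE('h) G u"
proof -
  obtain S where "antipode G S"
    using assms(1) unfolding compact_quantum_group_def hopf_star_algebra_def by blast
  then interpret cqg G S
    using assms(1) by unfold_locales
  \<comment> \<open>\<open>e\<close> codes the completion of the GNS sum, \<open>e'\<close> the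
    completion that carries the cocycle.\<close>
  obtain e :: "(nat \<Rightarrow> 'a) \<Rightarrow> 'k" where e: "inj e"
    using assms(3) unfolding large_universe_def by blast
  obtain e' :: "(nat \<Rightarrow> 'a) \<Rightarrow> 'h" where e': "inj e'"
    using assms(4) unfolding large_universe_def by blast
  show ?thesis
    by (rule iffI[OF proper_cocycle_if_haagerup[OF assms(2) e'] haagerup_if_proper_cocycle[OF assms(2) e]])
qed

end
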